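(* There is a universal constant $C_\ast<\infty$ with the following property. Let $\mu\in\mathcal P(\mathbb R^d)$ be such that $\mathsf g_{\mathrm{att}}\in L^1(\mu^{\otimes2})$ (i.e. $\iint|\log|x-y||\,d\mu^{\otimes 2}<\infty$), and assume that there is a constant $C_{\mathrm{mom}}<\infty$ such that $$\sup_{y\in\mathbb R^d}\int_{\mathbb R^d}|\tilde{\mathsf g}_{\mathrm{att}}(x,y)|^p\,d\mu(x)\le C_{\mathrm{mom}}^p\,p!\qquad\text{for every integer }p\ge1 .$$ Set $\beta_0=\dfrac1{C_\ast C_{\mathrm{mom}}}$. Then, for every fixed $0\le\beta<\beta_0$ with $e^{2\beta h_\mu^{\mathrm{att}}}\in L^1(\mu)$, there is a finite constant $C_{\mathrm{ub}}^{\mathrm{att}}(\beta,\mu)$ satisfying $$\sup_{N\ge1}\mathsf K^{\mathrm{att}}_{N,\beta}(\mu)\le C_{\mathrm{ub}}^{\mathrm{att}}(\beta,\mu).$$ Moreover, assume in addition $\mu\in L^\infty(\mathbb R^d)$, let $T_\mu^{\mathrm{att}}$ be the Hilbert--Schmidt operator on $L^2(\mu)$ with kernel $\tilde{\mathsf g}_{\mathrm{att}}$, and set $\mathsf K^{\mathrm{att}}_{\infty,\beta}(\mu)=e^{\beta I_\mu^{\mathrm{att}}}\det_2(\mathrm{Id}+\beta T^{\mathrm{att}}_\mu)^{-1/2}$. There is a threshold $0<\beta_{\mathrm q}=\beta_{\mathrm q}(d,\|\mu\|_{L^\infty},C_{\mathrm{mom}})\le\beta_0/2$ such that, for every fixed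 $0<\beta<\beta_{\mathrm q}$ with $e^{4\beta h_\mu^{\mathrm{att}}}\in L^1(\mu)$, the determinant defining $\mathsf K^{\mathrm{att}}_{\infty,\beta}(\mu)$ is positive and there are constants $C^{\mathrm{att}}_{\mathrm{rate}}(\beta,\mu)<\infty$ and $c_{\mathrm{att}}(\beta,\mu)>0$ satisfying $$\big|\mathsf K^{\mathrm{att}}_{N,\beta}(\mu)-\mathsf K^{\mathrm{att}}_{\infty,\beta}(\mu)\big|\le C^{\mathrm{att}}_{\mathrm{rate}}(\beta,\mu)\,(e+N)^{-c_{\mathrm{att}}(\beta,\mu)}\qquad\text{for every }N\ge1 .$$
   Context: Fix a dimension $d\ge1$. $\mathcal P(\mathbb R^d)$ is the set of Borel probability measures; an absolutely continuous measure is identified with its Lebesgue density. The attractive logarithmic kernel is $\mathsf g_{\mathrm{att}}(x)=\log|x|$, viewed as the two-body kernel $(x,y)\mapsto\log|x-y|$. Set $$h^{\mathrm{att}}_\mu(x)=\int\log|x-y|\,d\mu(y),\qquad I^{\mathrm{att}}_\mu=\tfrac12\iint\log|x-y|\,d\mu(x)d\mu(y),$$ $$\tilde{\mathsf g}_{\mathrm{att}}(x,y)=\log|x-y|-h^{\mathrm{att}}_\mu(x)-h^{\mathrm{att}}_\mu(y)+2I^{\mathrm{att}}_\mu .$$ For $X_N=(x_1,\dots,x_N)$, $$\mathsf F^{\mathrm{att}}_N(X_N,\mu)=\frac1{2N^2}\sum_{1\le i\ne j\le N}\tilde{\mathsf g}_{\mathrm{att}}(x_i,x_j)-\frac1{N^2}\sum_{i=1}^Nh^{\mathrm{att}}_\mu(x_i)+\frac1NI^{\mathrm{att}}_\mu,\qquad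 \mathsf K^{\mathrm{att}}_{N,\beta}(\mu)=\mathbb E_{\mu^{\otimes N}}\big[e^{-\beta N\mathsf F^{\mathrm{att}}_N(X_N,\mu)}\big].$$ For a self-adjoint Hilbert--Schmidt operator $T$ with nonzero eigenvalues $(\lambda_j)$ (repeated with multiplicity), $\det_2(\mathrm{Id}+\beta T)=\prod_j(1+\beta\lambda_j)e^{-\beta\lambda_j}$. *)

theory Defs
  imports "HOL-Probability.Probability"
begin

text \<open>
  The constant of the theorem is uniform in the dimension, so \<open>d\<close> has to be quantified inside the
  formula and cannot be a type. A point of \<open>\<real>\<^sup>d\<close> is a function \<open>nat \<Rightarrow> real\<close> that is
  \<open>undefined\<close> outside \<open>{..<d}\<close>, i.e. an element of \<open>space (Rd d)\<close>.
\<close>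

type_synonym point = "nat \<Rightarrow> real"

definition Rd :: "nat \<Rightarrow> point measure" where
  "Rd d = (\<Pi>\<^sub>M i\<in>{..<d}. borel)"

definition lebesgue_Rd :: "nat \<Rightarrow> point measure" where
  "lebesgue_Rd d = (\<Pi>\<^sub>M i\<in>{..<d}. lborel)"

definition edist :: "nat \<Rightarrow> point \<Rightarrow> point \<Rightarrow> real" where
  "edist d x y = L2_set (\<lambda>i. x i - y i) {..<d}"

definition prob_measures :: "nat \<Rightarrow> point measure set" where
  "prob_measures d = {\<mu>. prob_space \<mu> \<and> sets \<mu> = sets (Rd d)}"

text \<open>
  The kernel takes the value \<open>- \<infinity>\<close> on the diagonal, whereas \<open>ln 0 = 0\<close> in HOL. With the
  extended value, integrability of the kernel excludes atoms, as it should; the diagonal is then a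
  null set, and the real-valued kernel below may take any value there.
\<close>

definition g_att :: "nat \<Rightarrow> point \<Rightarrow> point \<Rightarrow> ereal" where
  "g_att d x y = (if edist d x y = 0 then - \<infinity> else ereal (ln (edist d x y)))"

definition g_att_L1 :: "nat \<Rightarrow> point measure \<Rightarrow> bool" where
  "g_att_L1 d \<mu> \<longleftrightarrow> (\<integral>\<^sup>+ z. e2ennreal \<bar>g_att d (fst z) (snd z)\<bar> \<partial>(\<mu> \<Otimes>\<^sub>M \<mu>)) < \<infinity>"

abbreviation g_real :: "nat \<Rightarrow> point \<Rightarrow> point \<Rightarrow> real" where
  "g_real d x y \<equiv> real_of_ereal (g_att d x y)"

definition h_att :: "nat \<Rightarrow> point measure \<Rightarrow> point \<Rightarrow> real" where
  "h_att d \<mu> x = (LINT y|\<mu>. g_real d x y)"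

definition I_att :: "nat \<Rightarrow> point measure \<Rightarrow> real" where
  "I_att d \<mu> = 1/2 * (LINT z|(\<mu> \<Otimes>\<^sub>M \<mu>). g_real d (fst z) (snd z))"

definition gt_att :: "nat \<Rightarrow> point measure \<Rightarrow> point \<Rightarrow> point \<Rightarrow> real" where
  "gt_att d \<mu> x y = g_real d x y - h_att d \<mu> x - h_att d \<mu> y + 2 * I_att d \<mu>"

definition F_att :: "nat \<Rightarrow> nat \<Rightarrow> (nat \<Rightarrow> point) \<Rightarrow> point measure \<Rightarrow> real" where
  "F_att d N X \<mu> =
     1 / (2 * (real N)\<^sup>2) * (\<Sum>i\<in>{1..N}. \<Sum>j\<in>{1..N} - {i}. gt_att d \<mu> (X i) (X j))
     - 1 / (real N)\<^sup>2 * (\<Sum>i\<in>{1..N}. h_att d \<mu> (X i)) + 1 / real N * I_att d \<mu>"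

text \<open>The expectation may be infinite, hence the values in \<open>[0, \<infinity>]\<close>.\<close>

definition K_att :: "nat \<Rightarrow> nat \<Rightarrow> real \<Rightarrow> point measure \<Rightarrow> ennreal" where
  "K_att d N \<beta> \<mu> =
     (\<integral>\<^sup>+ X. ennreal (exp (- \<beta> * real N * F_att d N X \<mu>)) \<partial>(\<Pi>\<^sub>M i\<in>{1..N}. \<mu>))"

definition Linf_norm :: "nat \<Rightarrow> point measure \<Rightarrow> ennreal" where
  "Linf_norm d \<mu> = esssup (lebesgue_Rd d) (RN_deriv (lebesgue_Rd d) \<mu>)"

definition in_Linf :: "nat \<Rightarrow> point measure \<Rightarrow> bool" where
  "in_Linf d \<mu> \<longleftrightarrow> absolutely_continuous (lebesgue_Rd d) \<mu> \<and> Linf_norm d \<mu> < \<infinity>"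

text \<open>
  Integral operators on (real) \<open>L\<^sup>2(\<mu>)\<close>. Elements of \<open>L\<^sup>2(\<mu>)\<close> are represented by functions, and
  equality, in particular linear independence, is understood \<open>\<mu>\<close>-almost everywhere.
\<close>

definition L2_fun :: "'a measure \<Rightarrow> ('a \<Rightarrow> real) set" where
  "L2_fun M = {f \<in> borel_measurable M. integrable M (\<lambda>x. (f x)\<^sup>2)}"

definition kernel_op :: "'a measure \<Rightarrow> ('a \<Rightarrow> 'a \<Rightarrow> real) \<Rightarrow> ('a \<Rightarrow> real) \<Rightarrow> 'a \<Rightarrow> real" where
  "kernel_op M k f x = (LINT y|M. k x y * f y)"

definition eigenspace :: "'a measure \<Rightarrow> ('a \<Rightarrow> 'a \<Rightarrow> real) \<Rightarrow> real \<Rightarrow> ('a \<Rightarrow> real) set" where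
  "eigenspace M k \<kappa> = {f \<in> L2_fun M. AE x in M. kernel_op M k f x = \<kappa> * f x}"

definition AE_independent :: "'a measure \<Rightarrow> nat \<Rightarrow> (nat \<Rightarrow> 'a \<Rightarrow> real) \<Rightarrow> bool" where
  "AE_independent M n f \<longleftrightarrow>
     (\<forall>c :: nat \<Rightarrow> real. (AE x in M. (\<Sum>i<n. c i * f i x) = 0) \<longrightarrow> (\<forall>i<n. c i = 0))"

text \<open>
  The dimension of the eigenspace; the supremum is that of a finite set when \<open>\<kappa> \<noteq> 0\<close> and the
  operator is Hilbert--Schmidt.
\<close>

definition eigen_mult :: "'a measure \<Rightarrow> ('a \<Rightarrow> 'a \<Rightarrow> real) \<Rightarrow> real \<Rightarrow> nat" where
  "eigen_mult M k \<kappa> =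
     Sup {n. \<exists>f. (\<forall>i<n. f i \<in> eigenspace M k \<kappa>) \<and> AE_independent M n f}"

definition nonzero_eigenvalues :: "'a measure \<Rightarrow> ('a \<Rightarrow> 'a \<Rightarrow> real) \<Rightarrow> real set" where
  "nonzero_eigenvalues M k =
     {\<kappa>. \<kappa> \<noteq> 0 \<and> (\<exists>f\<in>eigenspace M k \<kappa>. \<not> (AE x in M. f x = 0))}"

text \<open>
  \<open>det\<^sub>2 (Id + \<beta> T)\<close> for the operator \<open>T\<close> with kernel \<open>k\<close>, as an unordered product over the
  distinct nonzero eigenvalues, each factor being repeated according to multiplicity.
\<close>

definition det2 :: "'a measure \<Rightarrow> ('a \<Rightarrow> 'a \<Rightarrow> real) \<Rightarrow> real \<Rightarrow> real" where
  "det2 M k \<beta> = Lim (finite_subsets_at_top (nonzero_eigenvalues M k))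
     (\<lambda>E. \<Prod>\<kappa>\<in>E. ((1 + \<beta> * \<kappa>) * exp (- \<beta> * \<kappa>)) ^ eigen_mult M k \<kappa>)"

definition K_inf_att :: "nat \<Rightarrow> real \<Rightarrow> point measure \<Rightarrow> real" where
  "K_inf_att d \<beta> \<mu> = exp (\<beta> * I_att d \<mu>) * det2 \<mu> (gt_att d \<mu>) \<beta> powr (- 1/2)"

end

theory Submission
  imports Defs
begin

text \<open>
  Up to the factor \<open>exp (- \<beta> I)\<close>, the partition function is the expectation of
  \<open>exp (- z U / 2 + \<beta> H)\<close>, where \<open>U\<close> is the U-statistic of a kernel \<open>g\<close> proportional to the
  modulated kernel, hence degenerate, \<open>H\<close> is the empirical mean of \<open>h\<close>, and \<open>z\<close> is \<open>\<beta>\<close> up to the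
  same proportionality factor.

  Splitting the particles at random into two groups and integrating out one of them bounds the
  exponential moments of \<open>U\<close> uniformly in \<open>N\<close>; by AM-GM the term \<open>\<beta> H\<close> costs only the
  integrability of \<open>exp (2 \<beta> h)\<close>.

  For the limit, let \<open>u\<^sub>n\<close> be the iterated kernels of \<open>g\<close> and \<open>\<Phi>\<^sub>n\<close> the expectation of
  \<open>U(u\<^sub>n) exp (- z U / 2)\<close>. Integrating out one particle gives
  \<open>\<Phi>\<^sub>n + z \<Phi>\<^sub>n\<^sub>+\<^sub>1 + z tr u\<^sub>n\<^sub>+\<^sub>1 Z = O(N\<^sup>-\<^sup>1\<^sup>/\<^sup>2)\<close> with \<open>Z\<close> the expectation of \<open>exp (- z U / 2)\<close>.
  Iterating over \<open>n\<close> expresses \<open>Z' = - \<Phi>\<^sub>0 / 2\<close> through \<open>Z\<close> and the traces, so that \<open>Z\<close> converges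
  to the exponential of a power series in \<open>z\<close> whose coefficients are the traces of the powers of \<open>g\<close>.
  By the spectral theorem, whose eigenfunctions are obtained from power iteration, this is the
  regularised determinant. Finally \<open>H\<close> concentrates at \<open>2 I\<close>, since \<open>h\<close> has exponential moments.
\<close>

section \<open>Sub-exponential functions and degenerate kernels\<close>

text \<open>The kernel has no sign, and its logarithmic singularity rules out pointwise bounds. All
  that the moment hypothesis gives is an exponential moment of each row
  \<open>x \<mapsto> g x y\<close>, uniform in \<open>y\<close>. Every estimate is therefore made
  conditionally on some of the particles, where the centred rows lose their linear term. This is why
  \<open>U\<close>, a sum of order N^2 terms divided by N, has moments of order one. The hierarchy
  for \<open>\<Phi>\<^sub>n\<close> is not closed. It can be cut off because a single composition
  already makes the kernel bounded: all \<open>u\<^sub>n\<close>, divided by 4, satisfy the same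
  hypotheses as \<open>g\<close>, so the \<open>\<Phi>\<^sub>n\<close> are bounded uniformly in n
  and the tail carries the factor z^n. The regularisation of the determinant has the same origin:
  \<open>U\<close> omits the diagonal, where the logarithm diverges, and the recursion only produces
  traces of compositions, of order two and higher. Constants: scaling by 1 / (2 Cmom) turns \<beta>
  into z = 2 Cmom \<beta>. The splitting argument asks for |z| \<le> 1/24 after AM-GM, whence 48.
  The limit uses z \<le> 1/100, which leaves room for fourth powers of the weight, whence
  200.\<close>

definition psi :: "real \<Rightarrow> real" where
  "psi u = exp u - 1 - u"

lemma psi_sums: "(\<lambda>n. u ^ (n + 2) / fact (n + 2)) sums psi u"
proof -
  have "(\<lambda>n. u ^ n /\<^sub>R fact n) sums exp u" by (rule exp_converges)
  then have "(\<lambda>n. u ^ (n + 2) /\<^sub>R fact (n + 2)) sums (exp u - (\<Sum>n<2. u ^ n /\<^sub>R fact n))"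
    by (rule sums_split_initial_segment)
  moreover have "exp u - (\<Sum>n<2. u ^ n /\<^sub>R fact n) = psi u"
    by (simp add: psi_def numeral_2_eq_2)
  ultimately show ?thesis by (simp add: divide_inverse mult.commute)
qed

lemma psi_nonneg: "0 \<le> psi u"
  using exp_ge_add_one_self[of u] unfolding psi_def by linarith

text \<open>The power series of \<open>psi\<close> starts at order two, so a contraction factor
  comes out squared. This quadratic gain is the source of all moment estimates for centred
  functions.\<close>

lemma psi_mult_le:
  assumes "\<bar>s\<bar> \<le> 1"
  shows "psi (s * u) \<le> s\<^sup>2 * psi \<bar>u\<bar>"
proof (rule sums_le[OF _ psi_sums sums_mult[OF psi_sums]])
  fix n
  have "(s * u) ^ (n + 2) \<le> \<bar>s\<bar> ^ (n + 2) * \<bar>u\<bar> ^ (n + 2)"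
    by (metis abs_ge_self abs_mult power_abs power_mult_distrib)
  also have "\<dots> \<le> \<bar>s\<bar> ^ 2 * \<bar>u\<bar> ^ (n + 2)"
    by (intro mult_right_mono power_decreasing) (use assms in auto)
  finally show "(s * u) ^ (n + 2) / fact (n + 2) \<le> s\<^sup>2 * (\<bar>u\<bar> ^ (n + 2) / fact (n + 2))"
    by (simp add: divide_right_mono)
qed

lemma psi_abs_le: "psi u \<le> u\<^sup>2 * exp \<bar>u\<bar>"
proof (rule sums_le[OF _ psi_sums sums_mult[OF exp_converges]])
  fix n
  have "u ^ (n + 2) / fact (n + 2) \<le> \<bar>u\<bar> ^ (n + 2) / fact n"
  proof (rule frac_le)
    show "u ^ (n + 2) \<le> \<bar>u\<bar> ^ (n + 2)" by (metis abs_ge_self power_abs)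
    show "(fact n :: real) \<le> fact (n + 2)" by (rule fact_mono) simp
  qed auto
  then show "u ^ (n + 2) / fact (n + 2) \<le> u\<^sup>2 * (\<bar>u\<bar> ^ n /\<^sub>R fact n)"
    by (simp add: power_add power2_eq_square field_simps)
qed

lemma exp_abs_le_cosh: "exp \<bar>u\<bar> \<le> exp u + exp (- u)" for u :: real
  by (cases "u \<ge> 0") (auto simp: abs_if)

text \<open>Trades \<open>psi\<close> for pure exponentials, which factorise over independent
  variables. Enlarging the argument by \<open>l\<close> buys the factor 1 / l^2; the optimal
  \<open>l\<close> is chosen in \<open>decoupled_term_bound\<close>.\<close>

lemma psi_le_cosh:
  assumes "l \<ge> 1"
  shows "psi u \<le> (exp (l * u) + exp (- l * u)) / l\<^sup>2"
proof -
  have "psi u = psi ((1 / l) * (l * u))" using assms by simp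
  also have "\<dots> \<le> (1 / l)\<^sup>2 * psi \<bar>l * u\<bar>" by (rule psi_mult_le) (use assms in simp)
  also have "\<dots> \<le> (1 / l)\<^sup>2 * (exp (l * u) + exp (- l * u))"
  proof (rule mult_left_mono)
    have "exp (l * u) > 0" "exp (- l * u) > 0" by auto
    then show "psi \<bar>l * u\<bar> \<le> exp (l * u) + exp (- l * u)"
      using exp_abs_le_cosh[of "l * u"] unfolding psi_def by simp
  qed simp
  finally show ?thesis by (simp add: power_one_over)
qed

text \<open>Jensen's inequality for weights of total mass at most one; the missing mass sits at the
  point 0, where the exponential is 1.\<close>

lemma exp_sum_le_convex:
  fixes a :: "'i \<Rightarrow> real"
  assumes "finite F" "\<And>i. i \<in> F \<Longrightarrow> 0 \<le> c i" "sum c F \<le> 1"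
  shows "exp (\<Sum>i\<in>F. c i * a i) \<le> (\<Sum>i\<in>F. c i * exp (a i)) + (1 - sum c F)"
proof -
  \<comment> \<open>\<open>None\<close> is the extra point that carries the missing mass.\<close>
  let ?b = "\<lambda>i. case i of None \<Rightarrow> 0 | Some i \<Rightarrow> a i"
  let ?d = "\<lambda>i. case i of None \<Rightarrow> 1 - sum c F | Some i \<Rightarrow> c i"
  have sum: "sum g (insert None (Some ` F)) = g None + (\<Sum>i\<in>F. g (Some i))"
    for g :: "'i option \<Rightarrow> real"
    using assms(1) by (subst sum.insert) (auto simp: sum.reindex)
  have "exp (\<Sum>i\<in>insert None (Some ` F). ?d i *\<^sub>R ?b i)
      \<le> (\<Sum>i\<in>insert None (Some ` F). ?d i * exp (?b i))"
    by (rule convex_on_sum[where C = UNIV and f = exp])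
      (use assms in \<open>auto simp: sum exp_convex split: option.split\<close>)
  then show ?thesis by (simp add: sum)
qed

text \<open>The left-hand side divided by m! is one term of the exponential series at m. This is the
  half of Stirling's formula that is needed for \<open>decoupled_coefficient\<close>.\<close>

lemma power_le_exp_fact: "real m ^ m \<le> fact m * exp 1 ^ m"
proof -
  have "(\<Sum>n\<in>{m}. real m ^ n /\<^sub>R fact n) \<le> exp (real m)"
    unfolding exp_def by (rule sum_le_suminf[OF summable_exp_generic]) auto
  then have "real m ^ m / fact m \<le> exp (real m)" by (simp add: divide_inverse mult.commute)
  then show ?thesis by (simp add: field_simps exp_of_nat_mult[of m 1, simplified])
qed

text \<open>The centred part of the unit ball of the exponential Orlicz space. The moment is a
  nonnegative integral, so that its finiteness is part of the bound.\<close>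

definition subexp :: "'a measure \<Rightarrow> ('a \<Rightarrow> real) \<Rightarrow> bool" where
  "subexp M w \<longleftrightarrow> w \<in> borel_measurable M \<and> (\<integral>\<^sup>+x. ennreal (exp \<bar>w x\<bar>) \<partial>M) \<le> 2 \<and> (LINT x|M. w x) = 0"

text \<open>Degeneracy in the sense of Hoeffding, with all rows in one Orlicz ball. It is demanded
  at every \<open>y\<close> and not almost everywhere, so that the rows through arbitrary sample
  points can be used without exceptional sets.\<close>

definition deg_kernel :: "'a measure \<Rightarrow> ('a \<Rightarrow> 'a \<Rightarrow> real) \<Rightarrow> bool" where
  "deg_kernel M k \<longleftrightarrow> (\<lambda>(x, y). k x y) \<in> borel_measurable (M \<Otimes>\<^sub>M M) \<and>
     (\<forall>x\<in>space M. \<forall>y\<in>space M. k x y = k y x) \<and> (\<forall>y\<in>space M. subexp M (\<lambda>x. k x y))"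

lemma subexp_measurable: "subexp M w \<Longrightarrow> w \<in> borel_measurable M"
  by (simp add: subexp_def)

section \<open>Moment generating functions of centred sub-exponential functions\<close>

context prob_space
begin

lemma exp_abs_integrable:
  assumes "subexp M w"
  shows "integrable M (\<lambda>x. exp \<bar>w x\<bar>)" "(LINT x|M. exp \<bar>w x\<bar>) \<le> 2"
proof -
  have [measurable]: "w \<in> borel_measurable M" using assms by (simp add: subexp_def)
  have le: "(\<integral>\<^sup>+x. ennreal (exp \<bar>w x\<bar>) \<partial>M) \<le> 2" using assms by (simp add: subexp_def)
  show "integrable M (\<lambda>x. exp \<bar>w x\<bar>)"
    by (rule integrableI_nonneg) (use le in \<open>auto intro: le_less_trans\<close>)
  then have "ennreal (LINT x|M. exp \<bar>w x\<bar>) = (\<integral>\<^sup>+x. ennreal (exp \<bar>w x\<bar>) \<partial>M)"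
    by (subst nn_integral_eq_integral) auto
  with le have "ennreal (LINT x|M. exp \<bar>w x\<bar>) \<le> ennreal 2" by simp
  then show "(LINT x|M. exp \<bar>w x\<bar>) \<le> 2" by (subst (asm) ennreal_le_iff) auto
qed

lemma subexp_integrable:
  assumes "subexp M w"
  shows "integrable M w"
proof (rule Bochner_Integration.integrable_bound[OF exp_abs_integrable(1)[OF assms]])
  show "w \<in> borel_measurable M" using assms by (simp add: subexp_def)
  show "AE x in M. norm (w x) \<le> norm (exp \<bar>w x\<bar>)"
    by (intro AE_I2) (smt (verit) exp_ge_add_one_self real_norm_def exp_gt_zero)
qed

text \<open>The linear term integrates to zero, and \<open>psi (t * w)\<close> is at most t^2 times
  \<open>exp \<bar>w\<bar> - 1\<close>, whose mean is at most 1. The first part is kept as an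
  identity because \<open>decoupled_mgf\<close> expands powers of its right-hand side.\<close>

lemma subexp_psi:
  assumes "subexp M w" "\<bar>t\<bar> \<le> 1"
  shows "(\<integral>\<^sup>+x. ennreal (exp (t * w x)) \<partial>M) = 1 + (\<integral>\<^sup>+x. ennreal (psi (t * w x)) \<partial>M)"
    and "(\<integral>\<^sup>+x. ennreal (psi (t * w x)) \<partial>M) \<le> ennreal (t\<^sup>2)"
proof -
  note [simp] = subexp_integrable[OF assms(1)] exp_abs_integrable[OF assms(1)]
  have [measurable]: "w \<in> borel_measurable M" using assms by (simp add: subexp_def)
  have int: "integrable M (\<lambda>x. exp (t * w x))"
  proof (rule Bochner_Integration.integrable_bound[OF exp_abs_integrable(1)[OF assms(1)]])
    have "t * w x \<le> \<bar>w x\<bar>" for x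
      using mult_right_mono[OF assms(2), of "\<bar>w x\<bar>"] by (simp add: abs_mult[symmetric])
    then show "AE x in M. norm (exp (t * w x)) \<le> norm (exp \<bar>w x\<bar>)" by simp
  qed simp
  have ipsi: "integrable M (\<lambda>x. psi (t * w x))" using int by (simp add: psi_def)
  have eq: "(LINT x|M. psi (t * w x)) = (LINT x|M. exp (t * w x)) - 1"
    using int assms(1) by (simp add: psi_def subexp_def prob_space)
  have "0 \<le> (LINT x|M. psi (t * w x))" by (simp add: psi_nonneg)
  then show "(\<integral>\<^sup>+x. ennreal (exp (t * w x)) \<partial>M) = 1 + (\<integral>\<^sup>+x. ennreal (psi (t * w x)) \<partial>M)"
    using eq ipsi int by (simp add: nn_integral_eq_integral psi_nonneg flip: ennreal_plus ennreal_1)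
  have "(LINT x|M. psi (t * w x)) \<le> (LINT x|M. t\<^sup>2 * (exp \<bar>w x\<bar> - 1))"
  proof (rule integral_mono[OF ipsi])
    fix x
    show "psi (t * w x) \<le> t\<^sup>2 * (exp \<bar>w x\<bar> - 1)"
      by (rule order_trans[OF psi_mult_le[OF assms(2)] mult_left_mono]) (auto simp: psi_def)
  qed auto
  also have "\<dots> = t\<^sup>2 * ((LINT x|M. exp \<bar>w x\<bar>) - 1)"
    by (simp add: prob_space)
  also have "\<dots> \<le> t\<^sup>2 * 1"
    by (rule mult_left_mono) (use exp_abs_integrable(2)[OF assms(1)] in auto)
  finally show "(\<integral>\<^sup>+x. ennreal (psi (t * w x)) \<partial>M) \<le> ennreal (t\<^sup>2)"
    using ipsi by (simp add: nn_integral_eq_integral psi_nonneg)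
qed

lemma subexp_mgf:
  assumes "subexp M w" "\<bar>t\<bar> \<le> 1"
  shows "(\<integral>\<^sup>+x. ennreal (exp (t * w x)) \<partial>M) \<le> ennreal (exp (t\<^sup>2))"
proof -
  have "(\<integral>\<^sup>+x. ennreal (exp (t * w x)) \<partial>M) \<le> 1 + ennreal (t\<^sup>2)"
    unfolding subexp_psi(1)[OF assms] by (intro add_left_mono subexp_psi(2)[OF assms])
  also have "\<dots> = ennreal (1 + t\<^sup>2)" by simp
  also have "\<dots> \<le> ennreal (exp (t\<^sup>2))" by (intro ennreal_leI) simp
  finally show ?thesis .
qed

text \<open>The ball is absolutely convex by Jensen's inequality; the missing weight contributes exp
  0 = 1, which is below the bound 2.\<close>

lemma subexp_sum:
  assumes "finite F" "\<And>i. i \<in> F \<Longrightarrow> subexp M (w i)" "(\<Sum>i\<in>F. \<bar>c i\<bar>) \<le> 1"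
  shows "subexp M (\<lambda>x. \<Sum>i\<in>F. c i * w i x)"
proof -
  have [measurable]: "w i \<in> borel_measurable M" if "i \<in> F" for i
    using assms(2)[OF that] by (simp add: subexp_def)
  have 1: "ennreal (exp \<bar>\<Sum>i\<in>F. c i * w i x\<bar>)
      \<le> ennreal ((\<Sum>i\<in>F. \<bar>c i\<bar> * exp \<bar>w i x\<bar>) + (1 - (\<Sum>i\<in>F. \<bar>c i\<bar>)))" for x
  proof (intro ennreal_leI)
    have "\<bar>\<Sum>i\<in>F. c i * w i x\<bar> \<le> (\<Sum>i\<in>F. \<bar>c i\<bar> * \<bar>w i x\<bar>)"
      by (rule order_trans[OF sum_abs]) (simp add: abs_mult)
    then show "exp \<bar>\<Sum>i\<in>F. c i * w i x\<bar> \<le> (\<Sum>i\<in>F. \<bar>c i\<bar> * exp \<bar>w i x\<bar>) + (1 - (\<Sum>i\<in>F. \<bar>c i\<bar>))"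
      using exp_sum_le_convex[OF assms(1), of "\<lambda>i. \<bar>c i\<bar>" "\<lambda>i. \<bar>w i x\<bar>"] assms(3)
      by (meson abs_ge_zero exp_le_cancel_iff order_trans)
  qed
  have int: "integrable M (\<lambda>x. (\<Sum>i\<in>F. \<bar>c i\<bar> * exp \<bar>w i x\<bar>) + (1 - (\<Sum>i\<in>F. \<bar>c i\<bar>)))"
    using exp_abs_integrable(1)[OF assms(2)] by auto
  have "(\<integral>\<^sup>+x. ennreal (exp \<bar>\<Sum>i\<in>F. c i * w i x\<bar>) \<partial>M)
      \<le> (\<integral>\<^sup>+x. ennreal ((\<Sum>i\<in>F. \<bar>c i\<bar> * exp \<bar>w i x\<bar>) + (1 - (\<Sum>i\<in>F. \<bar>c i\<bar>))) \<partial>M)"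
    by (intro nn_integral_mono 1)
  also have "\<dots> = ennreal (LINT x|M. (\<Sum>i\<in>F. \<bar>c i\<bar> * exp \<bar>w i x\<bar>) + (1 - (\<Sum>i\<in>F. \<bar>c i\<bar>)))"
    by (rule nn_integral_eq_integral[OF int]) (use assms(3) in \<open>auto intro!: add_nonneg_nonneg sum_nonneg\<close>)
  also have "(LINT x|M. (\<Sum>i\<in>F. \<bar>c i\<bar> * exp \<bar>w i x\<bar>) + (1 - (\<Sum>i\<in>F. \<bar>c i\<bar>)))
      = (\<Sum>i\<in>F. \<bar>c i\<bar> * (LINT x|M. exp \<bar>w i x\<bar>)) + (1 - (\<Sum>i\<in>F. \<bar>c i\<bar>))"
    using exp_abs_integrable(1)[OF assms(2)] by (subst Bochner_Integration.integral_add) (auto simp: prob_space)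
  also have "\<dots> \<le> (\<Sum>i\<in>F. \<bar>c i\<bar> * 2) + (1 - (\<Sum>i\<in>F. \<bar>c i\<bar>))"
    using exp_abs_integrable(2)[OF assms(2)] by (intro add_right_mono sum_mono mult_left_mono) auto
  also have "\<dots> \<le> 2" using assms(3) by (simp flip: sum_distrib_right)
  finally have "(\<integral>\<^sup>+x. ennreal (exp \<bar>\<Sum>i\<in>F. c i * w i x\<bar>) \<partial>M) \<le> 2"
    by (simp add: ennreal_leI)
  moreover have "(LINT x|M. (\<Sum>i\<in>F. c i * w i x)) = 0"
    using assms(2) subexp_integrable[OF assms(2)] by (simp add: subexp_def)
  ultimately show ?thesis unfolding subexp_def by auto
qed

text \<open>All functions depend on the same variable, so no independence is available: the sum is
  \<open>s * card F\<close> times an absolutely convex combination, and the quadratic bound applies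
  with this factor.\<close>

lemma subexp_sum_mgf:
  fixes s :: real
  assumes "finite F" "\<And>i. i \<in> F \<Longrightarrow> subexp M (w i)" "\<And>i. i \<in> F \<Longrightarrow> \<bar>c i\<bar> \<le> s"
    "0 \<le> s" "s * card F \<le> 1"
  shows "(\<integral>\<^sup>+x. ennreal (exp (\<Sum>i\<in>F. c i * w i x)) \<partial>M) \<le> ennreal (exp ((s * card F)\<^sup>2))"
proof (cases "s * card F = 0")
  case True
  then have "c i * w i x = 0" if "i \<in> F" for i x
  proof -
    have "card F \<noteq> 0" using assms(1) that by auto
    then have "s = 0" using True by simp
    then show ?thesis using assms(3)[OF that] by simp
  qed
  then have "(\<Sum>i\<in>F. c i * w i x) = 0" for x by (simp add: sum.neutral)
  then show ?thesis by (simp add: emeasure_space_1)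
next
  case False
  let ?t = "s * card F"
  have t: "?t > 0" using False mult_nonneg_nonneg[OF assms(4) of_nat_0_le_iff[of "card F"]] by linarith
  have "(\<Sum>i\<in>F. \<bar>c i / ?t\<bar>) \<le> (\<Sum>i\<in>F. s / ?t)"
  proof (rule sum_mono)
    fix i assume "i \<in> F"
    have "\<bar>c i / ?t\<bar> = \<bar>c i\<bar> / ?t" using t by (simp only: abs_divide abs_of_pos)
    also have "\<dots> \<le> s / ?t" using t assms(3)[OF \<open>i \<in> F\<close>] by (intro divide_right_mono) linarith+
    finally show "\<bar>c i / ?t\<bar> \<le> s / ?t" .
  qed
  also have "\<dots> = card F * s / ?t" by simp
  also have "\<dots> = 1" using t by (metis divide_self less_irrefl mult.commute)
  finally have "subexp M (\<lambda>x. \<Sum>i\<in>F. (c i / ?t) * w i x)"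
    by (intro subexp_sum assms)
  moreover have "?t * (\<Sum>i\<in>F. (c i / ?t) * w i x) = (\<Sum>i\<in>F. c i * w i x)" for x
    unfolding sum_distrib_left by (rule sum.cong) (use False in auto)
  ultimately show ?thesis
    using subexp_mgf[of "\<lambda>x. \<Sum>i\<in>F. (c i / ?t) * w i x" ?t] t assms(5) by simp
qed

end

section \<open>Exponential moments of degenerate U-statistics\<close>

lemma deg_kernel_measurable:
  "deg_kernel M k \<Longrightarrow> (\<lambda>(x, y). k x y) \<in> borel_measurable (M \<Otimes>\<^sub>M M)"
  by (simp add: deg_kernel_def)

lemma deg_kernel_sym: "deg_kernel M k \<Longrightarrow> x \<in> space M \<Longrightarrow> y \<in> space M \<Longrightarrow> k x y = k y x"
  by (simp add: deg_kernel_def)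

lemma deg_kernel_subexp: "deg_kernel M k \<Longrightarrow> y \<in> space M \<Longrightarrow> subexp M (\<lambda>x. k x y)"
  by (simp add: deg_kernel_def)

lemma subexp_cong:
  assumes "\<And>x. x \<in> space M \<Longrightarrow> f x = g x"
  shows "subexp M f = subexp M g"
proof -
  have "f \<in> borel_measurable M \<longleftrightarrow> g \<in> borel_measurable M"
    by (rule measurable_cong) (rule assms)
  moreover have "(\<integral>\<^sup>+x. ennreal (exp \<bar>f x\<bar>) \<partial>M) = (\<integral>\<^sup>+x. ennreal (exp \<bar>g x\<bar>) \<partial>M)"
    by (rule nn_integral_cong) (simp add: assms)
  moreover have "(LINT x|M. f x) = (LINT x|M. g x)"
    by (rule Bochner_Integration.integral_cong) (simp_all add: assms)
  ultimately show ?thesis by (simp add: subexp_def)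
qed

lemma deg_kernel_subexp_right:
  assumes "deg_kernel M k" "x \<in> space M"
  shows "subexp M (\<lambda>y. k x y)"
  using deg_kernel_subexp[OF assms] subexp_cong[of M "\<lambda>y. k x y" "\<lambda>y. k y x"]
    deg_kernel_sym[OF assms] by simp

lemma kernel_component_measurable:
  assumes "(\<lambda>(x, y). k x y) \<in> borel_measurable (M \<Otimes>\<^sub>M M)" "i \<in> I" "j \<in> I"
  shows "(\<lambda>X. k (X i) (X j)) \<in> borel_measurable (Pi\<^sub>M I (\<lambda>_. M))"
proof -
  have "(\<lambda>X. (X i, X j)) \<in> Pi\<^sub>M I (\<lambda>_. M) \<rightarrow>\<^sub>M M \<Otimes>\<^sub>M M"
    using assms(2,3) by measurable
  from measurable_compose[OF this assms(1)] show ?thesis by simp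
qed

section \<open>Averaging over the splittings of an index set\<close>

lemma card_separating_subsets:
  assumes "finite I" "i \<in> I" "j \<in> I" "i \<noteq> j"
  shows "4 * card {S \<in> Pow I. i \<in> S \<and> j \<notin> S} = 2 ^ card I"
proof -
  let ?K = "I - {i, j}"
  have "{S \<in> Pow I. i \<in> S \<and> j \<notin> S} = insert i ` Pow ?K"
  proof safe
    fix S assume S: "S \<subseteq> I" "i \<in> S" "j \<notin> S"
    show "S \<in> insert i ` Pow ?K"
      by (rule image_eqI[of _ _ "S - {i}"]) (use S in auto)
  qed (use assms in auto)
  moreover have "inj_on (insert i) (Pow ?K)" by (auto simp: inj_on_def)
  ultimately have "card {S \<in> Pow I. i \<in> S \<and> j \<notin> S} = 2 ^ card ?K"
    by (simp add: card_image card_Pow assms(1))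
  moreover have "card I = card ?K + 2"
    using card_Diff_subset[of "{i, j}" I] card_mono[of I "{i, j}"] assms by simp
  ultimately show ?thesis by (simp add: power_add)
qed

text \<open>A uniformly random subset contains i and misses j with probability 1/4. This is the
  factor 4 between the thresholds 1/6 for two separate groups and 1/24 for the full sum.\<close>

lemma sum_separating_subsets:
  fixes a :: "'i \<Rightarrow> 'i \<Rightarrow> real"
  assumes "finite I"
  shows "(\<Sum>S\<in>Pow I. \<Sum>i\<in>S. \<Sum>j\<in>I - S. a i j) = 2 ^ card I / 4 * (\<Sum>i\<in>I. \<Sum>j\<in>I - {i}. a i j)"
proof -
  have "(\<Sum>i\<in>S. \<Sum>j\<in>I - S. a i j) = (\<Sum>i\<in>I. \<Sum>j\<in>I. if i \<in> S \<and> j \<notin> S then a i j else 0)"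
    if "S \<in> Pow I" for S
  proof -
    have "(\<Sum>j\<in>I. if i \<in> S \<and> j \<notin> S then a i j else 0) = (if i \<in> S then \<Sum>j\<in>I - S. a i j else 0)" for i
      using assms by (auto simp: sum.If_cases intro!: sum.cong)
    then show ?thesis using assms that by (auto simp: sum.If_cases Int_absorb1)
  qed
  then have "(\<Sum>S\<in>Pow I. \<Sum>i\<in>S. \<Sum>j\<in>I - S. a i j)
      = (\<Sum>S\<in>Pow I. \<Sum>i\<in>I. \<Sum>j\<in>I. if i \<in> S \<and> j \<notin> S then a i j else 0)"
    by (rule sum.cong[OF refl])
  also have "\<dots> = (\<Sum>i\<in>I. \<Sum>j\<in>I. \<Sum>S\<in>Pow I. if i \<in> S \<and> j \<notin> S then a i j else 0)"
    by (subst sum.swap, intro sum.cong refl, rule sum.swap)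
  also have "\<dots> = (\<Sum>i\<in>I. \<Sum>j\<in>I. if i = j then 0 else 2 ^ card I / 4 * a i j)"
  proof (intro sum.cong refl)
    fix i j assume ij: "i \<in> I" "j \<in> I"
    have "(\<Sum>S\<in>Pow I. if i \<in> S \<and> j \<notin> S then a i j else 0) = real (card {S \<in> Pow I. i \<in> S \<and> j \<notin> S}) * a i j"
      using assms by (simp add: sum.If_cases Int_def)
    also have "\<dots> = (if i = j then 0 else 2 ^ card I / 4 * a i j)"
    proof (cases "i = j")
      case False
      have "real (4 * card {S \<in> Pow I. i \<in> S \<and> j \<notin> S}) = real (2 ^ card I)"
        by (rule arg_cong[OF card_separating_subsets[OF assms ij False]])
      then have "real (card {S \<in> Pow I. i \<in> S \<and> j \<notin> S}) = 2 ^ card I / 4" by simp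
      then show ?thesis using False by simp
    next
      case True
      then have "{S \<in> Pow I. i \<in> S \<and> j \<notin> S} = {}" by auto
      then show ?thesis using True by simp
    qed
    finally show "(\<Sum>S\<in>Pow I. if i \<in> S \<and> j \<notin> S then a i j else 0)
        = (if i = j then 0 else 2 ^ card I / 4 * a i j)" .
  qed
  also have "\<dots> = 2 ^ card I / 4 * (\<Sum>i\<in>I. \<Sum>j\<in>I - {i}. a i j)"
    unfolding sum_distrib_left
  proof (rule sum.cong[OF refl])
    fix i assume "i \<in> I"
    have "(\<Sum>j\<in>I. if i = j then 0 else 2 ^ card I / 4 * a i j) = (\<Sum>j\<in>I - {i}. if i = j then 0 else 2 ^ card I / 4 * a i j)"
      using assms by (intro sum.mono_neutral_right) auto
    also have "\<dots> = (\<Sum>j\<in>I - {i}. 2 ^ card I / 4 * a i j)" by (intro sum.cong) auto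
    finally show "(\<Sum>j\<in>I. if i = j then 0 else 2 ^ card I / 4 * a i j) = (\<Sum>j\<in>I - {i}. 2 ^ card I / 4 * a i j)" .
  qed
  finally show ?thesis .
qed

section \<open>Independent samples and decoupled sums\<close>

locale sample_space = prob_space M for M :: "'a measure"
begin

sublocale fpow: product_sigma_finite "\<lambda>_ :: nat. M"
  by unfold_locales

text \<open>With the points \<open>x i\<close> frozen, the variables \<open>y j\<close> are
  independent, so after interchanging the sums the expectation is a product of \<open>card J\<close>
  equal factors.\<close>

lemma subexp_sum_mgf_prod:
  fixes s :: real and J :: "nat set"
  assumes K: "deg_kernel M k" and "finite J" "finite F" and x: "\<And>i. i \<in> F \<Longrightarrow> x i \<in> space M"
    and c: "\<And>i. i \<in> F \<Longrightarrow> \<bar>c i\<bar> \<le> s" "0 \<le> s" "s * card F \<le> 1"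
  shows "(\<integral>\<^sup>+y. ennreal (exp (\<Sum>i\<in>F. c i * (\<Sum>j\<in>J. k (x i) (y j)))) \<partial>Pi\<^sub>M J (\<lambda>_. M))
    \<le> ennreal (exp ((s * card F)\<^sup>2 * card J))"
proof -
  have km: "(\<lambda>y. k (x i) y) \<in> borel_measurable M" if "i \<in> F" for i
    using subexp_measurable[OF deg_kernel_subexp_right[OF K x[OF that]]] .
  have "(\<integral>\<^sup>+y. ennreal (exp (\<Sum>i\<in>F. c i * (\<Sum>j\<in>J. k (x i) (y j)))) \<partial>Pi\<^sub>M J (\<lambda>_. M))
      = (\<integral>\<^sup>+y. (\<Prod>j\<in>J. ennreal (exp (\<Sum>i\<in>F. c i * k (x i) (y j)))) \<partial>Pi\<^sub>M J (\<lambda>_. M))"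
  proof (rule nn_integral_cong)
    fix y
    have "(\<Sum>i\<in>F. c i * (\<Sum>j\<in>J. k (x i) (y j))) = (\<Sum>j\<in>J. \<Sum>i\<in>F. c i * k (x i) (y j))"
      by (simp add: sum_distrib_left sum.swap[of _ F J])
    then show "ennreal (exp (\<Sum>i\<in>F. c i * (\<Sum>j\<in>J. k (x i) (y j)))) = (\<Prod>j\<in>J. ennreal (exp (\<Sum>i\<in>F. c i * k (x i) (y j))))"
      using \<open>finite J\<close> by (simp add: exp_sum prod_ennreal)
  qed
  also have "\<dots> = (\<Prod>j\<in>J. \<integral>\<^sup>+y. ennreal (exp (\<Sum>i\<in>F. c i * k (x i) y)) \<partial>M)"
    by (rule fpow.product_nn_integral_prod[OF \<open>finite J\<close>]) (use km in measurable)
  also have "\<dots> \<le> (\<Prod>j\<in>J. ennreal (exp ((s * card F)\<^sup>2)))"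
    by (intro prod_mono_ennreal subexp_sum_mgf[OF \<open>finite F\<close> _ c] deg_kernel_subexp_right[OF K x])
  also have "\<dots> = ennreal (exp ((s * card F)\<^sup>2 * card J))"
    by (subst mult.commute) (simp add: ennreal_power exp_of_nat_mult)
  finally show ?thesis .
qed

text \<open>Each \<open>psi\<close> is replaced by two exponentials with opposite signs. Multiplying
  out gives 2^m exponentials of linear combinations of m frozen rows; each has expectation at most
  e^m, and every factor has gained 1 / l^2 = m / (36 N).\<close>

lemma decoupled_term_bound:
  fixes N m :: nat and J :: "nat set"
  assumes K: "deg_kernel M k" and J: "finite J" "card J \<le> N" and m: "m \<le> N" and t: "\<bar>t\<bar> \<le> 1 / 6"
    and x: "\<And>i. i < m \<Longrightarrow> x i \<in> space M"
  shows "(\<integral>\<^sup>+y. (\<Prod>i<m. ennreal (psi (t / N * (\<Sum>j\<in>J. k (x i) (y j))))) \<partial>Pi\<^sub>M J (\<lambda>_. M))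
    \<le> ennreal ((real m / (36 * N) * 2 * exp 1) ^ m)"
proof (cases "m = 0")
  case True
  interpret PJ: prob_space "Pi\<^sub>M J (\<lambda>_. M)" by (rule prob_space_PiM) unfold_locales
  show ?thesis using True by (simp add: PJ.emeasure_space_1)
next
  case False
  note [measurable] = deg_kernel_measurable[OF K]
  have [measurable]: "(\<lambda>y. k (x i) y) \<in> borel_measurable M" if "i < m" for i
    using subexp_measurable[OF deg_kernel_subexp_right[OF K x[OF that]]] .
  \<comment> \<open>The coefficients \<open>l * t / N\<close> of m rows have total mass 6 |t| sqrt
    (m / N) \<le> 1. This is the largest enlargement, up to a constant, that the threshold |t| \<le>
    1/6 permits.\<close>
  define l where "l = 6 * sqrt (N / m)"
  define G where "G i y = (\<Sum>j\<in>J. k (x i) (y j))" for i and y :: "nat \<Rightarrow> 'a"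
  \<comment> \<open>\<open>S\<close> is the set of indices that take the plus sign when the product
    of the two-term sums is multiplied out.\<close>
  define e where "e S i = (if i \<in> S then l * (t / N) else - l * (t / N))" for S and i :: nat
  have N: "N > 0" using m False by simp
  have "1 \<le> sqrt (N / m)" using m False by simp
  then have l1: "l \<ge> 1" unfolding l_def by linarith
  have l2: "l\<^sup>2 = 36 * N / m" by (simp add: l_def power_mult_distrib)
  have Gm [measurable]: "G i \<in> borel_measurable (Pi\<^sub>M J (\<lambda>_. M))" if "i < m" for i
    unfolding G_def
    by (intro borel_measurable_sum measurable_compose[OF measurable_component_singleton])
      (use that in auto)
  have "(\<Prod>i<m. psi (t / N * G i y)) \<le> (1 / l\<^sup>2) ^ m * (\<Sum>S\<in>Pow {..<m}. exp (\<Sum>i<m. e S i * G i y))" for y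
  proof -
    have "(\<Prod>i<m. psi (t / N * G i y))
        \<le> (\<Prod>i<m. (1 / l\<^sup>2) * (exp (l * (t / N * G i y)) + exp (- l * (t / N * G i y))))"
    proof (intro prod_mono conjI psi_nonneg)
      fix i
      show "psi (t / N * G i y) \<le> (1 / l\<^sup>2) * (exp (l * (t / N * G i y)) + exp (- l * (t / N * G i y)))"
        using psi_le_cosh[OF l1, of "t / N * G i y"] by (simp only: times_divide_eq_left mult_1_left)
    qed
    also have "\<dots> = (1 / l\<^sup>2) ^ m * (\<Prod>i<m. exp (l * (t / N * G i y)) + exp (- l * (t / N * G i y)))"
      by (simp only: prod.distrib prod_constant card_lessThan)
    also have "(\<Prod>i<m. exp (l * (t / N * G i y)) + exp (- l * (t / N * G i y))) = (\<Sum>S\<in>Pow {..<m}. exp (\<Sum>i<m. e S i * G i y))"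
    proof (subst prod_add, simp, rule sum.cong[OF refl])
      fix S assume "S \<in> Pow {..<m}"
      then have S: "S \<subseteq> {..<m}" by simp
      have "exp (\<Sum>i<m. e S i * G i y) = (\<Prod>i\<in>S. exp (e S i * G i y)) * (\<Prod>i\<in>{..<m} - S. exp (e S i * G i y))"
        by (simp add: exp_sum prod.subset_diff[OF S] mult.commute)
      also have "\<dots> = (\<Prod>i\<in>S. exp (l * (t / N * G i y))) * (\<Prod>i\<in>{..<m} - S. exp (- l * (t / N * G i y)))"
        by (intro arg_cong2[where f = "(*)"] prod.cong) (auto simp: e_def)
      finally show "(\<Prod>i\<in>S. exp (l * (t / N * G i y))) * (\<Prod>i\<in>{..<m} - S. exp (- l * (t / N * G i y)))
          = exp (\<Sum>i<m. e S i * G i y)" ..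
    qed
    finally show ?thesis .
  qed
  then have "(\<integral>\<^sup>+y. (\<Prod>i<m. ennreal (psi (t / N * G i y))) \<partial>Pi\<^sub>M J (\<lambda>_. M))
      \<le> (\<integral>\<^sup>+y. ennreal ((1 / l\<^sup>2) ^ m) * (\<Sum>S\<in>Pow {..<m}. ennreal (exp (\<Sum>i<m. e S i * G i y))) \<partial>Pi\<^sub>M J (\<lambda>_. M))"
    by (intro nn_integral_mono, subst prod_ennreal, simp add: psi_nonneg, subst sum_ennreal, simp,
        subst ennreal_mult[symmetric]) (simp_all add: ennreal_leI sum_nonneg del: times_divide_eq_left)
  also have "\<dots> = ennreal ((1 / l\<^sup>2) ^ m) * (\<Sum>S\<in>Pow {..<m}. \<integral>\<^sup>+y. ennreal (exp (\<Sum>i<m. e S i * G i y)) \<partial>Pi\<^sub>M J (\<lambda>_. M))"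
    by (subst nn_integral_cmult, measurable, subst nn_integral_sum, measurable)
  also have "\<dots> \<le> ennreal ((1 / l\<^sup>2) ^ m) * (\<Sum>S\<in>Pow {..<m}. ennreal (exp m))"
  proof (intro mult_left_mono sum_mono zero_le)
    fix S assume "S \<in> Pow {..<m}"
    have lm: "l * (\<bar>t\<bar> / N) * m = 6 * \<bar>t\<bar> * sqrt (m / N)"
      using N False by (simp add: l_def real_sqrt_divide field_simps)
    have sq: "sqrt (m / N) \<le> 1" using m N by simp
    have "6 * \<bar>t\<bar> * sqrt (m / N) \<le> 1"
      by (rule mult_le_one[OF _ _ sq]) (use t in auto)
    then have lm1: "l * (\<bar>t\<bar> / N) * m \<le> 1" unfolding lm .
    have "(\<integral>\<^sup>+y. ennreal (exp (\<Sum>i<m. e S i * G i y)) \<partial>Pi\<^sub>M J (\<lambda>_. M))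
        \<le> ennreal (exp ((l * (\<bar>t\<bar> / N) * card {..<m})\<^sup>2 * card J))"
      unfolding G_def
      by (rule subexp_sum_mgf_prod[OF K J(1)]) (use x l1 lm1 in \<open>auto simp: e_def abs_mult\<close>)
    also have "\<dots> \<le> ennreal (exp m)"
    proof (intro ennreal_leI, subst exp_le_cancel_iff)
      have "(l * (\<bar>t\<bar> / N) * card {..<m})\<^sup>2 * card J \<le> (l * (\<bar>t\<bar> / N) * m)\<^sup>2 * N"
        using J by (simp add: mult_left_mono)
      also have "\<dots> = (6 * \<bar>t\<bar>)\<^sup>2 * m"
        unfolding lm power_mult_distrib using N by simp
      also have "\<dots> \<le> 1 * real m"
      proof (intro mult_right_mono power_le_one)
        show "6 * \<bar>t\<bar> \<le> 1" using t by linarith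
      qed auto
      finally show "(l * (\<bar>t\<bar> / N) * card {..<m})\<^sup>2 * card J \<le> real m" by simp
    qed
    finally show "(\<integral>\<^sup>+y. ennreal (exp (\<Sum>i<m. e S i * G i y)) \<partial>Pi\<^sub>M J (\<lambda>_. M)) \<le> ennreal (exp m)" .
  qed
  also have "\<dots> = ennreal ((1 / l\<^sup>2) ^ m * (2 ^ m * exp 1 ^ m))"
  proof -
    have "(\<Sum>S\<in>Pow {..<m}. exp (real m)) = 2 ^ m * exp 1 ^ m"
      using exp_of_nat_mult[of m "1 :: real"] by (simp add: card_Pow)
    then have "(\<Sum>S\<in>Pow {..<m}. ennreal (exp m)) = ennreal (2 ^ m * exp 1 ^ m)"
      by (subst sum_ennreal) auto
    then show ?thesis by (simp only:, subst ennreal_mult) auto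
  qed
  also have "(1 / l\<^sup>2) ^ m * (2 ^ m * exp 1 ^ m) = (real m / (36 * N) * 2 * exp 1) ^ m"
  proof -
    have "real m / (36 * N) * 2 * exp 1 = 1 / l\<^sup>2 * (2 * exp 1)" by (simp add: l2)
    then show ?thesis by (simp only: power_mult_distrib)
  qed
  finally show ?thesis unfolding G_def .
qed

text \<open>The binomial coefficient is at most N^m / m!, which cancels the powers of N, and m^m /
  m! \<le> e^m leaves (e^2 / 18)^m. As e \<le> 3, this is a geometric sequence with ratio 1/2; the
  constant 36, hence the threshold 1/6, is fixed here.\<close>

lemma decoupled_coefficient:
  fixes n m N :: nat
  assumes "m \<le> n" "n \<le> N"
  shows "real (n choose m) * (real m / (36 * N) * 2 * exp 1) ^ m \<le> (1 / 2) ^ m"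
proof (cases "m = 0")
  case False
  then have N: "N > 0" using assms by simp
  have "real (n choose m) \<le> real N ^ m / fact m"
  proof -
    have "real (n choose m) * fact m \<le> real n ^ m"
      using binomial_fact_pow[of n m] by (metis of_nat_fact of_nat_le_iff of_nat_mult of_nat_power)
    also have "\<dots> \<le> real N ^ m" using assms by (intro power_mono) auto
    finally show ?thesis by (simp add: field_simps)
  qed
  then have "real (n choose m) * (real m / (36 * N) * 2 * exp 1) ^ m
      \<le> real N ^ m / fact m * (real m / (36 * N) * 2 * exp 1) ^ m"
    by (intro mult_right_mono) auto
  also have "\<dots> = real m ^ m / fact m * (exp 1 / 18) ^ m"
  proof -
    have "real m / (36 * N) * 2 * exp 1 = (real m / N) * (exp 1 / 18)" by simp
    then show ?thesis using N by (simp only: power_mult_distrib power_divide) simp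
  qed
  also have "\<dots> \<le> exp 1 ^ m * (exp 1 / 18) ^ m"
    using power_le_exp_fact[of m] by (intro mult_right_mono) (auto simp: field_simps)
  also have "\<dots> = (exp 1 * exp 1 / 18) ^ m" by (simp flip: power_mult_distrib)
  also have "\<dots> \<le> (1 / 2) ^ m"
  proof (intro power_mono)
    have "exp 1 * exp (1::real) \<le> 3 * 3" by (intro mult_mono exp_le) auto
    then show "exp 1 * exp 1 / 18 \<le> (1 / 2 :: real)" by simp
  qed auto
  finally show ?thesis .
qed simp

text \<open>Given the particles in \<open>J\<close>, those in \<open>S\<close> contribute \<open>(1 + c)\<^bsup>card S\<^esup>\<close>, as the linear term
  vanishes by degeneracy. The moments of \<open>c\<close> are then estimated term by term.\<close>

lemma decoupled_mgf:
  fixes S J :: "nat set" and N :: nat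
  assumes K: "deg_kernel M k" and fin: "finite S" "finite J" and SJ: "S \<inter> J = {}"
    and N: "card S \<le> N" "card J \<le> N" "0 < N" and t: "\<bar>t\<bar> \<le> 1 / 6"
  shows "(\<integral>\<^sup>+X. ennreal (exp (t / N * (\<Sum>i\<in>S. \<Sum>j\<in>J. k (X i) (X j)))) \<partial>Pi\<^sub>M (S \<union> J) (\<lambda>_. M)) \<le> 2"
proof -
  note [measurable] = deg_kernel_measurable[OF K]
  define G where "G y \<xi> = (\<Sum>j\<in>J. k \<xi> (y j))" for y :: "nat \<Rightarrow> 'a" and \<xi>
  define c where "c y = (\<integral>\<^sup>+\<xi>. ennreal (psi (t / N * G y \<xi>)) \<partial>M)" for y
  let ?n = "card S"
  have [measurable]: "psi \<in> borel_measurable borel" unfolding psi_def by measurable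
  have Gm2 [measurable]: "(\<lambda>(y, \<xi>). G y \<xi>) \<in> borel_measurable (Pi\<^sub>M J (\<lambda>_. M) \<Otimes>\<^sub>M M)"
    unfolding G_def by measurable
  have Gm [measurable]: "G y \<in> borel_measurable M" if "y \<in> space (Pi\<^sub>M J (\<lambda>_. M))" for y
    using measurable_compose[OF measurable_Pair1'[OF that] Gm2] by simp
  have inner: "(\<integral>\<^sup>+x. ennreal (exp (t / N * (\<Sum>i\<in>S. \<Sum>j\<in>J. k (merge J S (y, x) i) (merge J S (y, x) j)))) \<partial>Pi\<^sub>M S (\<lambda>_. M))
      = (1 + c y) ^ ?n" if y: "y \<in> space (Pi\<^sub>M J (\<lambda>_. M))" for y
  proof -
    have "(\<integral>\<^sup>+x. ennreal (exp (t / N * (\<Sum>i\<in>S. \<Sum>j\<in>J. k (merge J S (y, x) i) (merge J S (y, x) j)))) \<partial>Pi\<^sub>M S (\<lambda>_. M))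
      = (\<integral>\<^sup>+x. (\<Prod>i\<in>S. ennreal (exp (t / N * G y (x i)))) \<partial>Pi\<^sub>M S (\<lambda>_. M))"
    proof (rule nn_integral_cong)
      fix x
      have "(\<Sum>i\<in>S. \<Sum>j\<in>J. k (merge J S (y, x) i) (merge J S (y, x) j)) = (\<Sum>i\<in>S. G y (x i))"
        unfolding G_def using SJ by (intro sum.cong refl) (auto simp: merge_def)
      then show "ennreal (exp (t / N * (\<Sum>i\<in>S. \<Sum>j\<in>J. k (merge J S (y, x) i) (merge J S (y, x) j))))
          = (\<Prod>i\<in>S. ennreal (exp (t / N * G y (x i))))"
        using fin by (simp only: sum_distrib_left exp_sum prod_ennreal exp_ge_zero)
    qed
    also have "\<dots> = (\<integral>\<^sup>+\<xi>. ennreal (exp (t / N * G y \<xi>)) \<partial>M) ^ ?n"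
      using y by (subst fpow.product_nn_integral_prod[OF fin(1)]) auto
    also have "(\<integral>\<^sup>+\<xi>. ennreal (exp (t / N * G y \<xi>)) \<partial>M) = 1 + c y"
    proof -
      have "subexp M (\<lambda>\<xi>. \<Sum>j\<in>J. 1 / N * k \<xi> (y j))"
        using y N by (intro subexp_sum fin deg_kernel_subexp[OF K])
          (auto simp: space_PiM)
      from subexp_psi(1)[OF this, of t] t show ?thesis
        by (simp add: c_def G_def sum_distrib_left)
    qed
    finally show ?thesis .
  qed
  \<comment> \<open>The m-th power of the inner expectation is an expectation over m independent
    replicas of one particle. Interchanging the integrals then allows the particles in
    \<open>J\<close> to be integrated with the replicas frozen.\<close>
  have pw: "(c y) ^ m = (\<integral>\<^sup>+x. (\<Prod>i<m. ennreal (psi (t / N * G y (x i)))) \<partial>Pi\<^sub>M {..<m} (\<lambda>_. M))"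
    if y: "y \<in> space (Pi\<^sub>M J (\<lambda>_. M))" for y m
    using y by (subst fpow.product_nn_integral_prod) (auto simp: c_def)
  have [measurable]: "c \<in> borel_measurable (Pi\<^sub>M J (\<lambda>_. M))"
    unfolding c_def by measurable
  have cm: "(\<integral>\<^sup>+y. (c y) ^ m \<partial>Pi\<^sub>M J (\<lambda>_. M)) \<le> ennreal ((real m / (36 * N) * 2 * exp 1) ^ m)"
    if "m \<le> N" for m
  proof -
    interpret PJ: sigma_finite_measure "Pi\<^sub>M J (\<lambda>_. M)" by (rule fpow.sigma_finite) fact
    interpret Pm: prob_space "Pi\<^sub>M {..<m} (\<lambda>_. M)" by (rule prob_space_PiM) unfold_locales
    interpret PP: pair_sigma_finite "Pi\<^sub>M J (\<lambda>_. M)" "Pi\<^sub>M {..<m} (\<lambda>_. M)" ..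
    have "(\<integral>\<^sup>+y. (c y) ^ m \<partial>Pi\<^sub>M J (\<lambda>_. M))
        = (\<integral>\<^sup>+y. (\<integral>\<^sup>+x. (\<Prod>i<m. ennreal (psi (t / N * G y (x i)))) \<partial>Pi\<^sub>M {..<m} (\<lambda>_. M)) \<partial>Pi\<^sub>M J (\<lambda>_. M))"
      by (intro nn_integral_cong pw)
    also have "\<dots> = (\<integral>\<^sup>+x. (\<integral>\<^sup>+y. (\<Prod>i<m. ennreal (psi (t / N * G y (x i)))) \<partial>Pi\<^sub>M J (\<lambda>_. M)) \<partial>Pi\<^sub>M {..<m} (\<lambda>_. M))"
      by (rule PP.Fubini'[symmetric]) measurable
    also have "\<dots> \<le> (\<integral>\<^sup>+x. ennreal ((real m / (36 * N) * 2 * exp 1) ^ m) \<partial>Pi\<^sub>M {..<m} (\<lambda>_. M))"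
      unfolding G_def
      by (intro nn_integral_mono decoupled_term_bound[OF K] that fin N t) (auto simp: space_PiM)
    also have "\<dots> = ennreal ((real m / (36 * N) * 2 * exp 1) ^ m)"
      by (simp add: Pm.emeasure_space_1)
    finally show ?thesis .
  qed
  have "(\<integral>\<^sup>+X. ennreal (exp (t / N * (\<Sum>i\<in>S. \<Sum>j\<in>J. k (X i) (X j)))) \<partial>Pi\<^sub>M (S \<union> J) (\<lambda>_. M))
      = (\<integral>\<^sup>+y. (\<integral>\<^sup>+x. ennreal (exp (t / N * (\<Sum>i\<in>S. \<Sum>j\<in>J. k (merge J S (y, x) i) (merge J S (y, x) j)))) \<partial>Pi\<^sub>M S (\<lambda>_. M)) \<partial>Pi\<^sub>M J (\<lambda>_. M))"
    unfolding Un_commute[of S J]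
    by (rule fpow.product_nn_integral_fold) (use SJ fin in \<open>auto\<close>)
  also have "\<dots> = (\<integral>\<^sup>+y. (1 + c y) ^ ?n \<partial>Pi\<^sub>M J (\<lambda>_. M))"
    by (intro nn_integral_cong inner)
  also have "\<dots> = (\<integral>\<^sup>+y. (\<Sum>m\<le>?n. of_nat (?n choose m) * (c y) ^ m) \<partial>Pi\<^sub>M J (\<lambda>_. M))"
    by (intro nn_integral_cong) (simp add: add.commute[of 1] binomial_ring)
  also have "\<dots> = (\<Sum>m\<le>?n. of_nat (?n choose m) * (\<integral>\<^sup>+y. (c y) ^ m \<partial>Pi\<^sub>M J (\<lambda>_. M)))"
    by (subst nn_integral_sum, measurable, intro sum.cong refl, rule nn_integral_cmult, measurable)
  also have "\<dots> \<le> (\<Sum>m\<le>?n. of_nat (?n choose m) * ennreal ((real m / (36 * N) * 2 * exp 1) ^ m))"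
    by (intro sum_mono mult_left_mono cm) (use N in auto)
  also have "\<dots> = (\<Sum>m\<le>?n. ennreal (real (?n choose m) * (real m / (36 * N) * 2 * exp 1) ^ m))"
    by (simp add: ennreal_mult ennreal_of_nat_eq_real_of_nat)
  also have "\<dots> \<le> (\<Sum>m\<le>?n. ennreal ((1 / 2) ^ m))"
    by (intro sum_mono ennreal_leI decoupled_coefficient) (use N in auto)
  also have "\<dots> = ennreal (\<Sum>m\<le>?n. (1 / 2) ^ m)" by (rule sum_ennreal) simp
  also have "\<dots> \<le> ennreal 2"
    by (intro ennreal_leI) (simp add: sum_gp0)
  finally show ?thesis by simp
qed

text \<open>The full sum is four times the average, over all subsets S, of the sums between S and
  its complement; convexity moves this average out of the exponential, and
  \<open>decoupled_mgf\<close> applies with 4 t. The normalisation N may exceed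
  \<open>card I\<close>, which is what the removal of one particle requires later.\<close>

lemma U_statistic_mgf:
  fixes I :: "nat set" and N :: nat
  assumes K: "deg_kernel M k" and fin: "finite I" and N: "card I \<le> N" "0 < N" and t: "\<bar>t\<bar> \<le> 1 / 24"
  shows "(\<integral>\<^sup>+X. ennreal (exp (t / N * (\<Sum>i\<in>I. \<Sum>j\<in>I - {i}. k (X i) (X j)))) \<partial>Pi\<^sub>M I (\<lambda>_. M)) \<le> 2"
proof -
  note [measurable] = deg_kernel_measurable[OF K]
  let ?p = "1 / 2 ^ card I :: real"
  let ?D = "\<lambda>S X. \<Sum>i\<in>S. \<Sum>j\<in>I - S. k (X i) (X j)"
  have Dm: "?D S \<in> borel_measurable (Pi\<^sub>M I (\<lambda>_. M))" if "S \<subseteq> I" for S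
    using that by (intro borel_measurable_sum kernel_component_measurable) auto
  have p: "(\<Sum>S\<in>Pow I. ?p) = 1" using fin by (simp add: card_Pow)
  have "exp (t / N * (\<Sum>i\<in>I. \<Sum>j\<in>I - {i}. k (X i) (X j))) \<le> (\<Sum>S\<in>Pow I. ?p * exp (4 * t / N * ?D S X))" for X
  proof -
    have "t / N * (\<Sum>i\<in>I. \<Sum>j\<in>I - {i}. k (X i) (X j)) = ?p * (4 * t / N) * (\<Sum>S\<in>Pow I. ?D S X)"
      unfolding sum_separating_subsets[OF fin] by simp
    also have "\<dots> = (\<Sum>S\<in>Pow I. ?p * (4 * t / N * ?D S X))"
      by (simp add: sum_distrib_left mult.assoc)
    finally show ?thesis
      using exp_sum_le_convex[of "Pow I" "\<lambda>_. ?p" "\<lambda>S. 4 * t / N * ?D S X"] fin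
      unfolding p by simp
  qed
  then have "(\<integral>\<^sup>+X. ennreal (exp (t / N * (\<Sum>i\<in>I. \<Sum>j\<in>I - {i}. k (X i) (X j)))) \<partial>Pi\<^sub>M I (\<lambda>_. M))
      \<le> (\<integral>\<^sup>+X. (\<Sum>S\<in>Pow I. ennreal ?p * ennreal (exp (4 * t / N * ?D S X))) \<partial>Pi\<^sub>M I (\<lambda>_. M))"
    by (intro nn_integral_mono) (simp add: sum_ennreal ennreal_leI flip: ennreal_mult)
  also have "\<dots> = (\<Sum>S\<in>Pow I. ennreal ?p * (\<integral>\<^sup>+X. ennreal (exp (4 * t / N * ?D S X)) \<partial>Pi\<^sub>M I (\<lambda>_. M)))"
    using Dm by (subst nn_integral_sum) (auto intro!: sum.cong nn_integral_cmult)
  also have "\<dots> \<le> (\<Sum>S\<in>Pow I. ennreal ?p * 2)"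
  proof (intro sum_mono mult_left_mono zero_le)
    fix S assume "S \<in> Pow I"
    then have S: "S \<subseteq> I" by simp
    then have eq: "S \<union> (I - S) = I" by auto
    have "finite S" "card S \<le> card I" "card (I - S) \<le> card I"
      using S fin by (auto intro: finite_subset card_mono)
    then show "(\<integral>\<^sup>+X. ennreal (exp (4 * t / N * ?D S X)) \<partial>Pi\<^sub>M I (\<lambda>_. M)) \<le> 2"
      using decoupled_mgf[OF K, of S "I - S" N "4 * t"] fin N t unfolding eq by auto
  qed
  also have "\<dots> = ennreal (\<Sum>S\<in>Pow I. ?p) * 2"
    by (subst sum_ennreal[symmetric]) (simp_all add: mult.assoc)
  finally show ?thesis unfolding p by simp
qed

end

section \<open>Hilbert--Schmidt kernels\<close>

lemma L2_funD:
  assumes "f \<in> L2_fun N"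
  shows "f \<in> borel_measurable N" "integrable N (\<lambda>x. (f x)\<^sup>2)"
  using assms by (auto simp: L2_fun_def)

lemma L2_fun_mult_integrable:
  assumes "f \<in> L2_fun N" "g \<in> L2_fun N"
  shows "integrable N (\<lambda>x. f x * g x)"
proof (rule Bochner_Integration.integrable_bound)
  show "integrable N (\<lambda>x. (f x)\<^sup>2 + (g x)\<^sup>2)" using L2_funD[OF assms(1)] L2_funD[OF assms(2)] by simp
  show "(\<lambda>x. f x * g x) \<in> borel_measurable N" using L2_funD[OF assms(1)] L2_funD[OF assms(2)] by measurable
  have "\<bar>f x * g x\<bar> \<le> (f x)\<^sup>2 + (g x)\<^sup>2" for x
    using sum_squares_bound[of "f x" "g x"] sum_squares_bound[of "f x" "- g x"]
      zero_le_power2[of "f x"] zero_le_power2[of "g x"] by (simp add: abs_le_iff del: zero_le_power2)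
  then show "AE x in N. norm (f x * g x) \<le> norm ((f x)\<^sup>2 + (g x)\<^sup>2)"
    by (intro AE_I2) simp
qed

lemma L2_fun_add:
  assumes "f \<in> L2_fun N" "g \<in> L2_fun N"
  shows "(\<lambda>x. f x + g x) \<in> L2_fun N"
  using L2_funD[OF assms(1)] L2_funD[OF assms(2)] L2_fun_mult_integrable[OF assms]
  by (auto simp: L2_fun_def power2_sum mult.assoc)

lemma L2_fun_cmult: "f \<in> L2_fun N \<Longrightarrow> (\<lambda>x. c * f x) \<in> L2_fun N"
  by (auto simp: L2_fun_def power_mult_distrib)

lemma L2_fun_diff:
  assumes "f \<in> L2_fun N" "g \<in> L2_fun N"
  shows "(\<lambda>x. f x - g x) \<in> L2_fun N"
  using L2_fun_add[OF assms(1) L2_fun_cmult[OF assms(2), of "-1"]] by simp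

lemma L2_norm_AE_0_iff:
  assumes "f \<in> L2_fun N"
  shows "(LINT x|N. (f x)\<^sup>2) = 0 \<longleftrightarrow> (AE x in N. f x = 0)"
  using integral_nonneg_eq_0_iff_AE[OF L2_funD(2)[OF assms]] by simp

lemma L2_Cauchy_Schwarz:
  assumes f: "f \<in> L2_fun N" and g: "g \<in> L2_fun N"
  shows "(LINT x|N. f x * g x)\<^sup>2 \<le> (LINT x|N. (f x)\<^sup>2) * (LINT x|N. (g x)\<^sup>2)"
proof -
  define A B C where "A = (LINT x|N. (f x)\<^sup>2)" "B = (LINT x|N. f x * g x)" "C = (LINT x|N. (g x)\<^sup>2)"
  note int = L2_funD(2)[OF f] L2_funD(2)[OF g] L2_fun_mult_integrable[OF f g]
  have q: "0 \<le> t\<^sup>2 * A - 2 * t * B + C" for t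
  proof -
    have "0 \<le> (LINT x|N. (t * f x - g x)\<^sup>2)" by simp
    also have "\<dots> = (LINT x|N. t\<^sup>2 * (f x)\<^sup>2 - 2 * t * (f x * g x) + (g x)\<^sup>2)"
      by (simp add: power2_diff power_mult_distrib algebra_simps)
    also have "\<dots> = t\<^sup>2 * A - 2 * t * B + C"
      using int by (simp add: A_B_C_def)
    finally show ?thesis .
  qed
  have A0: "0 \<le> A" by (simp add: A_B_C_def)
  show ?thesis
  proof (cases "A = 0")
    case True
    have "B = 0"
    proof (rule ccontr)
      assume "B \<noteq> 0"
      then show False using q[of "(C + 1) / (2 * B)"] True by (simp add: field_simps)
    qed
    then show ?thesis using True by (simp add: A_B_C_def)
  next
    case False
    then have "A > 0" using A0 by simp
    with q[of "B / A"] have "B\<^sup>2 \<le> A * C" by (simp add: field_simps power2_eq_square)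
    then show ?thesis by (simp add: A_B_C_def)
  qed
qed

lemma L2_triangle:
  assumes f: "f \<in> L2_fun N" and g: "g \<in> L2_fun N"
  shows "(LINT x|N. (f x + g x)\<^sup>2) \<le> 2 * (LINT x|N. (f x)\<^sup>2) + 2 * (LINT x|N. (g x)\<^sup>2)"
proof -
  note int = L2_funD(2)[OF f] L2_funD(2)[OF g] L2_funD(2)[OF L2_fun_add[OF f g]]
  have "(LINT x|N. (f x + g x)\<^sup>2) \<le> (LINT x|N. 2 * (f x)\<^sup>2 + 2 * (g x)\<^sup>2)"
  proof (rule integral_mono)
    fix x show "(f x + g x)\<^sup>2 \<le> 2 * (f x)\<^sup>2 + 2 * (g x)\<^sup>2"
      using zero_le_power2[of "f x - g x"] by (simp add: power2_eq_square algebra_simps)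
  qed (use int in auto)
  then show ?thesis using int by simp
qed

text \<open>On a finite measure space an L^2-Cauchy sequence is Cauchy in L^1, so a subsequence
  converges almost everywhere; Fatou's lemma along this subsequence bounds the L^2 distance to the
  limit.\<close>

lemma (in finite_measure) L2_complete:
  assumes f: "\<And>n. f n \<in> L2_fun M"
    and cauchy: "\<And>e. e > 0 \<Longrightarrow> \<exists>n0. \<forall>m\<ge>n0. \<forall>n\<ge>n0. (LINT x|M. (f m x - f n x)\<^sup>2) < e"
  obtains F where "F \<in> L2_fun M" "(\<lambda>n. LINT x|M. (f n x - F x)\<^sup>2) \<longlonglongrightarrow> 0"
proof -
  have [measurable]: "f n \<in> borel_measurable M" for n using L2_funD(1)[OF f] .
  have int: "integrable M (f n)" for n
    by (rule square_integrable_imp_integrable) (use L2_funD[OF f[of n]] in auto)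
  have one: "(\<lambda>_. 1) \<in> L2_fun M" by (simp add: L2_fun_def)
  have L1: "(LINT x|M. norm (f m x - f n x))\<^sup>2 \<le> (LINT x|M. (f m x - f n x)\<^sup>2) * measure M (space M)" for m n
  proof -
    have "(\<lambda>x. \<bar>f m x - f n x\<bar>) \<in> L2_fun M"
      using L2_funD[OF L2_fun_diff[OF f[of m] f[of n]]] by (simp add: L2_fun_def)
    from L2_Cauchy_Schwarz[OF this one] show ?thesis by simp
  qed
  obtain r where r: "strict_mono r" "AE x in M. Cauchy (\<lambda>i. f (r i) x)"
  proof (rule cauchy_L1_AE_cauchy_subseq[of M f])
    fix e :: real assume e: "e > 0"
    let ?c = "measure M (space M) + 1"
    have c: "?c > 0" by (simp add: add_nonneg_pos)
    then have "e\<^sup>2 / ?c > 0" using e by simp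
    from cauchy[OF this] obtain n0 where n0:
      "\<forall>m\<ge>n0. \<forall>n\<ge>n0. (LINT x|M. (f m x - f n x)\<^sup>2) < e\<^sup>2 / ?c" by auto
    show "\<exists>N. \<forall>i\<ge>N. \<forall>j\<ge>N. LINT x|M. norm (f i x - f j x) < e"
    proof (intro exI allI impI)
      fix i j assume ij: "i \<ge> n0" "j \<ge> n0"
      have "(LINT x|M. norm (f i x - f j x))\<^sup>2 \<le> (LINT x|M. (f i x - f j x)\<^sup>2) * ?c"
        by (rule order_trans[OF L1 mult_left_mono]) auto
      also have "\<dots> < e\<^sup>2 / ?c * ?c" using n0 ij c by (intro mult_strict_right_mono) auto
      also have "\<dots> = e\<^sup>2" using c by simp
      finally show "(LINT x|M. norm (f i x - f j x)) < e"
        using e by (rule_tac power2_less_imp_less) auto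
    qed
  qed (use int in auto)
  define F where "F x = lim (\<lambda>i. f (r i) x)" for x
  have [measurable]: "F \<in> borel_measurable M" unfolding F_def by measurable
  have lim: "AE x in M. (\<lambda>i. f (r i) x) \<longlonglongrightarrow> F x"
    using r(2) by eventually_elim (simp add: F_def Cauchy_convergent convergent_LIMSEQ_iff[symmetric])
  have fatou: "(\<integral>\<^sup>+x. ennreal ((f n x - F x)\<^sup>2) \<partial>M) \<le> ennreal e"
    if e: "0 < e" and n0: "\<forall>m\<ge>n0. \<forall>n\<ge>n0. (LINT x|M. (f m x - f n x)\<^sup>2) < e" and n: "n \<ge> n0" for n n0 e
  proof -
    have "(\<integral>\<^sup>+x. ennreal ((f n x - F x)\<^sup>2) \<partial>M) = (\<integral>\<^sup>+x. liminf (\<lambda>i. ennreal ((f n x - f (r i) x)\<^sup>2)) \<partial>M)"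
    proof (rule nn_integral_cong_AE)
      show "AE x in M. ennreal ((f n x - F x)\<^sup>2) = liminf (\<lambda>i. ennreal ((f n x - f (r i) x)\<^sup>2))"
        using lim
      proof eventually_elim
        case (elim x)
        have "(\<lambda>i. ennreal ((f n x - f (r i) x)\<^sup>2)) \<longlonglongrightarrow> ennreal ((f n x - F x)\<^sup>2)"
          by (intro tendsto_ennrealI tendsto_intros elim)
        from lim_imp_Liminf[OF trivial_limit_sequentially this] show ?case by simp
      qed
    qed
    also have "\<dots> \<le> liminf (\<lambda>i. \<integral>\<^sup>+x. ennreal ((f n x - f (r i) x)\<^sup>2) \<partial>M)"
      by (rule nn_integral_liminf) measurable
    also have "\<dots> \<le> ennreal e"
    proof (rule Liminf_le)
      show "\<forall>\<^sub>F i in sequentially. (\<integral>\<^sup>+x. ennreal ((f n x - f (r i) x)\<^sup>2) \<partial>M) \<le> ennreal e"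
        using eventually_ge_at_top[of n0]
      proof eventually_elim
        case (elim i)
        have "r i \<ge> n0" using seq_suble[OF r(1), of i] elim by simp
        then have "(LINT x|M. (f n x - f (r i) x)\<^sup>2) < e" using n0 n by auto
        then show ?case
          by (subst nn_integral_eq_integral[OF L2_funD(2)[OF L2_fun_diff[OF f f]]]) (auto intro: ennreal_leI)
      qed
    qed simp
    finally show ?thesis .
  qed
  have diff: "(\<lambda>x. f n x - F x) \<in> L2_fun M"
    if "0 < e" "\<forall>m\<ge>n0. \<forall>n\<ge>n0. (LINT x|M. (f m x - f n x)\<^sup>2) < e" "n \<ge> n0" for n n0 e
    using fatou[OF that] by (auto simp: L2_fun_def intro!: integrableI_nonneg elim: le_less_trans)
  show thesis
  proof (rule that)
    obtain n0 where n0: "\<forall>m\<ge>n0. \<forall>n\<ge>n0. (LINT x|M. (f m x - f n x)\<^sup>2) < 1" using cauchy[of 1] by auto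
    from L2_fun_diff[OF f[of n0] diff[OF _ n0 order_refl]] show "F \<in> L2_fun M" by simp
    then have "(\<lambda>x. f n x - F x) \<in> L2_fun M" for n by (intro L2_fun_diff f)
    note int = L2_funD(2)[OF this]
    show "(\<lambda>n. LINT x|M. (f n x - F x)\<^sup>2) \<longlonglongrightarrow> 0"
    proof (rule LIMSEQ_I)
      fix e :: real assume "e > 0"
      then have e: "e / 2 > 0" by simp
      from cauchy[OF this] obtain n0 where n0: "\<forall>m\<ge>n0. \<forall>n\<ge>n0. (LINT x|M. (f m x - f n x)\<^sup>2) < e / 2" by auto
      show "\<exists>no. \<forall>n\<ge>no. norm ((LINT x|M. (f n x - F x)\<^sup>2) - 0) < e"
      proof (intro exI allI impI)
        fix n assume "n \<ge> n0"
        from fatou[OF e n0 this] have "ennreal (LINT x|M. (f n x - F x)\<^sup>2) \<le> ennreal (e / 2)"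
          by (simp add: nn_integral_eq_integral[OF int])
        then have "(LINT x|M. (f n x - F x)\<^sup>2) \<le> e / 2" using e by (simp add: ennreal_le_iff)
        then show "norm ((LINT x|M. (f n x - F x)\<^sup>2) - 0) < e" using \<open>e > 0\<close> by simp
      qed
    qed
  qed
qed

text \<open>Every row and every column is square integrable, not only almost every one. Compositions
  are then given by convergent integrals at each point, and associativity and symmetry hold
  pointwise.\<close>

definition L2ker :: "'a measure \<Rightarrow> ('a \<Rightarrow> 'a \<Rightarrow> real) \<Rightarrow> bool" where
  "L2ker M k \<longleftrightarrow> (\<lambda>(x, y). k x y) \<in> L2_fun (M \<Otimes>\<^sub>M M) \<and>
     (\<forall>x\<in>space M. (\<lambda>y. k x y) \<in> L2_fun M) \<and> (\<forall>y\<in>space M. (\<lambda>x. k x y) \<in> L2_fun M)"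

definition kcomp :: "'a measure \<Rightarrow> ('a \<Rightarrow> 'a \<Rightarrow> real) \<Rightarrow> ('a \<Rightarrow> 'a \<Rightarrow> real) \<Rightarrow> 'a \<Rightarrow> 'a \<Rightarrow> real" where
  "kcomp M k l x y = (LINT w|M. k x w * l w y)"

text \<open>The Hilbert--Schmidt inner product. Against a symmetric \<open>k\<close> it is a trace:
  for T with kernel \<open>k\<close>, \<open>hs M (gpow M k n) k\<close> is the trace of T^(n +
  2).\<close>

definition hs :: "'a measure \<Rightarrow> ('a \<Rightarrow> 'a \<Rightarrow> real) \<Rightarrow> ('a \<Rightarrow> 'a \<Rightarrow> real) \<Rightarrow> real" where
  "hs M k l = (LINT (x, y)|(M \<Otimes>\<^sub>M M). k x y * l x y)"

definition sym_kernel :: "'a measure \<Rightarrow> ('a \<Rightarrow> 'a \<Rightarrow> real) \<Rightarrow> bool" where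
  "sym_kernel M k \<longleftrightarrow> (\<forall>x\<in>space M. \<forall>y\<in>space M. k x y = k y x)"

lemma L2kerD:
  assumes "L2ker M k"
  shows "(\<lambda>(x, y). k x y) \<in> L2_fun (M \<Otimes>\<^sub>M M)" "(\<lambda>(x, y). k x y) \<in> borel_measurable (M \<Otimes>\<^sub>M M)"
    "x \<in> space M \<Longrightarrow> (\<lambda>y. k x y) \<in> L2_fun M" "x \<in> space M \<Longrightarrow> (\<lambda>y. k y x) \<in> L2_fun M"
  using assms by (auto simp: L2ker_def L2_fun_def)

section \<open>Calculus of square-integrable kernels\<close>

context sample_space
begin

sublocale pp: pair_prob_space M M ..

lemma integrable_pair_mult:
  assumes "integrable M f" "integrable M g"
  shows "integrable (M \<Otimes>\<^sub>M M) (\<lambda>(x, y). f x * g y :: real)"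
proof (rule pp.Fubini_integrable)
  have [measurable]: "f \<in> borel_measurable M" "g \<in> borel_measurable M" using assms by auto
  show "(\<lambda>(x, y). f x * g y) \<in> borel_measurable (M \<Otimes>\<^sub>M M)" by measurable
  have "(LINT y|M. norm (case (x, y) of (x, y) \<Rightarrow> f x * g y)) = \<bar>f x\<bar> * (LINT y|M. \<bar>g y\<bar>)" for x
    by (simp add: abs_mult)
  then show "integrable M (\<lambda>x. LINT y|M. norm (case (x, y) of (x, y) \<Rightarrow> f x * g y))"
    using assms by simp
  show "AE x in M. integrable M (\<lambda>y. case (x, y) of (x, y) \<Rightarrow> f x * g y)" using assms by simp
qed

lemma L2_fun_tensor:
  assumes "f \<in> L2_fun M" "g \<in> L2_fun M"
  shows "(\<lambda>(x, y). f x * g y) \<in> L2_fun (M \<Otimes>\<^sub>M M)"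
proof -
  have [measurable]: "f \<in> borel_measurable M" "g \<in> borel_measurable M"
    using assms by (auto simp: L2_fun_def)
  show ?thesis
    using integrable_pair_mult[OF L2_funD(2)[OF assms(1)] L2_funD(2)[OF assms(2)]]
    by (simp add: L2_fun_def case_prod_unfold power_mult_distrib)
qed

lemma L2ker_tensor:
  assumes "f \<in> L2_fun M" "g \<in> L2_fun M"
  shows "L2ker M (\<lambda>x y. f x * g y)"
proof -
  have "(\<lambda>x. f x * g y) \<in> L2_fun M" for y
    using L2_fun_cmult[OF assms(1), of "g y"] by (simp add: mult.commute)
  then show ?thesis using L2_fun_tensor[OF assms] L2_fun_cmult[OF assms(2)] by (simp add: L2ker_def)
qed

lemma L2ker_add: "L2ker M k \<Longrightarrow> L2ker M l \<Longrightarrow> L2ker M (\<lambda>x y. k x y + l x y)"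
  unfolding L2ker_def
  using L2_fun_add[of "\<lambda>(x, y). k x y" "M \<Otimes>\<^sub>M M" "\<lambda>(x, y). l x y"]
  by (auto intro: L2_fun_add simp: case_prod_unfold)

lemma L2ker_cmult: "L2ker M k \<Longrightarrow> L2ker M (\<lambda>x y. c * k x y)"
  unfolding L2ker_def
  using L2_fun_cmult[of "\<lambda>(x, y). k x y" "M \<Otimes>\<^sub>M M" c]
  by (auto intro: L2_fun_cmult simp: case_prod_unfold)

lemma L2ker_diff: "L2ker M k \<Longrightarrow> L2ker M l \<Longrightarrow> L2ker M (\<lambda>x y. k x y - l x y)"
  using L2ker_add[of k "\<lambda>x y. - 1 * l x y"] L2ker_cmult[of l "-1"] by simp

lemma triple_integrable:
  assumes l: "(\<lambda>(x, y). l x y) \<in> L2_fun (M \<Otimes>\<^sub>M M)" and f: "f \<in> L2_fun M" and g: "g \<in> L2_fun M"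
  shows "integrable (M \<Otimes>\<^sub>M M) (\<lambda>(w, v). f w * l w v * g v)"
  using L2_fun_mult_integrable[OF l L2_fun_tensor[OF f g]]
  by (simp add: case_prod_unfold mult_ac)

text \<open>Fubini's theorem, justified by pairing \<open>l\<close> with the square-integrable
  tensor of \<open>f\<close> and \<open>g\<close>. Associativity of composition and self-adjointness
  are both instances.\<close>

lemma kernel_swap:
  assumes l: "(\<lambda>(x, y). l x y) \<in> L2_fun (M \<Otimes>\<^sub>M M)" and f: "f \<in> L2_fun M" and g: "g \<in> L2_fun M"
  shows "(LINT v|M. (LINT w|M. f w * l w v) * g v) = (LINT w|M. f w * (LINT v|M. l w v * g v))"
proof -
  have "(LINT v|M. (LINT w|M. f w * l w v) * g v) = (LINT v|M. LINT w|M. f w * l w v * g v)"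
    by simp
  also have "\<dots> = (LINT w|M. LINT v|M. f w * l w v * g v)"
    by (rule pp.Fubini_integral) (rule triple_integrable[OF assms])
  also have "\<dots> = (LINT w|M. f w * (LINT v|M. l w v * g v))" by (simp add: mult.assoc)
  finally show ?thesis .
qed

lemma hs_iterated:
  assumes "L2ker M k" "L2ker M l"
  shows "hs M k l = (LINT x|M. LINT y|M. k x y * l x y)" "hs M k l = (LINT y|M. LINT x|M. k x y * l x y)"
proof -
  have "integrable (M \<Otimes>\<^sub>M M) (\<lambda>(x, y). k x y * l x y)"
    using L2_fun_mult_integrable[OF L2kerD(1)[OF assms(1)] L2kerD(1)[OF assms(2)]]
    by (simp add: case_prod_unfold)
  from pp.integral_fst[OF this] pp.integral_snd[OF this]
  show "hs M k l = (LINT x|M. LINT y|M. k x y * l x y)" "hs M k l = (LINT y|M. LINT x|M. k x y * l x y)"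
    by (simp_all add: hs_def)
qed

lemma hs_nonneg: "0 \<le> hs M k k"
  unfolding hs_def by (rule Bochner_Integration.integral_nonneg) auto

lemma hs_self: "hs M k k = (LINT z|(M \<Otimes>\<^sub>M M). (case z of (x, y) \<Rightarrow> k x y)\<^sup>2)"
  by (simp add: hs_def case_prod_unfold power2_eq_square)

lemma hs_commute: "hs M k l = hs M l k"
  by (simp add: hs_def mult.commute)

lemma hs_Cauchy_Schwarz:
  assumes "L2ker M k" "L2ker M l"
  shows "(hs M k l)\<^sup>2 \<le> hs M k k * hs M l l"
  using L2_Cauchy_Schwarz[OF L2kerD(1)[OF assms(1)] L2kerD(1)[OF assms(2)]]
  by (simp add: hs_def case_prod_unfold power2_eq_square)

lemma hs_eq_0_iff:
  assumes "L2ker M k"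
  shows "hs M k k = 0 \<longleftrightarrow> (AE z in M \<Otimes>\<^sub>M M. k (fst z) (snd z) = 0)"
  using L2_norm_AE_0_iff[OF L2kerD(1)[OF assms]] by (simp add: hs_self case_prod_unfold)

lemma hs_add_left:
  assumes "L2ker M k" "L2ker M l" "L2ker M m"
  shows "hs M (\<lambda>x y. k x y + l x y) m = hs M k m + hs M l m"
  using L2_fun_mult_integrable[OF L2kerD(1)[OF assms(1)] L2kerD(1)[OF assms(3)]]
    L2_fun_mult_integrable[OF L2kerD(1)[OF assms(2)] L2kerD(1)[OF assms(3)]]
  by (simp add: hs_def case_prod_unfold distrib_right)

lemma hs_cmult_left: "hs M (\<lambda>x y. c * k x y) m = c * hs M k m"
  by (simp add: hs_def case_prod_unfold mult.assoc)

lemma hs_diff_left: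
  assumes "L2ker M k" "L2ker M l" "L2ker M m"
  shows "hs M (\<lambda>x y. k x y - l x y) m = hs M k m - hs M l m"
  using hs_add_left[OF assms(1) L2ker_cmult[OF assms(2), of "-1"] assms(3)] hs_cmult_left[of "-1" l m]
  by simp

lemma hs_diff_self:
  assumes "L2ker M k" "L2ker M l"
  shows "hs M (\<lambda>x y. k x y - l x y) (\<lambda>x y. k x y - l x y) = hs M k k - 2 * hs M k l + hs M l l"
  using assms hs_commute[of k "\<lambda>x y. k x y - l x y"] hs_commute[of l "\<lambda>x y. k x y - l x y"]
  by (simp add: hs_diff_left L2ker_diff hs_commute[of l k])

lemma kernel_op_L2:
  assumes k: "L2ker M k" and f: "f \<in> L2_fun M"
  shows "kernel_op M k f \<in> L2_fun M"
    and "(LINT x|M. (kernel_op M k f x)\<^sup>2) \<le> hs M k k * (LINT x|M. (f x)\<^sup>2)"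
proof -
  note [measurable] = L2kerD(2)[OF k] L2_funD(1)[OF f]
  have [measurable]: "kernel_op M k f \<in> borel_measurable M" unfolding kernel_op_def by measurable
  have le: "(kernel_op M k f x)\<^sup>2 \<le> (LINT y|M. k x y * k x y) * (LINT x|M. (f x)\<^sup>2)" if "x \<in> space M" for x
    using L2_Cauchy_Schwarz[OF L2kerD(3)[OF k that] f] by (simp add: kernel_op_def power2_eq_square)
  have "integrable (M \<Otimes>\<^sub>M M) (\<lambda>(x, y). k x y * k x y)"
    using L2_funD(2)[OF L2kerD(1)[OF k]] by (simp add: case_prod_unfold power2_eq_square)
  from pp.integrable_fst[OF this]
  have int: "integrable M (\<lambda>x. (LINT y|M. k x y * k x y) * (LINT x|M. (f x)\<^sup>2))" by simp
  have int2: "integrable M (\<lambda>x. (kernel_op M k f x)\<^sup>2)"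
    by (rule Bochner_Integration.integrable_bound[OF int])
      (use le in \<open>auto intro!: AE_I2 order_trans[OF _ abs_ge_self]\<close>)
  then show "kernel_op M k f \<in> L2_fun M" by (simp add: L2_fun_def)
  have "(LINT x|M. (kernel_op M k f x)\<^sup>2) \<le> (LINT x|M. (LINT y|M. k x y * k x y) * (LINT x|M. (f x)\<^sup>2))"
    by (rule integral_mono_AE[OF int2 int]) (use le in \<open>auto intro: AE_I2\<close>)
  also have "\<dots> = hs M k k * (LINT x|M. (f x)\<^sup>2)" by (simp add: hs_iterated(1)[OF k k])
  finally show "(LINT x|M. (kernel_op M k f x)\<^sup>2) \<le> hs M k k * (LINT x|M. (f x)\<^sup>2)" .
qed

lemma L2ker_kcomp:
  assumes k: "L2ker M k" and l: "L2ker M l"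
  shows "L2ker M (kcomp M k l)" and "hs M (kcomp M k l) (kcomp M k l) \<le> hs M k k * hs M l l"
proof -
  note [measurable] = L2kerD(2)[OF k] L2kerD(2)[OF l]
  have [measurable]: "(\<lambda>(x, y). kcomp M k l x y) \<in> borel_measurable (M \<Otimes>\<^sub>M M)"
    unfolding kcomp_def by measurable
  define K L where "K x = (LINT y|M. (k x y)\<^sup>2)" and "L y = (LINT x|M. (l x y)\<^sup>2)" for x y
  have K: "integrable M K" "(LINT x|M. K x) = hs M k k"
    using pp.integrable_fst[of "\<lambda>x y. (k x y)\<^sup>2"] L2_funD(2)[OF L2kerD(1)[OF k]]
    by (simp_all add: K_def[abs_def] case_prod_unfold hs_iterated(1)[OF k k] power2_eq_square)
  have L: "integrable M L" "(LINT y|M. L y) = hs M l l"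
    using pp.integrable_snd[of "\<lambda>x y. (l x y)\<^sup>2"] L2_funD(2)[OF L2kerD(1)[OF l]]
    by (simp_all add: L_def[abs_def] case_prod_unfold hs_iterated(2)[OF l l] power2_eq_square)
  have KL: "integrable (M \<Otimes>\<^sub>M M) (\<lambda>(x, y). K x * L y)" by (rule integrable_pair_mult[OF K(1) L(1)])
  have le: "(kcomp M k l x y)\<^sup>2 \<le> K x * L y" if "x \<in> space M" "y \<in> space M" for x y
    using L2_Cauchy_Schwarz[OF L2kerD(3)[OF k that(1)] L2kerD(4)[OF l that(2)]]
    by (simp add: kcomp_def K_def L_def)
  have int: "integrable (M \<Otimes>\<^sub>M M) (\<lambda>z. (case z of (x, y) \<Rightarrow> kcomp M k l x y)\<^sup>2)"
    by (rule Bochner_Integration.integrable_bound[OF KL])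
      (auto simp: space_pair_measure intro!: AE_I2 order_trans[OF le abs_ge_self])
  have rows: "(\<lambda>y. kcomp M k l x y) \<in> L2_fun M" if x: "x \<in> space M" for x
  proof -
    have "integrable M (\<lambda>y. K x * L y)" using L by simp
    then have "integrable M (\<lambda>y. (kcomp M k l x y)\<^sup>2)"
      by (rule Bochner_Integration.integrable_bound)
        (use x in \<open>auto intro!: AE_I2 order_trans[OF le abs_ge_self]\<close>)
    then show ?thesis using x by (simp add: L2_fun_def)
  qed
  have cols: "(\<lambda>x. kcomp M k l x y) \<in> L2_fun M" if y: "y \<in> space M" for y
  proof -
    have "integrable M (\<lambda>x. K x * L y)" using K by simp
    then have "integrable M (\<lambda>x. (kcomp M k l x y)\<^sup>2)"
      by (rule Bochner_Integration.integrable_bound)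
        (use y in \<open>auto intro!: AE_I2 order_trans[OF le abs_ge_self]\<close>)
    then show ?thesis using y by (simp add: L2_fun_def)
  qed
  show "L2ker M (kcomp M k l)" using int rows cols by (simp add: L2ker_def L2_fun_def)
  have "hs M (kcomp M k l) (kcomp M k l) \<le> (LINT (x, y)|(M \<Otimes>\<^sub>M M). K x * L y)"
    unfolding hs_self by (rule integral_mono_AE[OF int KL]) (auto simp: space_pair_measure le intro!: AE_I2)
  also have "\<dots> = (LINT x|M. LINT y|M. K x * L y)" by (rule pp.integral_fst[symmetric]) (rule KL)
  also have "\<dots> = hs M k k * hs M l l" by (simp add: K L)
  finally show "hs M (kcomp M k l) (kcomp M k l) \<le> hs M k k * hs M l l" .
qed

lemma kcomp_assoc:
  assumes "L2ker M k" "L2ker M l" "L2ker M m" "x \<in> space M" "y \<in> space M"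
  shows "kcomp M (kcomp M k l) m x y = kcomp M k (kcomp M l m) x y"
  using kernel_swap[OF L2kerD(1)[OF assms(2)] L2kerD(3)[OF assms(1,4)] L2kerD(4)[OF assms(3,5)]]
  by (simp add: kcomp_def)

lemma kcomp_cong:
  assumes "\<And>w. w \<in> space M \<Longrightarrow> k x w = k' x w" "\<And>w. w \<in> space M \<Longrightarrow> l w y = l' w y"
  shows "kcomp M k l x y = kcomp M k' l' x y"
  unfolding kcomp_def by (rule Bochner_Integration.integral_cong) (auto simp: assms)

lemma kernel_op_sym:
  assumes k: "L2ker M k" "sym_kernel M k" and f: "f \<in> L2_fun M" and g: "g \<in> L2_fun M"
  shows "(LINT x|M. kernel_op M k f x * g x) = (LINT x|M. f x * kernel_op M k g x)"
proof -
  have "(LINT x|M. kernel_op M k f x * g x) = (LINT v|M. (LINT w|M. f w * k w v) * g v)"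
  proof (rule Bochner_Integration.integral_cong[OF refl])
    fix x assume "x \<in> space M"
    then have "kernel_op M k f x = (LINT w|M. f w * k w x)"
      unfolding kernel_op_def using k(2)
      by (intro Bochner_Integration.integral_cong refl) (simp add: sym_kernel_def mult.commute)
    then show "kernel_op M k f x * g x = (LINT w|M. f w * k w x) * g x" by simp
  qed
  also have "\<dots> = (LINT x|M. f x * kernel_op M k g x)"
    unfolding kernel_op_def by (rule kernel_swap[OF L2kerD(1)[OF k(1)] f g])
  finally show ?thesis .
qed

lemma hs_kcomp_sym:
  assumes k: "L2ker M k" "sym_kernel M k" and u: "L2ker M u" and v: "L2ker M v"
  shows "hs M (kcomp M k u) v = hs M u (kcomp M k v)"
  unfolding hs_iterated(2)[OF L2ker_kcomp(1)[OF k(1) u] v] hs_iterated(2)[OF u L2ker_kcomp(1)[OF k(1) v]]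
proof (rule Bochner_Integration.integral_cong[OF refl])
  fix y assume y: "y \<in> space M"
  show "(LINT x|M. kcomp M k u x y * v x y) = (LINT x|M. u x y * kcomp M k v x y)"
    using kernel_op_sym[OF k L2kerD(4)[OF u y] L2kerD(4)[OF v y]]
    by (simp add: kernel_op_def kcomp_def)
qed

end

section \<open>Existence of eigenfunctions\<close>

text \<open>The index is shifted: \<open>n\<close> stands for the power n + 1, since the identity
  has no kernel.\<close>

primrec gpow :: "'a measure \<Rightarrow> ('a \<Rightarrow> 'a \<Rightarrow> real) \<Rightarrow> nat \<Rightarrow> 'a \<Rightarrow> 'a \<Rightarrow> real" where
  "gpow M k 0 = k"
| "gpow M k (Suc n) = kcomp M k (gpow M k n)"

section \<open>Kernel powers and power iteration\<close>

context sample_space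
begin

text \<open>\<open>ennreal\<close> truncates at 0, so the densities \<open>F\<close> and
  \<open>- F\<close> define the positive and the negative part of a signed measure. They agree on
  rectangles, which form a generator stable under intersections, hence everywhere.\<close>

lemma AE_0_rectangles:
  assumes F: "integrable (M \<Otimes>\<^sub>M M) F"
    and rect: "\<And>A B. A \<in> sets M \<Longrightarrow> B \<in> sets M \<Longrightarrow>
      (LINT z|(M \<Otimes>\<^sub>M M). F z * indicator (A \<times> B) z) = 0"
  shows "AE z in M \<Otimes>\<^sub>M M. F z = (0 :: real)"
proof -
  let ?P = "M \<Otimes>\<^sub>M M"
  let ?E = "{a \<times> b |a b. a \<in> sets M \<and> b \<in> sets M}"
  let ?D = "\<lambda>F. density ?P (\<lambda>z. ennreal (F z))"
  have [measurable]: "F \<in> borel_measurable ?P" using F by simp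
  have fin: "(\<integral>\<^sup>+z. ennreal \<bar>F z\<bar> \<partial>?P) < \<infinity>"
    using F by (simp add: integrable_iff_bounded)
  have eq: "?D F = ?D (\<lambda>z. - F z)"
  proof (rule measure_eqI_generator_eq[OF Int_stable_pair_measure_generator[of M M]])
    show "?E \<subseteq> Pow (space ?P)"
      using sets.space_closed[of M] by (auto simp: space_pair_measure)
    show "sets (?D F) = sigma_sets (space ?P) ?E" "sets (?D (\<lambda>z. - F z)) = sigma_sets (space ?P) ?E"
      by (simp_all add: sets_pair_measure space_pair_measure)
    show "range (\<lambda>_. space ?P) \<subseteq> ?E" by (auto simp: space_pair_measure)
    show "(\<Union>i. (\<lambda>_ :: nat. space ?P) i) = space ?P" by simp
    have "(\<integral>\<^sup>+z. ennreal (F z) \<partial>?P) \<le> (\<integral>\<^sup>+z. ennreal \<bar>F z\<bar> \<partial>?P)"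
      by (intro nn_integral_mono ennreal_leI) simp
    then have "(\<integral>\<^sup>+z. ennreal (F z) \<partial>?P) \<noteq> \<infinity>" using fin by auto
    moreover have "emeasure (?D F) (space ?P) = (\<integral>\<^sup>+z. ennreal (F z) \<partial>?P)"
      by (subst emeasure_density) (auto intro!: nn_integral_cong)
    ultimately show "emeasure (?D F) ((\<lambda>_ :: nat. space ?P) i) \<noteq> \<infinity>" for i by simp
  next
    fix X assume "X \<in> ?E"
    then obtain A B where X: "X = A \<times> B" and AB: "A \<in> sets M" "B \<in> sets M" by auto
    then have XS [measurable]: "X \<in> sets ?P" by auto
    let ?G = "\<lambda>z. F z * indicator X z"
    have int: "integrable ?P ?G" by (rule integrable_real_mult_indicator[OF XS F])
    have le: "(\<integral>\<^sup>+z. ennreal (?G z) \<partial>?P) < \<infinity>" "(\<integral>\<^sup>+z. ennreal (- ?G z) \<partial>?P) < \<infinity>"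
      using int by (auto simp: real_integrable_def less_top[symmetric])
    have eqr: "enn2real (\<integral>\<^sup>+z. ennreal (?G z) \<partial>?P) = enn2real (\<integral>\<^sup>+z. ennreal (- ?G z) \<partial>?P)"
      using rect[OF AB] real_lebesgue_integral_def[OF int] by (simp add: X)
    have "(\<integral>\<^sup>+z. ennreal (?G z) \<partial>?P) = (\<integral>\<^sup>+z. ennreal (- ?G z) \<partial>?P)"
      by (rule trans[OF sym[OF ennreal_enn2real] trans[OF arg_cong[OF eqr, of ennreal] ennreal_enn2real]])
        (use le in auto)
    moreover have "emeasure (?D F) X = (\<integral>\<^sup>+z. ennreal (?G z) \<partial>?P)"
      "emeasure (?D (\<lambda>z. - F z)) X = (\<integral>\<^sup>+z. ennreal (- ?G z) \<partial>?P)"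
      by (simp_all add: emeasure_density XS) (auto intro!: nn_integral_cong simp: indicator_def)
    ultimately show "emeasure (?D F) X = emeasure (?D (\<lambda>z. - F z)) X" by simp
  qed
  have "AE z in ?P. ennreal (F z) = ennreal (- F z)"
    using eq by (subst (asm) pp.density_unique_iff) auto
  then show ?thesis
  proof eventually_elim
    case (elim z)
    show ?case
    proof (cases "F z \<ge> 0")
      case True
      then have "ennreal (- F z) = 0" by (intro ennreal_neg) simp
      then have "ennreal (F z) = 0" using elim by simp
      then show ?thesis using True by (subst (asm) ennreal_eq_0_iff) linarith
    next
      case False
      then have "ennreal (F z) = 0" by (intro ennreal_neg) simp
      then have "ennreal (- F z) = 0" using elim by simp
      then show ?thesis using False by (subst (asm) ennreal_eq_0_iff) linarith
    qed
  qed
qed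

text \<open>By Fubini almost every row and column has finite norm; setting the others to zero
  changes the kernel on a null set only. Limits in L^2 become kernels in the sense of
  \<open>L2ker\<close> in this way.\<close>

lemma L2ker_representative:
  assumes "F \<in> L2_fun (M \<Otimes>\<^sub>M M)"
  obtains p where "L2ker M p" "AE z in M \<Otimes>\<^sub>M M. F z = p (fst z) (snd z)"
proof -
  have [measurable]: "F \<in> borel_measurable (M \<Otimes>\<^sub>M M)" using assms by (simp add: L2_fun_def)
  have int: "integrable (M \<Otimes>\<^sub>M M) (\<lambda>(x, y). (F (x, y))\<^sup>2)"
    using assms by (simp add: L2_fun_def case_prod_unfold)
  define A where "A = {x \<in> space M. (\<integral>\<^sup>+y. ennreal ((F (x, y))\<^sup>2) \<partial>M) < \<infinity>}"
  define B where "B = {y \<in> space M. (\<integral>\<^sup>+x. ennreal ((F (x, y))\<^sup>2) \<partial>M) < \<infinity>}"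
  have [measurable]: "A \<in> sets M" "B \<in> sets M" unfolding A_def B_def by measurable
  have fin: "(\<integral>\<^sup>+y. ennreal (f y) \<partial>M) < \<infinity>" if "integrable M f" for f :: "'a \<Rightarrow> real"
    using that by (simp add: real_integrable_def less_top)
  have A: "AE x in M. x \<in> A"
    using pp.AE_integrable_fst[OF int] AE_space
    by eventually_elim (use fin in \<open>auto simp: A_def\<close>)
  have B: "AE y in M. y \<in> B"
    using pp.AE_integrable_snd[OF int] AE_space
    by eventually_elim (use fin in \<open>auto simp: B_def\<close>)
  define p where "p x y = indicator A x * indicator B y * F (x, y)" for x y
  have [measurable]: "(\<lambda>(x, y). p x y) \<in> borel_measurable (M \<Otimes>\<^sub>M M)" unfolding p_def by measurable
  have AB: "AE z in M \<Otimes>\<^sub>M M. fst z \<in> A \<and> snd z \<in> B"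
  proof (rule pp.AE_pair_measure)
    show "AE x in M. AE y in M. fst (x, y) \<in> A \<and> snd (x, y) \<in> B"
      using A by eventually_elim (use B in auto)
  qed measurable
  show thesis
  proof (rule that)
    show "AE z in M \<Otimes>\<^sub>M M. F z = p (fst z) (snd z)"
      using AB by eventually_elim (simp add: p_def)
    have "integrable (M \<Otimes>\<^sub>M M) (\<lambda>z. (case z of (x, y) \<Rightarrow> p x y)\<^sup>2)"
      by (rule Bochner_Integration.integrable_bound[OF int])
        (auto intro!: AE_I2 simp: p_def indicator_def)
    moreover have "integrable M (\<lambda>y. (p x y)\<^sup>2)" if x: "x \<in> space M" for x
    proof (rule integrableI_nonneg)
      have "(\<integral>\<^sup>+y. ennreal ((p x y)\<^sup>2) \<partial>M) \<le> (\<integral>\<^sup>+y. ennreal (indicator A x * (F (x, y))\<^sup>2) \<partial>M)"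
        by (intro nn_integral_mono ennreal_leI) (auto simp: p_def indicator_def)
      also have "\<dots> < \<infinity>" by (auto simp: A_def indicator_def)
      finally show "(\<integral>\<^sup>+y. ennreal ((p x y)\<^sup>2) \<partial>M) < \<infinity>" .
    qed (use x in auto)
    moreover have "integrable M (\<lambda>x. (p x y)\<^sup>2)" if y: "y \<in> space M" for y
    proof (rule integrableI_nonneg)
      have "(\<integral>\<^sup>+x. ennreal ((p x y)\<^sup>2) \<partial>M) \<le> (\<integral>\<^sup>+x. ennreal (indicator B y * (F (x, y))\<^sup>2) \<partial>M)"
        by (intro nn_integral_mono ennreal_leI) (auto simp: p_def indicator_def)
      also have "\<dots> < \<infinity>" by (auto simp: B_def indicator_def)
      finally show "(\<integral>\<^sup>+x. ennreal ((p x y)\<^sup>2) \<partial>M) < \<infinity>" .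
    qed (use y in auto)
    ultimately show "L2ker M p" by (auto simp: L2ker_def L2_fun_def)
  qed
qed

lemma gpow_L2ker: "L2ker M k \<Longrightarrow> L2ker M (gpow M k n)"
  by (induction n) (auto intro: L2ker_kcomp)

text \<open>The successor compensates the shift of the index: (a + 1) + (b + 1) = (a + b + 1) +
  1.\<close>

lemma gpow_add:
  assumes "L2ker M k" "x \<in> space M" "y \<in> space M"
  shows "gpow M k (Suc (a + b)) x y = kcomp M (gpow M k a) (gpow M k b) x y"
  using assms(2,3)
proof (induction a arbitrary: x y)
  case (Suc a)
  have "gpow M k (Suc (Suc a + b)) x y = kcomp M k (gpow M k (Suc (a + b))) x y" by simp
  also have "\<dots> = kcomp M k (kcomp M (gpow M k a) (gpow M k b)) x y"
    by (rule kcomp_cong) (use Suc in auto)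
  also have "\<dots> = kcomp M (gpow M k (Suc a)) (gpow M k b) x y"
    using kcomp_assoc[OF assms(1) gpow_L2ker[OF assms(1)] gpow_L2ker[OF assms(1)] Suc.prems] by simp
  finally show ?case .
qed simp

lemma gpow_sym:
  assumes k: "L2ker M k" "sym_kernel M k"
  shows "sym_kernel M (gpow M k n)"
proof (induction n)
  case (Suc n)
  show ?case unfolding sym_kernel_def
  proof (intro ballI)
    fix x y assume xy: "x \<in> space M" "y \<in> space M"
    have "gpow M k (Suc n) x y = (LINT w|M. k x w * gpow M k n w y)" by (simp add: kcomp_def)
    also have "\<dots> = (LINT w|M. gpow M k n y w * k w x)"
      by (rule Bochner_Integration.integral_cong[OF refl])
        (use Suc k(2) xy in \<open>simp add: sym_kernel_def\<close>)
    also have "\<dots> = gpow M k (Suc (n + 0)) y x"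
      unfolding gpow_add[OF k(1) xy(2,1)] by (simp add: kcomp_def)
    finally show "gpow M k (Suc n) x y = gpow M k (Suc n) y x" by simp
  qed
qed (use assms in simp)

lemma hs_gpow:
  assumes k: "L2ker M k" "sym_kernel M k"
  shows "hs M (gpow M k a) (gpow M k b) = hs M (gpow M k (a + b)) k"
proof (induction b arbitrary: a)
  case (Suc b)
  have "hs M (gpow M k a) (gpow M k (Suc b)) = hs M (gpow M k (Suc a)) (gpow M k b)"
    using hs_kcomp_sym[OF k gpow_L2ker[OF k(1)] gpow_L2ker[OF k(1)], of a b] by simp
  then show ?case using Suc[of "Suc a"] by simp
qed simp

lemma hs_cong:
  assumes "\<And>x y. x \<in> space M \<Longrightarrow> y \<in> space M \<Longrightarrow> k x y = k' x y"
    "\<And>x y. x \<in> space M \<Longrightarrow> y \<in> space M \<Longrightarrow> l x y = l' x y"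
  shows "hs M k l = hs M k' l'"
  unfolding hs_def
  by (rule Bochner_Integration.integral_cong) (auto simp: space_pair_measure assms)

lemma hs_triangle:
  assumes "L2ker M k" "L2ker M l"
  shows "hs M (\<lambda>x y. k x y + l x y) (\<lambda>x y. k x y + l x y) \<le> 2 * hs M k k + 2 * hs M l l"
  using L2_triangle[OF L2kerD(1)[OF assms(1)] L2kerD(1)[OF assms(2)]]
  by (simp add: hs_self case_prod_unfold)

lemma kcomp_add_right:
  assumes "L2ker M k" "L2ker M p" "L2ker M q" "x \<in> space M" "y \<in> space M"
  shows "kcomp M k (\<lambda>x y. p x y + q x y) x y = kcomp M k p x y + kcomp M k q x y"
  using L2_fun_mult_integrable[OF L2kerD(3)[OF assms(1,4)] L2kerD(4)[OF assms(2,5)]]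
    L2_fun_mult_integrable[OF L2kerD(3)[OF assms(1,4)] L2kerD(4)[OF assms(3,5)]]
  by (simp add: kcomp_def distrib_left)

lemma kcomp_cmult_right: "kcomp M k (\<lambda>x y. c * p x y) x y = c * kcomp M k p x y"
proof -
  have "kcomp M k (\<lambda>x y. c * p x y) x y = (LINT w|M. c * (k x w * p w y))"
    by (simp add: kcomp_def mult.left_commute)
  then show ?thesis by (simp add: kcomp_def)
qed

text \<open>If T^2 vanished, then so would \<parallel>T f\<parallel>^2 = <f, T^2 f> for all f;
  taking f to be an indicator shows that \<open>k\<close> integrates to zero over all rectangles.
  This starts the iteration: all later powers are non-zero by log-convexity.\<close>

lemma hs_kcomp_self_pos:
  assumes k: "L2ker M k" "sym_kernel M k" and nz: "hs M k k \<noteq> 0"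
  shows "0 < hs M (kcomp M k k) (kcomp M k k)"
proof (rule ccontr)
  assume "\<not> ?thesis"
  then have 0: "hs M (kcomp M k k) (kcomp M k k) = 0"
    using hs_nonneg[of "kcomp M k k"] by linarith
  have op0: "AE x in M. kernel_op M k f x = 0" if f: "f \<in> L2_fun M" for f
  proof -
    let ?g = "kernel_op M k f"
    have g: "?g \<in> L2_fun M" by (rule kernel_op_L2(1)[OF k(1) f])
    have gg: "kernel_op M k ?g x = kernel_op M (kcomp M k k) f x" if x: "x \<in> space M" for x
      using kernel_swap[OF L2kerD(1)[OF k(1)] L2kerD(3)[OF k(1) x] f]
      by (simp add: kernel_op_def kcomp_def)
    have "(LINT x|M. (kernel_op M k ?g x)\<^sup>2) = (LINT x|M. (kernel_op M (kcomp M k k) f x)\<^sup>2)"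
      by (rule Bochner_Integration.integral_cong) (auto simp: gg)
    also have "\<dots> \<le> 0"
      using kernel_op_L2(2)[OF L2ker_kcomp(1)[OF k(1) k(1)] f] 0 by simp
    finally have le: "(LINT x|M. (kernel_op M k ?g x)\<^sup>2) \<le> 0" .
    have "(LINT x|M. ?g x * ?g x) = (LINT x|M. f x * kernel_op M k ?g x)"
      by (rule kernel_op_sym[OF k f g])
    moreover have "(LINT x|M. f x * kernel_op M k ?g x)\<^sup>2 \<le> (LINT x|M. (f x)\<^sup>2) * 0"
      using L2_Cauchy_Schwarz[OF f kernel_op_L2(1)[OF k(1) g]] mult_left_mono[OF le, of "LINT x|M. (f x)\<^sup>2"]
      by (meson Bochner_Integration.integral_nonneg order_trans zero_le_power2)
    ultimately have "(LINT x|M. ?g x * ?g x)\<^sup>2 \<le> 0" by (simp only: mult_zero_right)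
    then have "(LINT x|M. ?g x * ?g x) = 0" by simp
    then have "(LINT x|M. (?g x)\<^sup>2) = 0" unfolding power2_eq_square .
    then show ?thesis by (simp add: L2_norm_AE_0_iff[OF g])
  qed
  have int: "integrable (M \<Otimes>\<^sub>M M) (\<lambda>z. case z of (x, y) \<Rightarrow> k x y)"
    using pp.square_integrable_imp_integrable[of "\<lambda>z. case z of (x, y) \<Rightarrow> k x y"] L2_funD[OF L2kerD(1)[OF k(1)]]
    by simp
  have "AE z in M \<Otimes>\<^sub>M M. (case z of (x, y) \<Rightarrow> k x y) = 0"
  proof (rule AE_0_rectangles[OF int])
    fix A B assume AB: "A \<in> sets M" "B \<in> sets M"
    have ind: "indicator A \<in> L2_fun M" "indicator B \<in> L2_fun M"
      using AB by (auto simp: L2_fun_def power2_eq_square indicator_inter_arith[symmetric]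
          intro!: integrable_real_indicator emeasure_finite simp: less_top[symmetric])
    have "(LINT z|(M \<Otimes>\<^sub>M M). (case z of (x, y) \<Rightarrow> k x y) * indicator (A \<times> B) z)
        = (LINT (w, v)|(M \<Otimes>\<^sub>M M). indicator A w * k w v * indicator B v)"
      by (rule Bochner_Integration.integral_cong) (auto simp: indicator_def)
    also have "\<dots> = (LINT w|M. LINT v|M. indicator A w * k w v * indicator B v)"
      by (rule pp.integral_fst[symmetric, OF triple_integrable[OF L2kerD(1)[OF k(1)] ind]])
    also have "\<dots> = (LINT w|M. indicator A w * kernel_op M k (indicator B) w)"
      by (simp add: kernel_op_def mult.assoc)
    also have "\<dots> = 0"
      by (rule integral_eq_zero_AE) (use op0[OF ind(2)] in auto)
    finally show "(LINT z|(M \<Otimes>\<^sub>M M). (case z of (x, y) \<Rightarrow> k x y) * indicator (A \<times> B) z) = 0" .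
  qed
  then have "hs M k k = 0"
    unfolding hs_eq_0_iff[OF k(1)] by (simp add: case_prod_unfold)
  then show False using nz by simp
qed

text \<open>The inner products of the even iterates depend only on the sum of their indices. Hence the
  iterates, normalised by the powers of the limit of the ratios, form a Cauchy sequence, and no
  compactness argument is needed.\<close>

lemma power_iteration:
  assumes k: "L2ker M k" "sym_kernel M k" and nz: "hs M k k \<noteq> 0"
  obtains L p where "0 < L" "L2ker M p" "hs M p p \<noteq> 0"
    "AE z in M \<Otimes>\<^sub>M M. kcomp M k (kcomp M k p) (fst z) (snd z) = L * p (fst z) (snd z)"
proof -
  let ?u = "gpow M k"
  note u = gpow_L2ker[OF k(1)]
  define t where "t n = hs M (?u n) (?u n)" for n
  have hst: "hs M (?u a) (?u b) = t ((a + b) div 2)" if "even (a + b)" for a b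
  proof -
    define c where "c = (a + b) div 2"
    then have "a + b = 2 * c" using that by simp
    then have c: "a + b = c + c" by simp
    have "hs M (?u a) (?u b) = hs M (?u c) (?u c)"
      unfolding hs_gpow[OF k, of a b] hs_gpow[OF k, of c c] c ..
    also have "c = (a + b) div 2" using c by simp
    finally show ?thesis by (simp add: t_def)
  qed
  have t0: "0 \<le> t n" for n by (simp add: t_def hs_nonneg)
  \<comment> \<open>Cauchy--Schwarz for the iterates \<open>n\<close> and \<open>n + 2\<close>,
    whose inner product is again a \<open>t\<close>. It makes the ratios \<open>r\<close>
    increase.\<close>
  have logconv: "(t (Suc n))\<^sup>2 \<le> t n * t (Suc (Suc n))" for n
  proof -
    have "(n + (n + 2)) div 2 = Suc n" by simp
    then show ?thesis using hs_Cauchy_Schwarz[OF u[of n] u[of "n + 2"]] hst[of n "n + 2"]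
      by (simp add: t_def del: gpow.simps)
  qed
  have tpos: "0 < t n \<and> 0 < t (Suc n)" for n
  proof (induction n)
    case 0
    have "0 < hs M k k" using nz hs_nonneg[of k] by linarith
    then show ?case using hs_kcomp_self_pos[OF k nz] by (simp add: t_def)
  next
    case (Suc n)
    then have "0 < t n * t (Suc (Suc n))" using logconv[of n] by (meson less_le_trans zero_less_power)
    then show ?case using Suc by (simp add: zero_less_mult_iff)
  qed
  then have tp: "0 < t n" for n by auto
  define r where "r n = t (Suc n) / t n" for n
  have r0: "0 < r n" for n using tp by (simp add: r_def)
  have rinc: "incseq r"
  proof (rule incseq_SucI)
    fix n show "r n \<le> r (Suc n)"
      using logconv[of n] tp[of n] tp[of "Suc n"] by (simp add: r_def field_simps power2_eq_square)
  qed
  have rbd: "r n \<le> hs M k k" for n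
    using L2ker_kcomp(2)[OF k(1) u[of n]] tp[of n] by (simp add: r_def t_def field_simps)
  obtain L where L: "r \<longlonglongrightarrow> L" "\<And>n. r n \<le> L"
    using incseq_convergent[OF rinc] rbd by blast
  have L0: "0 < L" using r0[of 0] L(2)[of 0] by linarith
  define c where "c n = t n / L ^ n" for n
  have c0: "0 \<le> c n" for n using t0 L0 by (simp add: c_def)
  have cdec: "decseq c"
  proof (rule decseq_SucI)
    fix n
    have "t (Suc n) \<le> L * t n" using L(2)[of n] tp[of n] by (simp add: r_def field_simps)
    then show "c (Suc n) \<le> c n" using L0 by (simp add: c_def field_simps)
  qed
  \<comment> \<open>The lower bound that keeps the limit kernel from vanishing: for the increasing
    ratios, \<open>r b ^ Suc a * t b \<le> t (b + Suc a) \<le> t a * t b\<close>. Hence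
    \<open>L ^ Suc a \<le> t a\<close>, and the normalised \<open>c\<close> stays above
    \<open>L > 0\<close>.\<close>
  have subm: "t (b + Suc a) \<le> t a * t b" for a b
  proof -
    have "t (b + Suc a) = hs M (kcomp M (?u a) (?u b)) (kcomp M (?u a) (?u b))"
      unfolding t_def
      by (rule hs_cong) (use gpow_add[OF k(1), of _ _ a b] in \<open>simp_all add: add.commute\<close>)
    also have "\<dots> \<le> t a * t b" unfolding t_def by (rule L2ker_kcomp(2)[OF u u])
    finally show ?thesis .
  qed
  have rpow: "r b ^ n * t b \<le> t (b + n)" for b n
  proof (induction n)
    case (Suc n)
    have "r b ^ Suc n * t b = r b * (r b ^ n * t b)" by simp
    also have "\<dots> \<le> r b * t (b + n)" using Suc r0[of b] by (intro mult_left_mono) auto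
    also have "\<dots> \<le> r (b + n) * t (b + n)"
      using incseqD[OF rinc, of b "b + n"] t0 by (intro mult_right_mono) auto
    also have "\<dots> = t (b + Suc n)" using tp[of "b + n"] by (simp add: r_def)
    finally show ?case .
  qed simp
  have "L ^ Suc a \<le> t a" for a
  proof (rule LIMSEQ_le_const2[OF tendsto_power[OF L(1)]])
    have "r b ^ Suc a * t b \<le> t a * t b" for b by (rule order_trans[OF rpow subm])
    then have "r b ^ Suc a \<le> t a" for b using tp[of b] by (meson mult_le_cancel_right_pos)
    then show "\<exists>N. \<forall>n\<ge>N. r n ^ Suc a \<le> t a" by blast
  qed
  then have cL: "L \<le> c n" for n using L0 by (simp add: c_def field_simps)
  obtain cl where cl: "c \<longlonglongrightarrow> cl" using decseq_convergent[OF cdec, of 0] c0 by blast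
  \<comment> \<open>Only even indices, that is odd powers of T, so that eigenvalues of opposite sign
    cannot make the sequence oscillate. As \<open>hs M (v m) (v n) = c (m + n)\<close>, the Cauchy
    property is just the convergence of \<open>c\<close>.\<close>
  define v where "v n x y = (1 / L ^ n) * ?u (2 * n) x y" for n x y
  have v: "L2ker M (v n)" for n unfolding v_def[abs_def] by (rule L2ker_cmult[OF u])
  have hv: "hs M (v m) (v n) = c (m + n)" for m n
  proof -
    have "hs M (v m) (v n) = (1 / L ^ m) * ((1 / L ^ n) * hs M (?u (2 * m)) (?u (2 * n)))"
      unfolding v_def[abs_def] hs_cmult_left
      by (subst hs_commute, subst hs_cmult_left, subst hs_commute) simp
    also have "hs M (?u (2 * m)) (?u (2 * n)) = t (m + n)" using hst[of "2 * m" "2 * n"] by simp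
    finally show ?thesis by (simp add: c_def power_add)
  qed
  have Qf: "finite_measure (M \<Otimes>\<^sub>M M)" by unfold_locales
  obtain F where F: "F \<in> L2_fun (M \<Otimes>\<^sub>M M)"
    "(\<lambda>n. LINT z|(M \<Otimes>\<^sub>M M). ((case z of (x, y) \<Rightarrow> v n x y) - F z)\<^sup>2) \<longlonglongrightarrow> 0"
  proof (rule finite_measure.L2_complete[OF Qf, of "\<lambda>n z. case z of (x, y) \<Rightarrow> v n x y"])
    show "(\<lambda>(x, y). v n x y) \<in> L2_fun (M \<Otimes>\<^sub>M M)" for n by (rule L2kerD(1)[OF v])
    fix e :: real assume "e > 0"
    then have "e / 4 > 0" by simp
    from LIMSEQ_D[OF cl this] obtain n0 where n0: "\<And>n. n \<ge> n0 \<Longrightarrow> \<bar>c n - cl\<bar> < e / 4" by auto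
    show "\<exists>n0. \<forall>m\<ge>n0. \<forall>n\<ge>n0. (LINT z|(M \<Otimes>\<^sub>M M). ((case z of (x, y) \<Rightarrow> v m x y) - (case z of (x, y) \<Rightarrow> v n x y))\<^sup>2) < e"
    proof (intro exI allI impI)
      fix m n assume mn: "n0 \<le> m" "n0 \<le> n"
      have "(LINT z|(M \<Otimes>\<^sub>M M). ((case z of (x, y) \<Rightarrow> v m x y) - (case z of (x, y) \<Rightarrow> v n x y))\<^sup>2)
          = hs M (\<lambda>x y. v m x y - v n x y) (\<lambda>x y. v m x y - v n x y)"
        by (simp add: hs_self case_prod_unfold)
      also have "\<dots> = c (m + m) - 2 * c (m + n) + c (n + n)"
        unfolding hs_diff_self[OF v v] hv ..
      also have "\<dots> < e" using n0[of "m + m"] n0[of "m + n"] n0[of "n + n"] mn by linarith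
      finally show "(LINT z|(M \<Otimes>\<^sub>M M). ((case z of (x, y) \<Rightarrow> v m x y) - (case z of (x, y) \<Rightarrow> v n x y))\<^sup>2) < e" .
    qed
  qed
  obtain p where p: "L2ker M p" and Fp: "AE z in M \<Otimes>\<^sub>M M. F z = p (fst z) (snd z)"
    using L2ker_representative[OF F(1)] by blast
  let ?d = "\<lambda>n x y. p x y - v n x y"
  have d: "L2ker M (?d n)" for n by (rule L2ker_diff[OF p v])
  have "(\<lambda>n. hs M (?d n) (?d n)) = (\<lambda>n. LINT z|(M \<Otimes>\<^sub>M M). ((case z of (x, y) \<Rightarrow> v n x y) - F z)\<^sup>2)"
  proof
    fix n
    note [measurable] = L2kerD(2)[OF p] L2kerD(2)[OF v] L2_funD(1)[OF F(1)]
    show "hs M (?d n) (?d n) = (LINT z|(M \<Otimes>\<^sub>M M). ((case z of (x, y) \<Rightarrow> v n x y) - F z)\<^sup>2)"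
      unfolding hs_self
    proof (rule integral_cong_AE)
      show "AE z in M \<Otimes>\<^sub>M M. (case z of (x, y) \<Rightarrow> ?d n x y)\<^sup>2 = ((case z of (x, y) \<Rightarrow> v n x y) - F z)\<^sup>2"
        using Fp by eventually_elim (simp add: case_prod_unfold power2_commute)
    qed measurable
  qed
  then have dlim: "(\<lambda>n. hs M (?d n) (?d n)) \<longlonglongrightarrow> 0" using F(2) by simp
  have pnz: "hs M p p \<noteq> 0"
  proof
    assume 0: "hs M p p = 0"
    have "L \<le> 2 * hs M (?d n) (?d n)" for n
    proof -
      have "L \<le> hs M (v n) (v n)" using cL hv by simp
      also have "\<dots> = hs M (\<lambda>x y. p x y + (- 1) * ?d n x y) (\<lambda>x y. p x y + (- 1) * ?d n x y)" by simp
      also have "\<dots> \<le> 2 * hs M p p + 2 * hs M (\<lambda>x y. (- 1) * ?d n x y) (\<lambda>x y. (- 1) * ?d n x y)"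
        by (rule hs_triangle[OF p L2ker_cmult[OF d]])
      also have "hs M (\<lambda>x y. (- 1) * ?d n x y) (\<lambda>x y. (- 1) * ?d n x y) = hs M (?d n) (?d n)"
        unfolding hs_def
        by (rule Bochner_Integration.integral_cong[OF refl]) (auto simp: algebra_simps)
      finally show ?thesis using 0 by simp
    qed
    then have "L \<le> 2 * 0" by (intro LIMSEQ_le_const[OF tendsto_mult_left[OF dlim]]) auto
    then show False using L0 by simp
  qed
  let ?A = "\<lambda>q. kcomp M k (kcomp M k q)"
  have A: "L2ker M (?A q)" if "L2ker M q" for q by (intro L2ker_kcomp k that)
  have Aadd: "?A (\<lambda>x y. q x y + q' x y) x y = ?A q x y + ?A q' x y"
    if "L2ker M q" "L2ker M q'" "x \<in> space M" "y \<in> space M" for q q' x y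
  proof -
    have "?A (\<lambda>x y. q x y + q' x y) x y = kcomp M k (\<lambda>x y. kcomp M k q x y + kcomp M k q' x y) x y"
      by (rule kcomp_cong) (use kcomp_add_right[OF k(1)] that in auto)
    also have "\<dots> = ?A q x y + ?A q' x y"
      by (rule kcomp_add_right) (intro k L2ker_kcomp that)+
    finally show ?thesis .
  qed
  have Av: "?A (v n) x y = L * v (Suc n) x y" if "x \<in> space M" "y \<in> space M" for n x y
    unfolding v_def[abs_def] kcomp_cmult_right using L0 by simp
  let ?q = "\<lambda>x y. ?A p x y - L * p x y"
  have q: "L2ker M ?q" by (intro L2ker_diff A L2ker_cmult p)
  have "hs M ?q ?q \<le> 2 * ((hs M k k)\<^sup>2 * hs M (?d n) (?d n)) + 2 * (L\<^sup>2 * hs M (?d (Suc n)) (?d (Suc n)))" for n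
  proof -
    have qeq: "?q x y = ?A (?d n) x y + (- L) * ?d (Suc n) x y"
      if xy: "x \<in> space M" "y \<in> space M" for x y
      using Aadd[OF d v xy, of n n] Av[OF xy, of n] by (simp add: algebra_simps)
    have "hs M ?q ?q = hs M (\<lambda>x y. ?A (?d n) x y + (- L) * ?d (Suc n) x y) (\<lambda>x y. ?A (?d n) x y + (- L) * ?d (Suc n) x y)"
      by (rule hs_cong) (rule qeq; assumption)+
    also have "\<dots> \<le> 2 * hs M (?A (?d n)) (?A (?d n)) + 2 * hs M (\<lambda>x y. (- L) * ?d (Suc n) x y) (\<lambda>x y. (- L) * ?d (Suc n) x y)"
      by (rule hs_triangle[OF A[OF d] L2ker_cmult[OF d]])
    also have "hs M (\<lambda>x y. (- L) * ?d (Suc n) x y) (\<lambda>x y. (- L) * ?d (Suc n) x y) = L\<^sup>2 * hs M (?d (Suc n)) (?d (Suc n))"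
      unfolding hs_cmult_left
      by (subst hs_commute, subst hs_cmult_left) (simp add: power2_eq_square)
    also have "hs M (?A (?d n)) (?A (?d n)) \<le> hs M k k * (hs M k k * hs M (?d n) (?d n))"
      by (rule order_trans[OF L2ker_kcomp(2)[OF k(1) L2ker_kcomp(1)[OF k(1) d]]])
        (intro mult_left_mono L2ker_kcomp(2) k d hs_nonneg)
    finally show ?thesis by (simp add: power2_eq_square mult.assoc)
  qed
  then have qle: "\<exists>N. \<forall>n\<ge>N. hs M ?q ?q
      \<le> 2 * ((hs M k k)\<^sup>2 * hs M (?d n) (?d n)) + 2 * (L\<^sup>2 * hs M (?d (Suc n)) (?d (Suc n)))" by blast
  have "(\<lambda>n. 2 * ((hs M k k)\<^sup>2 * hs M (?d n) (?d n)) + 2 * (L\<^sup>2 * hs M (?d (Suc n)) (?d (Suc n))))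
      \<longlonglongrightarrow> 2 * ((hs M k k)\<^sup>2 * 0) + 2 * (L\<^sup>2 * 0)"
    by (intro tendsto_add tendsto_mult tendsto_const dlim LIMSEQ_Suc[OF dlim])
  from LIMSEQ_le_const[OF this qle] have "hs M ?q ?q \<le> 2 * ((hs M k k)\<^sup>2 * 0) + 2 * (L\<^sup>2 * 0)" .
  then have "hs M ?q ?q = 0" using hs_nonneg[of ?q] by simp
  then have "AE z in M \<Otimes>\<^sub>M M. ?A p (fst z) (snd z) = L * p (fst z) (snd z)"
    unfolding hs_eq_0_iff[OF q] by simp
  then show thesis using that L0 p pnz by blast
qed

text \<open>A non-null column f of the limit kernel satisfies T^2 f = L f. Then sqrt L f + T f and
  sqrt L f - T f satisfy the eigenvalue equation for sqrt L and - sqrt L, and they cannot both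
  vanish because their sum is 2 sqrt L f.\<close>

lemma eigenfunction_exists:
  assumes k: "L2ker M k" "sym_kernel M k" and nz: "hs M k k \<noteq> 0"
  obtains \<theta> f where "\<theta> \<noteq> 0" "f \<in> L2_fun M" "\<not> (AE x in M. f x = 0)"
    "AE x in M. kernel_op M k f x = \<theta> * f x"
proof -
  obtain L p where L: "0 < L" and p: "L2ker M p" "hs M p p \<noteq> 0"
    and eig: "AE z in M \<Otimes>\<^sub>M M. kcomp M k (kcomp M k p) (fst z) (snd z) = L * p (fst z) (snd z)"
    using power_iteration[OF assms] by blast
  note [measurable] = L2kerD(2)[OF k(1)] L2kerD(2)[OF p(1)]
    L2kerD(2)[OF L2ker_kcomp(1)[OF k(1) L2ker_kcomp(1)[OF k(1) p(1)]]]
  have "AE x in M. AE y in M. kcomp M k (kcomp M k p) x y = L * p x y"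
    using pp.AE_pair[OF eig] by simp
  then have eig': "AE y in M. AE x in M. kcomp M k (kcomp M k p) x y = L * p x y"
    by (subst (asm) pp.AE_commute) auto
  obtain y where y: "y \<in> space M" "AE x in M. kcomp M k (kcomp M k p) x y = L * p x y"
    "\<not> (AE x in M. p x y = 0)"
  proof (rule ccontr)
    assume "\<not> thesis"
    then have no: "AE x in M. p x y = 0" if "y \<in> space M" "AE x in M. kcomp M k (kcomp M k p) x y = L * p x y" for y
      using that \<open>\<And>y. y \<in> space M \<Longrightarrow> _ \<Longrightarrow> _ \<Longrightarrow> thesis\<close> by blast
    have "AE y in M. (LINT x|M. p x y * p x y) = 0"
      using eig' AE_space
    proof eventually_elim
      case (elim y)
      then show ?case by (intro integral_eq_zero_AE) (use no in auto)
    qed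
    then have "hs M p p = 0" unfolding hs_iterated(2)[OF p(1) p(1)] by (rule integral_eq_zero_AE)
    then show False using p(2) by simp
  qed
  define f where "f x = p x y" for x
  define g where "g = kernel_op M k f"
  have f: "f \<in> L2_fun M" using L2kerD(4)[OF p(1) y(1)] by (simp add: f_def[abs_def])
  have g: "g \<in> L2_fun M" unfolding g_def by (rule kernel_op_L2(1)[OF k(1) f])
  have Tg: "AE x in M. kernel_op M k g x = L * f x"
    using y(2) by (simp add: kernel_op_def kcomp_def g_def f_def[abs_def])
  define m where "m = sqrt L"
  have m: "m > 0" "m * m = L" using L by (auto simp: m_def)
  have lin: "kernel_op M k (\<lambda>x. m * f x + c * g x) x = m * g x + c * kernel_op M k g x" if x: "x \<in> space M" for x c
  proof -
    have i: "integrable M (\<lambda>w. k x w * f w)" "integrable M (\<lambda>w. k x w * g w)"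
      using L2_fun_mult_integrable[OF L2kerD(3)[OF k(1) x] f] L2_fun_mult_integrable[OF L2kerD(3)[OF k(1) x] g]
      by auto
    have "kernel_op M k (\<lambda>x. m * f x + c * g x) x = (LINT w|M. m * (k x w * f w) + c * (k x w * g w))"
      by (simp add: kernel_op_def algebra_simps)
    also have "\<dots> = m * g x + c * kernel_op M k g x" using i by (simp add: kernel_op_def g_def)
    finally show ?thesis .
  qed
  have eigc: "AE x in M. kernel_op M k (\<lambda>x. m * f x + c * g x) x = (c * m) * (m * f x + c * g x)"
    if c: "c * c = 1" for c
    using Tg AE_space
  proof eventually_elim
    case (elim x)
    have "(c * m) * (m * f x + c * g x) = c * (m * m) * f x + (c * c) * m * g x" by algebra
    then show ?case unfolding m(2) c using lin[OF elim(2), of c] elim(1) by simp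
  qed
  have L2c: "(\<lambda>x. m * f x + c * g x) \<in> L2_fun M" for c by (intro L2_fun_add L2_fun_cmult f g)
  show thesis
  proof (cases "AE x in M. m * f x + 1 * g x = 0")
    case False
    then show thesis using that[of m "\<lambda>x. m * f x + 1 * g x"] L2c[of 1] eigc[of 1] m by auto
  next
    case True
    have "\<not> (AE x in M. m * f x + (- 1) * g x = 0)"
    proof
      assume "AE x in M. m * f x + (- 1) * g x = 0"
      with True have "AE x in M. f x = 0" by eventually_elim (use m in auto)
      then show False using y(3) by (simp add: f_def)
    qed
    then show thesis using that[of "- m" "\<lambda>x. m * f x + (- 1) * g x"] L2c[of "-1"] eigc[of "-1"] m by auto
  qed
qed

end

section \<open>Spectral completeness\<close>

text \<open>Gaussian elimination with pivot \<open>p\<close> in the last equation. It yields, among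
  more than m eigenfunctions, a non-trivial combination orthogonal to m given functions, which
  identifies the supremum in \<open>eigen_mult\<close> with the size of an orthonormal
  basis.\<close>

lemma underdetermined_system:
  fixes a :: "'j \<Rightarrow> nat \<Rightarrow> real"
  assumes "finite J" "m < card J"
  shows "\<exists>c. (\<exists>j\<in>J. c j \<noteq> 0) \<and> (\<forall>i<m. (\<Sum>j\<in>J. c j * a j i) = 0)"
  using assms
proof (induction m arbitrary: J a)
  case 0
  then have "J \<noteq> {}" by auto
  then show ?case by (intro exI[of _ "\<lambda>_. 1"]) auto
next
  case (Suc m)
  show ?case
  proof (cases "\<forall>j\<in>J. a j m = 0")
    case True
    obtain c where "\<exists>j\<in>J. c j \<noteq> 0" "\<forall>i<m. (\<Sum>j\<in>J. c j * a j i) = 0"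
      using Suc.IH[OF Suc.prems(1), of a] Suc.prems(2) by auto
    then show ?thesis using True by (intro exI[of _ c]) (auto simp: less_Suc_eq)
  next
    case False
    then obtain p where p: "p \<in> J" "a p m \<noteq> 0" by auto
    let ?J = "J - {p}"
    have "finite ?J" "m < card ?J" using Suc.prems p by auto
    from Suc.IH[OF this, of "\<lambda>j i. a j i - a j m / a p m * a p i"] obtain c where
      c: "\<exists>j\<in>?J. c j \<noteq> 0" "\<forall>i<m. (\<Sum>j\<in>?J. c j * (a j i - a j m / a p m * a p i)) = 0" by blast
    let ?s = "\<Sum>j\<in>?J. c j * a j m / a p m"
    define d where "d j = (if j = p then - ?s else c j)" for j
    have split: "(\<Sum>j\<in>J. d j * a j i) = (\<Sum>j\<in>?J. c j * a j i) - ?s * a p i" for i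
    proof -
      have "(\<Sum>j\<in>J. d j * a j i) = d p * a p i + (\<Sum>j\<in>?J. d j * a j i)"
        by (rule sum.remove) (use Suc.prems p in auto)
      also have "(\<Sum>j\<in>?J. d j * a j i) = (\<Sum>j\<in>?J. c j * a j i)" by (intro sum.cong) (auto simp: d_def)
      finally show ?thesis by (simp add: d_def)
    qed
    show ?thesis
    proof (intro exI[of _ d] conjI allI impI)
      show "\<exists>j\<in>J. d j \<noteq> 0" using c(1) by (auto simp: d_def)
      fix i assume "i < Suc m"
      then consider "i < m" | "i = m" by linarith
      then show "(\<Sum>j\<in>J. d j * a j i) = 0"
      proof cases
        case 1
        then have "(\<Sum>j\<in>?J. c j * (a j i - a j m / a p m * a p i)) = 0" using c(2) by simp
        then show ?thesis unfolding split
          by (simp add: right_diff_distrib sum_subtractf sum_distrib_right mult.assoc)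
      next
        case 2
        have "?s * a p m = (\<Sum>j\<in>?J. c j * a j m)" using p by (simp add: sum_distrib_right)
        then show ?thesis unfolding split 2 by simp
      qed
    qed
  qed
qed

lemma eigenspaceD:
  assumes "f \<in> eigenspace M k \<kappa>"
  shows "f \<in> L2_fun M" "AE x in M. kernel_op M k f x = \<kappa> * f x"
  using assms by (auto simp: eigenspace_def)

definition ortho :: "'a measure \<Rightarrow> 'i set \<Rightarrow> ('i \<Rightarrow> 'a \<Rightarrow> real) \<Rightarrow> bool" where
  "ortho M A e \<longleftrightarrow> (\<forall>i\<in>A. e i \<in> L2_fun M) \<and>
     (\<forall>i\<in>A. \<forall>j\<in>A. (LINT x|M. e i x * e j x) = (if i = j then 1 else 0))"

definition residual :: "('a \<Rightarrow> 'a \<Rightarrow> real) \<Rightarrow> ('i \<Rightarrow> real) \<Rightarrow> ('i \<Rightarrow> 'a \<Rightarrow> real) \<Rightarrow> 'i set \<Rightarrow> 'a \<Rightarrow> 'a \<Rightarrow> real" where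
  "residual k l e A x y = k x y - (\<Sum>i\<in>A. l i * (e i x * e i y))"

section \<open>Residual kernels and bases of the eigenspaces\<close>

context sample_space
begin

lemma L2ker_sum:
  assumes "\<And>i. i \<in> F \<Longrightarrow> L2ker M (u i)"
  shows "L2ker M (\<lambda>x y. \<Sum>i\<in>F. u i x y)"
  using assms
proof (induction F rule: infinite_finite_induct)
  case (insert a F)
  then have "L2ker M (\<lambda>x y. u a x y + (\<Sum>i\<in>F. u i x y))" by (intro L2ker_add) auto
  then show ?case using insert.hyps by simp
qed (auto simp: L2ker_def L2_fun_def)

lemma hs_sum_left:
  assumes "\<And>i. i \<in> F \<Longrightarrow> L2ker M (u i)" "L2ker M m"
  shows "hs M (\<lambda>x y. \<Sum>i\<in>F. u i x y) m = (\<Sum>i\<in>F. hs M (u i) m)"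
  using assms(1)
proof (induction F rule: infinite_finite_induct)
  case (insert a F)
  have "hs M (\<lambda>x y. u a x y + (\<Sum>i\<in>F. u i x y)) m = hs M (u a) m + hs M (\<lambda>x y. \<Sum>i\<in>F. u i x y) m"
    by (intro hs_add_left L2ker_sum assms(2) insert.prems) auto
  then show ?case using insert by simp
qed (auto simp: hs_def case_prod_unfold)

lemma hs_tensor_right:
  assumes "L2ker M k" "f \<in> L2_fun M" "g \<in> L2_fun M"
  shows "hs M k (\<lambda>x y. f x * g y) = (LINT x|M. f x * kernel_op M k g x)"
  unfolding hs_iterated(1)[OF assms(1) L2ker_tensor[OF assms(2,3)]]
  by (simp add: kernel_op_def mult.left_commute flip: integral_mult_right_zero)

lemma hs_tensor_tensor:
  assumes "f \<in> L2_fun M" "g \<in> L2_fun M" "f' \<in> L2_fun M" "g' \<in> L2_fun M"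
  shows "hs M (\<lambda>x y. f x * g y) (\<lambda>x y. f' x * g' y) = (LINT x|M. f x * f' x) * (LINT x|M. g x * g' x)"
proof -
  have "kernel_op M (\<lambda>x y. f x * g y) g' x = f x * (LINT y|M. g y * g' y)" for x
    by (simp add: kernel_op_def mult.assoc)
  then show ?thesis
    unfolding hs_tensor_right[OF L2ker_tensor[OF assms(1,2)] assms(3,4)]
    by (simp add: mult.left_commute[of "f' _"] mult.commute[of "f' _"] flip: mult.assoc)
qed

lemma residual_L2ker:
  assumes "L2ker M k" "\<And>i. i \<in> A \<Longrightarrow> e i \<in> L2_fun M"
  shows "L2ker M (residual k l e A)"
  unfolding residual_def[abs_def]
  by (intro L2ker_diff L2ker_sum L2ker_cmult L2ker_tensor assms)

lemma residual_sym: "sym_kernel M k \<Longrightarrow> sym_kernel M (residual k l e A)"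
  by (simp add: sym_kernel_def residual_def mult.commute)

lemma hs_kernel_eigen:
  assumes k: "L2ker M k" and f: "f \<in> L2_fun M" and e: "e \<in> eigenspace M k \<kappa>"
  shows "hs M k (\<lambda>x y. f x * e y) = \<kappa> * (LINT x|M. f x * e x)"
proof -
  note eD = eigenspaceD[OF e]
  note [measurable] = L2_funD(1)[OF f] L2_funD(1)[OF eD(1)] L2_funD(1)[OF kernel_op_L2(1)[OF k eD(1)]]
  have "(LINT x|M. f x * kernel_op M k e x) = (LINT x|M. \<kappa> * (f x * e x))"
  proof (rule integral_cong_AE)
    show "AE x in M. f x * kernel_op M k e x = \<kappa> * (f x * e x)"
      using eD(2) by eventually_elim simp
  qed measurable
  then show ?thesis unfolding hs_tensor_right[OF k f eD(1)] by simp
qed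

text \<open>Pythagoras in the Hilbert--Schmidt space. Stating it for \<open>A \<subseteq> B\<close>
  shows that the inner product depends on the larger set alone; the case A = B is Bessel's
  inequality, and the general case makes the residuals along an increasing chain Cauchy.\<close>

lemma hs_residual:
  assumes k: "L2ker M k" and o: "ortho M B e" and fin: "finite B" and AB: "A \<subseteq> B"
    and eig: "\<And>i. i \<in> B \<Longrightarrow> e i \<in> eigenspace M k (l i)"
  shows "hs M (residual k l e A) (residual k l e B) = hs M k k - (\<Sum>i\<in>B. (l i)\<^sup>2)"
proof -
  have eL: "e i \<in> L2_fun M" if "i \<in> B" for i using o that by (simp add: ortho_def)
  have finA: "finite A" using fin AB finite_subset by blast
  have oo: "(LINT x|M. e i x * e j x) = (if i = j then 1 else 0)" if "i \<in> B" "j \<in> B" for i j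
    using o that by (simp add: ortho_def)
  let ?S = "\<lambda>A x y. \<Sum>i\<in>A. l i * (e i x * e i y)"
  have te: "L2ker M (\<lambda>x y. l i * (e i x * e i y))" if "i \<in> B" for i
    by (intro L2ker_cmult L2ker_tensor eL that)
  have S: "L2ker M (?S C)" if "C \<subseteq> B" for C by (intro L2ker_sum te) (use that in auto)
  have sk: "hs M (?S C) k = (\<Sum>i\<in>C. (l i)\<^sup>2)" if C: "C \<subseteq> B" for C
  proof -
    have "hs M (?S C) k = (\<Sum>i\<in>C. l i * hs M (\<lambda>x y. e i x * e i y) k)"
      using C by (subst hs_sum_left) (auto simp: hs_cmult_left intro!: te k)
    also have "\<dots> = (\<Sum>i\<in>C. (l i)\<^sup>2)"
    proof (rule sum.cong[OF refl])
      fix i assume "i \<in> C"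
      then have i: "i \<in> B" using C by auto
      have "hs M (\<lambda>x y. e i x * e i y) k = l i"
        unfolding hs_commute[of "\<lambda>x y. e i x * e i y"] hs_kernel_eigen[OF k eL[OF i] eig[OF i]]
        using oo[OF i i] by simp
      then show "l i * hs M (\<lambda>x y. e i x * e i y) k = (l i)\<^sup>2" by (simp add: power2_eq_square)
    qed
    finally show ?thesis .
  qed
  have SS: "hs M (?S A) (?S B) = (\<Sum>i\<in>A. (l i)\<^sup>2)"
  proof -
    have "hs M (\<lambda>x y. e i x * e i y) (?S B) = (\<Sum>j\<in>B. l j * hs M (\<lambda>x y. e j x * e j y) (\<lambda>x y. e i x * e i y))"
      if i: "i \<in> B" for i
      by (subst hs_commute, subst hs_sum_left) (auto simp: hs_cmult_left i intro!: te L2ker_tensor eL)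
    then have "hs M (?S A) (?S B) = (\<Sum>i\<in>A. l i * (\<Sum>j\<in>B. l j * hs M (\<lambda>x y. e j x * e j y) (\<lambda>x y. e i x * e i y)))"
      using AB S[OF order_refl] te by (subst hs_sum_left) (auto simp: hs_cmult_left subset_iff)
    also have "\<dots> = (\<Sum>i\<in>A. l i * (\<Sum>j\<in>B. if j = i then l j else 0))"
      using AB by (intro sum.cong refl arg_cong2[where f = "(*)"])
        (auto simp: hs_tensor_tensor eL oo subset_iff)
    also have "\<dots> = (\<Sum>i\<in>A. (l i)\<^sup>2)"
      using AB fin by (intro sum.cong refl) (auto simp: power2_eq_square)
    finally show ?thesis .
  qed
  have res: "residual k l e C = (\<lambda>x y. k x y - ?S C x y)" for C by (simp add: residual_def fun_eq_iff)
  have "hs M (residual k l e A) (residual k l e B)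
      = hs M k (residual k l e B) - hs M (?S A) (residual k l e B)"
    unfolding res[of A] by (rule hs_diff_left) (use k AB S in \<open>auto intro!: residual_L2ker eL\<close>)
  also have "hs M k (residual k l e B) = hs M k k - (\<Sum>i\<in>B. (l i)\<^sup>2)"
  proof -
    have "hs M (residual k l e B) k = hs M k k - hs M (?S B) k"
      unfolding res[of B] by (rule hs_diff_left) (intro k S order_refl)+
    then show ?thesis using hs_commute[of k "residual k l e B"] sk[OF order_refl] by linarith
  qed
  also have "hs M (?S A) (residual k l e B) = 0"
  proof -
    have "hs M (residual k l e B) (?S A) = hs M k (?S A) - hs M (?S B) (?S A)"
      unfolding res[of B] by (rule hs_diff_left) (intro k S order_refl AB)+
    then show ?thesis
      using hs_commute[of "?S A" "residual k l e B"] hs_commute[of k "?S A"] hs_commute[of "?S A" "?S B"] SS sk[OF AB]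
      by linarith
  qed
  finally show ?thesis by simp
qed

lemma eigen_orthogonal:
  assumes k: "L2ker M k" "sym_kernel M k" and f: "f \<in> eigenspace M k \<kappa>" and g: "g \<in> eigenspace M k \<nu>"
    and ne: "\<kappa> \<noteq> \<nu>"
  shows "(LINT x|M. f x * g x) = 0"
proof -
  note fD = eigenspaceD[OF f] and gD = eigenspaceD[OF g]
  have *: "(LINT x|M. b x * kernel_op M k a x) = c * (LINT x|M. b x * a x)"
    if "a \<in> eigenspace M k c" "b \<in> L2_fun M" for a b c
    using hs_kernel_eigen[OF k(1) that(2,1)] hs_tensor_right[OF k(1) that(2) eigenspaceD(1)[OF that(1)]]
    by simp
  have "(LINT x|M. g x * f x) = (LINT x|M. f x * g x)"
    "(LINT x|M. g x * kernel_op M k f x) = (LINT x|M. kernel_op M k f x * g x)"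
    by (simp_all only: mult.commute)
  then have "\<kappa> * (LINT x|M. f x * g x) = \<nu> * (LINT x|M. f x * g x)"
    using *[OF f gD(1)] *[OF g fD(1)] kernel_op_sym[OF k fD(1) gD(1)] by metis
  then show ?thesis using ne by simp
qed

lemma kernel_op_linear:
  assumes k: "L2ker M k" and f: "f \<in> L2_fun M" and g: "g \<in> L2_fun M" and x: "x \<in> space M"
  shows "kernel_op M k (\<lambda>x. a * f x + b * g x) x = a * kernel_op M k f x + b * kernel_op M k g x"
proof -
  have "kernel_op M k (\<lambda>x. a * f x + b * g x) x = (LINT w|M. a * (k x w * f w) + b * (k x w * g w))"
    by (simp add: kernel_op_def algebra_simps)
  then show ?thesis
    using L2_fun_mult_integrable[OF L2kerD(3)[OF k x] f] L2_fun_mult_integrable[OF L2kerD(3)[OF k x] g]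
    by (simp add: kernel_op_def)
qed

lemma eigenspace_linear:
  assumes k: "L2ker M k" and f: "f \<in> eigenspace M k \<kappa>" and g: "g \<in> eigenspace M k \<kappa>"
  shows "(\<lambda>x. a * f x + b * g x) \<in> eigenspace M k \<kappa>"
proof -
  note fD = eigenspaceD[OF f] and gD = eigenspaceD[OF g]
  have "AE x in M. kernel_op M k (\<lambda>x. a * f x + b * g x) x = \<kappa> * (a * f x + b * g x)"
    using fD(2) gD(2) AE_space
    by eventually_elim (simp add: kernel_op_linear[OF k fD(1) gD(1)] algebra_simps)
  then show ?thesis using fD(1) gD(1) by (simp add: eigenspace_def L2_fun_add L2_fun_cmult)
qed

lemma eigenspace_sum:
  assumes k: "L2ker M k" and F: "finite F" "\<And>i. i \<in> F \<Longrightarrow> f i \<in> eigenspace M k \<kappa>"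
  shows "(\<lambda>x. \<Sum>i\<in>F. c i * f i x) \<in> eigenspace M k \<kappa>"
  using F
proof (induction F)
  case empty
  show ?case by (auto simp: eigenspace_def L2_fun_def kernel_op_def)
next
  case (insert a F)
  then have "(\<lambda>x. c a * f a x + 1 * (\<Sum>i\<in>F. c i * f i x)) \<in> eigenspace M k \<kappa>"
    by (intro eigenspace_linear[OF k]) auto
  then show ?case using insert.hyps by simp
qed

lemma ortho_sum_inner:
  assumes "finite A" "ortho M A e" "j \<in> A"
  shows "(LINT x|M. (\<Sum>i\<in>A. c i * e i x) * e j x) = c j"
proof -
  have i: "integrable M (\<lambda>x. e i x * e j x)" if "i \<in> A" for i
    using assms that by (auto simp: ortho_def intro: L2_fun_mult_integrable)
  have "(LINT x|M. (\<Sum>i\<in>A. c i * e i x) * e j x) = (LINT x|M. (\<Sum>i\<in>A. c i * (e i x * e j x)))"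
    by (simp add: sum_distrib_right mult.assoc)
  also have "\<dots> = (\<Sum>i\<in>A. c i * (LINT x|M. e i x * e j x))"
    using i by (subst Bochner_Integration.integral_sum) auto
  also have "\<dots> = (\<Sum>i\<in>A. if i = j then c i else 0)"
    using assms by (intro sum.cong) (auto simp: ortho_def)
  finally show ?thesis using assms by simp
qed

text \<open>Bessel's inequality bounds the size of orthonormal families in the eigenspace by
  \<open>hs M k k\<close> / \<kappa>^2, so a largest one exists. It is complete, since a normalised
  orthogonal eigenfunction could be appended, and no independent family is larger; its size is
  therefore \<open>eigen_mult\<close>.\<close>

lemma eigenbasis_exists:
  assumes k: "L2ker M k" "sym_kernel M k" and \<kappa>: "\<kappa> \<noteq> 0"
  obtains e where "ortho M {..<eigen_mult M k \<kappa>} e" "\<And>i. i < eigen_mult M k \<kappa> \<Longrightarrow> e i \<in> eigenspace M k \<kappa>"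
    "\<And>f. f \<in> eigenspace M k \<kappa> \<Longrightarrow> (\<And>i. i < eigen_mult M k \<kappa> \<Longrightarrow> (LINT x|M. f x * e i x) = 0) \<Longrightarrow> AE x in M. f x = 0"
proof -
  let ?P = "\<lambda>n e. ortho M {..<n :: nat} e \<and> (\<forall>i<n. e i \<in> eigenspace M k \<kappa>)"
  have bd: "n \<le> nat \<lfloor>hs M k k / \<kappa>\<^sup>2\<rfloor>" if ex: "\<exists>e. ?P n e" for n
  proof -
    obtain e where e: "?P n e" using ex by blast
    have "0 \<le> hs M (residual k (\<lambda>_. \<kappa>) e {..<n}) (residual k (\<lambda>_. \<kappa>) e {..<n})" by (rule hs_nonneg)
    also have "\<dots> = hs M k k - (\<Sum>i<n. \<kappa>\<^sup>2)"
      by (rule hs_residual[OF k(1)]) (use e in auto)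
    finally have "real n * \<kappa>\<^sup>2 \<le> hs M k k" by simp
    then have "real n \<le> hs M k k / \<kappa>\<^sup>2" using \<kappa> by (simp add: field_simps)
    then show ?thesis by linarith
  qed
  have ex0: "\<exists>e. ?P 0 e" by (simp add: ortho_def)
  define m where "m = (GREATEST n. \<exists>e. ?P n e)"
  have "\<exists>e. ?P m e" unfolding m_def by (rule GreatestI_nat[where P = "\<lambda>n. \<exists>e. ?P n e", OF ex0]) (rule bd)
  then obtain e where e: "?P m e" by blast
  have max: "n \<le> m" if "\<exists>e. ?P n e" for n
    unfolding m_def by (rule Greatest_le_nat[where P = "\<lambda>n. \<exists>e. ?P n e", OF that]) (rule bd)
  have complete: "AE x in M. f x = 0"
    if f: "f \<in> eigenspace M k \<kappa>" and o: "\<And>i. i < m \<Longrightarrow> (LINT x|M. f x * e i x) = 0" for f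
  proof (rule ccontr)
    assume "\<not> ?thesis"
    then have nz: "(LINT x|M. (f x)\<^sup>2) \<noteq> 0"
      using L2_norm_AE_0_iff[OF eigenspaceD(1)[OF f]] by simp
    define c where "c = 1 / sqrt (LINT x|M. (f x)\<^sup>2)"
    have "0 \<le> (LINT x|M. (f x)\<^sup>2)" by simp
    with nz have c: "c * c * (LINT x|M. f x * f x) = 1"
      by (simp add: c_def power2_eq_square)
    let ?e = "\<lambda>i. if i = m then (\<lambda>x. c * f x) else e i"
    have g: "(\<lambda>x. c * f x) \<in> eigenspace M k \<kappa>" using eigenspace_linear[OF k(1) f f, of c 0] by simp
    have "?P (Suc m) ?e"
    proof (intro conjI allI impI)
      have 1: "(LINT x|M. c * f x * (c * f x)) = 1"
        using c by (simp add: mult.assoc mult.left_commute[of "f _"])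
      have 2: "(LINT x|M. c * f x * e i x) = 0" "(LINT x|M. e i x * (c * f x)) = 0" if "i < m" for i
        using o[OF that] by (simp_all add: mult.assoc mult.left_commute[of "e _ _"] mult.commute[of "e _ _"])
      show "ortho M {..<Suc m} ?e"
        using e 1 2 eigenspaceD(1)[OF g] by (auto simp: ortho_def less_Suc_eq)
    qed (use e g in \<open>auto simp: less_Suc_eq\<close>)
    then show False using max[of "Suc m"] by auto
  qed
  have indep: "n \<le> m" if f: "\<forall>i<n. f i \<in> eigenspace M k \<kappa>" "AE_independent M n f" for n f
  proof (rule ccontr)
    assume "\<not> n \<le> m"
    then have "m < card {..<n}" by simp
    from underdetermined_system[OF _ this, of "\<lambda>j i. LINT x|M. f j x * e i x"]
    obtain c where c: "\<exists>j\<in>{..<n}. c j \<noteq> 0" "\<forall>i<m. (\<Sum>j<n. c j * (LINT x|M. f j x * e i x)) = 0" by auto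
    let ?g = "\<lambda>x. \<Sum>j<n. c j * f j x"
    have "AE x in M. ?g x = 0"
    proof (rule complete)
      show "?g \<in> eigenspace M k \<kappa>" by (rule eigenspace_sum[OF k(1)]) (use f in auto)
      fix i assume i: "i < m"
      have int: "integrable M (\<lambda>x. f j x * e i x)" if "j < n" for j
        using f(1) e i that by (auto simp: ortho_def intro!: L2_fun_mult_integrable dest: eigenspaceD)
      have "(LINT x|M. ?g x * e i x) = (LINT x|M. (\<Sum>j<n. c j * (f j x * e i x)))"
        by (simp add: sum_distrib_right mult.assoc)
      also have "\<dots> = (\<Sum>j<n. c j * (LINT x|M. f j x * e i x))"
        using int by (subst Bochner_Integration.integral_sum) auto
      finally show "(LINT x|M. ?g x * e i x) = 0" using c(2) i by simp
    qed
    then have "\<forall>i<n. c i = 0" using f(2) by (simp add: AE_independent_def)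
    then show False using c(1) by auto
  qed
  have ind_e: "AE_independent M m e"
    unfolding AE_independent_def
  proof (intro allI impI)
    fix c :: "nat \<Rightarrow> real" and j assume z: "AE x in M. (\<Sum>i<m. c i * e i x) = 0" and j: "j < m"
    have "(LINT x|M. (\<Sum>i<m. c i * e i x) * e j x) = c j"
      by (rule ortho_sum_inner) (use e j in auto)
    moreover have "(LINT x|M. (\<Sum>i<m. c i * e i x) * e j x) = 0"
      by (rule integral_eq_zero_AE) (use z in auto)
    ultimately show "c j = 0" by simp
  qed
  have "eigen_mult M k \<kappa> = m"
    unfolding eigen_mult_def
    by (rule cSup_eq_maximum) (use e ind_e indep in auto)
  then show thesis using that e complete by auto
qed

end

section \<open>Exhaustion of a kernel by its eigenfunctions\<close>

context sample_space
begin

text \<open>One family for all non-zero numbers at once, indexed by pairs of a number and a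
  position; eigenfunctions for distinct numbers are orthogonal by symmetry.\<close>

lemma spectral_basis:
  assumes k: "L2ker M k" "sym_kernel M k"
  obtains e :: "real \<times> nat \<Rightarrow> 'a \<Rightarrow> real" where
    "\<And>E. 0 \<notin> E \<Longrightarrow> ortho M (Sigma E (\<lambda>\<kappa>. {..<eigen_mult M k \<kappa>})) e"
    "\<And>\<kappa> i. \<kappa> \<noteq> 0 \<Longrightarrow> i < eigen_mult M k \<kappa> \<Longrightarrow> e (\<kappa>, i) \<in> eigenspace M k \<kappa>"
    "\<And>\<kappa> f. \<kappa> \<noteq> 0 \<Longrightarrow> f \<in> eigenspace M k \<kappa> \<Longrightarrow>
      \<forall>i<eigen_mult M k \<kappa>. (LINT x|M. f x * e (\<kappa>, i) x) = 0 \<Longrightarrow> AE x in M. f x = 0"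
proof -
  let ?Q = "\<lambda>\<kappa> e. \<kappa> \<noteq> 0 \<longrightarrow> ortho M {..<eigen_mult M k \<kappa>} e \<and>
      (\<forall>i<eigen_mult M k \<kappa>. e i \<in> eigenspace M k \<kappa>) \<and>
      (\<forall>f\<in>eigenspace M k \<kappa>. (\<forall>i<eigen_mult M k \<kappa>. (LINT x|M. f x * e i x) = 0) \<longrightarrow> (AE x in M. f x = 0))"
  have "\<exists>e. ?Q \<kappa> e" for \<kappa>
  proof (cases "\<kappa> = 0")
    case False
    show ?thesis by (rule eigenbasis_exists[OF k False]) blast
  qed simp
  then have "\<forall>\<kappa>. \<exists>e. ?Q \<kappa> e" by blast
  from choice[OF this] obtain e0 where e0: "\<And>\<kappa>. ?Q \<kappa> (e0 \<kappa>)" by blast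
  define e where "e = (\<lambda>(\<kappa>, i). e0 \<kappa> i)"
  have eig: "e (\<kappa>, i) \<in> eigenspace M k \<kappa>" if "\<kappa> \<noteq> 0" "i < eigen_mult M k \<kappa>" for \<kappa> i
    using e0[of \<kappa>] that by (simp add: e_def)
  show thesis
  proof (rule that)
    fix E :: "real set" assume E: "0 \<notin> E"
    then have nz: "\<kappa> \<noteq> 0" if "\<kappa> \<in> E" for \<kappa> using that by auto
    show "ortho M (Sigma E (\<lambda>\<kappa>. {..<eigen_mult M k \<kappa>})) e"
      unfolding ortho_def
    proof (intro conjI ballI)
      fix p assume "p \<in> Sigma E (\<lambda>\<kappa>. {..<eigen_mult M k \<kappa>})"
      then obtain \<kappa> i where p: "p = (\<kappa>, i)" "\<kappa> \<in> E" "i < eigen_mult M k \<kappa>" by auto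
      show "e p \<in> L2_fun M" unfolding p(1) by (rule eigenspaceD(1)[OF eig[OF nz]]) (use p in auto)
      fix q assume "q \<in> Sigma E (\<lambda>\<kappa>. {..<eigen_mult M k \<kappa>})"
      then obtain \<nu> j where q: "q = (\<nu>, j)" "\<nu> \<in> E" "j < eigen_mult M k \<nu>" by auto
      show "(LINT x|M. e p x * e q x) = (if p = q then 1 else 0)"
      proof (cases "\<kappa> = \<nu>")
        case True
        then show ?thesis using e0[of \<kappa>] nz[OF p(2)] p q by (auto simp: e_def ortho_def)
      next
        case False
        then show ?thesis
          using eigen_orthogonal[OF k eig[OF nz[OF p(2)] p(3)] eig[OF nz[OF q(2)] q(3)] False] p(1) q(1)
          by simp
      qed
    qed
  next
    fix \<kappa> f assume *: "\<kappa> \<noteq> 0" "f \<in> eigenspace M k \<kappa>"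
      "\<forall>i<eigen_mult M k \<kappa>. (LINT x|M. f x * e (\<kappa>, i) x) = 0"
    then show "AE x in M. f x = 0" using e0[of \<kappa>] by (auto simp: e_def)
  qed (rule eig)
qed

lemma L2ker_transpose:
  assumes p: "L2ker M p"
  shows "L2ker M (\<lambda>x y. p y x)" "hs M (\<lambda>x y. p y x) (\<lambda>x y. p y x) = hs M p p"
proof -
  note [measurable] = L2kerD(2)[OF p]
  have "integrable (M \<Otimes>\<^sub>M M) (\<lambda>(x, y). (p x y)\<^sup>2)"
    using L2_funD(2)[OF L2kerD(1)[OF p]] by (simp add: case_prod_unfold)
  from pp.integrable_product_swap[OF this]
  have "integrable (M \<Otimes>\<^sub>M M) (\<lambda>z. (case z of (x, y) \<Rightarrow> p y x)\<^sup>2)" by (simp add: case_prod_unfold)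
  then show pt: "L2ker M (\<lambda>x y. p y x)"
    using L2kerD(3,4)[OF p] by (auto simp: L2ker_def L2_fun_def)
  show "hs M (\<lambda>x y. p y x) (\<lambda>x y. p y x) = hs M p p"
    unfolding hs_iterated(1)[OF pt pt] hs_iterated(2)[OF p p] ..
qed

lemma L2ker_Cauchy_limit:
  assumes r: "\<And>n. L2ker M (r n)" "\<And>n. sym_kernel M (r n)"
    and c: "\<And>m n. m \<le> n \<Longrightarrow> hs M (\<lambda>x y. r m x y - r n x y) (\<lambda>x y. r m x y - r n x y) = s n - s m" "s \<longlonglongrightarrow> sl"
  obtains p where "L2ker M p" "sym_kernel M p"
    "(\<lambda>n. hs M (\<lambda>x y. r n x y - p x y) (\<lambda>x y. r n x y - p x y)) \<longlonglongrightarrow> 0"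
proof -
  have neg: "hs M (\<lambda>x y. a x y - b x y) (\<lambda>x y. a x y - b x y) = hs M (\<lambda>x y. b x y - a x y) (\<lambda>x y. b x y - a x y)"
    for a b :: "'a \<Rightarrow> 'a \<Rightarrow> real"
    unfolding hs_def by (rule Bochner_Integration.integral_cong[OF refl]) (auto simp: algebra_simps)
  have c': "hs M (\<lambda>x y. r m x y - r n x y) (\<lambda>x y. r m x y - r n x y) = \<bar>s n - s m\<bar>" for m n
  proof (cases "m \<le> n")
    case True
    then show ?thesis using c(1)[OF True] hs_nonneg[of "\<lambda>x y. r m x y - r n x y"] by simp
  next
    case False
    then show ?thesis using c(1)[of n m] neg[of "r m" "r n"] hs_nonneg[of "\<lambda>x y. r n x y - r m x y"] by simp
  qed
  have Qf: "finite_measure (M \<Otimes>\<^sub>M M)" by unfold_locales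
  obtain F where F: "F \<in> L2_fun (M \<Otimes>\<^sub>M M)"
    "(\<lambda>n. LINT z|(M \<Otimes>\<^sub>M M). ((case z of (x, y) \<Rightarrow> r n x y) - F z)\<^sup>2) \<longlonglongrightarrow> 0"
  proof (rule finite_measure.L2_complete[OF Qf, of "\<lambda>n z. case z of (x, y) \<Rightarrow> r n x y"])
    show "(\<lambda>(x, y). r n x y) \<in> L2_fun (M \<Otimes>\<^sub>M M)" for n by (rule L2kerD(1)[OF r(1)])
    fix e :: real assume "e > 0"
    then have "e / 2 > 0" by simp
    from LIMSEQ_D[OF c(2) this] obtain n0 where n0: "\<And>n. n \<ge> n0 \<Longrightarrow> \<bar>s n - sl\<bar> < e / 2" by auto
    show "\<exists>n0. \<forall>m\<ge>n0. \<forall>n\<ge>n0. (LINT z|(M \<Otimes>\<^sub>M M). ((case z of (x, y) \<Rightarrow> r m x y) - (case z of (x, y) \<Rightarrow> r n x y))\<^sup>2) < e"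
    proof (intro exI allI impI)
      fix m n assume mn: "n0 \<le> m" "n0 \<le> n"
      have "(LINT z|(M \<Otimes>\<^sub>M M). ((case z of (x, y) \<Rightarrow> r m x y) - (case z of (x, y) \<Rightarrow> r n x y))\<^sup>2) = \<bar>s n - s m\<bar>"
        using c'[of m n] by (simp add: hs_self case_prod_unfold)
      also have "\<dots> < e" using n0[OF mn(1)] n0[OF mn(2)] by linarith
      finally show "(LINT z|(M \<Otimes>\<^sub>M M). ((case z of (x, y) \<Rightarrow> r m x y) - (case z of (x, y) \<Rightarrow> r n x y))\<^sup>2) < e" .
    qed
  qed
  obtain q where q: "L2ker M q" and Fq: "AE z in M \<Otimes>\<^sub>M M. F z = q (fst z) (snd z)"
    using L2ker_representative[OF F(1)] by blast
  let ?d = "\<lambda>n x y. r n x y - q x y"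
  have d: "L2ker M (?d n)" for n by (intro L2ker_diff r q)
  have "(\<lambda>n. hs M (?d n) (?d n)) = (\<lambda>n. LINT z|(M \<Otimes>\<^sub>M M). ((case z of (x, y) \<Rightarrow> r n x y) - F z)\<^sup>2)"
  proof
    fix n
    note [measurable] = L2kerD(2)[OF q] L2kerD(2)[OF r(1)] L2_funD(1)[OF F(1)]
    show "hs M (?d n) (?d n) = (LINT z|(M \<Otimes>\<^sub>M M). ((case z of (x, y) \<Rightarrow> r n x y) - F z)\<^sup>2)"
      unfolding hs_self
    proof (rule integral_cong_AE)
      show "AE z in M \<Otimes>\<^sub>M M. (case z of (x, y) \<Rightarrow> ?d n x y)\<^sup>2 = ((case z of (x, y) \<Rightarrow> r n x y) - F z)\<^sup>2"
        using Fq by eventually_elim (simp add: case_prod_unfold)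
    qed measurable
  qed
  then have dlim: "(\<lambda>n. hs M (?d n) (?d n)) \<longlonglongrightarrow> 0" using F(2) by simp
  \<comment> \<open>The L^2 limit is symmetric only almost everywhere. Averaging with the transpose
    makes it symmetric at every point and, the \<open>r n\<close> being symmetric, does not increase
    the distance to them.\<close>
  define p where "p x y = 1 / 2 * q x y + 1 / 2 * q y x" for x y
  have p: "L2ker M p" unfolding p_def[abs_def] by (intro L2ker_add L2ker_cmult q L2ker_transpose)
  have "hs M (\<lambda>x y. r n x y - p x y) (\<lambda>x y. r n x y - p x y) \<le> hs M (?d n) (?d n)" for n
  proof -
    let ?h = "\<lambda>x y. 1 / 2 * ?d n x y"
    have h: "L2ker M ?h" by (intro L2ker_cmult d)
    have hh: "hs M ?h ?h = 1 / 4 * hs M (?d n) (?d n)"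
      unfolding hs_cmult_left by (subst hs_commute, subst hs_cmult_left) simp
    have "hs M (\<lambda>x y. r n x y - p x y) (\<lambda>x y. r n x y - p x y) = hs M (\<lambda>x y. ?h x y + ?h y x) (\<lambda>x y. ?h x y + ?h y x)"
      by (rule hs_cong) (use r(2)[of n] in \<open>auto simp: p_def sym_kernel_def field_simps\<close>)
    also have "\<dots> \<le> 2 * hs M ?h ?h + 2 * hs M (\<lambda>x y. ?h y x) (\<lambda>x y. ?h y x)"
      by (rule hs_triangle[OF h L2ker_transpose(1)[OF h]])
    also have "\<dots> = hs M (?d n) (?d n)" unfolding L2ker_transpose(2)[OF h] hh by simp
    finally show ?thesis .
  qed
  then have "(\<lambda>n. hs M (\<lambda>x y. r n x y - p x y) (\<lambda>x y. r n x y - p x y)) \<longlonglongrightarrow> 0"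
    by (intro tendsto_sandwich[OF _ _ tendsto_const dlim] always_eventually allI hs_nonneg)
  moreover have "sym_kernel M p" by (simp add: sym_kernel_def p_def)
  ultimately show thesis using that p by blast
qed

lemma kernel_op_residual:
  assumes k: "L2ker M k" and f: "f \<in> L2_fun M" and e: "\<And>i. i \<in> A \<Longrightarrow> e i \<in> L2_fun M" and x: "x \<in> space M"
  shows "kernel_op M (residual k l e A) f x = kernel_op M k f x - (\<Sum>i\<in>A. l i * (e i x * (LINT w|M. e i w * f w)))"
proof -
  have i1: "integrable M (\<lambda>w. k x w * f w)" by (rule L2_fun_mult_integrable[OF L2kerD(3)[OF k x] f])
  have i2: "integrable M (\<lambda>w. l i * (e i x * (e i w * f w)))" if "i \<in> A" for i
    using L2_fun_mult_integrable[OF e[OF that] f] by simp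
  have "kernel_op M (residual k l e A) f x = (LINT w|M. k x w * f w - (\<Sum>i\<in>A. l i * (e i x * (e i w * f w))))"
    by (simp add: kernel_op_def residual_def left_diff_distrib sum_distrib_right mult.assoc)
  also have "\<dots> = kernel_op M k f x - (\<Sum>i\<in>A. l i * (e i x * (LINT w|M. e i w * f w)))"
    using i1 i2 by (subst Bochner_Integration.integral_diff)
      (auto simp: kernel_op_def Bochner_Integration.integral_sum intro!: Bochner_Integration.integrable_sum)
  finally show ?thesis .
qed

lemma kernel_op_diff_kernel:
  assumes "L2ker M k" "L2ker M l" "f \<in> L2_fun M" "x \<in> space M"
  shows "kernel_op M (\<lambda>x y. k x y - l x y) f x = kernel_op M k f x - kernel_op M l f x"
  using L2_fun_mult_integrable[OF L2kerD(3)[OF assms(1,4)] assms(3)]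
    L2_fun_mult_integrable[OF L2kerD(3)[OF assms(2,4)] assms(3)]
  by (simp add: kernel_op_def left_diff_distrib)

lemma eigen_square_sum:
  fixes E :: "real set"
  assumes E: "finite E"
  shows "(\<Sum>p\<in>Sigma E (\<lambda>\<kappa>. {..<eigen_mult M k \<kappa>}). (fst p) ^ n) = (\<Sum>\<kappa>\<in>E. eigen_mult M k \<kappa> * \<kappa> ^ n)"
  using E by (subst sum.Sigma[symmetric, of E "\<lambda>\<kappa>. {..<eigen_mult M k \<kappa>}" "\<lambda>\<kappa> i. \<kappa> ^ n", unfolded case_prod_unfold]) auto

text \<open>Otherwise the residual kernels converge to a non-zero kernel, and an eigenfunction of the limit
  would be an eigenfunction of \<open>k\<close> orthogonal to all those already removed.\<close>

lemma spectral_completeness: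
  assumes k: "L2ker M k" "sym_kernel M k" and \<epsilon>: "\<epsilon> > 0"
  shows "\<exists>E. finite E \<and> E \<subseteq> nonzero_eigenvalues M k \<and> hs M k k - (\<Sum>\<kappa>\<in>E. eigen_mult M k \<kappa> * \<kappa>\<^sup>2) < \<epsilon>"
proof (rule ccontr)
  assume neg: "\<not> ?thesis"
  let ?m = "eigen_mult M k"
  let ?S = "\<lambda>E. Sigma E (\<lambda>\<kappa>. {..<?m \<kappa>})"
  let ?NE = "nonzero_eigenvalues M k"
  obtain e :: "real \<times> nat \<Rightarrow> 'a \<Rightarrow> real" where
    o: "\<And>E. 0 \<notin> E \<Longrightarrow> ortho M (?S E) e" and
    eig: "\<And>\<kappa> i. \<kappa> \<noteq> 0 \<Longrightarrow> i < ?m \<kappa> \<Longrightarrow> e (\<kappa>, i) \<in> eigenspace M k \<kappa>" and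
    compl: "\<And>\<kappa> f. \<kappa> \<noteq> 0 \<Longrightarrow> f \<in> eigenspace M k \<kappa> \<Longrightarrow>
      \<forall>i<?m \<kappa>. (LINT x|M. f x * e (\<kappa>, i) x) = 0 \<Longrightarrow> AE x in M. f x = 0"
    by (rule spectral_basis[OF k]) (rule that)
  define \<sigma> :: "real set \<Rightarrow> real" where "\<sigma> E = (\<Sum>\<kappa>\<in>E. ?m \<kappa> * \<kappa>\<^sup>2)" for E
  let ?r = "\<lambda>E. residual k fst e (?S E)"
  have NE0: "0 \<notin> E" if "E \<subseteq> ?NE" for E using that by (auto simp: nonzero_eigenvalues_def)
  have eL: "e p \<in> L2_fun M" if "E \<subseteq> ?NE" "p \<in> ?S E" for p E
    using o[OF NE0[OF that(1)]] that(2) unfolding ortho_def by blast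
  have hr: "hs M (?r E) (?r E') = hs M k k - \<sigma> E'" if "E \<subseteq> E'" "E' \<subseteq> ?NE" "finite E'" for E E'
  proof -
    have "hs M (?r E) (?r E') = hs M k k - (\<Sum>p\<in>?S E'. (fst p)\<^sup>2)"
      by (rule hs_residual[OF k(1) o[OF NE0[OF that(2)]]])
        (use that NE0[OF that(2)] in \<open>auto intro!: eig finite_SigmaI\<close>)
    then show ?thesis unfolding \<sigma>_def
      using eigen_square_sum[OF that(3), of 2 k] by simp
  qed
  have sk: "\<sigma> E \<le> hs M k k" if "E \<subseteq> ?NE" "finite E" for E
    using hr[OF order_refl that] hs_nonneg[of "?r E"] by linarith
  let ?FE = "{E. finite E \<and> E \<subseteq> ?NE}"
  \<comment> \<open>The supremum of the part of \<open>hs M k k\<close> that finite sets of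
    eigenvalues account for. The sets \<open>E n\<close> below approach it and are made increasing
    by unions, so that their residuals form a Cauchy sequence.\<close>
  define s where "s = (SUP E\<in>?FE. \<sigma> E)"
  have bdd: "bdd_above (\<sigma> ` ?FE)" using sk by (intro bdd_aboveI[of _ "hs M k k"]) auto
  have ne: "?FE \<noteq> {}" by auto
  have le_s: "\<sigma> E \<le> s" if "finite E" "E \<subseteq> ?NE" for E
    unfolding s_def by (rule cSUP_upper[OF _ bdd]) (use that in auto)
  have "\<exists>E. finite E \<and> E \<subseteq> ?NE \<and> s - 1 / Suc n < \<sigma> E" for n
  proof -
    have "s - 1 / Suc n < s" by simp
    then show ?thesis unfolding s_def using less_cSUP_iff[OF ne bdd] by auto
  qed
  then obtain E0 where E0: "\<And>n. finite (E0 n)" "\<And>n. E0 n \<subseteq> ?NE" "\<And>n. s - 1 / Suc n < \<sigma> (E0 n)" by metis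
  define E where "E n = (\<Union>j\<le>n. E0 j)" for n
  have E: "finite (E n)" "E n \<subseteq> ?NE" for n using E0 by (auto simp: E_def)
  have Emono: "E m \<subseteq> E n" if "m \<le> n" for m n
    unfolding E_def by (rule UN_mono) (use that in auto)
  have smono: "\<sigma> A \<le> \<sigma> B" if "A \<subseteq> B" "finite B" for A B
    unfolding \<sigma>_def by (rule sum_mono2[OF that(2,1)]) auto
  have slim: "(\<lambda>n. \<sigma> (E n)) \<longlonglongrightarrow> s"
  proof (rule tendsto_sandwich)
    show "\<forall>\<^sub>F n in sequentially. s - 1 / Suc n \<le> \<sigma> (E n)"
    proof (intro always_eventually allI)
      fix n show "s - 1 / Suc n \<le> \<sigma> (E n)"
        using E0(3)[of n] smono[of "E0 n" "E n", OF _ E(1)] by (force simp: E_def)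
    qed
    show "\<forall>\<^sub>F n in sequentially. \<sigma> (E n) \<le> s" using le_s E by (intro always_eventually) auto
    have "(\<lambda>n. s - 1 / Suc n) \<longlonglongrightarrow> s - 0" by (intro tendsto_diff tendsto_const LIMSEQ_Suc lim_1_over_n)
    then show "(\<lambda>n. s - 1 / Suc n) \<longlonglongrightarrow> s" by simp
  qed simp
  have rL: "L2ker M (?r (E n))" for n by (intro residual_L2ker k eL[OF E(2)])
  have rd: "hs M (\<lambda>x y. ?r (E m) x y - ?r (E n) x y) (\<lambda>x y. ?r (E m) x y - ?r (E n) x y) = \<sigma> (E n) - \<sigma> (E m)"
    if "m \<le> n" for m n
    unfolding hs_diff_self[OF rL rL] hr[OF Emono[OF that] E(2,1)] hr[OF order_refl E(2,1)] by simp
  obtain p where p: "L2ker M p" "sym_kernel M p"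
    and plim: "(\<lambda>n. hs M (\<lambda>x y. ?r (E n) x y - p x y) (\<lambda>x y. ?r (E n) x y - p x y)) \<longlonglongrightarrow> 0"
    by (rule L2ker_Cauchy_limit[where r = "\<lambda>n. ?r (E n)", OF rL residual_sym[OF k(2)] rd slim]) blast+
  let ?d = "\<lambda>n x y. ?r (E n) x y - p x y"
  have d: "L2ker M (?d n)" for n by (intro L2ker_diff rL p)
  have pnz: "hs M p p \<noteq> 0"
  proof
    assume 0: "hs M p p = 0"
    have "\<epsilon> \<le> 2 * hs M (?d n) (?d n)" for n
    proof -
      have "\<epsilon> \<le> hs M k k - \<sigma> (E n)" using neg E unfolding \<sigma>_def by (meson not_less)
      also have "\<dots> = hs M (?r (E n)) (?r (E n))" using hr[OF order_refl E(2,1)] by simp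
      also have "\<dots> = hs M (\<lambda>x y. ?d n x y + p x y) (\<lambda>x y. ?d n x y + p x y)" by simp
      also have "\<dots> \<le> 2 * hs M (?d n) (?d n) + 2 * hs M p p" by (rule hs_triangle[OF d p(1)])
      finally show ?thesis using 0 by simp
    qed
    then have "\<epsilon> \<le> 2 * 0" by (intro LIMSEQ_le_const[OF tendsto_mult_left[OF plim]]) auto
    then show False using \<epsilon> by simp
  qed
  obtain \<theta> f where \<theta>: "\<theta> \<noteq> 0" and f: "f \<in> L2_fun M" "\<not> (AE x in M. f x = 0)"
    and pf: "AE x in M. kernel_op M p f x = \<theta> * f x"
    using eigenfunction_exists[OF p pnz] by blast
  have fp: "f \<in> eigenspace M p \<theta>" using f pf by (simp add: eigenspace_def)
  \<comment> \<open>An eigenvalue missed by all \<open>E n\<close> would increase every sum by its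
    multiplicity times \<kappa>^2, although the sums already converge to the supremum. Any other
    number has no eigenfunctions to contribute.\<close>
  have mult0: "?m \<kappa> = 0" if \<kappa>: "\<kappa> \<noteq> 0" "\<And>n. \<kappa> \<notin> E n" for \<kappa>
  proof (cases "\<kappa> \<in> ?NE")
    case True
    have "?m \<kappa> * \<kappa>\<^sup>2 \<le> s - \<sigma> (E n)" for n
    proof -
      have "\<sigma> (insert \<kappa> (E n)) = ?m \<kappa> * \<kappa>\<^sup>2 + \<sigma> (E n)"
        unfolding \<sigma>_def using \<kappa>(2)[of n] E(1)[of n] by simp
      then show ?thesis using le_s[of "insert \<kappa> (E n)"] E[of n] True by auto
    qed
    moreover have "(\<lambda>n. s - \<sigma> (E n)) \<longlonglongrightarrow> s - s" by (intro tendsto_diff tendsto_const slim)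
    ultimately have "?m \<kappa> * \<kappa>\<^sup>2 \<le> s - s" by (intro LIMSEQ_le_const) auto
    then have "?m \<kappa> * \<kappa>\<^sup>2 \<le> 0" by simp
    then show ?thesis using \<kappa>(1) by (auto simp: mult_le_0_iff)
  next
    case False
    show ?thesis
    proof (rule ccontr)
      assume "?m \<kappa> \<noteq> 0"
      then have i: "0 < ?m \<kappa>" by simp
      have "AE x in M. e (\<kappa>, 0) x = 0"
        using False eig[OF \<kappa>(1) i] \<kappa>(1) by (auto simp: nonzero_eigenvalues_def)
      then have "(LINT x|M. e (\<kappa>, 0) x * e (\<kappa>, 0) x) = 0" by (intro integral_eq_zero_AE) auto
      moreover have "(LINT x|M. e (\<kappa>, 0) x * e (\<kappa>, 0) x) = 1"
        using o[of "{\<kappa>}"] \<kappa>(1) i by (auto simp: ortho_def)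
      ultimately show False by simp
    qed
  qed
  \<comment> \<open>From some n on, the residual operators annihilate
    \<open>e (\<kappa>, i)\<close>, hence so does the limit \<open>p\<close>; the eigenfunction
    \<open>f\<close> of \<open>p\<close> with \<theta> \<noteq> 0 is then orthogonal to it.\<close>
  have ef: "(LINT x|M. e (\<kappa>, i) x * f x) = 0" if \<kappa>: "\<kappa> \<noteq> 0" and i: "i < ?m \<kappa>" for \<kappa> i
  proof -
    let ?e = "e (\<kappa>, i)"
    have eE: "?e \<in> eigenspace M k \<kappa>" by (rule eig[OF \<kappa> i])
    note eL' = eigenspaceD(1)[OF eE]
    obtain n0 where n0: "\<kappa> \<in> E n0" using mult0[OF \<kappa>] i by force
    let ?t = "\<lambda>x y. f x * ?e y"
    have t: "L2ker M ?t" by (rule L2ker_tensor[OF f(1) eL'])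
    have z: "hs M (?r (E n)) ?t = 0" if "n \<ge> n0" for n
    proof -
      have kE: "\<kappa> \<in> E n" using n0 Emono[OF that] by auto
      have oE: "ortho M (?S (E n)) e" by (rule o[OF NE0[OF E(2)]])
      have mem: "(\<kappa>, i) \<in> ?S (E n)" using kE i by auto
      have ko: "kernel_op M (?r (E n)) ?e x = kernel_op M k ?e x - \<kappa> * ?e x" if "x \<in> space M" for x
      proof -
        have "(\<Sum>q\<in>?S (E n). fst q * (e q x * (LINT w|M. e q w * ?e w))) = (\<Sum>q\<in>?S (E n). if q = (\<kappa>, i) then \<kappa> * ?e x else 0)"
        proof (rule sum.cong[OF refl])
          fix q assume "q \<in> ?S (E n)"
          then have "(LINT w|M. e q w * ?e w) = (if q = (\<kappa>, i) then 1 else 0)"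
            using oE mem unfolding ortho_def by blast
          then show "fst q * (e q x * (LINT w|M. e q w * ?e w)) = (if q = (\<kappa>, i) then \<kappa> * ?e x else 0)" by auto
        qed
        also have "\<dots> = \<kappa> * ?e x" using mem E(1) by (subst sum.delta) auto
        finally show ?thesis
          using kernel_op_residual[where A = "?S (E n)" and l = fst, OF k(1) eL' eL[OF E(2)] that] by simp
      qed
      have "AE x in M. f x * kernel_op M (?r (E n)) ?e x = 0"
        using eigenspaceD(2)[OF eE] AE_space by eventually_elim (simp add: ko)
      then show ?thesis unfolding hs_tensor_right[OF rL f(1) eL'] by (rule integral_eq_zero_AE)
    qed
    have "(hs M p ?t)\<^sup>2 \<le> hs M (?d n) (?d n) * hs M ?t ?t" if "n \<ge> n0" for n
    proof -
      have "hs M (?d n) ?t = hs M (?r (E n)) ?t - hs M p ?t" by (rule hs_diff_left[OF rL p(1) t])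
      then have eq: "(hs M (?d n) ?t)\<^sup>2 = (hs M p ?t)\<^sup>2" unfolding z[OF that] by simp
      show ?thesis unfolding eq[symmetric] by (rule hs_Cauchy_Schwarz[OF d t])
    qed
    then have "(hs M p ?t)\<^sup>2 \<le> 0 * hs M ?t ?t"
      by (intro LIMSEQ_le_const[OF tendsto_mult_right[OF plim]]) auto
    then have "hs M p ?t = 0" by simp
    moreover have "hs M p ?t = \<theta> * (LINT x|M. e (\<kappa>, i) x * f x)"
    proof -
      have "hs M p ?t = (LINT x|M. f x * kernel_op M p ?e x)" by (rule hs_tensor_right[OF p(1) f(1) eL'])
      also have "\<dots> = (LINT x|M. kernel_op M p f x * ?e x)" by (rule kernel_op_sym[OF p f(1) eL', symmetric])
      also have "\<dots> = (LINT x|M. ?e x * kernel_op M p f x)" by (simp only: mult.commute)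
      also have "\<dots> = \<theta> * (LINT x|M. ?e x * f x)"
        using hs_kernel_eigen[OF p(1) eL' fp] hs_tensor_right[OF p(1) eL' f(1)] by simp
      finally show ?thesis .
    qed
    ultimately show ?thesis using \<theta> by simp
  qed
  \<comment> \<open>By the orthogonality just shown, the removed spectral parts annihilate
    \<open>f\<close>, so the operators of \<open>k\<close> and of all residuals agree on
    \<open>f\<close>.\<close>
  have "f \<in> eigenspace M k \<theta>"
  proof -
    let ?g = "\<lambda>x. kernel_op M k f x - kernel_op M p f x"
    have g: "?g \<in> L2_fun M" by (intro L2_fun_diff kernel_op_L2 k p f)
    have "(LINT x|M. (?g x)\<^sup>2) \<le> hs M (?d n) (?d n) * (LINT x|M. (f x)\<^sup>2)" for n
    proof -
      have "?g x = kernel_op M (?d n) f x" if x: "x \<in> space M" for x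
      proof -
        have "(\<Sum>q\<in>?S (E n). fst q * (e q x * (LINT w|M. e q w * f w))) = 0"
          using NE0[OF E(2)[of n]] ef by (intro sum.neutral) auto
        then show ?thesis
          using kernel_op_residual[where A = "?S (E n)" and l = fst, OF k(1) f(1) eL[OF E(2)] x]
            kernel_op_diff_kernel[OF rL p(1) f(1) x, of n] by simp
      qed
      then have "(LINT x|M. (?g x)\<^sup>2) = (LINT x|M. (kernel_op M (?d n) f x)\<^sup>2)"
        by (intro Bochner_Integration.integral_cong) auto
      also have "\<dots> \<le> hs M (?d n) (?d n) * (LINT x|M. (f x)\<^sup>2)" by (rule kernel_op_L2(2)[OF d f(1)])
      finally show ?thesis .
    qed
    then have "(LINT x|M. (?g x)\<^sup>2) \<le> 0 * (LINT x|M. (f x)\<^sup>2)"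
      by (intro LIMSEQ_le_const[OF tendsto_mult_right[OF plim]]) auto
    moreover have "0 \<le> (LINT x|M. (?g x)\<^sup>2)" by simp
    ultimately have "(LINT x|M. (?g x)\<^sup>2) = 0" by linarith
    then have "AE x in M. ?g x = 0" using L2_norm_AE_0_iff[OF g] by simp
    then have "AE x in M. kernel_op M k f x = \<theta> * f x" using pf by eventually_elim simp
    then show ?thesis using f by (simp add: eigenspace_def)
  qed
  then have "AE x in M. f x = 0"
    by (rule compl[OF \<theta>]) (use ef[OF \<theta>] in \<open>simp add: mult.commute[of "f _"]\<close>)
  then show False using f(2) by simp
qed

section \<open>Traces of powers and eigenvalue sums\<close>

lemma hs_gpow_eigen:
  assumes k: "L2ker M k" "sym_kernel M k" and e: "e \<in> eigenspace M k \<kappa>"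
  shows "hs M (gpow M k n) (\<lambda>x y. e x * e y) = \<kappa> ^ (n + 1) * (LINT x|M. e x * e x)"
proof (induction n)
  case 0
  show ?case using hs_kernel_eigen[OF k(1) eigenspaceD(1)[OF e] e] by simp
next
  case (Suc n)
  note eL = eigenspaceD(1)[OF e]
  note t = L2ker_tensor[OF eL eL]
  note u = gpow_L2ker[OF k(1), of n]
  have "hs M (gpow M k (Suc n)) (\<lambda>x y. e x * e y) = hs M (gpow M k n) (kcomp M k (\<lambda>x y. e x * e y))"
    using hs_kcomp_sym[OF k u t] by simp
  also have "\<dots> = hs M (gpow M k n) (\<lambda>x y. \<kappa> * (e x * e y))"
    unfolding hs_iterated(2)[OF u L2ker_kcomp(1)[OF k(1) t]] hs_iterated(2)[OF u L2ker_cmult[OF t]]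
  proof (rule Bochner_Integration.integral_cong[OF refl])
    fix y assume y: "y \<in> space M"
    have eq: "kcomp M k (\<lambda>x y. e x * e y) x y = kernel_op M k e x * e y" for x
      by (simp add: kcomp_def kernel_op_def flip: mult.assoc)
    note [measurable] = L2_funD(1)[OF L2kerD(4)[OF u y]] L2_funD(1)[OF kernel_op_L2(1)[OF k(1) eL]] L2_funD(1)[OF eL]
    show "(LINT x|M. gpow M k n x y * kcomp M k (\<lambda>x y. e x * e y) x y) = (LINT x|M. gpow M k n x y * (\<kappa> * (e x * e y)))"
      unfolding eq
    proof (rule integral_cong_AE)
      show "AE x in M. gpow M k n x y * (kernel_op M k e x * e y) = gpow M k n x y * (\<kappa> * (e x * e y))"
        using eigenspaceD(2)[OF e] by eventually_elim simp
    qed measurable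
  qed
  also have "\<dots> = \<kappa> * hs M (gpow M k n) (\<lambda>x y. e x * e y)"
    by (subst hs_commute, subst hs_cmult_left, subst hs_commute) simp
  finally show ?case using Suc by simp
qed

text \<open>Pairing the power n + 1 with the residual leaves exactly the error of the trace of order
  n + 2. Cauchy--Schwarz therefore controls the errors of all orders by the norm of one and the same
  residual.\<close>

lemma trace_approximation:
  assumes k: "L2ker M k" "sym_kernel M k" and E: "finite E" "E \<subseteq> nonzero_eigenvalues M k"
  shows "(hs M (gpow M k n) k - (\<Sum>\<kappa>\<in>E. eigen_mult M k \<kappa> * \<kappa> ^ (n + 2)))\<^sup>2
      \<le> hs M (gpow M k n) (gpow M k n) * (hs M k k - (\<Sum>\<kappa>\<in>E. eigen_mult M k \<kappa> * \<kappa>\<^sup>2))"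
    and "0 \<le> hs M k k - (\<Sum>\<kappa>\<in>E. eigen_mult M k \<kappa> * \<kappa>\<^sup>2)"
proof -
  let ?m = "eigen_mult M k"
  let ?S = "Sigma E (\<lambda>\<kappa>. {..<?m \<kappa>})"
  obtain e :: "real \<times> nat \<Rightarrow> 'a \<Rightarrow> real" where
    o': "\<And>E. 0 \<notin> E \<Longrightarrow> ortho M (Sigma E (\<lambda>\<kappa>. {..<?m \<kappa>})) e" and
    eig: "\<And>\<kappa> i. \<kappa> \<noteq> 0 \<Longrightarrow> i < ?m \<kappa> \<Longrightarrow> e (\<kappa>, i) \<in> eigenspace M k \<kappa>"
    by (rule spectral_basis[OF k]) (rule that)
  have E0: "0 \<notin> E" using E by (auto simp: nonzero_eigenvalues_def)
  note o = o'[OF E0]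
  have eL: "e p \<in> L2_fun M" if "p \<in> ?S" for p
    using o that unfolding ortho_def by blast
  let ?r = "residual k fst e ?S"
  note u = gpow_L2ker[OF k(1), of n]
  have r: "L2ker M ?r" by (intro residual_L2ker k eL)
  have hr: "hs M ?r ?r = hs M k k - (\<Sum>\<kappa>\<in>E. ?m \<kappa> * \<kappa>\<^sup>2)"
  proof -
    have "hs M ?r ?r = hs M k k - (\<Sum>p\<in>?S. (fst p)\<^sup>2)"
      by (rule hs_residual[OF k(1) o]) (use E E0 in \<open>auto intro!: eig finite_SigmaI\<close>)
    then show ?thesis using eigen_square_sum[OF E(1), of 2 k] by simp
  qed
  then show "0 \<le> hs M k k - (\<Sum>\<kappa>\<in>E. ?m \<kappa> * \<kappa>\<^sup>2)" using hs_nonneg[of ?r] by simp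
  have te: "L2ker M (\<lambda>x y. fst p * (e p x * e p y))" if "p \<in> ?S" for p
    by (intro L2ker_cmult L2ker_tensor eL that)
  have "hs M (\<lambda>x y. \<Sum>p\<in>?S. fst p * (e p x * e p y)) (gpow M k n) = (\<Sum>p\<in>?S. (fst p) ^ (n + 2))"
  proof -
    have "hs M (\<lambda>x y. \<Sum>p\<in>?S. fst p * (e p x * e p y)) (gpow M k n)
        = (\<Sum>p\<in>?S. fst p * hs M (\<lambda>x y. e p x * e p y) (gpow M k n))"
      by (subst hs_sum_left) (auto simp: hs_cmult_left intro!: te u)
    also have "\<dots> = (\<Sum>p\<in>?S. (fst p) ^ (n + 2))"
    proof (rule sum.cong[OF refl])
      fix p assume p: "p \<in> ?S"
      then obtain \<kappa> i where ki: "p = (\<kappa>, i)" "\<kappa> \<in> E" "i < ?m \<kappa>" by auto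
      then have "\<kappa> \<noteq> 0" using E0 by auto
      then have "e p \<in> eigenspace M k (fst p)" using eig[of \<kappa> i] ki by simp
      note h = hs_gpow_eigen[OF k this, of n]
      have "hs M (gpow M k n) (\<lambda>x y. e p x * e p y) = fst p ^ (n + 1)"
      proof -
        have "(LINT x|M. e p x * e p x) = (if p = p then 1 else 0)" using o p unfolding ortho_def by blast
        then show ?thesis using h by simp
      qed
      then show "fst p * hs M (\<lambda>x y. e p x * e p y) (gpow M k n) = (fst p) ^ (n + 2)"
        using hs_commute[of "\<lambda>x y. e p x * e p y" "gpow M k n"] by simp
    qed
    finally show ?thesis .
  qed
  moreover have "hs M ?r (gpow M k n) = hs M k (gpow M k n) - hs M (\<lambda>x y. \<Sum>p\<in>?S. fst p * (e p x * e p y)) (gpow M k n)"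
    unfolding residual_def[abs_def] by (rule hs_diff_left[OF k(1) L2ker_sum[OF te] u])
  ultimately have "hs M ?r (gpow M k n) = hs M (gpow M k n) k - (\<Sum>\<kappa>\<in>E. ?m \<kappa> * \<kappa> ^ (n + 2))"
    using eigen_square_sum[OF E(1), of "n + 2" k] hs_commute[of k "gpow M k n"] by simp
  then show "(hs M (gpow M k n) k - (\<Sum>\<kappa>\<in>E. ?m \<kappa> * \<kappa> ^ (n + 2)))\<^sup>2
      \<le> hs M (gpow M k n) (gpow M k n) * (hs M k k - (\<Sum>\<kappa>\<in>E. ?m \<kappa> * \<kappa>\<^sup>2))"
    using hs_Cauchy_Schwarz[OF u r] hs_commute[of ?r "gpow M k n"] hr by simp
qed

end

section \<open>The regularised determinant\<close>

lemma log_det_factor_sums: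
  fixes x :: real
  assumes "\<bar>x\<bar> < 1"
  shows "(\<lambda>n. - ((- 1) ^ n * x ^ (n + 2) / real (n + 2))) sums (ln (1 + x) - x)"
proof -
  let ?f = "\<lambda>n. (- 1) ^ n * (1 / real (n + 1)) * x ^ Suc n"
  have "summable ?f"
  proof (rule summable_comparison_test)
    show "\<exists>N. \<forall>n\<ge>N. norm (?f n) \<le> \<bar>x\<bar> ^ n"
    proof (intro exI allI impI)
      fix n :: nat
      have "norm (?f n) = \<bar>x\<bar> ^ n * (\<bar>x\<bar> / real (n + 1))" by (simp add: abs_mult power_abs)
      also have "\<dots> \<le> \<bar>x\<bar> ^ n * 1" using assms by (intro mult_left_mono) (auto simp: field_simps)
      finally show "norm (?f n) \<le> \<bar>x\<bar> ^ n" by simp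
    qed
    show "summable (\<lambda>n. \<bar>x\<bar> ^ n)" using assms by (simp add: summable_geometric)
  qed
  moreover have "ln (1 + x) = (\<Sum>n. ?f n)"
    using ln_series[of "1 + x"] assms by simp
  ultimately have "?f sums ln (1 + x)" by (simp add: sums_iff)
  from sums_split_initial_segment[OF this, of 1]
  have "(\<lambda>n. ?f (n + 1)) sums (ln (1 + x) - x)" by simp
  moreover have "?f (n + 1) = - ((- 1) ^ n * x ^ (n + 2) / real (n + 2))" for n by simp
  ultimately show ?thesis by (simp only:)
qed

context sample_space
begin

lemma hs_gpow_le:
  assumes k: "L2ker M k"
  shows "hs M (gpow M k n) (gpow M k n) \<le> hs M k k ^ (n + 1)"
proof (induction n)
  case (Suc n)
  have "hs M (gpow M k (Suc n)) (gpow M k (Suc n)) \<le> hs M k k * hs M (gpow M k n) (gpow M k n)"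
    using L2ker_kcomp(2)[OF k gpow_L2ker[OF k]] by simp
  also have "\<dots> \<le> hs M k k * hs M k k ^ (n + 1)" by (rule mult_left_mono[OF Suc hs_nonneg])
  finally show ?case by simp
qed simp

lemma hs_gpow_trace_le:
  assumes k: "L2ker M k" and b: "hs M k k \<le> b\<^sup>2" "0 \<le> b"
  shows "\<bar>hs M (gpow M k n) k\<bar> \<le> b ^ (n + 2)"
proof -
  have "(hs M (gpow M k n) k)\<^sup>2 \<le> hs M (gpow M k n) (gpow M k n) * hs M k k"
    by (rule hs_Cauchy_Schwarz[OF gpow_L2ker[OF k] k])
  also have "\<dots> \<le> hs M k k ^ (n + 1) * hs M k k"
    by (rule mult_right_mono[OF hs_gpow_le[OF k] hs_nonneg])
  also have "\<dots> = hs M k k ^ (n + 2)" by simp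
  also have "\<dots> \<le> (b\<^sup>2) ^ (n + 2)" by (intro power_mono b hs_nonneg)
  also have "\<dots> = (b ^ (n + 2))\<^sup>2" by (simp only: power_mult[symmetric] mult.commute)
  finally have "\<bar>hs M (gpow M k n) k\<bar>\<^sup>2 \<le> (b ^ (n + 2))\<^sup>2" unfolding power2_abs .
  then show ?thesis by (rule power2_le_imp_le) (rule zero_le_power[OF b(2)])
qed

lemma eigenvalue_le:
  assumes k: "L2ker M k" and \<kappa>: "\<kappa> \<in> nonzero_eigenvalues M k" and b: "hs M k k \<le> b\<^sup>2" "0 \<le> b"
  shows "\<bar>\<kappa>\<bar> \<le> b"
proof -
  obtain f where f: "f \<in> eigenspace M k \<kappa>" "\<not> (AE x in M. f x = 0)"
    using \<kappa> by (auto simp: nonzero_eigenvalues_def)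
  note fD = eigenspaceD[OF f(1)]
  note [measurable] = L2_funD(1)[OF fD(1)] L2_funD(1)[OF kernel_op_L2(1)[OF k fD(1)]]
  have "0 \<le> (LINT x|M. (f x)\<^sup>2)" by simp
  then have pos: "0 < (LINT x|M. (f x)\<^sup>2)"
    using f(2) L2_norm_AE_0_iff[OF fD(1)] by linarith
  have "(LINT x|M. (kernel_op M k f x)\<^sup>2) = (LINT x|M. \<kappa>\<^sup>2 * (f x)\<^sup>2)"
  proof (rule integral_cong_AE)
    show "AE x in M. (kernel_op M k f x)\<^sup>2 = \<kappa>\<^sup>2 * (f x)\<^sup>2"
      using fD(2) by eventually_elim (simp add: power_mult_distrib)
  qed measurable
  then have "\<kappa>\<^sup>2 * (LINT x|M. (f x)\<^sup>2) \<le> b\<^sup>2 * (LINT x|M. (f x)\<^sup>2)"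
    using kernel_op_L2(2)[OF k fD(1)] mult_right_mono[OF b(1), of "LINT x|M. (f x)\<^sup>2"] by simp
  then have "\<kappa>\<^sup>2 \<le> b\<^sup>2" using pos by simp
  then show ?thesis using b(2) by (simp add: abs_le_square_iff[symmetric])
qed

text \<open>The logarithm of each factor is a power series starting at the second power of the
  eigenvalue, so summation over eigenvalues produces approximate traces of order two and higher. The
  smallness condition keeps all factors positive and the errors geometrically summable; completeness
  then makes the unordered product converge, so that \<open>Lim\<close> is a genuine limit.\<close>

lemma det2_eq:
  assumes k: "L2ker M k" "sym_kernel M k" and b: "hs M k k \<le> b\<^sup>2" "0 \<le> b" and \<beta>: "\<bar>\<beta>\<bar> * b \<le> 1 / 2"
  shows "det2 M k \<beta> = exp (- (\<Sum>n. (- 1) ^ n * \<beta> ^ (n + 2) * hs M (gpow M k n) k / real (n + 2)))"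
proof -
  let ?m = "eigen_mult M k"
  let ?NE = "nonzero_eigenvalues M k"
  define \<sigma> where "\<sigma> E n = (\<Sum>\<kappa>\<in>E. ?m \<kappa> * \<kappa> ^ (n + 2))" for E :: "real set" and n :: nat
  define \<tau> where "\<tau> n = hs M (gpow M k n) k" for n
  \<comment> \<open>The Hilbert--Schmidt norm of the residual after removing the eigenvalues in
    \<open>E\<close>.\<close>
  define \<delta> where "\<delta> E = sqrt (hs M k k - (\<Sum>\<kappa>\<in>E. ?m \<kappa> * \<kappa>\<^sup>2))" for E :: "real set"
  let ?c = "\<lambda>n. (- 1) ^ n * \<beta> ^ (n + 2) / real (n + 2)"
  let ?T = "\<Sum>n. ?c n * \<tau> n"
  have sm: "summable (\<lambda>n. (1 / 2 :: real) ^ n)" by (simp add: summable_geometric)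
  have pb: "\<bar>\<beta>\<bar> ^ j * b ^ j \<le> (1 / 2) ^ j" for j
    using power_mono[OF \<beta>, of j] b(2) by (simp add: power_mult_distrib)
  have cb: "\<bar>?c n\<bar> \<le> \<bar>\<beta>\<bar> ^ (n + 2)" for n
  proof -
    have "\<bar>?c n\<bar> = \<bar>\<beta>\<bar> ^ (n + 2) / real (n + 2)" by (simp add: abs_mult power_abs)
    also have "\<dots> \<le> \<bar>\<beta>\<bar> ^ (n + 2) / 1" by (intro divide_left_mono) auto
    finally show ?thesis by simp
  qed
  have "summable (\<lambda>n. ?c n * \<tau> n)"
  proof (rule summable_comparison_test[OF _ sm], intro exI allI impI)
    fix n
    have "norm (?c n * \<tau> n) \<le> \<bar>\<beta>\<bar> ^ (n + 2) * b ^ (n + 2)"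
      unfolding real_norm_def abs_mult \<tau>_def
      by (intro mult_mono cb[unfolded abs_mult] hs_gpow_trace_le k b) auto
    also have "\<dots> \<le> (1 / 2) ^ (n + 2)" by (rule pb)
    also have "\<dots> \<le> (1 / 2) ^ n" by (intro power_decreasing) auto
    finally show "norm (?c n * \<tau> n) \<le> (1 / 2) ^ n" .
  qed
  then have Ts: "(\<lambda>n. ?c n * \<tau> n) sums ?T" by (rule summable_sums)
  have fac: "(\<Prod>\<kappa>\<in>E. ((1 + \<beta> * \<kappa>) * exp (- \<beta> * \<kappa>)) ^ ?m \<kappa>) = exp (\<Sum>\<kappa>\<in>E. ?m \<kappa> * (ln (1 + \<beta> * \<kappa>) - \<beta> * \<kappa>))"
    and ser: "(\<lambda>n. - (?c n * \<sigma> E n)) sums (\<Sum>\<kappa>\<in>E. ?m \<kappa> * (ln (1 + \<beta> * \<kappa>) - \<beta> * \<kappa>))"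
    if E: "finite E" "E \<subseteq> ?NE" for E
  proof -
    have small: "\<bar>\<beta> * \<kappa>\<bar> < 1" if "\<kappa> \<in> E" for \<kappa>
    proof -
      have "\<bar>\<beta> * \<kappa>\<bar> \<le> \<bar>\<beta>\<bar> * b"
        unfolding abs_mult using that E by (intro mult_left_mono eigenvalue_le[OF k(1) _ b]) auto
      then show ?thesis using \<beta> by linarith
    qed
    have "((1 + \<beta> * \<kappa>) * exp (- \<beta> * \<kappa>)) ^ ?m \<kappa> = exp (?m \<kappa> * (ln (1 + \<beta> * \<kappa>) - \<beta> * \<kappa>))" if "\<kappa> \<in> E" for \<kappa>
    proof -
      have "1 + \<beta> * \<kappa> > 0" using small[OF that] by linarith
      then have "(1 + \<beta> * \<kappa>) * exp (- \<beta> * \<kappa>) = exp (ln (1 + \<beta> * \<kappa>) - \<beta> * \<kappa>)"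
        by (simp add: exp_diff exp_minus divide_inverse)
      then show ?thesis by (simp add: exp_of_nat_mult)
    qed
    then show "(\<Prod>\<kappa>\<in>E. ((1 + \<beta> * \<kappa>) * exp (- \<beta> * \<kappa>)) ^ ?m \<kappa>) = exp (\<Sum>\<kappa>\<in>E. ?m \<kappa> * (ln (1 + \<beta> * \<kappa>) - \<beta> * \<kappa>))"
      using E by (simp add: exp_sum)
    have "(\<lambda>n. \<Sum>\<kappa>\<in>E. ?m \<kappa> * (- ((- 1) ^ n * (\<beta> * \<kappa>) ^ (n + 2) / real (n + 2))))
        sums (\<Sum>\<kappa>\<in>E. ?m \<kappa> * (ln (1 + \<beta> * \<kappa>) - \<beta> * \<kappa>))"
      by (intro sums_sum sums_mult log_det_factor_sums small)
    moreover have "(\<Sum>\<kappa>\<in>E. ?m \<kappa> * (- ((- 1) ^ n * (\<beta> * \<kappa>) ^ (n + 2) / real (n + 2)))) = - (?c n * \<sigma> E n)" for n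
      unfolding \<sigma>_def sum_distrib_left sum_negf[symmetric]
      by (rule sum.cong[OF refl]) (simp add: power_mult_distrib)
    ultimately show "(\<lambda>n. - (?c n * \<sigma> E n)) sums (\<Sum>\<kappa>\<in>E. ?m \<kappa> * (ln (1 + \<beta> * \<kappa>) - \<beta> * \<kappa>))" by simp
  qed
  have close: "\<bar>(\<Sum>\<kappa>\<in>E. ?m \<kappa> * (ln (1 + \<beta> * \<kappa>) - \<beta> * \<kappa>)) - (- ?T)\<bar> \<le> 2 * \<bar>\<beta>\<bar> * \<delta> E"
    if E: "finite E" "E \<subseteq> ?NE" for E
  proof -
    let ?D = "(\<Sum>\<kappa>\<in>E. ?m \<kappa> * (ln (1 + \<beta> * \<kappa>) - \<beta> * \<kappa>)) - (- ?T)"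
    have d0: "0 \<le> \<delta> E" using trace_approximation(2)[OF k E] by (simp add: \<delta>_def)
    have s: "(\<lambda>n. ?c n * (\<tau> n - \<sigma> E n)) sums ?D"
      using sums_diff[OF ser[OF E] sums_minus[OF Ts]] by (simp add: right_diff_distrib)
    have g: "(\<lambda>n. \<bar>\<beta>\<bar> * \<delta> E * (1 / 2) ^ n) sums (\<bar>\<beta>\<bar> * \<delta> E * 2)"
      using sums_mult[OF geometric_sums[of "1 / 2 :: real"], of "\<bar>\<beta>\<bar> * \<delta> E"] by simp
    have le: "\<bar>?c n * (\<tau> n - \<sigma> E n)\<bar> \<le> \<bar>\<beta>\<bar> * \<delta> E * (1 / 2) ^ n" for n
    proof -
      have "(\<tau> n - \<sigma> E n)\<^sup>2 \<le> hs M (gpow M k n) (gpow M k n) * (\<delta> E)\<^sup>2"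
        using trace_approximation[OF k E] by (simp add: \<tau>_def \<sigma>_def \<delta>_def)
      also have "\<dots> \<le> (b\<^sup>2) ^ (n + 1) * (\<delta> E)\<^sup>2"
        by (intro mult_right_mono order_trans[OF hs_gpow_le[OF k(1)]] power_mono b hs_nonneg) simp
      also have "\<dots> = (b ^ (n + 1) * \<delta> E)\<^sup>2" by (simp only: power_mult_distrib power_mult[symmetric] mult.commute)
      finally have "\<bar>\<tau> n - \<sigma> E n\<bar>\<^sup>2 \<le> (b ^ (n + 1) * \<delta> E)\<^sup>2" unfolding power2_abs .
      then have "\<bar>\<tau> n - \<sigma> E n\<bar> \<le> b ^ (n + 1) * \<delta> E"
        by (rule power2_le_imp_le) (intro mult_nonneg_nonneg zero_le_power b(2) d0)
      then have "\<bar>?c n * (\<tau> n - \<sigma> E n)\<bar> \<le> \<bar>\<beta>\<bar> ^ (n + 2) * (b ^ (n + 1) * \<delta> E)"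
        unfolding abs_mult by (intro mult_mono cb[unfolded abs_mult]) auto
      also have "\<dots> = (\<bar>\<beta>\<bar> * \<delta> E) * (\<bar>\<beta>\<bar> ^ (n + 1) * b ^ (n + 1))" by simp
      also have "\<dots> \<le> (\<bar>\<beta>\<bar> * \<delta> E) * (1 / 2) ^ n"
        using d0 by (intro mult_left_mono order_trans[OF pb] power_decreasing) auto
      finally show ?thesis .
    qed
    have "?D \<le> \<bar>\<beta>\<bar> * \<delta> E * 2"
      by (rule sums_le[OF _ s g]) (use le in \<open>simp only: abs_le_iff\<close>)
    moreover have "- ?D \<le> \<bar>\<beta>\<bar> * \<delta> E * 2"
      by (rule sums_le[OF _ sums_minus[OF s] g]) (use le in \<open>simp only: abs_le_iff\<close>)
    ultimately show ?thesis by linarith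
  qed
  \<comment> \<open>\<open>\<delta>\<close> decreases as the set grows, so one good set from the
    completeness theorem takes care of all larger ones.\<close>
  have \<delta>lim: "(\<delta> \<longlongrightarrow> 0) (finite_subsets_at_top ?NE)"
  proof (rule tendstoI)
    fix \<epsilon> :: real assume \<epsilon>: "\<epsilon> > 0"
    obtain E0 where E0: "finite E0" "E0 \<subseteq> ?NE" "hs M k k - (\<Sum>\<kappa>\<in>E0. ?m \<kappa> * \<kappa>\<^sup>2) < \<epsilon>\<^sup>2"
      using spectral_completeness[OF k, of "\<epsilon>\<^sup>2"] \<epsilon> by auto
    show "\<forall>\<^sub>F E in finite_subsets_at_top ?NE. dist (\<delta> E) 0 < \<epsilon>"
      unfolding eventually_finite_subsets_at_top
    proof (intro exI[of _ E0] conjI E0 allI impI)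
      fix E assume E: "finite E \<and> E0 \<subseteq> E \<and> E \<subseteq> ?NE"
      have "(\<Sum>\<kappa>\<in>E0. ?m \<kappa> * \<kappa>\<^sup>2) \<le> (\<Sum>\<kappa>\<in>E. ?m \<kappa> * \<kappa>\<^sup>2)" by (rule sum_mono2) (use E in auto)
      then have "\<delta> E < sqrt (\<epsilon>\<^sup>2)" unfolding \<delta>_def using E0(3) by (intro real_sqrt_less_mono) linarith
      moreover have "0 \<le> \<delta> E" using trace_approximation(2)[OF k, of E] E by (simp add: \<delta>_def)
      ultimately show "dist (\<delta> E) 0 < \<epsilon>" using \<epsilon> by simp
    qed
  qed
  have "((\<lambda>E. \<Sum>\<kappa>\<in>E. ?m \<kappa> * (ln (1 + \<beta> * \<kappa>) - \<beta> * \<kappa>)) \<longlongrightarrow> - ?T) (finite_subsets_at_top ?NE)"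
  proof (rule LIM_zero_cancel, rule Lim_null_comparison)
    show "\<forall>\<^sub>F E in finite_subsets_at_top ?NE.
        norm ((\<Sum>\<kappa>\<in>E. ?m \<kappa> * (ln (1 + \<beta> * \<kappa>) - \<beta> * \<kappa>)) - (- ?T)) \<le> 2 * \<bar>\<beta>\<bar> * \<delta> E"
      unfolding real_norm_def by (rule eventually_finite_subsets_at_top_weakI) (rule close)
    show "((\<lambda>E. 2 * \<bar>\<beta>\<bar> * \<delta> E) \<longlongrightarrow> 0) (finite_subsets_at_top ?NE)"
      using tendsto_mult_right_zero[OF \<delta>lim] by simp
  qed
  then have "((\<lambda>E. exp (\<Sum>\<kappa>\<in>E. ?m \<kappa> * (ln (1 + \<beta> * \<kappa>) - \<beta> * \<kappa>))) \<longlongrightarrow> exp (- ?T)) (finite_subsets_at_top ?NE)"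
    by (rule tendsto_exp)
  then have "((\<lambda>E. \<Prod>\<kappa>\<in>E. ((1 + \<beta> * \<kappa>) * exp (- \<beta> * \<kappa>)) ^ ?m \<kappa>) \<longlongrightarrow> exp (- ?T)) (finite_subsets_at_top ?NE)"
    by (rule Lim_transform_eventually) (rule eventually_finite_subsets_at_top_weakI, simp only: fac)
  then have "det2 M k \<beta> = exp (- ?T)"
    unfolding det2_def by (rule tendsto_Lim[OF finite_subsets_at_top_neq_bot])
  then show ?thesis by (simp add: \<tau>_def)
qed

end

section \<open>Powers of degenerate kernels\<close>

text \<open>A convenient form of AM-GM: products of three factors are dominated as soon as each
  factor has a fourth moment.\<close>

lemma young3:
  fixes a b c :: real
  shows "a * b * c \<le> a ^ 4 + b ^ 4 + c ^ 4 + 1"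
proof -
  have 1: "2 * (x * y) \<le> x\<^sup>2 + y\<^sup>2" for x y :: real using sum_squares_bound[of x y] by simp
  have "2 * (a * b * c) \<le> (a * b)\<^sup>2 + c\<^sup>2" by (rule 1)
  moreover have "2 * (a * b)\<^sup>2 \<le> a ^ 4 + b ^ 4" using 1[of "a\<^sup>2" "b\<^sup>2"] by (simp add: power_mult_distrib)
  moreover have "2 * c\<^sup>2 \<le> c ^ 4 + 1" using 1[of "c\<^sup>2" 1] by simp
  moreover have "0 \<le> a ^ 4" "0 \<le> b ^ 4" "0 \<le> c ^ 4" by simp_all
  ultimately show ?thesis by linarith
qed

lemma le_exp_scaled: "c > 0 \<Longrightarrow> x \<le> c * exp (x / c)" for x c :: real
  using exp_ge_add_one_self[of "x / c"] by (simp add: field_simps add_increasing)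

text \<open>The scale 16 serves the exponents 4 and 8: at most half of the available exponential
  moment is spent, and the rest absorbs the factors exp (\<gamma> / 100).\<close>

lemma power_le_exp_scaled:
  fixes x :: real
  assumes "0 \<le> x" "0 < n"
  shows "x ^ n \<le> 16 ^ n * exp (n * x / 16)"
proof -
  have "x ^ n \<le> (16 * exp (x / 16)) ^ n" using le_exp_scaled[of 16 x] assms by (intro power_mono) auto
  then show ?thesis by (simp add: power_mult_distrib exp_of_nat_mult[symmetric])
qed

context sample_space
begin

lemma subexp_moments:
  assumes "subexp M w"
  shows "(LINT x|M. \<bar>w x\<bar>) \<le> 1" "integrable M (\<lambda>x. (w x)\<^sup>2)" "(LINT x|M. (w x)\<^sup>2) \<le> 2" "w \<in> L2_fun M"
proof -
  note i = subexp_integrable[OF assms] exp_abs_integrable(1)[OF assms]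
  have [measurable]: "w \<in> borel_measurable M" using subexp_measurable[OF assms] .
  have q: "(w x)\<^sup>2 \<le> 2 * (exp \<bar>w x\<bar> - 1)" for x
    using exp_lower_Taylor_quadratic[of "\<bar>w x\<bar>"] by simp
  have q': "\<bar>w x\<bar> \<le> exp \<bar>w x\<bar> - 1" for x using exp_ge_add_one_self[of "\<bar>w x\<bar>"] by linarith
  have i2: "integrable M (\<lambda>x. 2 * (exp \<bar>w x\<bar> - 1))" "integrable M (\<lambda>x. exp \<bar>w x\<bar> - 1)" using i by simp_all
  have e: "(LINT x|M. exp \<bar>w x\<bar> - 1) \<le> 1"
    using i exp_abs_integrable(2)[OF assms] by (simp add: prob_space)
  show *: "integrable M (\<lambda>x. (w x)\<^sup>2)"
    by (rule Bochner_Integration.integrable_bound[OF i2(1)])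
      (auto intro!: AE_I2 order_trans[OF q] simp del: right_diff_distrib_numeral)
  then show "w \<in> L2_fun M" by (simp add: L2_fun_def)
  have "(LINT x|M. (w x)\<^sup>2) \<le> (LINT x|M. 2 * (exp \<bar>w x\<bar> - 1))"
    by (rule integral_mono[OF * i2(1) q])
  also have "\<dots> = 2 * (LINT x|M. exp \<bar>w x\<bar> - 1)" by (rule integral_mult_right_zero)
  finally show "(LINT x|M. (w x)\<^sup>2) \<le> 2" using e by linarith
  have "(LINT x|M. \<bar>w x\<bar>) \<le> (LINT x|M. exp \<bar>w x\<bar> - 1)"
    using i by (intro integral_mono[OF _ i2(2) q']) auto
  then show "(LINT x|M. \<bar>w x\<bar>) \<le> 1" using e by linarith
qed

lemma deg_kernel_L2ker:
  assumes "deg_kernel M k"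
  shows "L2ker M k" "sym_kernel M k" "hs M k k \<le> 2"
proof -
  note [measurable] = deg_kernel_measurable[OF assms]
  have rows: "(\<lambda>x. k x y) \<in> L2_fun M" "(LINT x|M. (k x y)\<^sup>2) \<le> 2" if "y \<in> space M" for y
    using subexp_moments[OF deg_kernel_subexp[OF assms that]] by auto
  have cols: "(\<lambda>y. k x y) \<in> L2_fun M" if "x \<in> space M" for x
    using subexp_moments[OF deg_kernel_subexp_right[OF assms that]] by auto
  have "(\<integral>\<^sup>+z. ennreal ((case z of (x, y) \<Rightarrow> k x y)\<^sup>2) \<partial>(M \<Otimes>\<^sub>M M))
      = (\<integral>\<^sup>+y. \<integral>\<^sup>+x. ennreal ((k x y)\<^sup>2) \<partial>M \<partial>M)"
    by (subst pp.nn_integral_snd[symmetric]) auto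
  also have "\<dots> \<le> (\<integral>\<^sup>+y. 2 \<partial>M)"
  proof (rule nn_integral_mono)
    fix y assume y: "y \<in> space M"
    have "(\<integral>\<^sup>+x. ennreal ((k x y)\<^sup>2) \<partial>M) = ennreal (LINT x|M. (k x y)\<^sup>2)"
      by (rule nn_integral_eq_integral[OF L2_funD(2)[OF rows(1)[OF y]]]) simp
    also have "\<dots> \<le> ennreal 2" by (rule ennreal_leI[OF rows(2)[OF y]])
    finally show "(\<integral>\<^sup>+x. ennreal ((k x y)\<^sup>2) \<partial>M) \<le> 2" by simp
  qed
  also have "\<dots> = 2" by (simp add: emeasure_space_1)
  finally have fin: "(\<integral>\<^sup>+z. ennreal ((case z of (x, y) \<Rightarrow> k x y)\<^sup>2) \<partial>(M \<Otimes>\<^sub>M M)) \<le> 2" .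
  have int: "integrable (M \<Otimes>\<^sub>M M) (\<lambda>z. (case z of (x, y) \<Rightarrow> k x y)\<^sup>2)"
    by (rule integrableI_nonneg) (use fin in \<open>auto intro: le_less_trans\<close>)
  then show "L2ker M k" using rows cols by (simp add: L2ker_def L2_fun_def)
  have "ennreal (hs M k k) \<le> ennreal 2"
    using fin unfolding hs_self by (subst (asm) nn_integral_eq_integral[OF int]) auto
  then show "hs M k k \<le> 2" by (subst (asm) ennreal_le_iff) auto
  show "sym_kernel M k" using deg_kernel_sym[OF assms] by (simp add: sym_kernel_def)
qed

text \<open>One composition is smoothing: by Cauchy--Schwarz, rows of squared L^2 norm at most 2
  give a kernel bounded by 2. Further compositions preserve the bound because the rows of
  \<open>g\<close> have L^1 norm at most 1. In particular the diagonal makes sense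
  pointwise.\<close>

lemma gpow_bound:
  assumes g: "deg_kernel M g" and "x \<in> space M" "y \<in> space M"
  shows "\<bar>gpow M g (Suc n) x y\<bar> \<le> 2"
  using assms(2,3)
proof (induction n arbitrary: x y)
  case 0
  have "\<bar>gpow M g (Suc 0) x y\<bar> \<le> sqrt ((LINT w|M. (g x w)\<^sup>2) * (LINT w|M. (g w y)\<^sup>2))"
    using L2_Cauchy_Schwarz[OF subexp_moments(4)[OF deg_kernel_subexp_right[OF g 0(1)]]
        subexp_moments(4)[OF deg_kernel_subexp[OF g 0(2)]]]
    by (simp add: kcomp_def real_le_rsqrt)
  also have "\<dots> \<le> sqrt (2 * 2)"
    by (intro real_sqrt_le_mono mult_mono subexp_moments(3) deg_kernel_subexp_right[OF g 0(1)] deg_kernel_subexp[OF g 0(2)]) auto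
  also have "\<dots> = 2" by (simp add: real_sqrt_abs2)
  finally show ?case .
next
  case (Suc n)
  let ?u = "gpow M g (Suc n)"
  note s = deg_kernel_subexp_right[OF g Suc.prems(1)]
  have L: "L2ker M ?u" by (rule gpow_L2ker[OF deg_kernel_L2ker(1)[OF g]])
  have i: "integrable M (\<lambda>w. g x w * ?u w y)"
    by (rule L2_fun_mult_integrable[OF subexp_moments(4)[OF s] L2kerD(4)[OF L Suc.prems(2)]])
  have "\<bar>gpow M g (Suc (Suc n)) x y\<bar> \<le> (LINT w|M. \<bar>g x w * ?u w y\<bar>)"
    unfolding gpow.simps(2)[of M g "Suc n"] kcomp_def by (rule integral_abs_bound)
  also have "\<dots> \<le> (LINT w|M. \<bar>g x w\<bar> * 2)"
  proof (rule integral_mono)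
    fix w assume "w \<in> space M"
    then show "\<bar>g x w * ?u w y\<bar> \<le> \<bar>g x w\<bar> * 2"
      unfolding abs_mult using Suc.IH Suc.prems by (intro mult_left_mono) auto
  qed (use i subexp_integrable[OF s] in auto)
  also have "\<dots> \<le> 2" using subexp_moments(1)[OF s] by simp
  finally show ?case .
qed

lemma gpow_degenerate:
  assumes g: "deg_kernel M g" and y: "y \<in> space M"
  shows "(LINT x|M. gpow M g n x y) = 0"
proof (cases n)
  case 0
  then show ?thesis using deg_kernel_subexp[OF g y] by (simp add: subexp_def)
next
  case (Suc m)
  note gL = deg_kernel_L2ker(1)[OF g]
  have one: "(\<lambda>_. 1) \<in> L2_fun M" by (simp add: L2_fun_def)
  have "(LINT x|M. gpow M g n x y) = (LINT v|M. (LINT w|M. 1 * g w v) * gpow M g m v y)"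
    using kernel_swap[OF L2kerD(1)[OF gL] one L2kerD(4)[OF gpow_L2ker[OF gL] y], of m]
    by (simp add: Suc kcomp_def)
  also have "\<dots> = (LINT v|M. 0)"
    by (rule Bochner_Integration.integral_cong[OF refl])
      (use deg_kernel_subexp[OF g] in \<open>simp add: subexp_def\<close>)
  finally show ?thesis by simp
qed

text \<open>The factor 1/4 brings the bound 2 down to 1/2, and exp (1/2) \<le> 2. It is the same for
  all n, so every estimate for degenerate kernels holds for all iterates with the same
  constants.\<close>

lemma deg_kernel_gpow:
  assumes g: "deg_kernel M g"
  shows "deg_kernel M (\<lambda>x y. gpow M g n x y / 4)"
proof -
  note gL = deg_kernel_L2ker[OF g]
  note uL = gpow_L2ker[OF gL(1), of n]
  note [measurable] = L2kerD(2)[OF uL]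
  have "subexp M (\<lambda>x. gpow M g n x y / 4)" if y: "y \<in> space M" for y
  proof -
    note [measurable] = L2_funD(1)[OF L2kerD(4)[OF uL y]]
    have "(\<integral>\<^sup>+x. ennreal (exp \<bar>gpow M g n x y / 4\<bar>) \<partial>M) \<le> 2"
    proof (cases n)
      case 0
      have "(\<integral>\<^sup>+x. ennreal (exp \<bar>gpow M g n x y / 4\<bar>) \<partial>M) \<le> (\<integral>\<^sup>+x. ennreal (exp \<bar>g x y\<bar>) \<partial>M)"
        by (intro nn_integral_mono ennreal_leI) (simp add: 0)
      also have "\<dots> \<le> 2" using deg_kernel_subexp[OF g y] by (simp add: subexp_def)
      finally show ?thesis .
    next
      case (Suc m)
      have "(\<integral>\<^sup>+x. ennreal (exp \<bar>gpow M g n x y / 4\<bar>) \<partial>M) \<le> (\<integral>\<^sup>+x. ennreal 2 \<partial>M)"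
      proof (intro nn_integral_mono ennreal_leI)
        fix x assume "x \<in> space M"
        then have "\<bar>gpow M g n x y / 4\<bar> \<le> 1 / 2" unfolding Suc using gpow_bound[OF g _ y, of x m] by simp
        then have "exp \<bar>gpow M g n x y / 4\<bar> \<le> exp (1 / 2)" by simp
        also have "\<dots> \<le> 2" by (rule exp_half_le2)
        finally show "exp \<bar>gpow M g n x y / 4\<bar> \<le> 2" .
      qed
      then show ?thesis by (simp add: emeasure_space_1)
    qed
    then show ?thesis using gpow_degenerate[OF g y, of n] by (simp add: subexp_def)
  qed
  then show ?thesis using gpow_sym[OF gL(1,2), of n] by (auto simp: deg_kernel_def sym_kernel_def case_prod_unfold)
qed

end

section \<open>Sums of one row or of one function on the central limit scale\<close>

lemma exp_abs_integrable_bound: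
  assumes [measurable]: "T \<in> borel_measurable N"
    and "(\<integral>\<^sup>+x. ennreal (exp (T x)) \<partial>N) \<le> ennreal B" "(\<integral>\<^sup>+x. ennreal (exp (- T x)) \<partial>N) \<le> ennreal B" "0 \<le> B"
  shows "integrable N (\<lambda>x. exp \<bar>T x\<bar>)" "(LINT x|N. exp \<bar>T x\<bar>) \<le> 2 * B"
proof -
  have "(\<integral>\<^sup>+x. ennreal (exp \<bar>T x\<bar>) \<partial>N) \<le> (\<integral>\<^sup>+x. ennreal (exp (T x)) + ennreal (exp (- T x)) \<partial>N)"
    by (intro nn_integral_mono) (simp add: ennreal_leI exp_abs_le_cosh flip: ennreal_plus)
  also have "\<dots> \<le> ennreal B + ennreal B" by (subst nn_integral_add) (auto intro: add_mono assms)
  also have "\<dots> = ennreal (2 * B)" using assms(4) by (simp flip: ennreal_plus)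
  finally have le: "(\<integral>\<^sup>+x. ennreal (exp \<bar>T x\<bar>) \<partial>N) \<le> ennreal (2 * B)" .
  show int: "integrable N (\<lambda>x. exp \<bar>T x\<bar>)"
    by (rule integrableI_nonneg) (use le in \<open>auto intro: le_less_trans\<close>)
  have "ennreal (LINT x|N. exp \<bar>T x\<bar>) \<le> ennreal (2 * B)"
    using le by (subst (asm) nn_integral_eq_integral[OF int]) auto
  then show "(LINT x|N. exp \<bar>T x\<bar>) \<le> 2 * B" using assms(4) by (subst (asm) ennreal_le_iff) auto
qed

context sample_space
begin

lemma nn_integral_insert_const:
  fixes f :: "(nat \<Rightarrow> 'a) \<Rightarrow> ennreal"
  assumes "finite J" "i \<notin> J" and f: "f \<in> borel_measurable (Pi\<^sub>M (insert i J) (\<lambda>_. M))"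
    and eq: "\<And>x y. x \<in> space (Pi\<^sub>M J (\<lambda>_. M)) \<Longrightarrow> y \<in> space M \<Longrightarrow> f (x(i := y)) = h x"
  shows "(\<integral>\<^sup>+X. f X \<partial>Pi\<^sub>M (insert i J) (\<lambda>_. M)) = (\<integral>\<^sup>+x. h x \<partial>Pi\<^sub>M J (\<lambda>_. M))"
  unfolding fpow.product_nn_integral_insert[OF assms(1-3)]
proof (rule nn_integral_cong)
  fix x assume x: "x \<in> space (Pi\<^sub>M J (\<lambda>_. M))"
  have "(\<integral>\<^sup>+y. f (x(i := y)) \<partial>M) = (\<integral>\<^sup>+y. h x \<partial>M)" by (rule nn_integral_cong) (rule eq[OF x])
  then show "(\<integral>\<^sup>+y. f (x(i := y)) \<partial>M) = h x" by (simp add: emeasure_space_1)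
qed

text \<open>Given X i, the summands are independent and centred, so the sum over the row is of order
  sqrt N; the bound exp 1 \<le> 3 does not depend on the position of X i.\<close>

lemma row_sum_mgf:
  fixes J :: "nat set" and N :: nat
  assumes K: "deg_kernel M k" and J: "finite J" "i \<notin> J" "card J \<le> N" "0 < N" and t: "\<bar>t\<bar> \<le> 1"
  shows "(\<integral>\<^sup>+X. ennreal (exp (t * ((\<Sum>j\<in>J. k (X i) (X j)) / sqrt N))) \<partial>Pi\<^sub>M (insert i J) (\<lambda>_. M)) \<le> ennreal 3"
proof -
  note km = kernel_component_measurable[OF deg_kernel_measurable[OF K]]
  have m: "(\<lambda>X. ennreal (exp (t * ((\<Sum>j\<in>J. k (X i) (X j)) / sqrt N)))) \<in> borel_measurable (Pi\<^sub>M (insert i J) (\<lambda>_. M))"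
    by (intro measurable_compose[OF _ measurable_ennreal] measurable_compose[OF _ borel_measurable_exp]
        borel_measurable_times borel_measurable_divide borel_measurable_sum km borel_measurable_const) auto
  have s1: "sqrt N \<ge> 1" using J by simp
  have "(\<integral>\<^sup>+X. ennreal (exp (t * ((\<Sum>j\<in>J. k (X i) (X j)) / sqrt N))) \<partial>Pi\<^sub>M (insert i J) (\<lambda>_. M))
    = (\<integral>\<^sup>+y. (\<integral>\<^sup>+x. ennreal (exp (t * ((\<Sum>j\<in>J. k ((x(i := y)) i) ((x(i := y)) j)) / sqrt N))) \<partial>Pi\<^sub>M J (\<lambda>_. M)) \<partial>M)"
    by (rule fpow.product_nn_integral_insert_rev[OF J(1,2) m])
  also have "\<dots> \<le> (\<integral>\<^sup>+y. ennreal 3 \<partial>M)"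
  proof (rule nn_integral_mono)
    fix y assume y: "y \<in> space M"
    \<comment> \<open>The sum over the singleton brings the exponent into the form of
      \<open>subexp_sum_mgf_prod\<close>, with one frozen point.\<close>
    have "(\<integral>\<^sup>+x. ennreal (exp (t * ((\<Sum>j\<in>J. k ((x(i := y)) i) ((x(i := y)) j)) / sqrt N))) \<partial>Pi\<^sub>M J (\<lambda>_. M))
      = (\<integral>\<^sup>+x. ennreal (exp (\<Sum>_\<in>{0 :: nat}. t / sqrt N * (\<Sum>j\<in>J. k y (x j)))) \<partial>Pi\<^sub>M J (\<lambda>_. M))"
    proof (rule nn_integral_cong)
      fix x
      have "(\<Sum>j\<in>J. k ((x(i := y)) i) ((x(i := y)) j)) = (\<Sum>j\<in>J. k y (x j))"
        by (rule sum.cong) (use J in auto)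
      then show "ennreal (exp (t * ((\<Sum>j\<in>J. k ((x(i := y)) i) ((x(i := y)) j)) / sqrt N)))
        = ennreal (exp (\<Sum>_\<in>{0 :: nat}. t / sqrt N * (\<Sum>j\<in>J. k y (x j))))" by simp
    qed
    also have "\<dots> \<le> ennreal (exp ((\<bar>t\<bar> / sqrt N * card {0 :: nat})\<^sup>2 * card J))"
    proof (rule subexp_sum_mgf_prod[OF K J(1), where x = "\<lambda>_. y"])
      have "\<bar>t\<bar> / sqrt N \<le> 1 / 1" using t s1 by (intro frac_le) simp_all
      then show "\<bar>t\<bar> / sqrt N * card {0 :: nat} \<le> 1" by simp
    qed (use y in \<open>auto simp: abs_divide\<close>)
    also have "\<dots> \<le> ennreal 3"
    proof (rule ennreal_leI)
      have "(\<bar>t\<bar> / sqrt N * card {0 :: nat})\<^sup>2 * card J = t\<^sup>2 * (card J / N)"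
        by (simp add: power_divide)
      also have "\<dots> \<le> 1 * 1" using t J by (intro mult_mono) (auto simp: abs_square_le_1)
      finally have "exp ((\<bar>t\<bar> / sqrt N * card {0 :: nat})\<^sup>2 * card J) \<le> exp 1" by simp
      then show "exp ((\<bar>t\<bar> / sqrt N * card {0 :: nat})\<^sup>2 * card J) \<le> 3" using exp_le by linarith
    qed
    finally show "(\<integral>\<^sup>+x. ennreal (exp (t * ((\<Sum>j\<in>J. k ((x(i := y)) i) ((x(i := y)) j)) / sqrt N))) \<partial>Pi\<^sub>M J (\<lambda>_. M)) \<le> ennreal 3" .
  qed
  also have "\<dots> = ennreal 3" by (simp add: emeasure_space_1)
  finally show ?thesis .
qed

lemma single_sum_mgf:
  fixes I J :: "nat set" and N :: nat
  assumes w: "subexp M w" and J: "finite J" "card J \<le> N" "0 < N" and t: "\<bar>t\<bar> \<le> 1"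
  shows "(\<integral>\<^sup>+X. ennreal (exp (t * ((\<Sum>j\<in>J. w (X j)) / sqrt N))) \<partial>Pi\<^sub>M J (\<lambda>_. M)) \<le> ennreal 3"
proof -
  note [measurable] = subexp_measurable[OF w]
  have s1: "sqrt N \<ge> 1" using J by simp
  have "(\<integral>\<^sup>+X. ennreal (exp (t * ((\<Sum>j\<in>J. w (X j)) / sqrt N))) \<partial>Pi\<^sub>M J (\<lambda>_. M))
      = (\<integral>\<^sup>+X. (\<Prod>j\<in>J. ennreal (exp (t / sqrt N * w (X j)))) \<partial>Pi\<^sub>M J (\<lambda>_. M))"
  proof (rule nn_integral_cong)
    fix X
    have "t * ((\<Sum>j\<in>J. w (X j)) / sqrt N) = (\<Sum>j\<in>J. t / sqrt N * w (X j))"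
      by (simp add: sum_distrib_left sum_divide_distrib)
    then show "ennreal (exp (t * ((\<Sum>j\<in>J. w (X j)) / sqrt N))) = (\<Prod>j\<in>J. ennreal (exp (t / sqrt N * w (X j))))"
      using J by (simp only: exp_sum prod_ennreal exp_ge_zero)
  qed
  also have "\<dots> = (\<Prod>j\<in>J. \<integral>\<^sup>+y. ennreal (exp (t / sqrt N * w y)) \<partial>M)"
    by (rule fpow.product_nn_integral_prod[OF J(1)]) measurable
  also have "\<dots> \<le> (\<Prod>j\<in>J. ennreal (exp ((t / sqrt N)\<^sup>2)))"
  proof (intro prod_mono_ennreal subexp_mgf[OF w])
    have "\<bar>t\<bar> / sqrt N \<le> 1 / 1" using t s1 by (intro frac_le) simp_all
    then show "\<bar>t / sqrt N\<bar> \<le> 1" by (simp add: abs_divide)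
  qed
  also have "\<dots> = ennreal (exp ((t / sqrt N)\<^sup>2 * card J))"
    by (subst mult.commute) (simp add: ennreal_power exp_of_nat_mult)
  also have "\<dots> \<le> ennreal 3"
  proof (rule ennreal_leI)
    have "(t / sqrt N)\<^sup>2 * card J = t\<^sup>2 * (card J / N)" by (simp add: power_divide)
    also have "\<dots> \<le> 1 * 1" using t J by (intro mult_mono) (auto simp: abs_square_le_1)
    finally have "exp ((t / sqrt N)\<^sup>2 * card J) \<le> exp 1" by simp
    then show "exp ((t / sqrt N)\<^sup>2 * card J) \<le> 3" using exp_le by linarith
  qed
  finally show ?thesis .
qed

end

section \<open>The cavity equation\<close>

definition pair_sum :: "('a \<Rightarrow> 'a \<Rightarrow> real) \<Rightarrow> nat set \<Rightarrow> (nat \<Rightarrow> 'a) \<Rightarrow> real" where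
  "pair_sum k I X = (\<Sum>i\<in>I. \<Sum>j\<in>I - {i}. k (X i) (X j))"

lemma pair_sum_insert:
  assumes "finite J" "i \<notin> J" "\<And>j. j \<in> J \<Longrightarrow> k (X j) (X i) = k (X i) (X j)"
  shows "pair_sum k (insert i J) X = pair_sum k J X + 2 * (\<Sum>j\<in>J. k (X i) (X j))"
proof -
  have "(\<Sum>j\<in>insert i J - {a}. k (X a) (X j)) = k (X a) (X i) + (\<Sum>j\<in>J - {a}. k (X a) (X j))" if "a \<in> J" for a
  proof -
    have "insert i J - {a} = insert i (J - {a})" using that assms(2) by auto
    then show ?thesis using assms(1,2) by simp
  qed
  then have "pair_sum k (insert i J) X = (\<Sum>j\<in>J. k (X i) (X j)) + (\<Sum>a\<in>J. k (X a) (X i) + (\<Sum>j\<in>J - {a}. k (X a) (X j)))"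
    using assms(1,2) by (simp add: pair_sum_def)
  then show ?thesis using assms(3) by (simp add: pair_sum_def sum.distrib)
qed

lemma double_sum_split:
  fixes a :: "'i \<Rightarrow> 'i \<Rightarrow> real"
  assumes "finite J"
  shows "(\<Sum>i\<in>J. \<Sum>j\<in>J. a i j) = (\<Sum>i\<in>J. \<Sum>j\<in>J - {i}. a i j) + (\<Sum>j\<in>J. a j j)"
proof -
  have "(\<Sum>i\<in>J. \<Sum>j\<in>J. a i j) = (\<Sum>i\<in>J. a i i + (\<Sum>j\<in>J - {i}. a i j))"
    by (rule sum.cong[OF refl]) (rule sum.remove[OF assms])
  then show ?thesis by (simp add: sum.distrib)
qed

lemma (in sample_space) pair_sum_measurable:
  assumes "deg_kernel M k" "J \<subseteq> I"
  shows "pair_sum k J \<in> borel_measurable (Pi\<^sub>M I (\<lambda>_. M))"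
  unfolding pair_sum_def[abs_def]
  by (intro borel_measurable_sum kernel_component_measurable deg_kernel_measurable[OF assms(1)])
    (use assms(2) in auto)

lemma exp_minus_one_le: "\<bar>exp u - 1\<bar> \<le> \<bar>u\<bar> * exp \<bar>u\<bar>" for u :: real
proof (cases "u \<ge> 0")
  case True
  have "1 - u \<le> exp (- u)" using exp_ge_add_one_self[of "- u"] by simp
  then have "exp u * (1 - u) \<le> exp u * exp (- u)" by (intro mult_left_mono) auto
  also have "\<dots> = 1" by (simp add: exp_minus)
  finally have "exp u - 1 \<le> u * exp u" by (simp add: algebra_simps)
  then show ?thesis using True by simp
next
  case False
  have "1 - exp u \<le> - u" using exp_ge_add_one_self[of u] by linarith
  also have "\<dots> \<le> - u * exp (- u)" using False by (simp add: mult_le_cancel_left1)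
  finally show ?thesis using False by simp
qed

text \<open>Particle \<open>i\<close> is singled out and \<open>J\<close> contains the others. The
  observable \<open>k\<close> and its composition \<open>q\<close> with the interaction
  \<open>g\<close> are kept general, so that one computation serves every step from an iterate to
  the next.\<close>

locale cavity = sample_space +
  fixes g k q :: "'a \<Rightarrow> 'a \<Rightarrow> real" and J :: "nat set" and i :: nat and N :: nat and z :: real
  assumes g: "deg_kernel M g" and k: "deg_kernel M k" and q: "deg_kernel M q"
    and q_comp: "\<And>x y. x \<in> space M \<Longrightarrow> y \<in> space M \<Longrightarrow> q x y = kcomp M g k x y"
    and q_diag: "\<And>x. x \<in> space M \<Longrightarrow> \<bar>q x x\<bar> \<le> 1 / 2"
    and J: "finite J" "i \<notin> J" "N = Suc (card J)"
    and z: "\<bar>z\<bar> \<le> 1 / 100"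
begin

definition "\<Omega> = Pi\<^sub>M (insert i J) (\<lambda>_. M)"
definition "\<tau> = (LINT x|M. q x x)"
definition "s = sqrt (real N)"
text \<open>Row sums of the removed particle with the others, divided by s = sqrt N so that their
  exponential moments are bounded uniformly in N.\<close>

definition "h X = (\<Sum>j\<in>J. k (X i) (X j)) / s"
definition "\<gamma> X = (\<Sum>j\<in>J. g (X i) (X j)) / s"
definition "\<rho> X = (\<Sum>j\<in>J. q (X i) (X j)) / s"
text \<open>The fluctuation of the diagonal around the trace. The factor 1/2 makes each summand
  sub-exponential in the normalised sense, as |q - \<tau>| \<le> 1.\<close>

definition "\<delta> X = (\<Sum>j\<in>J. (q (X j) (X j) - \<tau>) / 2) / s"
definition "Q X = pair_sum q (insert i J) X / N"
text \<open>The weight of the particles other than \<open>i\<close>. The full weight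
  \<open>W\<close> differs from it by the factor exp (- z \<gamma> / s), a perturbation of order
  N^(-1/2).\<close>

definition "W1 X = exp (- (z / (2 * N)) * pair_sum g J X)"
definition "W X = exp (- (z / (2 * N)) * pair_sum g (insert i J) X)"
text \<open>A single integrable majorant for all error terms. Its expectation is at most 2 + 6 + 6 +
  6 + 6 + 4 = 30; the divisor 24 is the threshold of \<open>U_statistic_mgf\<close>.\<close>

definition "Y X = W1 X ^ 4 + exp \<bar>h X\<bar> + exp \<bar>\<gamma> X\<bar> + exp \<bar>\<rho> X\<bar> + exp \<bar>\<delta> X\<bar> + exp (\<bar>Q X\<bar> / 24)"

section \<open>Moments of the cavity quantities\<close>

lemma N_pos: "0 < N" using J by simp

lemma s_ge_1: "1 \<le> s" using N_pos by (simp add: s_def)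

lemma s_square: "s * s = N" by (simp add: s_def)

lemma \<Omega>_space: "X \<in> space \<Omega> \<Longrightarrow> j \<in> insert i J \<Longrightarrow> X j \<in> space M"
  by (auto simp: \<Omega>_def space_PiM)

sublocale O: prob_space \<Omega>
  unfolding \<Omega>_def by (rule prob_space_PiM) unfold_locales

lemma \<tau>_le: "\<bar>\<tau>\<bar> \<le> 1 / 2"
proof -
  have [measurable]: "(\<lambda>(x, y). q x y) \<in> borel_measurable (M \<Otimes>\<^sub>M M)" by (rule deg_kernel_measurable[OF q])
  have [measurable]: "(\<lambda>x. q x x) \<in> borel_measurable M" by measurable
  have i: "integrable M (\<lambda>x. q x x)"
    by (rule integrable_const_bound[where B = "1 / 2"]) (use q_diag in auto)
  have "\<bar>\<tau>\<bar> \<le> (LINT x|M. \<bar>q x x\<bar>)" unfolding \<tau>_def by (rule integral_abs_bound)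
  also have "\<dots> \<le> (LINT x|M. 1 / 2)" by (rule integral_mono) (use i q_diag in auto)
  finally show ?thesis by (simp add: prob_space)
qed

lemma diag_subexp: "subexp M (\<lambda>x. (q x x - \<tau>) / 2)"
proof -
  have [measurable]: "(\<lambda>(x, y). q x y) \<in> borel_measurable (M \<Otimes>\<^sub>M M)" by (rule deg_kernel_measurable[OF q])
  have [measurable]: "(\<lambda>x. q x x) \<in> borel_measurable M" by measurable
  have i: "integrable M (\<lambda>x. q x x)"
    by (rule integrable_const_bound[where B = "1 / 2"]) (use q_diag in auto)
  have "(\<integral>\<^sup>+x. ennreal (exp \<bar>(q x x - \<tau>) / 2\<bar>) \<partial>M) \<le> (\<integral>\<^sup>+x. ennreal 2 \<partial>M)"
  proof (intro nn_integral_mono ennreal_leI)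
    fix x assume "x \<in> space M"
    from q_diag[OF this] \<tau>_le abs_triangle_ineq4[of "q x x" \<tau>] have "\<bar>q x x - \<tau>\<bar> \<le> 1" by linarith
    then have "\<bar>(q x x - \<tau>) / 2\<bar> \<le> 1 / 2" by (simp add: abs_divide)
    then have "exp \<bar>(q x x - \<tau>) / 2\<bar> \<le> exp (1 / 2)" by simp
    then show "exp \<bar>(q x x - \<tau>) / 2\<bar> \<le> 2" using exp_half_le2 by linarith
  qed
  then have "(\<integral>\<^sup>+x. ennreal (exp \<bar>(q x x - \<tau>) / 2\<bar>) \<partial>M) \<le> 2" by (simp add: emeasure_space_1)
  moreover have "(LINT x|M. (q x x - \<tau>) / 2) = 0" using i by (simp add: \<tau>_def prob_space)
  ultimately show ?thesis by (simp add: subexp_def)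
qed

lemma row_measurable: "deg_kernel M l \<Longrightarrow> (\<lambda>X. (\<Sum>j\<in>J. l (X i) (X j)) / s) \<in> borel_measurable \<Omega>"
  unfolding \<Omega>_def
  by (intro borel_measurable_divide borel_measurable_sum kernel_component_measurable deg_kernel_measurable
      borel_measurable_const) auto

lemma measurables [measurable]:
  "h \<in> borel_measurable \<Omega>" "\<gamma> \<in> borel_measurable \<Omega>" "\<rho> \<in> borel_measurable \<Omega>" "\<delta> \<in> borel_measurable \<Omega>"
  "Q \<in> borel_measurable \<Omega>" "W1 \<in> borel_measurable \<Omega>" "W \<in> borel_measurable \<Omega>"
proof -
  note [measurable] = pair_sum_measurable[OF g, of J "insert i J", folded \<Omega>_def]
    pair_sum_measurable[OF g, of "insert i J" "insert i J", folded \<Omega>_def]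
    pair_sum_measurable[OF q, of "insert i J" "insert i J", folded \<Omega>_def]
  show "h \<in> borel_measurable \<Omega>" "\<gamma> \<in> borel_measurable \<Omega>" "\<rho> \<in> borel_measurable \<Omega>"
    unfolding h_def[abs_def] \<gamma>_def[abs_def] \<rho>_def[abs_def] by (intro row_measurable g k q)+
  show "\<delta> \<in> borel_measurable \<Omega>"
    unfolding \<delta>_def[abs_def] \<Omega>_def
    by (intro borel_measurable_divide borel_measurable_sum borel_measurable_diff borel_measurable_const
        kernel_component_measurable deg_kernel_measurable[OF q]) auto
  show "Q \<in> borel_measurable \<Omega>" unfolding Q_def[abs_def] by (rule borel_measurable_divide) (auto intro: pair_sum_measurable[OF q, of "insert i J" "insert i J", folded \<Omega>_def])
  show "W1 \<in> borel_measurable \<Omega>" "W \<in> borel_measurable \<Omega>"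
    unfolding W1_def[abs_def] W_def[abs_def]
    by (intro measurable_compose[OF _ borel_measurable_exp] borel_measurable_times borel_measurable_const
        pair_sum_measurable[OF g, folded \<Omega>_def]; auto simp: \<Omega>_def intro: pair_sum_measurable[OF g])+
qed

lemma row_integrable:
  assumes l: "deg_kernel M l"
  shows "integrable \<Omega> (\<lambda>X. exp \<bar>(\<Sum>j\<in>J. l (X i) (X j)) / s\<bar>)"
    "(LINT X|\<Omega>. exp \<bar>(\<Sum>j\<in>J. l (X i) (X j)) / s\<bar>) \<le> 6"
proof -
  have b: "(\<integral>\<^sup>+X. ennreal (exp (t * ((\<Sum>j\<in>J. l (X i) (X j)) / s))) \<partial>\<Omega>) \<le> ennreal 3" if "\<bar>t\<bar> \<le> 1" for t
    unfolding \<Omega>_def s_def by (rule row_sum_mgf[OF l J(1,2)]) (use J that in auto)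
  from exp_abs_integrable_bound[OF row_measurable[OF l], of 3] b[of 1] b[of "- 1"]
  show "integrable \<Omega> (\<lambda>X. exp \<bar>(\<Sum>j\<in>J. l (X i) (X j)) / s\<bar>)"
    "(LINT X|\<Omega>. exp \<bar>(\<Sum>j\<in>J. l (X i) (X j)) / s\<bar>) \<le> 6" by simp_all
qed

lemma Y_integrable: "integrable \<Omega> Y" "(LINT X|\<Omega>. Y X) \<le> 30"
proof -
  have merge: "(\<integral>\<^sup>+X. f X \<partial>\<Omega>) = (\<integral>\<^sup>+x. h x \<partial>Pi\<^sub>M J (\<lambda>_. M))"
    if "f \<in> borel_measurable \<Omega>" "\<And>x y. x \<in> space (Pi\<^sub>M J (\<lambda>_. M)) \<Longrightarrow> y \<in> space M \<Longrightarrow> f (x(i := y)) = h x"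
    for f h
    using that unfolding \<Omega>_def by (intro nn_integral_insert_const J)
  \<comment> \<open>The fourth power of the weight corresponds to the exponent - 2 z, which the
    bound |z| \<le> 1/100 keeps below the threshold 1/24.\<close>
  have Wint: "integrable \<Omega> (\<lambda>X. W1 X ^ 4)" "(LINT X|\<Omega>. W1 X ^ 4) \<le> 2"
  proof -
    have "(\<integral>\<^sup>+X. ennreal (W1 X ^ 4) \<partial>\<Omega>) = (\<integral>\<^sup>+x. ennreal (exp (- 2 * z / N * (\<Sum>a\<in>J. \<Sum>b\<in>J - {a}. g (x a) (x b)))) \<partial>Pi\<^sub>M J (\<lambda>_. M))"
    proof (rule merge)
      fix x y
      have "pair_sum g J (x(i := y)) = (\<Sum>a\<in>J. \<Sum>b\<in>J - {a}. g (x a) (x b))"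
        unfolding pair_sum_def using J(2) by (intro sum.cong refl) auto
      then show "ennreal (W1 (x(i := y)) ^ 4) = ennreal (exp (- 2 * z / N * (\<Sum>a\<in>J. \<Sum>b\<in>J - {a}. g (x a) (x b))))"
        by (simp add: W1_def exp_of_nat_mult[symmetric] flip: exp_of_nat_mult)
    qed measurable
    also have "\<dots> \<le> 2"
      by (rule U_statistic_mgf[OF g J(1)]) (use J z N_pos in auto)
    finally have le: "(\<integral>\<^sup>+X. ennreal (W1 X ^ 4) \<partial>\<Omega>) \<le> ennreal 2" by simp
    show int: "integrable \<Omega> (\<lambda>X. W1 X ^ 4)"
      by (rule integrableI_nonneg) (use le in \<open>auto intro: le_less_trans\<close>)
    have "ennreal (LINT X|\<Omega>. W1 X ^ 4) \<le> ennreal 2"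
      using le by (subst (asm) nn_integral_eq_integral[OF int]) auto
    then show "(LINT X|\<Omega>. W1 X ^ 4) \<le> 2" by (subst (asm) ennreal_le_iff) auto
  qed
  have Dint: "integrable \<Omega> (\<lambda>X. exp \<bar>\<delta> X\<bar>)" "(LINT X|\<Omega>. exp \<bar>\<delta> X\<bar>) \<le> 6"
  proof -
    have b: "(\<integral>\<^sup>+X. ennreal (exp (t * \<delta> X)) \<partial>\<Omega>) \<le> ennreal 3" if t: "\<bar>t\<bar> \<le> 1" for t
    proof -
      have "(\<integral>\<^sup>+X. ennreal (exp (t * \<delta> X)) \<partial>\<Omega>) = (\<integral>\<^sup>+x. ennreal (exp (t * ((\<Sum>j\<in>J. (q (x j) (x j) - \<tau>) / 2) / sqrt N))) \<partial>Pi\<^sub>M J (\<lambda>_. M))"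
      proof (rule merge)
        fix x y
        have "(\<Sum>j\<in>J. (q ((x(i := y)) j) ((x(i := y)) j) - \<tau>) / 2) = (\<Sum>j\<in>J. (q (x j) (x j) - \<tau>) / 2)"
          using J(2) by (intro sum.cong refl) auto
        then show "ennreal (exp (t * \<delta> (x(i := y)))) = ennreal (exp (t * ((\<Sum>j\<in>J. (q (x j) (x j) - \<tau>) / 2) / sqrt N)))"
          by (simp add: \<delta>_def s_def)
      qed measurable
      also have "\<dots> \<le> ennreal 3"
        by (rule single_sum_mgf[OF diag_subexp J(1)]) (use J t in auto)
      finally show ?thesis .
    qed
    from exp_abs_integrable_bound[OF measurables(4), of 3] b[of 1] b[of "- 1"]
    show "integrable \<Omega> (\<lambda>X. exp \<bar>\<delta> X\<bar>)" "(LINT X|\<Omega>. exp \<bar>\<delta> X\<bar>) \<le> 6" by simp_all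
  qed
  have Qint: "integrable \<Omega> (\<lambda>X. exp (\<bar>Q X\<bar> / 24))" "(LINT X|\<Omega>. exp (\<bar>Q X\<bar> / 24)) \<le> 4"
  proof -
    have b: "(\<integral>\<^sup>+X. ennreal (exp (t / N * pair_sum q (insert i J) X)) \<partial>\<Omega>) \<le> 2" if "\<bar>t\<bar> \<le> 1 / 24" for t
      unfolding \<Omega>_def pair_sum_def by (rule U_statistic_mgf[OF q]) (use J that in auto)
    have [measurable]: "(\<lambda>X. Q X / 24) \<in> borel_measurable \<Omega>" by measurable
    from exp_abs_integrable_bound[OF this, of 2] b[of "1 / 24"] b[of "- 1 / 24"]
    show "integrable \<Omega> (\<lambda>X. exp (\<bar>Q X\<bar> / 24))" "(LINT X|\<Omega>. exp (\<bar>Q X\<bar> / 24)) \<le> 4"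
      by (simp_all add: Q_def abs_divide mult.commute)
  qed
  note rows = row_integrable[OF k, folded h_def] row_integrable[OF g, folded \<gamma>_def] row_integrable[OF q, folded \<rho>_def]
  show "integrable \<Omega> Y" unfolding Y_def[abs_def]
    by (intro Bochner_Integration.integrable_add Wint Dint Qint rows)
  show "(LINT X|\<Omega>. Y X) \<le> 30" unfolding Y_def using Wint Dint Qint rows by simp
qed

lemma dominated:
  assumes [measurable]: "f \<in> borel_measurable \<Omega>" and "\<And>X. X \<in> space \<Omega> \<Longrightarrow> \<bar>f X\<bar> \<le> c * Y X"
  shows "integrable \<Omega> f" "\<bar>LINT X|\<Omega>. f X\<bar> \<le> c * (LINT X|\<Omega>. Y X)"
proof -
  have Yi: "integrable \<Omega> (\<lambda>X. c * Y X)" using Y_integrable(1) by simp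
  show int: "integrable \<Omega> f"
    by (rule Bochner_Integration.integrable_bound[OF Yi])
      (use assms in \<open>auto intro!: AE_I2 intro: order_trans[OF _ abs_ge_self]\<close>)
  have "\<bar>LINT X|\<Omega>. f X\<bar> \<le> (LINT X|\<Omega>. \<bar>f X\<bar>)" by (rule integral_abs_bound)
  also have "\<dots> \<le> (LINT X|\<Omega>. c * Y X)" by (rule integral_mono) (use int Yi assms in auto)
  finally show "\<bar>LINT X|\<Omega>. f X\<bar> \<le> c * (LINT X|\<Omega>. Y X)" by simp
qed

lemma W_eq: "X \<in> space \<Omega> \<Longrightarrow> W X = W1 X * exp (- (z / s * \<gamma> X))"
proof -
  assume X: "X \<in> space \<Omega>"
  have "pair_sum g (insert i J) X = pair_sum g J X + 2 * (s * \<gamma> X)"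
    using s_ge_1 by (subst pair_sum_insert[OF J(1,2)]) (use \<Omega>_space[OF X] deg_kernel_sym[OF g] in \<open>auto simp: \<gamma>_def\<close>)
  moreover have "z / (2 * N) * (2 * (s * \<gamma> X)) = z / s * \<gamma> X"
    using s_ge_1 by (simp flip: s_square)
  ultimately show ?thesis unfolding W_def W1_def by (simp add: exp_add[symmetric] algebra_simps)
qed

text \<open>The place where the trace enters. The double sum over \<open>J\<close> includes the
  diagonal, which concentrates at \<tau>; adding particle \<open>i\<close> to obtain
  \<open>Q\<close> costs the row sum \<rho>, and the correction by \<tau> / s comes from
  \<open>J\<close> having N - 1 elements.\<close>

lemma full_sum_eq:
  assumes X: "X \<in> space \<Omega>"
  shows "(\<Sum>a\<in>J. \<Sum>b\<in>J. q (X a) (X b)) / N = Q X + \<tau> + (2 * \<delta> X - 2 * \<rho> X - \<tau> / s) / s"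
proof -
  have D: "(\<Sum>j\<in>J. q (X j) (X j)) = 2 * (s * \<delta> X) + card J * \<tau>"
  proof -
    have "(\<Sum>j\<in>J. (q (X j) (X j) - \<tau>) / 2) = (\<Sum>j\<in>J. q (X j) (X j) - \<tau>) / 2"
      by (rule sum_divide_distrib[symmetric])
    then have "2 * (s * \<delta> X) = (\<Sum>j\<in>J. q (X j) (X j) - \<tau>)" unfolding \<delta>_def using s_ge_1 by simp
    then show ?thesis by (simp add: sum_subtractf)
  qed
  have "pair_sum q (insert i J) X = pair_sum q J X + 2 * (s * \<rho> X)"
    using s_ge_1 by (subst pair_sum_insert[OF J(1,2)]) (use \<Omega>_space[OF X] deg_kernel_sym[OF q] in \<open>auto simp: \<rho>_def\<close>)
  then have "N * Q X = pair_sum q J X + 2 * (s * \<rho> X)" using N_pos by (simp add: Q_def)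
  then have "(\<Sum>a\<in>J. \<Sum>b\<in>J. q (X a) (X b)) = N * Q X - 2 * (s * \<rho> X) + (2 * (s * \<delta> X) + card J * \<tau>)"
    unfolding double_sum_split[OF J(1)] D[symmetric] pair_sum_def by simp
  also have "real (card J) = s * s - 1" using J(3) s_square by simp
  finally have e: "(\<Sum>a\<in>J. \<Sum>b\<in>J. q (X a) (X b)) = s * s * Q X - 2 * (s * \<rho> X) + (2 * (s * \<delta> X) + (s * s - 1) * \<tau>)"
    by (simp add: s_square)
  show ?thesis unfolding e s_square[symmetric] using s_ge_1 by (simp add: field_simps)
qed

lemma Y_parts:
  "0 \<le> W1 X" "W1 X ^ 4 \<le> Y X" "1 \<le> Y X" "\<bar>h X\<bar> ^ 4 \<le> 16 ^ 4 * Y X" "(\<bar>\<gamma> X\<bar>\<^sup>2 * exp (\<bar>\<gamma> X\<bar> / 100)) ^ 4 \<le> 16 ^ 8 * Y X"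
  "(\<bar>\<gamma> X\<bar> * exp (\<bar>\<gamma> X\<bar> / 100)) ^ 4 \<le> 16 ^ 4 * Y X" "\<bar>\<rho> X\<bar> ^ 4 \<le> 16 ^ 4 * Y X" "\<bar>\<delta> X\<bar> ^ 4 \<le> 16 ^ 4 * Y X"
  "(\<bar>Q X\<bar> + 1) ^ 4 \<le> 96 ^ 4 * Y X"
proof -
  have nn: "0 \<le> W1 X ^ 4" "0 < exp \<bar>h X\<bar>" "0 < exp \<bar>\<gamma> X\<bar>" "1 \<le> exp \<bar>\<rho> X\<bar>" "0 < exp \<bar>\<delta> X\<bar>" "0 < exp (\<bar>Q X\<bar> / 24)"
    by (simp_all add: W1_def)
  show "0 \<le> W1 X" by (simp add: W1_def)
  show "W1 X ^ 4 \<le> Y X" "1 \<le> Y X" using nn unfolding Y_def by linarith+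
  have Yge: "exp \<bar>h X\<bar> \<le> Y X" "exp \<bar>\<gamma> X\<bar> \<le> Y X" "exp \<bar>\<rho> X\<bar> \<le> Y X" "exp \<bar>\<delta> X\<bar> \<le> Y X" "exp (\<bar>Q X\<bar> / 24) \<le> Y X"
    using nn unfolding Y_def by linarith+
  have p4: "x ^ 4 \<le> 16 ^ 4 * Y X" if "0 \<le> x" "exp x \<le> Y X" for x
  proof -
    have "x ^ 4 \<le> 16 ^ 4 * exp (real 4 * x / 16)" by (rule power_le_exp_scaled) (use that in auto)
    also have "\<dots> \<le> 16 ^ 4 * exp x" using that by simp
    also have "\<dots> \<le> 16 ^ 4 * Y X" using that by simp
    finally show ?thesis .
  qed
  show "\<bar>h X\<bar> ^ 4 \<le> 16 ^ 4 * Y X" "\<bar>\<rho> X\<bar> ^ 4 \<le> 16 ^ 4 * Y X" "\<bar>\<delta> X\<bar> ^ 4 \<le> 16 ^ 4 * Y X"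
    by (intro p4 abs_ge_zero Yge)+
  define c where "c = \<bar>\<gamma> X\<bar>"
  have c: "0 \<le> c" "exp c \<le> Y X" using Yge by (simp_all add: c_def)
  have pc: "(c ^ n * exp (c / 100)) ^ 4 \<le> 16 ^ (4 * n) * Y X" if n: "n = 1 \<or> n = 2" for n
  proof -
    have "(c ^ n * exp (c / 100)) ^ 4 = c ^ (4 * n) * exp (c / 25)"
      by (simp add: power_mult_distrib exp_of_nat_mult[symmetric] power_mult[symmetric] mult.commute)
    also have "\<dots> \<le> 16 ^ (4 * n) * exp (real (4 * n) * c / 16) * exp (c / 25)"
      using n c by (intro mult_right_mono power_le_exp_scaled) auto
    also have "\<dots> = 16 ^ (4 * n) * exp (real (4 * n) * c / 16 + c / 25)" by (simp add: exp_add)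
    also have "\<dots> \<le> 16 ^ (4 * n) * exp c" using n c(1) by (intro mult_left_mono) auto
    also have "\<dots> \<le> 16 ^ (4 * n) * Y X" using c by simp
    finally show ?thesis .
  qed
  show "(\<bar>\<gamma> X\<bar>\<^sup>2 * exp (\<bar>\<gamma> X\<bar> / 100)) ^ 4 \<le> 16 ^ 8 * Y X" using pc[of 2] by (simp add: c_def)
  show "(\<bar>\<gamma> X\<bar> * exp (\<bar>\<gamma> X\<bar> / 100)) ^ 4 \<le> 16 ^ 4 * Y X" using pc[of 1] by (simp add: c_def)
  have "\<bar>Q X\<bar> + 1 \<le> 96 * exp (\<bar>Q X\<bar> / 96)"
    using exp_ge_add_one_self[of "\<bar>Q X\<bar> / 96"] by linarith
  then have "(\<bar>Q X\<bar> + 1) ^ 4 \<le> (96 * exp (\<bar>Q X\<bar> / 96)) ^ 4" by (intro power_mono) auto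
  also have "\<dots> = 96 ^ 4 * exp (\<bar>Q X\<bar> / 24)"
    by (simp add: power_mult_distrib exp_of_nat_mult[symmetric])
  also have "\<dots> \<le> 96 ^ 4 * Y X" using Yge by simp
  finally show "(\<bar>Q X\<bar> + 1) ^ 4 \<le> 96 ^ 4 * Y X" .
qed

lemma powers_of_16: "(16 :: real) ^ 4 = 65536" "(16 :: real) ^ 5 = 1048576" "(16 :: real) ^ 8 = 4294967296"
    "(16 :: real) ^ 9 = 68719476736" "(96 :: real) ^ 4 = 84934656"
  by simp_all

text \<open>\<open>young3\<close> splits each product into fourth powers, and each of these is
  bounded by a multiple of the majorant. The constants are powers of 16 for uniformity and are far
  from sharp.\<close>

lemma products_le:
  "W1 X * \<bar>h X\<bar> * (\<bar>\<gamma> X\<bar>\<^sup>2 * exp (\<bar>\<gamma> X\<bar> / 100)) \<le> 2 * 16 ^ 8 * Y X"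
  "W1 X * (\<bar>Q X\<bar> + 1) * (\<bar>\<gamma> X\<bar> * exp (\<bar>\<gamma> X\<bar> / 100)) \<le> 16 ^ 8 * Y X"
  "W1 X * \<bar>h X\<bar> \<le> 16 ^ 8 * Y X" "W1 X * \<bar>\<rho> X\<bar> \<le> 16 ^ 5 * Y X" "W1 X * \<bar>\<delta> X\<bar> \<le> 16 ^ 5 * Y X"
  "W1 X \<le> 16 * Y X" "W1 X * \<bar>h X\<bar> * \<bar>\<gamma> X\<bar> \<le> 16 ^ 8 * Y X" "W1 X * (\<bar>Q X\<bar> + 1) \<le> 16 ^ 8 * Y X"
proof -
  note P = Y_parts[of X]
  have g4: "\<bar>\<gamma> X\<bar> ^ 4 \<le> 16 ^ 4 * Y X"
  proof (rule order_trans[OF power_mono P(6)])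
    show "\<bar>\<gamma> X\<bar> \<le> \<bar>\<gamma> X\<bar> * exp (\<bar>\<gamma> X\<bar> / 100)" by (simp add: mult_le_cancel_left1)
  qed simp
  show "W1 X * \<bar>h X\<bar> * (\<bar>\<gamma> X\<bar>\<^sup>2 * exp (\<bar>\<gamma> X\<bar> / 100)) \<le> 2 * 16 ^ 8 * Y X"
    using young3[of "W1 X" "\<bar>h X\<bar>" "\<bar>\<gamma> X\<bar>\<^sup>2 * exp (\<bar>\<gamma> X\<bar> / 100)"] P unfolding powers_of_16 by linarith
  show "W1 X * (\<bar>Q X\<bar> + 1) * (\<bar>\<gamma> X\<bar> * exp (\<bar>\<gamma> X\<bar> / 100)) \<le> 16 ^ 8 * Y X"
    using young3[of "W1 X" "\<bar>Q X\<bar> + 1" "\<bar>\<gamma> X\<bar> * exp (\<bar>\<gamma> X\<bar> / 100)"] P unfolding powers_of_16 by linarith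
  show "W1 X * \<bar>h X\<bar> \<le> 16 ^ 8 * Y X" using young3[of "W1 X" "\<bar>h X\<bar>" 1] P unfolding powers_of_16 power_one mult_1_right by linarith
  show "W1 X * \<bar>\<rho> X\<bar> \<le> 16 ^ 5 * Y X" using young3[of "W1 X" "\<bar>\<rho> X\<bar>" 1] P unfolding powers_of_16 power_one mult_1_right by linarith
  show "W1 X * \<bar>\<delta> X\<bar> \<le> 16 ^ 5 * Y X" using young3[of "W1 X" "\<bar>\<delta> X\<bar>" 1] P unfolding powers_of_16 power_one mult_1_right by linarith
  show "W1 X \<le> 16 * Y X" using young3[of "W1 X" 1 1] P unfolding powers_of_16 power_one mult_1_right by linarith
  show "W1 X * \<bar>h X\<bar> * \<bar>\<gamma> X\<bar> \<le> 16 ^ 8 * Y X"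
    using young3[of "W1 X" "\<bar>h X\<bar>" "\<bar>\<gamma> X\<bar>"] P g4 unfolding powers_of_16 by linarith
  show "W1 X * (\<bar>Q X\<bar> + 1) \<le> 16 ^ 8 * Y X" using young3[of "W1 X" "\<bar>Q X\<bar> + 1" 1] P unfolding powers_of_16 power_one mult_1_right by linarith
qed

lemma error_le: "\<bar>2 * \<delta> X - 2 * \<rho> X - \<tau> / s\<bar> \<le> 2 * \<bar>\<delta> X\<bar> + 2 * \<bar>\<rho> X\<bar> + \<bar>\<tau>\<bar>"
proof -
  have "\<bar>\<tau> / s\<bar> \<le> \<bar>\<tau>\<bar> / 1" unfolding abs_divide using s_ge_1 by (intro divide_mono) auto
  then show ?thesis
    using abs_triangle_ineq4[of "2 * \<delta> X - 2 * \<rho> X" "\<tau> / s"] abs_triangle_ineq4[of "2 * \<delta> X" "2 * \<rho> X"]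
    by (simp add: abs_mult)
qed

text \<open>The expansion of the residual below in powers of the interaction with particle \<open>i\<close>: degeneracy
  makes \<open>F0\<close> integrate to zero, and integrating out particle \<open>i\<close> turns \<open>h * \<gamma>\<close> into the average of
  the composed kernel \<open>q\<close>, so that \<open>F1\<close> integrates to zero as well.\<close>

definition "F0 X = s * h X * W1 X"
definition "F1 X = z * h X * \<gamma> X * W1 X - z * ((\<Sum>a\<in>J. \<Sum>b\<in>J. q (X a) (X b)) / N) * W1 X"

section \<open>The expansion in the interaction with one particle\<close>

lemma F_integrable: "integrable \<Omega> F0" "integrable \<Omega> F1"
proof -
  have m: "(\<lambda>X. (\<Sum>a\<in>J. \<Sum>b\<in>J. q (X a) (X b)) / N) \<in> borel_measurable \<Omega>"
    unfolding \<Omega>_def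
    by (intro borel_measurable_divide borel_measurable_sum borel_measurable_const
        kernel_component_measurable deg_kernel_measurable[OF q]) auto
  note [measurable] = m
  show "integrable \<Omega> F0"
  proof (rule dominated)
    show "F0 \<in> borel_measurable \<Omega>" unfolding F0_def[abs_def] by measurable
    fix X
    have "\<bar>F0 X\<bar> = s * (W1 X * \<bar>h X\<bar>)" using s_ge_1 Y_parts(1)[of X] by (simp add: F0_def abs_mult)
    also have "\<dots> \<le> s * (16 ^ 8 * Y X)" using products_le(3)[of X] s_ge_1 by (intro mult_left_mono) auto
    finally show "\<bar>F0 X\<bar> \<le> (s * 16 ^ 8) * Y X" by simp
  qed
  show "integrable \<Omega> F1"
  proof (rule dominated)
    show "F1 \<in> borel_measurable \<Omega>" unfolding F1_def[abs_def] by measurable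
    fix X assume X: "X \<in> space \<Omega>"
    let ?S = "(\<Sum>a\<in>J. \<Sum>b\<in>J. q (X a) (X b)) / N"
    have w0: "0 \<le> W1 X" by (rule Y_parts)
    have "\<bar>?S\<bar> \<le> \<bar>Q X\<bar> + \<bar>\<tau>\<bar> + \<bar>2 * \<delta> X - 2 * \<rho> X - \<tau> / s\<bar> / s"
      unfolding full_sum_eq[OF X] using s_ge_1 by (simp add: abs_divide order_trans[OF abs_triangle_ineq])
    also have "\<bar>2 * \<delta> X - 2 * \<rho> X - \<tau> / s\<bar> / s \<le> \<bar>2 * \<delta> X - 2 * \<rho> X - \<tau> / s\<bar> / 1"
      using s_ge_1 by (intro divide_left_mono) auto
    also have "\<dots> \<le> 2 * \<bar>\<delta> X\<bar> + 2 * \<bar>\<rho> X\<bar> + \<bar>\<tau>\<bar>"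
      using error_le[of X] by simp
    finally have S: "\<bar>?S\<bar> \<le> (\<bar>Q X\<bar> + 1) + 2 * \<bar>\<delta> X\<bar> + 2 * \<bar>\<rho> X\<bar>" using \<tau>_le by linarith
    have "\<bar>F1 X\<bar> \<le> \<bar>z * h X * \<gamma> X * W1 X\<bar> + \<bar>z * ?S * W1 X\<bar>" unfolding F1_def by (rule abs_triangle_ineq4)
    also have "\<dots> = \<bar>z\<bar> * (W1 X * \<bar>h X\<bar> * \<bar>\<gamma> X\<bar> + W1 X * \<bar>?S\<bar>)"
      using w0 by (simp add: abs_mult algebra_simps)
    also have "\<dots> \<le> 1 * (W1 X * \<bar>h X\<bar> * \<bar>\<gamma> X\<bar> + W1 X * \<bar>?S\<bar>)"
      using z w0 by (intro mult_right_mono) auto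
    also have "\<dots> \<le> W1 X * \<bar>h X\<bar> * \<bar>\<gamma> X\<bar> + W1 X * ((\<bar>Q X\<bar> + 1) + 2 * \<bar>\<delta> X\<bar> + 2 * \<bar>\<rho> X\<bar>)"
      using mult_left_mono[OF S w0] by simp
    also have "\<dots> = W1 X * \<bar>h X\<bar> * \<bar>\<gamma> X\<bar> + W1 X * (\<bar>Q X\<bar> + 1) + 2 * (W1 X * \<bar>\<delta> X\<bar>) + 2 * (W1 X * \<bar>\<rho> X\<bar>)"
      by (simp add: algebra_simps)
    also have "\<dots> \<le> 16 ^ 9 * Y X"
      using products_le[of X] Y_parts(3)[of X] unfolding powers_of_16 by linarith
    finally show "\<bar>F1 X\<bar> \<le> 16 ^ 9 * Y X" .
  qed
qed

text \<open>\<open>W1\<close> does not depend on X i, so particle \<open>i\<close> can be integrated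
  out first. The products of g and k average to \<open>q\<close> for all pairs a, b including a = b,
  which is why \<open>F1\<close> subtracts the full double sum.\<close>

lemma F_mean_zero: "(LINT X|\<Omega>. F0 X) = 0" "(LINT X|\<Omega>. F1 X) = 0"
proof -
  have sumJ: "(\<Sum>j\<in>J. l ((x(i := y)) i) ((x(i := y)) j)) = (\<Sum>j\<in>J. l y (x j))" for l :: "'a \<Rightarrow> 'a \<Rightarrow> real" and x y
    using J(2) by (intro sum.cong refl) auto
  have W1J: "W1 (x(i := y)) = W1 x" for x y
    unfolding W1_def pair_sum_def using J(2) by (intro arg_cong[where f = exp] arg_cong2[where f = "(*)"] refl sum.cong) auto
  have QJ: "(\<Sum>a\<in>J. \<Sum>b\<in>J. q ((x(i := y)) a) ((x(i := y)) b)) = (\<Sum>a\<in>J. \<Sum>b\<in>J. q (x a) (x b))" for x y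
    using J(2) by (intro sum.cong refl) auto
  have xs: "x j \<in> space M" if "x \<in> space (Pi\<^sub>M J (\<lambda>_. M))" "j \<in> J" for x j
    using that by (auto simp: space_PiM)
  have "(LINT X|\<Omega>. F0 X) = (LINT x|Pi\<^sub>M J (\<lambda>_. M). LINT y|M. F0 (x(i := y)))"
    using F_integrable(1) unfolding \<Omega>_def by (rule fpow.product_integral_insert[OF J(1,2)])
  also have "\<dots> = (LINT x|Pi\<^sub>M J (\<lambda>_. M). 0)"
  proof (rule Bochner_Integration.integral_cong[OF refl])
    fix x assume x: "x \<in> space (Pi\<^sub>M J (\<lambda>_. M))"
    have "F0 (x(i := y)) = (\<Sum>j\<in>J. k y (x j)) * W1 x" for y
      unfolding F0_def h_def sumJ W1J using s_ge_1 by simp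
    then have "(LINT y|M. F0 (x(i := y))) = (LINT y|M. (\<Sum>j\<in>J. k y (x j))) * W1 x" by simp
    also have "(LINT y|M. (\<Sum>j\<in>J. k y (x j))) = (\<Sum>j\<in>J. LINT y|M. k y (x j))"
      by (rule Bochner_Integration.integral_sum) (rule subexp_integrable[OF deg_kernel_subexp[OF k xs[OF x]]])
    also have "\<dots> = 0"
      using deg_kernel_subexp[OF k xs[OF x]] by (intro sum.neutral) (auto simp: subexp_def)
    finally show "(LINT y|M. F0 (x(i := y))) = 0" by (simp only: mult_zero_left)
  qed
  finally show "(LINT X|\<Omega>. F0 X) = 0" by simp
  have "(LINT X|\<Omega>. F1 X) = (LINT x|Pi\<^sub>M J (\<lambda>_. M). LINT y|M. F1 (x(i := y)))"
    using F_integrable(2) unfolding \<Omega>_def by (rule fpow.product_integral_insert[OF J(1,2)])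
  also have "\<dots> = (LINT x|Pi\<^sub>M J (\<lambda>_. M). 0)"
  proof (rule Bochner_Integration.integral_cong[OF refl])
    fix x assume x: "x \<in> space (Pi\<^sub>M J (\<lambda>_. M))"
    let ?c = "z / N * W1 x"
    let ?q = "\<Sum>a\<in>J. \<Sum>b\<in>J. q (x a) (x b)"
    have kg: "integrable M (\<lambda>y. g y (x a) * k y (x b))" if "a \<in> J" "b \<in> J" for a b
      by (rule L2_fun_mult_integrable) (intro subexp_moments(4) deg_kernel_subexp g k xs[OF x] that)+
    have "F1 (x(i := y)) = ?c * (\<Sum>a\<in>J. \<Sum>b\<in>J. g y (x a) * k y (x b)) - ?c * ?q" for y
    proof -
      have "F1 (x(i := y)) = z * ((\<Sum>j\<in>J. k y (x j)) / s) * ((\<Sum>j\<in>J. g y (x j)) / s) * W1 x - z * (?q / N) * W1 x"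
        unfolding F1_def h_def \<gamma>_def sumJ W1J QJ ..
      also have "z * ((\<Sum>j\<in>J. k y (x j)) / s) * ((\<Sum>j\<in>J. g y (x j)) / s) * W1 x
          = ?c * ((\<Sum>j\<in>J. g y (x j)) * (\<Sum>j\<in>J. k y (x j)))"
        by (simp flip: s_square)
      also have "z * (?q / N) * W1 x = ?c * ?q" by simp
      finally show ?thesis unfolding sum_product .
    qed
    then have "(LINT y|M. F1 (x(i := y))) = (LINT y|M. ?c * (\<Sum>a\<in>J. \<Sum>b\<in>J. g y (x a) * k y (x b)) - ?c * ?q)"
      by simp
    also have "\<dots> = ?c * (LINT y|M. (\<Sum>a\<in>J. \<Sum>b\<in>J. g y (x a) * k y (x b))) - ?c * ?q"
      using kg by (subst Bochner_Integration.integral_diff)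
        (auto intro!: integrable_mult_right Bochner_Integration.integrable_sum simp: prob_space)
    also have "(LINT y|M. (\<Sum>a\<in>J. \<Sum>b\<in>J. g y (x a) * k y (x b))) = (\<Sum>a\<in>J. \<Sum>b\<in>J. LINT y|M. g y (x a) * k y (x b))"
      using kg by (simp add: Bochner_Integration.integral_sum Bochner_Integration.integrable_sum)
    also have "\<dots> = ?q"
    proof (intro sum.cong refl)
      fix a b assume ab: "a \<in> J" "b \<in> J"
      have "(LINT y|M. g y (x a) * k y (x b)) = kcomp M g k (x a) (x b)"
        unfolding kcomp_def
        by (rule Bochner_Integration.integral_cong[OF refl]) (use deg_kernel_sym[OF g] xs[OF x ab(1)] in simp)
      then show "(LINT y|M. g y (x a) * k y (x b)) = q (x a) (x b)" using q_comp xs[OF x] ab by simp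
    qed
    finally show "(LINT y|M. F1 (x(i := y))) = 0" by (simp only: diff_self)
  qed
  finally show "(LINT X|\<Omega>. F1 X) = 0" by simp
qed

text \<open>One particle's share of the loop equation: summed over \<open>i\<close>, the terms
  \<open>s * h\<close> give N times the U-statistic of \<open>k\<close>.\<close>

definition "resid X = (s * h X + z * Q X + z * \<tau>) * W X"

text \<open>Three contributions, each of order 1 / s: the second-order remainder of the exponential,
  where the prefactor s meets (\<gamma> / s)^2; the replacement of \<open>W\<close> by
  \<open>W1\<close> in terms of order one; and the difference between the full double sum and Q +
  \<tau>.\<close>

lemma error_bound:
  assumes X: "X \<in> space \<Omega>"
  shows "\<bar>resid X - F0 X + F1 X\<bar> \<le> 16 ^ 9 / s * Y X"
proof -
  let ?v = "z / s * \<gamma> X"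
  let ?e = "2 * \<delta> X - 2 * \<rho> X - \<tau> / s"
  have s0: "s > 0" using s_ge_1 by simp
  have w0: "0 \<le> W1 X" by (rule Y_parts)
  have "resid X - F0 X + F1 X = s * h X * W1 X * psi (- ?v) + z * (Q X + \<tau>) * (W X - W1 X) - z * (?e / s) * W1 X"
  proof -
    define u where "u = z / s"
    have su: "s * u = z" using s0 by (simp add: u_def)
    have "W X = W1 X * (1 - u * \<gamma> X + psi (- (u * \<gamma> X)))" unfolding W_eq[OF X] psi_def u_def by simp
    then have "s * h X * W X = s * h X * (W1 X * (1 - u * \<gamma> X + psi (- (u * \<gamma> X))))" by (rule arg_cong)
    also have "\<dots> = F0 X - (s * u) * h X * \<gamma> X * W1 X + s * h X * W1 X * psi (- (u * \<gamma> X))"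
      by (simp add: F0_def algebra_simps)
    finally have hW: "s * h X * W X = F0 X - z * h X * \<gamma> X * W1 X + s * h X * W1 X * psi (- ?v)"
      unfolding su unfolding u_def .
    have "F1 X = z * h X * \<gamma> X * W1 X - z * (Q X + \<tau> + ?e / s) * W1 X"
      unfolding F1_def full_sum_eq[OF X] ..
    with hW show ?thesis unfolding resid_def by (simp add: algebra_simps)
  qed
  moreover have "\<bar>s * h X * W1 X * psi (- ?v)\<bar> \<le> (2 * 16 ^ 8 * Y X) / s"
  proof -
    have v: "\<bar>?v\<bar> \<le> \<bar>\<gamma> X\<bar> / 100"
    proof -
      have "\<bar>?v\<bar> = \<bar>z\<bar> / s * \<bar>\<gamma> X\<bar>" using s0 by (simp add: abs_mult)
      also have "\<dots> \<le> (1 / 100) / 1 * \<bar>\<gamma> X\<bar>" using z s_ge_1 by (intro mult_right_mono frac_le) auto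
      finally show ?thesis by simp
    qed
    have v2: "?v\<^sup>2 \<le> \<bar>\<gamma> X\<bar>\<^sup>2 / (s * s)"
    proof -
      have "?v\<^sup>2 = z\<^sup>2 * (\<bar>\<gamma> X\<bar>\<^sup>2 / (s * s))" by (simp add: power_mult_distrib power_divide power2_eq_square)
      also have "\<dots> \<le> 1 * (\<bar>\<gamma> X\<bar>\<^sup>2 / (s * s))" using z by (intro mult_right_mono) (auto simp: abs_square_le_1)
      finally show ?thesis by simp
    qed
    have "psi (- ?v) \<le> (- ?v)\<^sup>2 * exp \<bar>- ?v\<bar>" by (rule psi_abs_le)
    also have "\<dots> = ?v\<^sup>2 * exp \<bar>?v\<bar>" by simp
    also have "\<dots> \<le> \<bar>\<gamma> X\<bar>\<^sup>2 / (s * s) * exp (\<bar>\<gamma> X\<bar> / 100)" using v v2 by (intro mult_mono) auto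
    finally have p: "psi (- ?v) \<le> \<bar>\<gamma> X\<bar>\<^sup>2 / (s * s) * exp (\<bar>\<gamma> X\<bar> / 100)" .
    have "\<bar>s * h X * W1 X * psi (- ?v)\<bar> = s * \<bar>h X\<bar> * W1 X * psi (- ?v)"
      using s0 w0 psi_nonneg[of "- ?v"] by (simp add: abs_mult)
    also have "\<dots> \<le> s * \<bar>h X\<bar> * W1 X * (\<bar>\<gamma> X\<bar>\<^sup>2 / (s * s) * exp (\<bar>\<gamma> X\<bar> / 100))"
      using s0 w0 by (intro mult_left_mono p) auto
    also have "\<dots> = W1 X * \<bar>h X\<bar> * (\<bar>\<gamma> X\<bar>\<^sup>2 * exp (\<bar>\<gamma> X\<bar> / 100)) / s"
      using s0 by (simp add: field_simps)
    also have "\<dots> \<le> (2 * 16 ^ 8 * Y X) / s" using products_le(1)[of X] s0 by (intro divide_right_mono) auto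
    finally show ?thesis .
  qed
  moreover have "\<bar>z * (Q X + \<tau>) * (W X - W1 X)\<bar> \<le> (16 ^ 8 * Y X) / s"
  proof -
    have "\<bar>exp (- ?v) - 1\<bar> \<le> \<bar>- ?v\<bar> * exp \<bar>- ?v\<bar>" by (rule exp_minus_one_le)
    also have "\<dots> = \<bar>?v\<bar> * exp \<bar>?v\<bar>" by simp
    also have "\<dots> \<le> (\<bar>\<gamma> X\<bar> / s) * exp (\<bar>\<gamma> X\<bar> / 100)"
    proof (rule mult_mono)
      have "\<bar>?v\<bar> = \<bar>z\<bar> * (\<bar>\<gamma> X\<bar> / s)" using s0 by (simp add: abs_mult)
      moreover have "\<bar>z\<bar> * (\<bar>\<gamma> X\<bar> / s) \<le> 1 * (\<bar>\<gamma> X\<bar> / s)" using z s0 by (intro mult_right_mono) auto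
      moreover have "\<bar>z\<bar> * (\<bar>\<gamma> X\<bar> / s) \<le> 1 / 100 * (\<bar>\<gamma> X\<bar> / 1)"
        using z s_ge_1 by (intro mult_mono divide_left_mono) auto
      ultimately show "\<bar>?v\<bar> \<le> \<bar>\<gamma> X\<bar> / s" "exp \<bar>?v\<bar> \<le> exp (\<bar>\<gamma> X\<bar> / 100)" by simp_all
    qed (use s0 in auto)
    finally have e: "\<bar>exp (- ?v) - 1\<bar> \<le> (\<bar>\<gamma> X\<bar> / s) * exp (\<bar>\<gamma> X\<bar> / 100)" .
    have "\<bar>z * (Q X + \<tau>) * (W X - W1 X)\<bar> = \<bar>z\<bar> * (W1 X * \<bar>Q X + \<tau>\<bar> * \<bar>exp (- ?v) - 1\<bar>)"
    proof -
      have "W X - W1 X = W1 X * (exp (- ?v) - 1)" unfolding W_eq[OF X] by (simp add: algebra_simps)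
      then show ?thesis using w0 by (simp add: abs_mult)
    qed
    also have "\<dots> \<le> 1 * (W1 X * (\<bar>Q X\<bar> + 1) * ((\<bar>\<gamma> X\<bar> / s) * exp (\<bar>\<gamma> X\<bar> / 100)))"
      using z w0 e \<tau>_le by (intro mult_mono) auto
    also have "\<dots> = W1 X * (\<bar>Q X\<bar> + 1) * (\<bar>\<gamma> X\<bar> * exp (\<bar>\<gamma> X\<bar> / 100)) / s" by simp
    also have "\<dots> \<le> (16 ^ 8 * Y X) / s" using products_le(2)[of X] s0 by (intro divide_right_mono) auto
    finally show ?thesis .
  qed
  moreover have "\<bar>z * (?e / s) * W1 X\<bar> \<le> (16 ^ 8 * Y X) / s"
  proof -
    have "\<bar>?e\<bar> \<le> 2 * \<bar>\<delta> X\<bar> + 2 * \<bar>\<rho> X\<bar> + 1"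
      using error_le[of X] \<tau>_le by linarith
    then have "W1 X * \<bar>?e\<bar> \<le> W1 X * (2 * \<bar>\<delta> X\<bar> + 2 * \<bar>\<rho> X\<bar> + 1)" by (rule mult_left_mono[OF _ w0])
    also have "\<dots> = 2 * (W1 X * \<bar>\<delta> X\<bar>) + 2 * (W1 X * \<bar>\<rho> X\<bar>) + W1 X" by (simp add: algebra_simps)
    also have "\<dots> \<le> 16 ^ 8 * Y X" using products_le[of X] Y_parts(3)[of X] unfolding powers_of_16 by linarith
    finally have le: "W1 X * \<bar>?e\<bar> \<le> 16 ^ 8 * Y X" .
    have "\<bar>z * (?e / s) * W1 X\<bar> = \<bar>z\<bar> * (W1 X * \<bar>?e\<bar> / s)" using s0 w0 by (simp add: abs_mult)
    also have "\<dots> \<le> 1 * (16 ^ 8 * Y X / s)"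
      by (rule mult_mono[OF _ divide_right_mono[OF le]]) (use z s0 w0 in auto)
    finally show ?thesis by simp
  qed
  ultimately have "\<bar>resid X - F0 X + F1 X\<bar> \<le> (2 * 16 ^ 8 * Y X) / s + (16 ^ 8 * Y X) / s + (16 ^ 8 * Y X) / s"
    by linarith
  also have "\<dots> \<le> 16 ^ 9 / s * Y X"
  proof -
    have y: "0 \<le> Y X / s" using Y_parts(3)[of X] s0 by (simp add: order_trans)
    have "(2 * 16 ^ 8 * Y X) / s + (16 ^ 8 * Y X) / s + (16 ^ 8 * Y X) / s = 4 * 16 ^ 8 * (Y X / s)" by simp
    also have "\<dots> \<le> 16 ^ 9 * (Y X / s)" using y unfolding powers_of_16 by linarith
    also have "\<dots> = 16 ^ 9 / s * Y X" by simp
    finally show ?thesis .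
  qed
  finally show ?thesis .
qed

lemma cavity_equation:
  "integrable \<Omega> resid" "\<bar>LINT X|\<Omega>. resid X\<bar> \<le> 16 ^ 9 * 30 / sqrt N"
proof -
  have s0: "s > 0" using s_ge_1 by simp
  have m: "(\<lambda>X. resid X - F0 X + F1 X) \<in> borel_measurable \<Omega>"
    using F_integrable unfolding resid_def[abs_def] by measurable
  note i = dominated(1)[OF m error_bound]
  have "(\<lambda>X. (resid X - F0 X + F1 X) + F0 X - F1 X) = resid" by (rule ext) simp
  then show it: "integrable \<Omega> resid"
    using Bochner_Integration.integrable_diff[OF Bochner_Integration.integrable_add[OF i F_integrable(1)] F_integrable(2)]
    by simp
  have "(LINT X|\<Omega>. resid X) = (LINT X|\<Omega>. resid X - F0 X + F1 X)"
    using it F_integrable F_mean_zero by simp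
  also have "\<bar>\<dots>\<bar> \<le> 16 ^ 9 / s * (LINT X|\<Omega>. Y X)" by (rule dominated(2)[OF m error_bound])
  also have "\<dots> \<le> 16 ^ 9 / s * 30" using Y_integrable(2) s0 by (intro mult_left_mono) auto
  finally show "\<bar>LINT X|\<Omega>. resid X\<bar> \<le> 16 ^ 9 * 30 / sqrt N" by (simp add: s_def)
qed

end

section \<open>The partition function\<close>

text \<open>When t lists the traces of the powers from order two on, \<open>L\<close> is minus half
  the logarithm of the regularised determinant. Its derivative is the coefficient of the limiting
  differential equation, and the crude bound keeps exp (L) and exp (- L) below 3.\<close>

lemma power_series_half_log:
  fixes t :: "nat \<Rightarrow> real"
  assumes t: "\<And>n. \<bar>t n\<bar> \<le> 2" and z: "\<bar>z\<bar> < 1 / 2"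
  defines "L \<equiv> \<lambda>z. 1 / 2 * (\<Sum>n. (- 1) ^ n * z ^ (n + 2) * t n / real (n + 2))"
  shows "(L has_real_derivative (1 / 2 * z * (\<Sum>n. (- z) ^ n * t n))) (at z)"
    and "summable (\<lambda>n. (- z) ^ n * t n)" and "\<bar>L z\<bar> \<le> 1"
proof -
  have sm: "summable (\<lambda>n. (- x) ^ n * t n)" if x: "\<bar>x\<bar> < 1" for x
  proof (rule summable_comparison_test)
    show "\<exists>N. \<forall>n\<ge>N. norm ((- x) ^ n * t n) \<le> 2 * \<bar>x\<bar> ^ n"
    proof (intro exI allI impI)
      fix n
      have "norm ((- x) ^ n * t n) = \<bar>x\<bar> ^ n * \<bar>t n\<bar>" by (simp add: abs_mult power_abs)
      also have "\<dots> \<le> \<bar>x\<bar> ^ n * 2" by (intro mult_left_mono t) auto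
      finally show "norm ((- x) ^ n * t n) \<le> 2 * \<bar>x\<bar> ^ n" by simp
    qed
    show "summable (\<lambda>n. 2 * \<bar>x\<bar> ^ n)" using x by (intro summable_mult summable_geometric) simp
  qed
  show "summable (\<lambda>n. (- z) ^ n * t n)" by (rule sm) (use z in auto)
  \<comment> \<open>Shifted by one, with a vanishing constant coefficient, to bring the series into
    the form of powers \<open>Suc n\<close> in which it is differentiated term by term.\<close>
  define c where "c n = (case n of 0 \<Rightarrow> 0 | Suc m \<Rightarrow> (- 1) ^ m * t m / real (m + 2))" for n
  have dterm: "c (Suc m) * real (Suc (Suc m)) * x ^ Suc m = x * ((- x) ^ m * t m)" for m x
  proof -
    have "(- x) ^ m = (- 1) ^ m * x ^ m" by (metis mult_minus1 power_mult_distrib)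
    then show ?thesis by (simp add: c_def field_simps)
  qed
  have ds: "summable (\<lambda>n. c n * real (Suc n) * x ^ n)" if "\<bar>x\<bar> < 1" for x
  proof -
    have "summable (\<lambda>m. c (Suc m) * real (Suc (Suc m)) * x ^ Suc m)"
      unfolding dterm by (intro summable_mult sm that)
    then show ?thesis by (subst (asm) summable_Suc_iff)
  qed
  have der: "((\<lambda>x. \<Sum>n. c n * x ^ Suc n) has_real_derivative (\<Sum>n. c n * real (Suc n) * z ^ n)) (at z)"
    by (rule DERIV_power_series'[where R = 1]) (use ds z in auto)
  have dsum: "(\<Sum>n. c n * real (Suc n) * z ^ n) = z * (\<Sum>n. (- z) ^ n * t n)"
  proof -
    have "(\<Sum>n. c n * real (Suc n) * z ^ n) = (\<Sum>m. c (Suc m) * real (Suc (Suc m)) * z ^ Suc m) + c 0"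
      using suminf_split_initial_segment[OF ds[of z], of 1] z by simp
    then show ?thesis unfolding dterm using z by (simp add: c_def suminf_mult sm)
  qed
  have Lx: "L x = 1 / 2 * (\<Sum>n. c n * x ^ Suc n)" if x: "\<bar>x\<bar> < 1" for x
  proof -
    have "summable (\<lambda>n. c n * x ^ Suc n)"
    proof (rule summable_comparison_test)
      show "\<exists>N. \<forall>n\<ge>N. norm (c n * x ^ Suc n) \<le> 2 * \<bar>x\<bar> ^ n"
      proof (intro exI allI impI)
        fix n
        have "\<bar>c n\<bar> \<le> 2"
        proof (cases n)
          case (Suc m)
          have "\<bar>t m\<bar> / real (m + 2) \<le> \<bar>t m\<bar> / 1" by (intro divide_left_mono) auto
          then show ?thesis using t[of m] Suc by (simp add: c_def abs_mult)
        qed (simp add: c_def)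
        moreover have "\<bar>x\<bar> ^ Suc n \<le> \<bar>x\<bar> ^ n" using x by (intro power_decreasing) auto
        ultimately have "\<bar>c n\<bar> * \<bar>x\<bar> ^ Suc n \<le> 2 * \<bar>x\<bar> ^ n" by (intro mult_mono) auto
        then show "norm (c n * x ^ Suc n) \<le> 2 * \<bar>x\<bar> ^ n" by (simp only: real_norm_def abs_mult power_abs)
      qed
      show "summable (\<lambda>n. 2 * \<bar>x\<bar> ^ n)" using x by (intro summable_mult summable_geometric) simp
    qed
    from suminf_split_initial_segment[OF this, of 1]
    have "(\<Sum>n. c n * x ^ Suc n) = (\<Sum>m. c (Suc m) * x ^ Suc (Suc m))" by (simp add: c_def)
    also have "\<dots> = (\<Sum>n. (- 1) ^ n * x ^ (n + 2) * t n / real (n + 2))"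
      by (rule suminf_cong) (simp add: c_def)
    finally show ?thesis by (simp add: L_def)
  qed
  have ev: "eventually (\<lambda>x. L x = 1 / 2 * (\<Sum>n. c n * x ^ Suc n)) (nhds z)"
  proof -
    have "eventually (\<lambda>x. x \<in> {-1<..<1}) (nhds z)" by (rule eventually_nhds_in_open) (use z in auto)
    then show ?thesis by eventually_elim (use Lx in auto)
  qed
  show "(L has_real_derivative (1 / 2 * z * (\<Sum>n. (- z) ^ n * t n))) (at z)"
    unfolding DERIV_cong_ev[OF refl ev refl] using DERIV_cmult[OF der, of "1 / 2"]
    unfolding dsum by (simp add: mult.assoc)
  have ts: "\<bar>(- 1) ^ n * z ^ (n + 2) * t n / real (n + 2)\<bar> \<le> (1 / 2) ^ n" for n
  proof -
    have "\<bar>(- 1) ^ n * z ^ (n + 2) * t n / real (n + 2)\<bar> = \<bar>z\<bar> ^ (n + 2) * (\<bar>t n\<bar> / real (n + 2))"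
      by (simp add: abs_mult power_abs)
    also have "\<dots> \<le> (1 / 2) ^ (n + 2) * (2 / 1)"
    proof (rule mult_mono)
      show "\<bar>z\<bar> ^ (n + 2) \<le> (1 / 2) ^ (n + 2)" by (rule power_mono) (use z in auto)
      show "\<bar>t n\<bar> / real (n + 2) \<le> 2 / 1" by (rule frac_le) (use t in auto)
    qed auto
    also have "\<dots> \<le> (1 / 2) ^ n" by simp
    finally show ?thesis .
  qed
  have gs: "(\<lambda>n. (1 / 2 :: real) ^ n) sums 2" using geometric_sums[of "1 / 2 :: real"] by simp
  have sa: "summable (\<lambda>n. \<bar>(- 1) ^ n * z ^ (n + 2) * t n / real (n + 2)\<bar>)"
    by (rule summable_comparison_test[OF _ sums_summable[OF gs]]) (use ts in auto)
  from sa have "\<bar>\<Sum>n. (- 1) ^ n * z ^ (n + 2) * t n / real (n + 2)\<bar> \<le> (\<Sum>n. \<bar>(- 1) ^ n * z ^ (n + 2) * t n / real (n + 2)\<bar>)"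
    by (rule summable_rabs)
  also have "\<dots> \<le> (\<Sum>n. (1 / 2) ^ n)"
    by (rule suminf_le[OF ts sa sums_summable[OF gs]])
  also have "\<dots> = 2" using gs by (simp add: sums_iff)
  finally show "\<bar>L z\<bar> \<le> 1" by (simp add: L_def)
qed

lemma psi_factor: "b * exp (- e / 2 * u) - b - e * (- 1 / 2 * (u * b)) = b * psi (- e / 2 * u)"
  by (simp add: psi_def algebra_simps)

lemma DERIV_quadratic_bound:
  fixes f :: "real \<Rightarrow> real"
  assumes "0 < r" and le: "\<And>e. \<bar>e\<bar> \<le> r \<Longrightarrow> \<bar>f (z + e) - f z - e * D\<bar> \<le> B * e\<^sup>2"
  shows "(f has_real_derivative D) (at z)"
  unfolding DERIV_def
proof (rule LIM_zero_cancel, rule Lim_null_comparison)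
  have "eventually (\<lambda>e. e \<in> {-r<..<r}) (at 0)"
    by (rule eventually_at_in_open'[THEN eventually_mono, of "{-r<..<r}"]) (use assms(1) in auto)
  moreover have "eventually (\<lambda>e :: real. e \<noteq> 0) (at 0)" by (simp add: eventually_at_filter)
  ultimately show "eventually (\<lambda>e. norm ((f (z + e) - f z) / e - D) \<le> B * \<bar>e\<bar>) (at 0)"
  proof eventually_elim
    case (elim e)
    have "\<bar>(f (z + e) - f z) / e - D\<bar> = \<bar>f (z + e) - f z - e * D\<bar> / \<bar>e\<bar>"
      using elim(2) by (simp add: abs_divide[symmetric] diff_divide_distrib)
    also have "\<dots> \<le> B * e\<^sup>2 / \<bar>e\<bar>" using elim by (intro divide_right_mono le) auto
    also have "\<dots> = B * \<bar>e\<bar>" using elim(2) by (simp add: power2_eq_square abs_if)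
    finally show ?case by simp
  qed
  show "((\<lambda>e. B * \<bar>e\<bar>) \<longlongrightarrow> 0) (at 0)" by (auto intro!: tendsto_eq_intros)
qed

section \<open>Moments, derivative and limit of the partition function\<close>

context sample_space
begin

definition "PN N = Pi\<^sub>M {1..N :: nat} (\<lambda>_. M)"

text \<open>Both orders of each pair are counted, and the divisor is N: the scale on which a
  degenerate kernel gives a quantity of order one.\<close>

definition Ustat :: "('a \<Rightarrow> 'a \<Rightarrow> real) \<Rightarrow> nat \<Rightarrow> (nat \<Rightarrow> 'a) \<Rightarrow> real" where
  "Ustat k N X = pair_sum k {1..N} X / N"

lemma prob_space_PN: "prob_space (PN N)"
  unfolding PN_def by (rule prob_space_PiM) unfold_locales

lemma Ustat_measurable:
  "deg_kernel M k \<Longrightarrow> Ustat k N \<in> borel_measurable (PN N)"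
  unfolding Ustat_def[abs_def] PN_def by (intro borel_measurable_divide pair_sum_measurable borel_measurable_const) auto

lemma Ustat_exp:
  assumes k: "deg_kernel M k" and N: "0 < N" and t: "\<bar>t\<bar> \<le> 1 / 24"
  shows "integrable (PN N) (\<lambda>X. exp (t * Ustat k N X))" "(LINT X|PN N. exp (t * Ustat k N X)) \<le> 2"
    and "integrable (PN N) (\<lambda>X. exp (\<bar>Ustat k N X\<bar> / 24))" "(LINT X|PN N. exp (\<bar>Ustat k N X\<bar> / 24)) \<le> 4"
proof -
  note [measurable] = Ustat_measurable[OF k]
  have b: "(\<integral>\<^sup>+X. ennreal (exp (t * Ustat k N X)) \<partial>PN N) \<le> ennreal 2" if "\<bar>t\<bar> \<le> 1 / 24" for t
    using U_statistic_mgf[OF k, of "{1..N}" N t] N that by (simp add: Ustat_def pair_sum_def PN_def)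
  show i: "integrable (PN N) (\<lambda>X. exp (t * Ustat k N X))"
    by (rule integrableI_nonneg) (use b[OF t] in \<open>auto intro: le_less_trans\<close>)
  have "ennreal (LINT X|PN N. exp (t * Ustat k N X)) \<le> ennreal 2"
    using b[OF t] by (subst (asm) nn_integral_eq_integral[OF i]) auto
  then show "(LINT X|PN N. exp (t * Ustat k N X)) \<le> 2" by (subst (asm) ennreal_le_iff) auto
  have "(\<lambda>X. Ustat k N X / 24) \<in> borel_measurable (PN N)" by measurable
  from exp_abs_integrable_bound[OF this, of 2] b[of "1 / 24"] b[of "- 1 / 24"]
  show "integrable (PN N) (\<lambda>X. exp (\<bar>Ustat k N X\<bar> / 24))" "(LINT X|PN N. exp (\<bar>Ustat k N X\<bar> / 24)) \<le> 4"
    by (simp_all add: abs_divide)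
qed

lemma square_le_exp: "u\<^sup>2 * exp (\<bar>u\<bar> / 100) \<le> 96\<^sup>2 * exp (\<bar>u\<bar> / 24)" for u :: real
proof -
  have "\<bar>u\<bar> \<le> 96 * exp (\<bar>u\<bar> / 96)" by (rule le_exp_scaled) simp
  then have "\<bar>u\<bar>\<^sup>2 \<le> (96 * exp (\<bar>u\<bar> / 96))\<^sup>2" by (intro power_mono) auto
  also have "\<dots> = 96\<^sup>2 * exp (\<bar>u\<bar> / 48)" by (simp add: power_mult_distrib exp_of_nat_mult[symmetric])
  finally have "u\<^sup>2 * exp (\<bar>u\<bar> / 100) \<le> 96\<^sup>2 * exp (\<bar>u\<bar> / 48) * exp (\<bar>u\<bar> / 100)"
    by (intro mult_right_mono) auto
  also have "\<dots> = 96\<^sup>2 * exp (\<bar>u\<bar> / 48 + \<bar>u\<bar> / 100)" by (simp only: exp_add mult.assoc)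
  also have "\<dots> \<le> 96\<^sup>2 * exp (\<bar>u\<bar> / 24)" by (intro mult_left_mono) auto
  finally show ?thesis .
qed

text \<open>AM-GM separates the observable from the weight. The bound depends neither on N nor on
  \<open>k\<close>, which is what allows the hierarchy of iterates to be cut off.\<close>

lemma Ustat_weighted:
  assumes g: "deg_kernel M g" and k: "deg_kernel M k" and N: "0 < N" and z: "\<bar>z\<bar> \<le> 1 / 100"
  shows "integrable (PN N) (\<lambda>X. Ustat k N X * exp (- z / 2 * Ustat g N X))"
    "\<bar>LINT X|PN N. Ustat k N X * exp (- z / 2 * Ustat g N X)\<bar> \<le> 96\<^sup>2 * 4 + 2"
proof -
  note [measurable] = Ustat_measurable[OF k] Ustat_measurable[OF g]
  have z': "\<bar>- z\<bar> \<le> 1 / 24" using z by simp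
  note e1 = Ustat_exp[OF g N z'] and e2 = Ustat_exp[OF k N z']
  let ?B = "\<lambda>X. 96\<^sup>2 * exp (\<bar>Ustat k N X\<bar> / 24) + exp (- z * Ustat g N X)"
  have B: "integrable (PN N) ?B" using e1(1) e2(3) by simp
  have le: "\<bar>Ustat k N X * exp (- z / 2 * Ustat g N X)\<bar> \<le> ?B X" for X
  proof -
    let ?u = "Ustat k N X" and ?w = "exp (- z / 2 * Ustat g N X)"
    have "\<bar>?u * ?w\<bar> \<le> ?u\<^sup>2 + ?w\<^sup>2"
    proof -
      have "2 * (\<bar>?u\<bar> * ?w) \<le> ?u\<^sup>2 + ?w\<^sup>2" using sum_squares_bound[of "\<bar>?u\<bar>" ?w] by simp
      moreover have "0 \<le> \<bar>?u\<bar> * ?w" by simp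
      moreover have "\<bar>?u * ?w\<bar> = \<bar>?u\<bar> * ?w" by (simp only: abs_mult abs_exp_cancel)
      ultimately show ?thesis by linarith
    qed
    moreover have "?w\<^sup>2 = exp (- z * Ustat g N X)" by (simp add: exp_of_nat_mult[symmetric])
    moreover have "?u\<^sup>2 \<le> 96\<^sup>2 * exp (\<bar>?u\<bar> / 24)"
      by (rule order_trans[OF _ square_le_exp]) (simp add: mult_le_cancel_left1)
    ultimately show ?thesis by linarith
  qed
  show i: "integrable (PN N) (\<lambda>X. Ustat k N X * exp (- z / 2 * Ustat g N X))"
    by (rule Bochner_Integration.integrable_bound[OF B]) (use le in \<open>auto intro!: AE_I2 intro: order_trans[OF _ abs_ge_self]\<close>)
  have "\<bar>LINT X|PN N. Ustat k N X * exp (- z / 2 * Ustat g N X)\<bar> \<le> (LINT X|PN N. \<bar>Ustat k N X * exp (- z / 2 * Ustat g N X)\<bar>)"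
    by (rule integral_abs_bound)
  also have "\<dots> \<le> (LINT X|PN N. ?B X)" by (rule integral_mono) (use i B le in auto)
  also have "\<dots> \<le> 96\<^sup>2 * 4 + 2" using e1(1,2) e2(3,4) by simp
  finally show "\<bar>LINT X|PN N. Ustat k N X * exp (- z / 2 * Ustat g N X)\<bar> \<le> 96\<^sup>2 * 4 + 2" .
qed

definition part_fun :: "('a \<Rightarrow> 'a \<Rightarrow> real) \<Rightarrow> nat \<Rightarrow> real \<Rightarrow> real" where
  "part_fun g N z = (LINT X|PN N. exp (- z / 2 * Ustat g N X))"

text \<open>Differentiation under the expectation. For increments up to 1/100 the remainder is e^2
  times U^2 exp (|U| / 100), and this is dominated by the integrable exp (|U| / 24).\<close>

lemma part_fun_deriv:
  assumes g: "deg_kernel M g" and N: "0 < N" and z: "\<bar>z\<bar> \<le> 1 / 100"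
  shows "(part_fun g N has_real_derivative - 1 / 2 * (LINT X|PN N. Ustat g N X * exp (- z / 2 * Ustat g N X))) (at z)"
proof (rule DERIV_quadratic_bound[where r = "1 / 100"])
  note [measurable] = Ustat_measurable[OF g]
  let ?U = "Ustat g N"
  let ?w = "\<lambda>z X. exp (- z / 2 * ?U X)"
  have iw: "integrable (PN N) (?w y)" if "\<bar>y\<bar> \<le> 1 / 50" for y
    using Ustat_exp(1)[OF g N, of "- y / 2"] that by simp
  note iU = Ustat_weighted(1)[OF g g N z]
  have e3: "integrable (PN N) (\<lambda>X. exp (\<bar>?U X\<bar> / 24))" "(LINT X|PN N. exp (\<bar>?U X\<bar> / 24)) \<le> 4"
    using Ustat_exp(3,4)[OF g N, of 0] by auto
  fix e :: real assume e: "\<bar>e\<bar> \<le> 1 / 100"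
  have ze: "\<bar>z + e\<bar> \<le> 1 / 50" using z e by linarith
  have zz: "\<bar>z\<bar> \<le> 1 / 50" using z by linarith
  let ?R = "\<lambda>X. ?w (z + e) X - ?w z X - e * (- 1 / 2 * (?U X * ?w z X))"
  have le: "\<bar>?R X\<bar> \<le> 96\<^sup>2 * e\<^sup>2 * exp (\<bar>?U X\<bar> / 24)" for X
  proof -
    let ?d = "- e / 2 * ?U X"
    have "?w (z + e) X = ?w z X * exp ?d"
      unfolding exp_add[symmetric] by (rule arg_cong[where f = exp]) (simp add: field_simps)
    then have "?R X = ?w z X * psi ?d" unfolding psi_factor[symmetric] by (simp only:)
    then have "\<bar>?R X\<bar> = ?w z X * psi ?d" using psi_nonneg[of ?d] by simp
    also have "\<dots> \<le> exp (\<bar>?U X\<bar> / 200) * (e\<^sup>2 * (?U X)\<^sup>2 * exp (\<bar>?U X\<bar> / 200))"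
    proof (rule mult_mono)
      have "- z / 2 * ?U X \<le> \<bar>z\<bar> / 2 * \<bar>?U X\<bar>" using abs_ge_self[of "- z / 2 * ?U X"] by (simp add: abs_mult)
      also have "\<dots> \<le> (1 / 100) / 2 * \<bar>?U X\<bar>" using z by (intro mult_right_mono divide_right_mono) auto
      finally show "?w z X \<le> exp (\<bar>?U X\<bar> / 200)" by simp
      have d: "\<bar>?d\<bar> \<le> \<bar>?U X\<bar> / 200"
      proof -
        have "\<bar>?d\<bar> = \<bar>e\<bar> / 2 * \<bar>?U X\<bar>" by (simp add: abs_mult)
        also have "\<dots> \<le> (1 / 100) / 2 * \<bar>?U X\<bar>" using e by (intro mult_right_mono divide_right_mono) auto
        finally show ?thesis by simp
      qed
      have "psi ?d \<le> ?d\<^sup>2 * exp \<bar>?d\<bar>" by (rule psi_abs_le)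
      also have "\<dots> \<le> (e\<^sup>2 * (?U X)\<^sup>2) * exp (\<bar>?U X\<bar> / 200)"
        using d by (intro mult_mono) (auto simp: power_mult_distrib power_divide)
      finally show "psi ?d \<le> e\<^sup>2 * (?U X)\<^sup>2 * exp (\<bar>?U X\<bar> / 200)" .
    qed (auto simp: psi_nonneg)
    also have "\<dots> = e\<^sup>2 * ((?U X)\<^sup>2 * exp (\<bar>?U X\<bar> / 100))"
    proof -
      have "exp (\<bar>?U X\<bar> / 100) = exp (\<bar>?U X\<bar> / 200) * exp (\<bar>?U X\<bar> / 200)" by (simp add: exp_add[symmetric])
      then show ?thesis by simp
    qed
    also have "\<dots> \<le> e\<^sup>2 * (96\<^sup>2 * exp (\<bar>?U X\<bar> / 24))" by (intro mult_left_mono square_le_exp) auto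
    finally show ?thesis by simp
  qed
  have iR: "integrable (PN N) ?R" using iw[OF ze] iw[OF zz] iU by auto
  have eq: "part_fun g N (z + e) - part_fun g N z - e * (- 1 / 2 * (LINT X|PN N. ?U X * ?w z X)) = (LINT X|PN N. ?R X)"
    unfolding part_fun_def using iw[OF ze] iw[OF zz] iU by simp
  have "\<bar>part_fun g N (z + e) - part_fun g N z - e * (- 1 / 2 * (LINT X|PN N. ?U X * ?w z X))\<bar> \<le> (LINT X|PN N. \<bar>?R X\<bar>)"
    unfolding eq by (rule integral_abs_bound)
  also have "\<dots> \<le> (LINT X|PN N. 96\<^sup>2 * e\<^sup>2 * exp (\<bar>?U X\<bar> / 24))"
    by (rule integral_mono) (use iR e3 le in auto)
  also have "\<dots> \<le> 96\<^sup>2 * e\<^sup>2 * 4"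
    unfolding integral_mult_right_zero using e3(2) by (intro mult_left_mono) auto
  finally show "\<bar>part_fun g N (z + e) - part_fun g N z - e * (- 1 / 2 * (LINT X|PN N. ?U X * ?w z X))\<bar> \<le> (96\<^sup>2 * 4) * e\<^sup>2"
    by simp
qed simp

text \<open>The cavity equations for all choices of the removed particle are summed and divided by
  N, so that exchangeability need not be invoked. The divisor 4 makes all iterates degenerate
  kernels in the normalised sense.\<close>

lemma loop_equation:
  fixes n N :: nat and z :: real
  assumes g: "deg_kernel M g" and N: "0 < N" and z: "\<bar>z\<bar> \<le> 1 / 100"
  defines "u \<equiv> \<lambda>n x y. gpow M g n x y / 4"
  defines "\<Phi> \<equiv> \<lambda>n. LINT X|PN N. Ustat (u n) N X * exp (- z / 2 * Ustat g N X)"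
  shows "\<bar>\<Phi> n + z * \<Phi> (Suc n) + z * (LINT x|M. u (Suc n) x x) * part_fun g N z\<bar> \<le> 16 ^ 9 * 30 / sqrt N"
proof -
  have du: "deg_kernel M (u n)" for n unfolding u_def by (rule deg_kernel_gpow[OF g])
  let ?w = "\<lambda>X. exp (- z / 2 * Ustat g N X)"
  let ?\<tau> = "LINT x|M. u (Suc n) x x"
  have cav: "cavity M g (u n) (u (Suc n)) ({1..N} - {i}) i N z" if i: "i \<in> {1..N}" for i
  proof
    show "u (Suc n) x y = kcomp M g (u n) x y" if "x \<in> space M" "y \<in> space M" for x y
      by (simp add: u_def kcomp_def flip: integral_divide_zero)
    show "\<bar>u (Suc n) x x\<bar> \<le> 1 / 2" if "x \<in> space M" for x
      using gpow_bound[OF g that that, of n] unfolding u_def abs_divide by linarith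
    show "N = Suc (card ({1..N} - {i}))" using i N by simp
  qed (use g du z in auto)
  define R where "R i X = ((\<Sum>j\<in>{1..N} - {i}. u n (X i) (X j)) + z * Ustat (u (Suc n)) N X + z * ?\<tau>) * ?w X" for i X
  have R: "integrable (PN N) (R i)" "\<bar>LINT X|PN N. R i X\<bar> \<le> 16 ^ 9 * 30 / sqrt N" if i: "i \<in> {1..N}" for i
  proof -
    interpret C: cavity M g "u n" "u (Suc n)" "{1..N} - {i}" i N z by (rule cav[OF i])
    have ins: "insert i ({1..N} - {i}) = {1..N}" using i by auto
    have "C.resid = R i"
    proof
      fix X
      have "C.s * C.h X = (\<Sum>j\<in>{1..N} - {i}. u n (X i) (X j))" using C.s_ge_1 unfolding C.h_def by simp
      moreover have "C.W X = ?w X" unfolding C.W_def ins Ustat_def by simp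
      ultimately show "C.resid X = R i X"
        unfolding C.resid_def R_def C.Q_def C.\<tau>_def ins Ustat_def by simp
    qed
    moreover have "C.\<Omega> = PN N" unfolding C.\<Omega>_def ins PN_def ..
    ultimately show "integrable (PN N) (R i)" "\<bar>LINT X|PN N. R i X\<bar> \<le> 16 ^ 9 * 30 / sqrt N"
      using C.cavity_equation unfolding \<open>C.resid = R i\<close> \<open>C.\<Omega> = PN N\<close> by simp_all
  qed
  have iw: "integrable (PN N) ?w" using Ustat_exp(1)[OF g N, of "- z / 2"] z by simp
  note iU = Ustat_weighted(1)[OF g du N z]
  have "(\<Sum>i=1..N. R i X) = N * ((Ustat (u n) N X + z * Ustat (u (Suc n)) N X + z * ?\<tau>) * ?w X)" for X
  proof -
    have "(\<Sum>i=1..N. R i X) = (pair_sum (u n) {1..N} X + N * (z * Ustat (u (Suc n)) N X) + N * (z * ?\<tau>)) * ?w X"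
      by (simp add: R_def pair_sum_def sum.distrib flip: sum_distrib_right)
    then show ?thesis using N by (simp add: Ustat_def algebra_simps)
  qed
  then have "(LINT X|PN N. (\<Sum>i=1..N. R i X)) = N * (LINT X|PN N. (Ustat (u n) N X + z * Ustat (u (Suc n)) N X + z * ?\<tau>) * ?w X)"
    by simp
  also have "(LINT X|PN N. (Ustat (u n) N X + z * Ustat (u (Suc n)) N X + z * ?\<tau>) * ?w X)
      = (LINT X|PN N. Ustat (u n) N X * ?w X + z * (Ustat (u (Suc n)) N X * ?w X) + z * ?\<tau> * ?w X)"
    by (simp add: algebra_simps)
  also have "\<dots> = \<Phi> n + z * \<Phi> (Suc n) + z * ?\<tau> * part_fun g N z"
    unfolding \<Phi>_def part_fun_def using iU iw by simp
  finally have eq: "N * (\<Phi> n + z * \<Phi> (Suc n) + z * ?\<tau> * part_fun g N z) = (\<Sum>i=1..N. LINT X|PN N. R i X)"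
    using R(1) by (simp add: Bochner_Integration.integral_sum)
  have "\<bar>N * (\<Phi> n + z * \<Phi> (Suc n) + z * ?\<tau> * part_fun g N z)\<bar> \<le> (\<Sum>i=1..N. \<bar>LINT X|PN N. R i X\<bar>)"
    unfolding eq by (rule sum_abs)
  also have "\<dots> \<le> (\<Sum>i=1..N. 16 ^ 9 * 30 / sqrt N)" by (intro sum_mono R(2)) auto
  also have "\<dots> = N * (16 ^ 9 * 30 / sqrt N)" by simp
  finally have "real N * \<bar>\<Phi> n + z * \<Phi> (Suc n) + z * ?\<tau> * part_fun g N z\<bar> \<le> N * (16 ^ 9 * 30 / sqrt N)"
    by (simp only: abs_mult abs_of_nat)
  then show ?thesis using N by (simp only: mult_le_cancel_left_pos of_nat_0_less_iff)
qed

lemma trace_diag: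
  assumes g: "deg_kernel M g"
  shows "(LINT x|M. gpow M g (Suc n) x x) = hs M (gpow M g n) g"
proof -
  note gL = deg_kernel_L2ker[OF g]
  have "(LINT x|M. gpow M g (Suc n) x x) = (LINT x|M. LINT w|M. gpow M g n x w * g x w)"
  proof (rule Bochner_Integration.integral_cong[OF refl])
    fix x assume x: "x \<in> space M"
    show "gpow M g (Suc n) x x = (LINT w|M. gpow M g n x w * g x w)"
      unfolding gpow.simps kcomp_def
      by (rule Bochner_Integration.integral_cong[OF refl])
        (use gpow_sym[OF gL(1,2), of n] x in \<open>simp add: sym_kernel_def mult.commute\<close>)
  qed
  then show ?thesis by (simp add: hs_iterated(1)[OF gpow_L2ker[OF gL(1)] gL(1)])
qed

lemma trace_le:
  assumes g: "deg_kernel M g"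
  shows "\<bar>hs M (gpow M g n) g\<bar> \<le> 2"
proof -
  note gL = deg_kernel_L2ker[OF g]
  note [measurable] = L2kerD(2)[OF gpow_L2ker[OF gL(1), of "Suc n"]]
  have [measurable]: "(\<lambda>x. gpow M g (Suc n) x x) \<in> borel_measurable M" by measurable
  have i: "integrable M (\<lambda>x. gpow M g (Suc n) x x)"
    by (rule integrable_const_bound[where B = 2]) (use gpow_bound[OF g] in \<open>auto simp del: gpow.simps\<close>)
  have "\<bar>LINT x|M. gpow M g (Suc n) x x\<bar> \<le> (LINT x|M. \<bar>gpow M g (Suc n) x x\<bar>)" by (rule integral_abs_bound)
  also have "\<dots> \<le> (LINT x|M. 2)" by (rule integral_mono) (use i gpow_bound[OF g] in \<open>auto simp del: gpow.simps\<close>)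
  finally show ?thesis unfolding trace_diag[OF g] by (simp add: prob_space)
qed

text \<open>Weighting the loop equations by (- z)^n makes them telescope: the errors add up to a
  geometric series with sum at most 2, and the boundary term tends to zero. The term n = 0 is a
  quarter of the U-statistic of \<open>g\<close>, which turns the identity into an approximate
  linear differential equation for the partition function.\<close>

lemma part_fun_ode:
  assumes g: "deg_kernel M g" and N: "0 < N" and z: "\<bar>z\<bar> \<le> 1 / 100"
  shows "\<bar>- 1 / 2 * (LINT X|PN N. Ustat g N X * exp (- z / 2 * Ustat g N X))
      - 1 / 2 * z * (\<Sum>n. (- z) ^ n * hs M (gpow M g n) g) * part_fun g N z\<bar> \<le> 4 * (16 ^ 9 * 30) / sqrt N"
proof -
  define u where "u n x y = gpow M g n x y / 4" for n x y
  define \<Phi> where "\<Phi> n = (LINT X|PN N. Ustat (u n) N X * exp (- z / 2 * Ustat g N X))" for n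
  define t where "t n = hs M (gpow M g n) g" for n
  define C where "C = 16 ^ 9 * 30 / sqrt N"
  have C0: "0 \<le> C" by (simp add: C_def)
  have du: "deg_kernel M (u n)" for n unfolding u_def by (rule deg_kernel_gpow[OF g])
  let ?f = "part_fun g N z"
  have loop: "\<bar>\<Phi> n + z * \<Phi> (Suc n) + z * (t n / 4) * ?f\<bar> \<le> C" for n
    using loop_equation[OF g N z, of n] trace_diag[OF g, of n]
    by (simp add: \<Phi>_def u_def[abs_def] t_def C_def del: gpow.simps)
  \<comment> \<open>The number \<open>P\<close> of steps does not depend on N, so it can be sent to
    infinity for fixed N.\<close>
  have tele: "\<bar>\<Phi> 0 + z * (\<Sum>n<P. (- z) ^ n * t n) / 4 * ?f - (- z) ^ P * \<Phi> P\<bar> \<le> C * (\<Sum>n<P. \<bar>z\<bar> ^ n)" for P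
  proof (induction P)
    case (Suc P)
    have eq: "\<Phi> 0 + z * (\<Sum>n<Suc P. (- z) ^ n * t n) / 4 * ?f - (- z) ^ Suc P * \<Phi> (Suc P)
        = (\<Phi> 0 + z * (\<Sum>n<P. (- z) ^ n * t n) / 4 * ?f - (- z) ^ P * \<Phi> P)
          + (- z) ^ P * (\<Phi> P + z * \<Phi> (Suc P) + z * (t P / 4) * ?f)"
      by (simp add: algebra_simps add_divide_distrib)
    have "\<bar>\<Phi> 0 + z * (\<Sum>n<Suc P. (- z) ^ n * t n) / 4 * ?f - (- z) ^ Suc P * \<Phi> (Suc P)\<bar> \<le> C * (\<Sum>n<P. \<bar>z\<bar> ^ n) + \<bar>z\<bar> ^ P * C"
      unfolding eq
    proof (rule order_trans[OF abs_triangle_ineq add_mono[OF Suc]])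
      show "\<bar>(- z) ^ P * (\<Phi> P + z * \<Phi> (Suc P) + z * (t P / 4) * ?f)\<bar> \<le> \<bar>z\<bar> ^ P * C"
        unfolding abs_mult power_abs abs_minus_cancel by (intro mult_left_mono loop) auto
    qed
    then show ?case by (simp add: algebra_simps)
  qed simp
  have z1: "\<bar>z\<bar> < 1 / 2" using z by linarith
  have gs: "(\<lambda>n. \<bar>z\<bar> ^ n) sums (1 / (1 - \<bar>z\<bar>))" using z1 by (intro geometric_sums) auto
  have "1 / (1 - \<bar>z\<bar>) \<le> 2" using z1 by (simp add: field_simps)
  then have geo: "(\<Sum>n<P. \<bar>z\<bar> ^ n) \<le> 2" for P
    using sum_le_suminf[OF sums_summable[OF gs], of "{..<P}"] gs by (simp add: sums_iff)
  have lim: "(\<lambda>P. \<Phi> 0 + z * (\<Sum>n<P. (- z) ^ n * t n) / 4 * ?f - (- z) ^ P * \<Phi> P)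
      \<longlonglongrightarrow> \<Phi> 0 + z * (\<Sum>n. (- z) ^ n * t n) / 4 * ?f - 0"
  proof (intro tendsto_intros)
    show "(4 :: real) \<noteq> 0" by simp
    have "summable (\<lambda>n. (- z) ^ n * t n)"
      by (rule power_series_half_log(2)) (use trace_le[OF g] z1 in \<open>auto simp: t_def\<close>)
    then show "(\<lambda>P. \<Sum>n<P. (- z) ^ n * t n) \<longlonglongrightarrow> (\<Sum>n. (- z) ^ n * t n)"
      by (rule summable_LIMSEQ)
    show "(\<lambda>P. (- z) ^ P * \<Phi> P) \<longlonglongrightarrow> 0"
    proof (rule Lim_null_comparison)
      show "eventually (\<lambda>P. norm ((- z) ^ P * \<Phi> P) \<le> \<bar>z\<bar> ^ P * (96\<^sup>2 * 4 + 2)) sequentially"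
      proof (intro always_eventually allI)
        fix P
        have "\<bar>\<Phi> P\<bar> \<le> 96\<^sup>2 * 4 + 2" unfolding \<Phi>_def by (rule Ustat_weighted(2)[OF g du N z])
        then show "norm ((- z) ^ P * \<Phi> P) \<le> \<bar>z\<bar> ^ P * (96\<^sup>2 * 4 + 2)"
          unfolding real_norm_def abs_mult power_abs abs_minus_cancel by (intro mult_left_mono) auto
      qed
      have "(\<lambda>P. \<bar>z\<bar> ^ P) \<longlonglongrightarrow> 0" using z1 by (intro LIMSEQ_power_zero) simp
      from tendsto_mult_left_zero[OF this] show "(\<lambda>P. \<bar>z\<bar> ^ P * (96\<^sup>2 * 4 + 2)) \<longlonglongrightarrow> 0" .
    qed
  qed
  have "\<bar>\<Phi> 0 + z * (\<Sum>n. (- z) ^ n * t n) / 4 * ?f - 0\<bar> \<le> C * 2"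
  proof (rule LIMSEQ_le_const2[OF tendsto_rabs[OF lim]], intro exI allI impI)
    fix P
    show "\<bar>\<Phi> 0 + z * (\<Sum>n<P. (- z) ^ n * t n) / 4 * ?f - (- z) ^ P * \<Phi> P\<bar> \<le> C * 2"
      by (rule order_trans[OF tele mult_left_mono[OF geo C0]])
  qed
  moreover have "(LINT X|PN N. Ustat g N X * exp (- z / 2 * Ustat g N X)) = 4 * \<Phi> 0"
  proof -
    have "Ustat g N X = 4 * Ustat (u 0) N X" for X
      by (simp add: Ustat_def u_def pair_sum_def sum_divide_distrib[symmetric])
    then show ?thesis by (simp add: \<Phi>_def mult.assoc)
  qed
  moreover have "- 1 / 2 * (4 * \<Phi> 0) - 1 / 2 * z * (\<Sum>n. (- z) ^ n * t n) * ?f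
      = - 2 * (\<Phi> 0 + z * (\<Sum>n. (- z) ^ n * t n) / 4 * ?f - 0)" by (simp add: algebra_simps)
  ultimately show ?thesis by (simp add: abs_mult t_def C_def)
qed

text \<open>With the integrating factor exp (- L), the derivative of \<open>r\<close> consists of
  the error alone. The mean value theorem compares r \<beta> with r 0 = 1, and multiplying back by
  exp (L \<beta>) \<le> 3 gives the claim.\<close>

lemma part_fun_limit:
  assumes g: "deg_kernel M g" and N: "0 < N" and \<beta>: "0 < \<beta>" "\<beta> \<le> 1 / 100"
  shows "\<bar>part_fun g N \<beta> - exp (1 / 2 * (\<Sum>n. (- 1) ^ n * \<beta> ^ (n + 2) * hs M (gpow M g n) g / real (n + 2)))\<bar> \<le> 16 ^ 11 * 30 / sqrt N"
proof -
  define L where "L z = 1 / 2 * (\<Sum>n. (- 1) ^ n * z ^ (n + 2) * hs M (gpow M g n) g / real (n + 2))" for z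
  let ?h = "\<lambda>z. 1 / 2 * z * (\<Sum>n. (- z) ^ n * hs M (gpow M g n) g)"
  let ?f = "part_fun g N"
  let ?D = "\<lambda>z. - 1 / 2 * (LINT X|PN N. Ustat g N X * exp (- z / 2 * Ustat g N X))"
  have L: "(L has_real_derivative ?h z) (at z)" "\<bar>L z\<bar> \<le> 1" if "\<bar>z\<bar> < 1 / 2" for z
    using power_series_half_log[of "\<lambda>n. hs M (gpow M g n) g" z] trace_le[OF g] that
    unfolding L_def[abs_def] by auto
  define r where "r z = ?f z * exp (- L z)" for z
  have der: "(r has_real_derivative (?D z - ?h z * ?f z) * exp (- L z)) (at z)" if z: "0 \<le> z" "z \<le> \<beta>" for z
    unfolding r_def[abs_def] using z \<beta>
    by (auto intro!: derivative_eq_intros part_fun_deriv[OF g N] L simp: algebra_simps)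
  obtain z where z: "0 < z" "z < \<beta>" "r \<beta> - r 0 = (\<beta> - 0) * ((?D z - ?h z * ?f z) * exp (- L z))"
    using MVT2[OF \<beta>(1) der] by blast
  interpret P: prob_space "PN N" by (rule prob_space_PN)
  have r0: "r 0 = 1"
    by (simp add: r_def part_fun_def L_def P.prob_space)
  have e1: "exp (- L z) \<le> 3" "exp (L \<beta>) \<le> 3" "0 < exp (L \<beta>)"
  proof -
    have "- L z \<le> 1" "L \<beta> \<le> 1" using L(2)[of z] L(2)[of \<beta>] z \<beta> by auto
    then have "exp (- L z) \<le> exp 1" "exp (L \<beta>) \<le> exp 1" by auto
    then show "exp (- L z) \<le> 3" "exp (L \<beta>) \<le> 3" using exp_le by linarith+
  qed simp
  have "\<bar>?D z - ?h z * ?f z\<bar> \<le> 4 * (16 ^ 9 * 30) / sqrt N"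
    by (rule part_fun_ode[OF g N]) (use z \<beta> in auto)
  then have "\<bar>r \<beta> - r 0\<bar> \<le> \<beta> * (4 * (16 ^ 9 * 30) / sqrt N * 3)"
    unfolding z(3) abs_mult using e1 \<beta> by (intro mult_mono) auto
  also have "\<dots> \<le> 1 * (4 * (16 ^ 9 * 30) / sqrt N * 3)" using \<beta> by (intro mult_right_mono) auto
  finally have r: "\<bar>r \<beta> - 1\<bar> \<le> 4 * (16 ^ 9 * 30) / sqrt N * 3" by (simp add: r0)
  have "?f \<beta> - exp (L \<beta>) = exp (L \<beta>) * (r \<beta> - 1)"
    by (simp add: r_def exp_minus field_simps)
  then have "\<bar>?f \<beta> - exp (L \<beta>)\<bar> \<le> 3 * (4 * (16 ^ 9 * 30) / sqrt N * 3)"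
    unfolding abs_mult by (simp only: abs_mult) (intro mult_mono r, use e1 in auto)
  also have "\<dots> \<le> 16 ^ 11 * 30 / sqrt N" by (simp add: divide_right_mono)
  finally show ?thesis by (simp add: L_def)
qed

end

section \<open>Tilting by a single-particle term\<close>

lemma exp_diff_le: "\<bar>exp a - exp b\<bar> \<le> \<bar>a - b\<bar> * (exp a + exp b)" for a b :: real
proof -
  have *: "exp x - exp y \<le> (x - y) * exp x" for x y :: real
  proof -
    have "1 + (y - x) \<le> exp (y - x)" by (rule exp_ge_add_one_self)
    then have "exp x * (1 + (y - x)) \<le> exp x * exp (y - x)" by (intro mult_left_mono) auto
    then show ?thesis by (simp add: exp_add[symmetric] algebra_simps)
  qed
  have "exp a - exp b \<le> \<bar>a - b\<bar> * exp a" "exp b - exp a \<le> \<bar>a - b\<bar> * exp b"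
    using *[of a b] *[of b a] mult_right_mono[of "a - b" "\<bar>a - b\<bar>" "exp a"] mult_right_mono[of "b - a" "\<bar>a - b\<bar>" "exp b"]
    by (auto intro: order_trans)
  moreover have "0 \<le> \<bar>a - b\<bar> * exp a" "0 \<le> \<bar>a - b\<bar> * exp b" by simp_all
  ultimately show ?thesis unfolding abs_le_iff distrib_left by linarith
qed

lemma power4_sum_le: "(x + y) ^ 4 \<le> 8 * (x ^ 4 + y ^ 4)" for x y :: real
proof -
  have 1: "(a + b)\<^sup>2 \<le> 2 * (a\<^sup>2 + b\<^sup>2)" for a b :: real
    using zero_le_power2[of "a - b"] by (simp add: power2_eq_square algebra_simps)
  have "(x + y) ^ 4 = ((x + y)\<^sup>2)\<^sup>2" by simp
  also have "\<dots> \<le> (2 * (x\<^sup>2 + y\<^sup>2))\<^sup>2" by (intro power_mono 1) auto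
  also have "\<dots> = 4 * (x\<^sup>2 + y\<^sup>2)\<^sup>2" by (simp only: power_mult_distrib) simp
  also have "\<dots> \<le> 4 * (2 * ((x\<^sup>2)\<^sup>2 + (y\<^sup>2)\<^sup>2))" by (intro mult_left_mono 1) auto
  finally show ?thesis by simp
qed

section \<open>Adding the empirical mean of a function\<close>

context sample_space
begin

definition mean :: "('a \<Rightarrow> real) \<Rightarrow> nat \<Rightarrow> (nat \<Rightarrow> 'a) \<Rightarrow> real" where
  "mean h N X = (\<Sum>i=1..N. h (X i)) / N"

lemma component_measurable:
  assumes "f \<in> M \<rightarrow>\<^sub>M L" "i \<in> {1..N}"
  shows "(\<lambda>X. f (X i)) \<in> PN N \<rightarrow>\<^sub>M L"
proof -
  have "(\<lambda>X. X i) \<in> PN N \<rightarrow>\<^sub>M M"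
    unfolding PN_def by (rule measurable_component_singleton) (rule assms(2))
  from measurable_compose[OF this assms(1)] show ?thesis .
qed

lemma mean_measurable:
  assumes [measurable]: "h \<in> borel_measurable M"
  shows "mean h N \<in> borel_measurable (PN N)"
proof -
  have "(\<lambda>X. h (X i)) \<in> borel_measurable (PN N)" if "i \<in> {1..N}" for i
    by (rule component_measurable[OF assms that])
  then show ?thesis unfolding mean_def[abs_def] by (intro borel_measurable_divide borel_measurable_sum) auto
qed

lemma nn_integral_component:
  assumes i: "i \<in> {1..N}" and f: "f \<in> borel_measurable M"
  shows "(\<integral>\<^sup>+X. f (X i) \<partial>PN N) = (\<integral>\<^sup>+x. f x \<partial>M)"
proof -
  have "M = distr (PN N) M (\<lambda>X. X i)"
    unfolding PN_def by (rule distr_PiM_component[symmetric, OF _ i]) unfold_locales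
  then have "(\<integral>\<^sup>+x. f x \<partial>M) = (\<integral>\<^sup>+x. f x \<partial>distr (PN N) M (\<lambda>X. X i))" by simp
  also have "\<dots> = (\<integral>\<^sup>+X. f (X i) \<partial>PN N)"
    using f by (intro nn_integral_distr) (use i in \<open>auto simp: PN_def\<close>)
  finally show ?thesis ..
qed

lemma AE_component:
  assumes "AE x in M. P x"
  shows "AE X in PN N. \<forall>i\<in>{1..N}. P (X i)"
  unfolding PN_def by (intro AE_finite_allI AE_PiM_component assms) (auto intro: prob_space_axioms)

lemma mean_mgf:
  assumes h: "h \<in> borel_measurable M" and N: "0 < N"
  shows "(\<integral>\<^sup>+X. ennreal (exp (c * mean h N X)) \<partial>PN N) \<le> (\<integral>\<^sup>+x. ennreal (exp (c * h x)) \<partial>M)"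
proof -
  note [measurable] = h
  have hm: "(\<lambda>X. ennreal (exp (c * h (X i)))) \<in> borel_measurable (PN N)" if "i \<in> {1..N}" for i
    by (rule component_measurable[OF _ that]) measurable
  have one: "(\<Sum>i=1..N. 1 / real N) = 1" using N by simp
  have "exp (c * mean h N X) \<le> (\<Sum>i=1..N. 1 / N * exp (c * h (X i)))" for X
    using exp_sum_le_convex[of "{1..N}" "\<lambda>_. 1 / N" "\<lambda>i. c * h (X i)"] N
    by (simp add: mean_def sum_distrib_left sum_divide_distrib)
  then have "(\<integral>\<^sup>+X. ennreal (exp (c * mean h N X)) \<partial>PN N)
      \<le> (\<integral>\<^sup>+X. (\<Sum>i=1..N. ennreal (1 / N) * ennreal (exp (c * h (X i)))) \<partial>PN N)"
    by (intro nn_integral_mono) (simp add: sum_ennreal ennreal_leI flip: ennreal_mult)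
  also have "\<dots> = (\<Sum>i=1..N. ennreal (1 / N) * (\<integral>\<^sup>+X. ennreal (exp (c * h (X i))) \<partial>PN N))"
    using hm by (subst nn_integral_sum) (auto intro!: sum.cong nn_integral_cmult simp del: One_nat_def)
  also have "\<dots> = (\<Sum>i=1..N. ennreal (1 / N) * (\<integral>\<^sup>+x. ennreal (exp (c * h x)) \<partial>M))"
    by (intro sum.cong refl arg_cong2[where f = "(*)"] nn_integral_component[where f = "\<lambda>x. ennreal (exp (c * h x))"]) auto
  also have "\<dots> = ennreal (\<Sum>i=1..N. 1 / N) * (\<integral>\<^sup>+x. ennreal (exp (c * h x)) \<partial>M)"
    by (subst sum_ennreal[symmetric]) (simp_all add: mult.assoc)
  finally show ?thesis unfolding one by simp
qed

text \<open>2 x y \<le> x^2 + y^2 for the two exponentials turns z / 2 into z and \<beta> into 2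
  \<beta>. This is the origin of the moment exp (2 \<beta> h).\<close>

lemma tilted_bound:
  assumes k: "deg_kernel M k" and h: "h \<in> borel_measurable M" and N: "0 < N" and z: "\<bar>z\<bar> \<le> 1 / 24"
  shows "(\<integral>\<^sup>+X. ennreal (exp (- z / 2 * Ustat k N X + \<beta> * mean h N X)) \<partial>PN N)
    \<le> 2 + (\<integral>\<^sup>+x. ennreal (exp (2 * \<beta> * h x)) \<partial>M)"
proof -
  note [measurable] = Ustat_measurable[OF k] mean_measurable[OF h]
  have z': "\<bar>- z\<bar> \<le> 1 / 24" using z by simp
  have "exp (- z / 2 * Ustat k N X + \<beta> * mean h N X) \<le> exp (- z * Ustat k N X) + exp (2 * \<beta> * mean h N X)" for X
  proof -
    let ?a = "exp (- z / 2 * Ustat k N X)" and ?b = "exp (\<beta> * mean h N X)"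
    have "2 * ?a * ?b \<le> ?a\<^sup>2 + ?b\<^sup>2" by (rule sum_squares_bound)
    moreover have "?a\<^sup>2 = exp (- z * Ustat k N X)" "?b\<^sup>2 = exp (2 * \<beta> * mean h N X)"
      by (simp_all add: exp_of_nat_mult[symmetric])
    moreover have "0 \<le> ?a * ?b" by simp
    ultimately show ?thesis unfolding exp_add by linarith
  qed
  then have "(\<integral>\<^sup>+X. ennreal (exp (- z / 2 * Ustat k N X + \<beta> * mean h N X)) \<partial>PN N)
      \<le> (\<integral>\<^sup>+X. ennreal (exp (- z * Ustat k N X)) + ennreal (exp (2 * \<beta> * mean h N X)) \<partial>PN N)"
    by (intro nn_integral_mono) (simp add: ennreal_leI flip: ennreal_plus)
  also have "\<dots> = (\<integral>\<^sup>+X. ennreal (exp (- z * Ustat k N X)) \<partial>PN N) + (\<integral>\<^sup>+X. ennreal (exp (2 * \<beta> * mean h N X)) \<partial>PN N)"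
    by (rule nn_integral_add) measurable
  also have "\<dots> \<le> 2 + (\<integral>\<^sup>+x. ennreal (exp (2 * \<beta> * h x)) \<partial>M)"
  proof (rule add_mono)
    have "(\<integral>\<^sup>+X. ennreal (exp (- z * Ustat k N X)) \<partial>PN N) = ennreal (LINT X|PN N. exp (- z * Ustat k N X))"
      by (rule nn_integral_eq_integral[OF Ustat_exp(1)[OF k N z']]) simp
    also have "\<dots> \<le> ennreal 2" by (rule ennreal_leI[OF Ustat_exp(2)[OF k N z']])
    finally show "(\<integral>\<^sup>+X. ennreal (exp (- z * Ustat k N X)) \<partial>PN N) \<le> 2" by simp
    show "(\<integral>\<^sup>+X. ennreal (exp (2 * \<beta> * mean h N X)) \<partial>PN N) \<le> (\<integral>\<^sup>+x. ennreal (exp (2 * \<beta> * h x)) \<partial>M)"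
      by (rule mean_mgf[OF h N])
  qed
  finally show ?thesis .
qed

text \<open>Replacing the empirical mean of \<open>h\<close> by \<open>m\<close> produces a product
  of three factors: the weight, a normalised sum of order one times N^(-1/2), and exp (\<beta> H) +
  exp (\<beta> m) with H the empirical mean. Dominating it by fourth powers is what requires the
  moment exp (4 \<beta> h).\<close>

lemma tilted_limit:
  assumes k: "deg_kernel M k" and h: "h \<in> borel_measurable M" and z: "0 < z" "z \<le> 1 / 100" and \<beta>: "0 < \<beta>"
    and w: "subexp M (\<lambda>x. l * (h x - m))" "0 < l" and int: "integrable M (\<lambda>x. exp (4 * \<beta> * h x))"
  obtains C where "0 \<le> C" "\<And>N. 0 < N \<Longrightarrow> integrable (PN N) (\<lambda>X. exp (- z / 2 * Ustat k N X + \<beta> * mean h N X))"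
    "\<And>N. 0 < N \<Longrightarrow> \<bar>(LINT X|PN N. exp (- z / 2 * Ustat k N X + \<beta> * mean h N X))
      - exp (\<beta> * m) * exp (1 / 2 * (\<Sum>n. (- 1) ^ n * z ^ (n + 2) * hs M (gpow M k n) k / real (n + 2)))\<bar> \<le> C / sqrt N"
proof -
  define L where "L = exp (1 / 2 * (\<Sum>n. (- 1) ^ n * z ^ (n + 2) * hs M (gpow M k n) k / real (n + 2)))"
  define A where "A = (LINT x|M. exp (4 * \<beta> * h x))"
  have A0: "0 \<le> A" by (simp add: A_def)
  define E where "E = 2 + 16 ^ 4 * 6 + 8 * (A + exp (4 * (\<beta> * m))) + 1"
  define C where "C = \<beta> / l * E + exp (\<beta> * m) * (16 ^ 11 * 30)"
  have E0: "0 \<le> E" using A0 by (simp add: E_def)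
  have main: "integrable (PN N) (\<lambda>X. exp (- z / 2 * Ustat k N X + \<beta> * mean h N X)) \<and>
      \<bar>(LINT X|PN N. exp (- z / 2 * Ustat k N X + \<beta> * mean h N X)) - exp (\<beta> * m) * L\<bar> \<le> C / sqrt N"
    if N: "0 < N" for N
  proof -
    note [measurable] = Ustat_measurable[OF k, of N] mean_measurable[OF h, of N]
    let ?W = "\<lambda>X. exp (- z / 2 * Ustat k N X)"
    let ?a = "\<lambda>X. \<beta> * mean h N X" and ?b = "\<beta> * m"
    let ?s = "sqrt (real N)"
    have s0: "0 < ?s" using N by simp
    define S where "S X = (\<Sum>i=1..N. l * (h (X i) - m)) / ?s" for X
    have "(\<lambda>X. h (X i)) \<in> borel_measurable (PN N)" if "i \<in> {1..N}" for i
      by (rule component_measurable[OF h that])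
    then have [measurable]: "S \<in> borel_measurable (PN N)"
      unfolding S_def[abs_def] by (intro borel_measurable_divide borel_measurable_sum borel_measurable_times borel_measurable_diff) auto
    have ab: "\<bar>?a X - ?b\<bar> = \<beta> / l / ?s * \<bar>S X\<bar>" for X
    proof -
      have "?s * S X = l * ((\<Sum>i=1..N. h (X i)) - N * m)"
        using s0 by (simp add: S_def sum_distrib_left[symmetric] sum_subtractf)
      also have "\<dots> = l * N * (mean h N X - m)" using N by (simp add: mean_def field_simps)
      finally have "?s * S X = (?s * ?s) * (l * (mean h N X - m))" by simp
      then have S: "S X = ?s * (l * (mean h N X - m))" using s0 by (simp only: mult.assoc mult_cancel_left) simp
      have "\<beta> / l / ?s * S X = \<beta> * (mean h N X - m)" unfolding S using s0 w(2) by simp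
      then have "?a X - ?b = \<beta> / l / ?s * S X" by (simp add: right_diff_distrib)
      then show ?thesis using s0 w(2) \<beta> by (simp add: abs_mult)
    qed
    have Sint: "integrable (PN N) (\<lambda>X. exp \<bar>S X\<bar>)" "(LINT X|PN N. exp \<bar>S X\<bar>) \<le> 6"
    proof -
      have b: "(\<integral>\<^sup>+X. ennreal (exp (t * S X)) \<partial>PN N) \<le> ennreal 3" if "\<bar>t\<bar> \<le> 1" for t
        unfolding PN_def S_def by (rule single_sum_mgf[OF w(1)]) (use N that in auto)
      from exp_abs_integrable_bound[of S "PN N" 3] b[of 1] b[of "- 1"]
      show "integrable (PN N) (\<lambda>X. exp \<bar>S X\<bar>)" "(LINT X|PN N. exp \<bar>S X\<bar>) \<le> 6" by simp_all
    qed
    have W4: "integrable (PN N) (\<lambda>X. exp (- (2 * z) * Ustat k N X))" "(LINT X|PN N. exp (- (2 * z) * Ustat k N X)) \<le> 2"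
      using Ustat_exp(1,2)[OF k N, of "- (2 * z)"] z by auto
    have h4: "integrable (PN N) (\<lambda>X. exp (4 * \<beta> * mean h N X))" "(LINT X|PN N. exp (4 * \<beta> * mean h N X)) \<le> A"
    proof -
      have le: "(\<integral>\<^sup>+X. ennreal (exp (4 * \<beta> * mean h N X)) \<partial>PN N) \<le> ennreal A"
        using mean_mgf[OF h N, of "4 * \<beta>"] nn_integral_eq_integral[OF int] by (simp add: A_def)
      show i: "integrable (PN N) (\<lambda>X. exp (4 * \<beta> * mean h N X))"
        by (rule integrableI_nonneg) (use le in \<open>auto intro: le_less_trans\<close>)
      have "ennreal (LINT X|PN N. exp (4 * \<beta> * mean h N X)) \<le> ennreal A"
        using le by (subst (asm) nn_integral_eq_integral[OF i]) auto
      then show "(LINT X|PN N. exp (4 * \<beta> * mean h N X)) \<le> A" using A0 by (subst (asm) ennreal_le_iff) auto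
    qed
    \<comment> \<open>The fourth powers from \<open>young3\<close>: the weight becomes exp (- 2 z
      U), and \<open>power4_sum_le\<close> produces the factor 8.\<close>
    let ?B = "\<lambda>X. exp (- (2 * z) * Ustat k N X) + 16 ^ 4 * exp \<bar>S X\<bar> + 8 * (exp (4 * \<beta> * mean h N X) + exp (4 * (\<beta> * m))) + 1"
    interpret P: prob_space "PN N" by (rule prob_space_PN)
    have B: "integrable (PN N) ?B" "(LINT X|PN N. ?B X) \<le> E"
    proof -
      show "integrable (PN N) ?B" using W4 Sint h4 by simp
      show "(LINT X|PN N. ?B X) \<le> E"
        using W4 Sint h4 by (simp add: E_def P.prob_space)
    qed
    have le: "\<bar>?W X * (exp (?a X) - exp ?b)\<bar> \<le> \<beta> / l / ?s * ?B X" for X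
    proof -
      have c0: "0 \<le> \<beta> / l / ?s" using \<beta> w s0 by simp
      have "\<bar>?W X * (exp (?a X) - exp ?b)\<bar> = ?W X * \<bar>exp (?a X) - exp ?b\<bar>" by (simp add: abs_mult)
      also have "\<dots> \<le> ?W X * (\<bar>?a X - ?b\<bar> * (exp (?a X) + exp ?b))" by (intro mult_left_mono exp_diff_le) auto
      also have "\<dots> = \<beta> / l / ?s * (?W X * \<bar>S X\<bar> * (exp (?a X) + exp ?b))" unfolding ab by simp
      also have "\<dots> \<le> \<beta> / l / ?s * ?B X"
      proof (rule mult_left_mono[OF _ c0])
        have "?W X * \<bar>S X\<bar> * (exp (?a X) + exp ?b) \<le> ?W X ^ 4 + \<bar>S X\<bar> ^ 4 + (exp (?a X) + exp ?b) ^ 4 + 1"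
          by (rule young3)
        moreover have "?W X ^ 4 = exp (- (2 * z) * Ustat k N X)" by (simp add: exp_of_nat_mult[symmetric])
        moreover have "\<bar>S X\<bar> ^ 4 \<le> 16 ^ 4 * exp \<bar>S X\<bar>"
        proof -
          have "\<bar>S X\<bar> ^ 4 \<le> 16 ^ 4 * exp (real 4 * \<bar>S X\<bar> / 16)" by (rule power_le_exp_scaled) auto
          also have "\<dots> \<le> 16 ^ 4 * exp \<bar>S X\<bar>" by (intro mult_left_mono) auto
          finally show ?thesis .
        qed
        moreover have "(exp (?a X) + exp ?b) ^ 4 \<le> 8 * (exp (?a X) ^ 4 + exp ?b ^ 4)" by (rule power4_sum_le)
        moreover have "exp (?a X) ^ 4 = exp (4 * \<beta> * mean h N X)" "exp ?b ^ 4 = exp (4 * (\<beta> * m))"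
          by (simp_all add: exp_of_nat_mult[symmetric] mult.assoc)
        ultimately show "?W X * \<bar>S X\<bar> * (exp (?a X) + exp ?b) \<le> ?B X" by simp
      qed
      finally show ?thesis .
    qed
    let ?D = "\<lambda>X. ?W X * (exp (?a X) - exp ?b)"
    have iB: "integrable (PN N) (\<lambda>X. \<beta> / l / ?s * ?B X)" using B(1) by (rule integrable_mult_right)
    have iD: "integrable (PN N) ?D"
      by (rule Bochner_Integration.integrable_bound[OF iB])
        (measurable, intro AE_I2, unfold real_norm_def, rule order_trans[OF le abs_ge_self])
    have iW: "integrable (PN N) ?W" using Ustat_exp(1)[OF k N, of "- z / 2"] z by simp
    have split: "exp (- z / 2 * Ustat k N X + \<beta> * mean h N X) = ?D X + exp ?b * ?W X" for X
      unfolding exp_add right_diff_distrib by (simp only: mult.commute diff_add_cancel)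
    have "\<bar>LINT X|PN N. ?D X\<bar> \<le> (LINT X|PN N. \<bar>?D X\<bar>)" by (rule integral_abs_bound)
    also have "\<dots> \<le> (LINT X|PN N. \<beta> / l / ?s * ?B X)" by (rule integral_mono[OF _ iB le]) (use iD in auto)
    also have "\<dots> = \<beta> / l / ?s * (LINT X|PN N. ?B X)" by (rule integral_mult_right_zero)
    also have "\<dots> \<le> \<beta> / l / ?s * E" using \<beta> w s0 by (intro mult_left_mono B(2)) auto
    finally have D: "\<bar>LINT X|PN N. ?D X\<bar> \<le> \<beta> / l / ?s * E" .
    have f: "\<bar>part_fun k N z - L\<bar> \<le> 16 ^ 11 * 30 / ?s"
      unfolding L_def by (rule part_fun_limit[OF k N z])
    have eq: "(LINT X|PN N. exp (- z / 2 * Ustat k N X + \<beta> * mean h N X)) - exp ?b * L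
        = (LINT X|PN N. ?D X) + exp ?b * (part_fun k N z - L)"
      unfolding split part_fun_def Bochner_Integration.integral_add[OF iD integrable_mult_right[OF iW]]
        integral_mult_right_zero right_diff_distrib[of "exp ?b"] by linarith
    have "\<bar>exp ?b * (part_fun k N z - L)\<bar> \<le> exp ?b * (16 ^ 11 * 30 / ?s)"
      unfolding abs_mult using f by (intro mult_mono) auto
    with D have "\<bar>(LINT X|PN N. ?D X) + exp ?b * (part_fun k N z - L)\<bar> \<le> \<beta> / l / ?s * E + exp ?b * (16 ^ 11 * 30 / ?s)"
      by (rule order_trans[OF abs_triangle_ineq add_mono])
    also have "\<dots> = C / ?s" using s0 by (simp add: C_def field_simps)
    finally show ?thesis unfolding eq[symmetric] unfolding split
      using Bochner_Integration.integrable_add[OF iD integrable_mult_right[OF iW]] by blast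
  qed
  have "0 \<le> C" using E0 \<beta> w by (simp add: C_def)
  then show thesis using that main unfolding L_def by blast
qed

text \<open>Dividing by a bound K for the exponential moment mixes it with the value 1 at the point
  0 in proportion 1 / K, by convexity; the result is at most 1 + (1 - 1 / K).\<close>

lemma subexp_scaled:
  assumes [measurable]: "w \<in> borel_measurable M" and l: "0 < l" and int: "integrable M (\<lambda>x. exp (l * \<bar>w x\<bar>))"
    and mean: "(LINT x|M. w x) = 0"
  obtains c where "0 < c" "subexp M (\<lambda>x. c * w x)"
proof -
  define K where "K = max 1 (LINT x|M. exp (l * \<bar>w x\<bar>))"
  have K: "1 \<le> K" "(LINT x|M. exp (l * \<bar>w x\<bar>)) \<le> K" by (simp_all add: K_def)
  have "(\<integral>\<^sup>+x. ennreal (exp \<bar>l / K * w x\<bar>) \<partial>M) \<le> (\<integral>\<^sup>+x. ennreal (1 / K * exp (l * \<bar>w x\<bar>) + (1 - 1 / K)) \<partial>M)"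
  proof (intro nn_integral_mono ennreal_leI)
    fix x
    have "\<bar>l / K * w x\<bar> = 1 / K * (l * \<bar>w x\<bar>)" using l K by (simp add: abs_mult)
    then show "exp \<bar>l / K * w x\<bar> \<le> 1 / K * exp (l * \<bar>w x\<bar>) + (1 - 1 / K)"
      using exp_sum_le_convex[of "{()}" "\<lambda>_. 1 / K" "\<lambda>_. l * \<bar>w x\<bar>"] K by simp
  qed
  also have "\<dots> = ennreal (LINT x|M. 1 / K * exp (l * \<bar>w x\<bar>) + (1 - 1 / K))"
    using int K by (intro nn_integral_eq_integral) auto
  also have "(LINT x|M. 1 / K * exp (l * \<bar>w x\<bar>) + (1 - 1 / K)) = 1 / K * (LINT x|M. exp (l * \<bar>w x\<bar>)) + (1 - 1 / K)"
    using int by (simp add: prob_space)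
  also have "\<dots> \<le> 1 / K * K + (1 - 1 / K)" using K by (intro add_right_mono mult_left_mono) auto
  also have "\<dots> \<le> 2" using K by simp
  finally have "(\<integral>\<^sup>+x. ennreal (exp \<bar>l / K * w x\<bar>) \<partial>M) \<le> 2" by (simp add: ennreal_leI)
  then have "subexp M (\<lambda>x. l / K * w x)" using mean by (simp add: subexp_def)
  moreover have "0 < l / K" using l K by simp
  ultimately show thesis using that by blast
qed

end

section \<open>The logarithmic gas\<close>

text \<open>True on the diagonal as well: the real part of - \<infinity> and ln 0 are both
  0.\<close>

lemma g_real_eq: "g_real d x y = ln (edist d x y)"
  by (simp add: g_att_def)

lemma edist_commute: "edist d x y = edist d y x"
  by (simp add: edist_def L2_set_def power2_commute)

lemma edist_nonneg: "0 \<le> edist d x y"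
  by (simp add: edist_def)

lemma edist_triangle: "edist d x z \<le> edist d x y + edist d y z"
proof -
  have "edist d x z = L2_set (\<lambda>i. (x i - y i) + (y i - z i)) {..<d}" by (simp add: edist_def)
  also have "\<dots> \<le> edist d x y + edist d y z" unfolding edist_def by (rule L2_set_triangle_ineq)
  finally show ?thesis .
qed

lemma edist_square: "(edist d x y)\<^sup>2 = (\<Sum>i<d. (x i - y i)\<^sup>2)"
  by (simp add: edist_def L2_set_def sum_nonneg)

lemma edist_eq_0_iff: "edist d x y = 0 \<longleftrightarrow> (\<forall>i<d. x i = y i)"
  by (auto simp: edist_def L2_set_eq_0_iff)

lemma gpow_scale: "gpow M (\<lambda>x y. c * k x y) n x y = c ^ (n + 1) * gpow M k n x y"
proof (induction n arbitrary: x y)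
  case (Suc n)
  have "gpow M (\<lambda>x y. c * k x y) (Suc n) x y = (LINT w|M. c ^ (Suc n + 1) * (k x w * gpow M k n w y))"
    by (simp add: kcomp_def Suc mult_ac)
  then show ?case by (simp add: kcomp_def)
qed simp

text \<open>For each f the two operators agree almost everywhere, so the eigenspaces and everything
  built from them coincide. This permits the kernel to be altered on a null set.\<close>

lemma det2_AE_cong:
  assumes [measurable]: "(\<lambda>(x, y). k x y) \<in> borel_measurable (M \<Otimes>\<^sub>M M)" "(\<lambda>(x, y). l x y) \<in> borel_measurable (M \<Otimes>\<^sub>M M)"
    and eq: "AE x in M. AE y in M. k x y = l x y"
  shows "det2 M k \<beta> = det2 M l \<beta>"
proof -
  have *: "AE x in M. kernel_op M k f x = kernel_op M l f x" if f: "f \<in> L2_fun M" for f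
    using eq AE_space
  proof eventually_elim
    case (elim x)
    have [measurable]: "f \<in> borel_measurable M" using f by (simp add: L2_fun_def)
    have [measurable]: "k x \<in> borel_measurable M" "l x \<in> borel_measurable M"
      using elim(2) measurable_compose[OF measurable_Pair1'[OF elim(2)] assms(1)]
        measurable_compose[OF measurable_Pair1'[OF elim(2)] assms(2)] by simp_all
    show ?case unfolding kernel_op_def
    proof (rule integral_cong_AE)
      show "AE y in M. k x y * f y = l x y * f y" using elim(1) by eventually_elim simp
    qed measurable
  qed
  have "(AE x in M. kernel_op M k f x = \<kappa> * f x) \<longleftrightarrow> (AE x in M. kernel_op M l f x = \<kappa> * f x)"
    if "f \<in> L2_fun M" for f \<kappa>
  proof
    assume "AE x in M. kernel_op M k f x = \<kappa> * f x"
    then show "AE x in M. kernel_op M l f x = \<kappa> * f x" using *[OF that] by eventually_elim simp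
  next
    assume "AE x in M. kernel_op M l f x = \<kappa> * f x"
    then show "AE x in M. kernel_op M k f x = \<kappa> * f x" using *[OF that] by eventually_elim simp
  qed
  then have "eigenspace M k = eigenspace M l"
    unfolding eigenspace_def fun_eq_iff by (intro allI Collect_cong conj_cong refl)
  then show ?thesis by (simp add: det2_def eigen_mult_def nonzero_eigenvalues_def)
qed

section \<open>The modulated logarithmic kernel\<close>

locale log_gas =
  fixes d :: nat and \<mu> :: "point measure" and Cmom :: real
  assumes d: "1 \<le> d" and \<mu>: "\<mu> \<in> prob_measures d" and L1: "g_att_L1 d \<mu>"
    and moments: "\<And>p. 1 \<le> p \<Longrightarrow> (SUP y\<in>space (Rd d). \<integral>\<^sup>+ x. ennreal (\<bar>gt_att d \<mu> x y\<bar> ^ p) \<partial>\<mu>) \<le> ennreal (Cmom ^ p * fact p)"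
begin

sublocale sample_space \<mu>
  using \<mu> by (simp add: prob_measures_def sample_space_def)

abbreviation "h \<equiv> h_att d \<mu>"
abbreviation "m \<equiv> 2 * I_att d \<mu>"
abbreviation "gt \<equiv> gt_att d \<mu>"

lemma sets_\<mu> [measurable_cong]: "sets \<mu> = sets (Rd d)"
  using \<mu> by (simp add: prob_measures_def)

lemma space_\<mu>: "space \<mu> = space (Rd d)"
  by (rule sets_eq_imp_space_eq[OF sets_\<mu>])

lemma coordinate_measurable: "i < d \<Longrightarrow> (\<lambda>x. x i) \<in> borel_measurable \<mu>"
  unfolding measurable_cong_sets[OF sets_\<mu> refl] Rd_def by (rule measurable_component_singleton) simp

lemma edist_measurable [measurable]: "(\<lambda>(x, y). edist d x y) \<in> borel_measurable (\<mu> \<Otimes>\<^sub>M \<mu>)"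
proof -
  have "(\<lambda>z. fst z i) \<in> borel_measurable (\<mu> \<Otimes>\<^sub>M \<mu>)" "(\<lambda>z. snd z i) \<in> borel_measurable (\<mu> \<Otimes>\<^sub>M \<mu>)" if "i < d" for i
    by (rule measurable_compose[OF measurable_fst coordinate_measurable[OF that]],
        rule measurable_compose[OF measurable_snd coordinate_measurable[OF that]])
  then have "(\<lambda>z. sqrt (\<Sum>i<d. (fst z i - snd z i)\<^sup>2)) \<in> borel_measurable (\<mu> \<Otimes>\<^sub>M \<mu>)"
    by (intro measurable_compose[OF _ borel_measurable_sqrt] borel_measurable_sum borel_measurable_power borel_measurable_diff) auto
  then show ?thesis by (simp add: edist_def L2_set_def case_prod_unfold)
qed

lemma kernel_measurable [measurable]: "(\<lambda>(x, y). ln (edist d x y)) \<in> borel_measurable (\<mu> \<Otimes>\<^sub>M \<mu>)"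
  by measurable

text \<open>The integrand is infinite on the diagonal, so the finiteness of its integral makes the
  diagonal a null set.\<close>

lemma L1_facts:
  "integrable (\<mu> \<Otimes>\<^sub>M \<mu>) (\<lambda>(x, y). ln (edist d x y))" "AE z in \<mu> \<Otimes>\<^sub>M \<mu>. edist d (fst z) (snd z) \<noteq> 0"
proof -
  let ?f = "\<lambda>z. if edist d (fst z) (snd z) = 0 then \<infinity> else ennreal \<bar>ln (edist d (fst z) (snd z))\<bar>"
  have eq: "e2ennreal \<bar>g_att d x y\<bar> = (if edist d x y = 0 then \<infinity> else ennreal \<bar>ln (edist d x y)\<bar>)" for x y
    by (simp add: g_att_def)
  have [measurable]: "?f \<in> borel_measurable (\<mu> \<Otimes>\<^sub>M \<mu>)" by measurable
  have fin: "(\<integral>\<^sup>+z. ?f z \<partial>(\<mu> \<Otimes>\<^sub>M \<mu>)) < \<infinity>" using L1 by (simp add: g_att_L1_def eq)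
  then have "AE z in \<mu> \<Otimes>\<^sub>M \<mu>. ?f z \<noteq> \<infinity>" by (intro nn_integral_PInf_AE) auto
  then show "AE z in \<mu> \<Otimes>\<^sub>M \<mu>. edist d (fst z) (snd z) \<noteq> 0" by eventually_elim auto
  have "(\<integral>\<^sup>+z. ennreal (norm (case z of (x, y) \<Rightarrow> ln (edist d x y))) \<partial>(\<mu> \<Otimes>\<^sub>M \<mu>)) \<le> (\<integral>\<^sup>+z. ?f z \<partial>(\<mu> \<Otimes>\<^sub>M \<mu>))"
    by (intro nn_integral_mono) (auto simp: case_prod_unfold)
  then show "integrable (\<mu> \<Otimes>\<^sub>M \<mu>) (\<lambda>(x, y). ln (edist d x y))"
    using fin by (intro integrableI_bounded) auto
qed

lemma h_eq: "h x = (LINT y|\<mu>. ln (edist d x y))"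
  by (simp add: h_att_def g_real_eq)

lemma h_measurable [measurable]: "h \<in> borel_measurable \<mu>"
  unfolding h_eq[abs_def] by measurable

lemma h_mean: "integrable \<mu> h" "(LINT x|\<mu>. h x) = m"
  using pp.integrable_fst[OF L1_facts(1)] pp.integral_fst[OF L1_facts(1)]
  by (simp_all add: h_eq[abs_def] I_att_def g_real_eq case_prod_unfold)

lemma gt_eq: "gt x y = ln (edist d x y) - h x - h y + m"
  by (simp add: gt_att_def g_real_eq)

lemma gt_measurable [measurable]: "(\<lambda>(x, y). gt x y) \<in> borel_measurable (\<mu> \<Otimes>\<^sub>M \<mu>)"
  unfolding gt_eq by measurable

lemma gt_sym: "gt x y = gt y x"
  by (simp add: gt_eq edist_commute[of d x y])

lemma gt_row_measurable: "y \<in> space \<mu> \<Longrightarrow> (\<lambda>x. gt x y) \<in> borel_measurable \<mu>"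
  using measurable_compose[OF measurable_Pair2'[of y \<mu> \<mu>] gt_measurable] by simp

lemma gt_degenerate: "AE y in \<mu>. (LINT x|\<mu>. gt x y) = 0"
  using pp.AE_integrable_snd[OF L1_facts(1)]
proof eventually_elim
  case (elim y)
  have "(LINT x|\<mu>. ln (edist d x y)) = h y" by (simp add: h_eq edist_commute[of d _ y])
  then show ?case unfolding gt_eq using elim h_mean by (simp add: prob_space)
qed

lemma row_moment:
  assumes "y \<in> space \<mu>" "1 \<le> p"
  shows "(\<integral>\<^sup>+ x. ennreal (\<bar>gt x y\<bar> ^ p) \<partial>\<mu>) \<le> ennreal (Cmom ^ p * fact p)"
  by (rule order_trans[OF SUP_upper moments[OF assms(2)]]) (use assms(1) in \<open>simp add: space_\<mu>\<close>)

lemma Rd_point: "(\<lambda>i\<in>{..<d}. f i) \<in> space \<mu>"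
  by (simp add: space_\<mu> Rd_def space_PiM)

text \<open>The points at distance 0 from y form a set whose square lies in the null diagonal. This
  holds for every y, which is needed for the specific test points below.\<close>

lemma no_atoms:
  assumes y: "y \<in> space \<mu>"
  shows "AE x in \<mu>. edist d x y \<noteq> 0"
proof -
  have em: "(\<lambda>x. edist d x y) \<in> borel_measurable \<mu>"
    using measurable_compose[OF measurable_Pair2'[OF y, of \<mu>] edist_measurable] by simp
  define A where "A = {x \<in> space \<mu>. edist d x y = 0}"
  have A: "A \<in> sets \<mu>" unfolding A_def using em by measurable
  have sub: "A \<times> A \<subseteq> {z \<in> space (\<mu> \<Otimes>\<^sub>M \<mu>). edist d (fst z) (snd z) = 0}"
    by (auto simp: A_def space_pair_measure edist_eq_0_iff)
  have "emeasure (\<mu> \<Otimes>\<^sub>M \<mu>) {z \<in> space (\<mu> \<Otimes>\<^sub>M \<mu>). edist d (fst z) (snd z) = 0} = 0"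
    using L1_facts(2) by (subst (asm) AE_iff_measurable[OF _ refl]) auto
  moreover have "{z \<in> space (\<mu> \<Otimes>\<^sub>M \<mu>). edist d (fst z) (snd z) = 0} \<in> sets (\<mu> \<Otimes>\<^sub>M \<mu>)"
    using edist_measurable by measurable
  ultimately have "emeasure (\<mu> \<Otimes>\<^sub>M \<mu>) (A \<times> A) = 0"
    using emeasure_mono[OF sub, of "\<mu> \<Otimes>\<^sub>M \<mu>"] by simp
  then have "emeasure \<mu> A * emeasure \<mu> A = 0"
    using emeasure_pair_measure_Times[OF A A] by simp
  then have "emeasure \<mu> A = 0" by simp
  then show ?thesis using A by (subst AE_iff_measurable[OF _ refl]) (simp_all add: A_def)
qed

text \<open>Otherwise \<open>|x - y|\<close> would, up to a factor depending only on \<open>x\<close>, be a function of \<open>y\<close> alone;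
  testing with the points \<open>0\<close> and \<open>\<plusminus>e\<^sub>i\<close> shows that all \<open>x\<close> coincide, so that \<open>\<mu>\<close> has an atom.\<close>

lemma Cmom_pos: "0 < Cmom"
proof (rule ccontr)
  assume "\<not> 0 < Cmom"
  \<comment> \<open>\<open>ennreal\<close> of a non-positive number is 0, so the bound on the first
    moment alone forces all rows to vanish.\<close>
  then have row0: "(\<integral>\<^sup>+ x. ennreal \<bar>gt x y\<bar> \<partial>\<mu>) = 0" if "y \<in> space \<mu>" for y
    using row_moment[OF that, of 1] by (simp add: ennreal_neg)
  have gt0: "AE x in \<mu>. gt x y = 0" if y: "y \<in> space \<mu>" for y
  proof -
    note [measurable] = gt_row_measurable[OF y]
    have "AE x in \<mu>. ennreal \<bar>gt x y\<bar> = 0"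
      using row0[OF y] by (subst (asm) nn_integral_0_iff_AE) simp_all
    then show ?thesis by eventually_elim simp
  qed
  define pt where "pt a i = (\<lambda>j\<in>{..<d}. if j = i then a else 0 :: real)" for a :: real and i :: nat
  define Q where "Q = (\<lambda>(a, i). pt a i) ` ({-1, 0, 1} \<times> {..<d})"
  have Q: "finite Q" "y \<in> space \<mu>" if "y \<in> Q" for y using that by (auto simp: Q_def pt_def Rd_point)
  have fQ: "finite Q" by (simp add: Q_def)
  let ?good = "\<lambda>x. \<forall>y\<in>Q. gt x y = 0 \<and> edist d x y \<noteq> 0"
  have good: "AE x in \<mu>. ?good x"
    by (intro AE_finite_allI fQ) (use gt0 no_atoms Q in auto)
  have "AE x in \<mu>. AE x' in \<mu>. edist d x x' \<noteq> 0" using pp.AE_pair[OF L1_facts(2)] by simp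
  then have "AE x in \<mu>. AE x' in \<mu>. ?good x \<and> ?good x' \<and> edist d x x' \<noteq> 0"
    using good
  proof eventually_elim
    case (elim x)
    show ?case using elim(1) good by eventually_elim (use elim(2) in auto)
  qed
  then have "\<exists>x. AE x' in \<mu>. ?good x \<and> ?good x' \<and> edist d x x' \<noteq> 0"
    using eventually_happens'[OF ae_filter_bot] by blast
  then obtain x x' where x: "?good x" "?good x'" "edist d x x' \<noteq> 0"
    using eventually_happens'[OF ae_filter_bot] by blast
  \<comment> \<open>Where \<open>gt\<close> vanishes for both x and x', the logarithms of the
    distances to y differ by h x - h x', whatever y is.\<close>
  define t where "t = exp (h x - h x')"
  have ratio: "(edist d x y)\<^sup>2 = t\<^sup>2 * (edist d x' y)\<^sup>2" if y: "y \<in> Q" for y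
  proof -
    have "ln (edist d x y) = (h x - h x') + ln (edist d x' y)"
      using bspec[OF x(1) y] bspec[OF x(2) y] unfolding gt_eq by linarith
    moreover have "0 < edist d x y" "0 < edist d x' y" using x(1,2) y edist_nonneg by (auto simp: less_le)
    ultimately have "edist d x y = t * edist d x' y" by (metis exp_add exp_ln t_def)
    then show ?thesis by (simp add: power_mult_distrib)
  qed
  have ed: "(edist d x (pt a i))\<^sup>2 = (\<Sum>j<d. (x j)\<^sup>2) - 2 * a * x i + a\<^sup>2" if "i < d" for x a i
  proof -
    have "(edist d x (pt a i))\<^sup>2 = (\<Sum>j<d. (x j)\<^sup>2 + (if j = i then - 2 * a * x i + a\<^sup>2 else 0))"
      unfolding edist_square by (intro sum.cong refl) (auto simp: pt_def power2_diff)
    then show ?thesis using that by (simp add: sum.distrib)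
  qed
  let ?n = "\<lambda>x. \<Sum>j<d. (x j)\<^sup>2 :: real"
  have eqs: "?n x - 2 * a * x i + a\<^sup>2 = t\<^sup>2 * (?n x' - 2 * a * x' i + a\<^sup>2)" if "i < d" "a \<in> {-1, 0, 1}" for a i
    using ratio[of "pt a i"] that ed[OF that(1)] by (force simp: Q_def)
  \<comment> \<open>The second difference in a = -1, 0, 1 removes the terms in x and x' and leaves 2
    = 2 t^2. The first coordinate exists because d \<ge> 1.\<close>
  have t1: "t\<^sup>2 = 1"
    using eqs[of 0 1] eqs[of 0 "-1"] eqs[of 0 0] d by (simp add: algebra_simps)
  have "x i = x' i" if "i < d" for i
    using eqs[OF that, of 1] eqs[OF that, of "-1"] unfolding t1 by simp
  then show False using x(3) by (simp add: edist_eq_0_iff)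
qed

definition "a = 1 / (2 * Cmom)"

lemma a_pos: "0 < a"
  using Cmom_pos by (simp add: a_def)

text \<open>The factorial in the moment hypothesis cancels that of the exponential series. As a Cmom
  = 1/2, what remains is the geometric series with sum 2, the constant in \<open>subexp\<close>; the
  term p = 0 is the total mass.\<close>

lemma gt_exp_moment:
  assumes y: "y \<in> space \<mu>"
  shows "(\<integral>\<^sup>+ x. ennreal (exp \<bar>a * gt x y\<bar>) \<partial>\<mu>) \<le> 2"
proof -
  note [measurable] = gt_row_measurable[OF y]
  have "ennreal (exp u) = (\<Sum>p. ennreal (u ^ p /\<^sub>R fact p))" if "0 \<le> u" for u :: real
    using exp_converges[of u] that by (subst suminf_ennreal_eq[of _ "exp u"]) auto
  then have "(\<integral>\<^sup>+ x. ennreal (exp \<bar>a * gt x y\<bar>) \<partial>\<mu>) = (\<integral>\<^sup>+ x. (\<Sum>p. ennreal (\<bar>a * gt x y\<bar> ^ p /\<^sub>R fact p)) \<partial>\<mu>)"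
    by simp
  also have "\<dots> = (\<Sum>p. \<integral>\<^sup>+ x. ennreal (\<bar>a * gt x y\<bar> ^ p /\<^sub>R fact p) \<partial>\<mu>)"
    by (rule nn_integral_suminf) measurable
  also have "\<dots> \<le> (\<Sum>p. ennreal ((1 / 2) ^ p))"
  proof (rule suminf_le)
    fix p
    have "(\<integral>\<^sup>+ x. ennreal (\<bar>a * gt x y\<bar> ^ p /\<^sub>R fact p) \<partial>\<mu>) = (\<integral>\<^sup>+ x. ennreal (a ^ p / fact p) * ennreal (\<bar>gt x y\<bar> ^ p) \<partial>\<mu>)"
      using a_pos by (intro nn_integral_cong) (simp add: abs_mult power_mult_distrib ennreal_mult[symmetric] field_simps)
    also have "\<dots> = ennreal (a ^ p / fact p) * (\<integral>\<^sup>+ x. ennreal (\<bar>gt x y\<bar> ^ p) \<partial>\<mu>)"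
      by (rule nn_integral_cmult) measurable
    also have "\<dots> \<le> ennreal (a ^ p / fact p) * ennreal (Cmom ^ p * fact p)"
    proof (rule mult_left_mono)
      show "(\<integral>\<^sup>+ x. ennreal (\<bar>gt x y\<bar> ^ p) \<partial>\<mu>) \<le> ennreal (Cmom ^ p * fact p)"
      proof (cases "p = 0")
        case True
        then show ?thesis by (simp add: emeasure_space_1)
      next
        case False
        then show ?thesis by (intro row_moment[OF y]) simp
      qed
    qed simp
    also have "\<dots> = ennreal ((a * Cmom) ^ p)"
      using a_pos Cmom_pos by (subst ennreal_mult[symmetric]) (simp_all add: power_mult_distrib)
    also have "a * Cmom = 1 / 2" using Cmom_pos by (simp add: a_def)
    finally show "(\<integral>\<^sup>+ x. ennreal (\<bar>a * gt x y\<bar> ^ p /\<^sub>R fact p) \<partial>\<mu>) \<le> ennreal ((1 / 2) ^ p)" .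
  qed auto
  also have "\<dots> = ennreal 2"
    using geometric_sums[of "1 / 2 :: real"] by (intro suminf_ennreal_eq) auto
  finally show ?thesis by simp
qed

text \<open>\<open>gt\<close> is degenerate only almost everywhere, while the bounds above need it at every point.\<close>

definition "Bad = {y \<in> space \<mu>. (LINT x|\<mu>. gt x y) \<noteq> 0}"
text \<open>Both variables are cut off on the null set to preserve symmetry.\<close>

definition "k x y = (if x \<in> Bad \<or> y \<in> Bad then 0 else a * gt x y)"

lemma Bad: "Bad \<in> sets \<mu>" "AE y in \<mu>. y \<notin> Bad"
proof -
  have [measurable]: "(\<lambda>y. LINT x|\<mu>. gt x y) \<in> borel_measurable \<mu>" by measurable
  show "Bad \<in> sets \<mu>" unfolding Bad_def by measurable
  show "AE y in \<mu>. y \<notin> Bad" using gt_degenerate by eventually_elim (simp add: Bad_def)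
qed

lemma k_measurable [measurable]: "(\<lambda>(x, y). k x y) \<in> borel_measurable (\<mu> \<Otimes>\<^sub>M \<mu>)"
proof -
  note [measurable] = Bad(1)
  show ?thesis unfolding k_def by measurable
qed

lemma deg_kernel_k: "deg_kernel \<mu> k"
  unfolding deg_kernel_def
proof (intro conjI ballI)
  show "(\<lambda>(x, y). k x y) \<in> borel_measurable (\<mu> \<Otimes>\<^sub>M \<mu>)" by measurable
  show "k x y = k y x" for x y by (simp add: k_def gt_sym[of x y])
  fix y assume y: "y \<in> space \<mu>"
  note [measurable] = gt_row_measurable[OF y]
  have km [measurable]: "(\<lambda>x. k x y) \<in> borel_measurable \<mu>"
    using measurable_compose[OF measurable_Pair2'[OF y, of \<mu>] k_measurable] by simp
  have "(\<integral>\<^sup>+ x. ennreal (exp \<bar>k x y\<bar>) \<partial>\<mu>) \<le> (\<integral>\<^sup>+ x. ennreal (exp \<bar>a * gt x y\<bar>) \<partial>\<mu>)"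
    by (intro nn_integral_mono ennreal_leI) (simp add: k_def)
  also have "\<dots> \<le> 2" by (rule gt_exp_moment[OF y])
  finally have "(\<integral>\<^sup>+ x. ennreal (exp \<bar>k x y\<bar>) \<partial>\<mu>) \<le> 2" .
  moreover have "(LINT x|\<mu>. k x y) = 0"
  proof (cases "y \<in> Bad")
    case False
    have "(LINT x|\<mu>. k x y) = (LINT x|\<mu>. a * gt x y)"
    proof (rule integral_cong_AE)
      show "AE x in \<mu>. k x y = a * gt x y" using Bad(2) by eventually_elim (simp add: k_def False)
    qed measurable
    then show ?thesis using False y by (simp add: Bad_def)
  qed (simp add: k_def)
  ultimately show "subexp \<mu> (\<lambda>x. k x y)" using km by (simp add: subexp_def)
qed

text \<open>The factor N in the exponent leaves the double sum with 1 / (2 N) and the sum over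
  \<open>h\<close> with 1 / N, so the U-statistic of \<open>k\<close> appears with z = \<beta> / a
  and the last term of the energy becomes the constant exp (- \<beta> I).\<close>

lemma F_att_eq:
  assumes "\<forall>i\<in>{1..N}. X i \<notin> Bad" and N: "0 < N"
  shows "exp (- \<beta> * real N * F_att d N X \<mu>)
    = exp (- \<beta> * I_att d \<mu>) * exp (- (\<beta> / a) / 2 * Ustat k N X + \<beta> * mean h N X)"
proof -
  have "pair_sum k {1..N} X = a * (\<Sum>i\<in>{1..N}. \<Sum>j\<in>{1..N} - {i}. gt (X i) (X j))"
    unfolding pair_sum_def sum_distrib_left
    by (intro sum.cong refl) (use assms(1) in \<open>auto simp: k_def\<close>)
  then have U: "(\<Sum>i\<in>{1..N}. \<Sum>j\<in>{1..N} - {i}. gt (X i) (X j)) = N * Ustat k N X / a"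
    using N a_pos by (simp add: Ustat_def)
  have H: "(\<Sum>i\<in>{1..N}. h (X i)) = N * mean h N X" using N by (simp add: mean_def)
  have "- \<beta> * real N * F_att d N X \<mu> = - \<beta> * I_att d \<mu> + (- (\<beta> / a) / 2 * Ustat k N X + \<beta> * mean h N X)"
    unfolding F_att_def U H using N a_pos by (simp add: field_simps power2_eq_square)
  then show ?thesis by (simp only: exp_add)
qed

lemma K_att_eq:
  assumes N: "0 < N"
  shows "K_att d N \<beta> \<mu> = ennreal (exp (- \<beta> * I_att d \<mu>))
    * (\<integral>\<^sup>+X. ennreal (exp (- (\<beta> / a) / 2 * Ustat k N X + \<beta> * mean h N X)) \<partial>PN N)"
proof -
  note [measurable] = Ustat_measurable[OF deg_kernel_k] mean_measurable[OF h_measurable]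
  have "K_att d N \<beta> \<mu> = (\<integral>\<^sup>+X. ennreal (exp (- \<beta> * real N * F_att d N X \<mu>)) \<partial>PN N)"
    unfolding K_att_def PN_def ..
  also have "\<dots> = (\<integral>\<^sup>+X. ennreal (exp (- \<beta> * I_att d \<mu>)) * ennreal (exp (- (\<beta> / a) / 2 * Ustat k N X + \<beta> * mean h N X)) \<partial>PN N)"
  proof (rule nn_integral_cong_AE)
    show "AE X in PN N. ennreal (exp (- \<beta> * real N * F_att d N X \<mu>))
        = ennreal (exp (- \<beta> * I_att d \<mu>)) * ennreal (exp (- (\<beta> / a) / 2 * Ustat k N X + \<beta> * mean h N X))"
      using AE_component[OF Bad(2), of N]
    proof eventually_elim
      case (elim X)
      show ?case unfolding F_att_eq[OF elim N] by (rule ennreal_mult) auto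
    qed
  qed
  also have "\<dots> = ennreal (exp (- \<beta> * I_att d \<mu>))
    * (\<integral>\<^sup>+X. ennreal (exp (- (\<beta> / a) / 2 * Ustat k N X + \<beta> * mean h N X)) \<partial>PN N)"
    by (rule nn_integral_cmult) measurable
  finally show ?thesis .
qed

section \<open>Uniform bound, determinant and limit for the gas\<close>

lemma uniform_bound:
  assumes \<beta>: "0 \<le> \<beta>" "\<beta> < 1 / (48 * Cmom)" and int: "integrable \<mu> (\<lambda>x. exp (2 * \<beta> * h x))"
  shows "\<exists>Cub :: real. (SUP N\<in>{1..}. K_att d N \<beta> \<mu>) \<le> ennreal Cub"
proof (intro exI SUP_least)
  fix N :: nat assume "N \<in> {1..}"
  then have N: "0 < N" by simp
  \<comment> \<open>z = 2 Cmom \<beta>, so the threshold 1/24 is reached at \<beta> = 1 / (48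
    Cmom).\<close>
  have z: "\<bar>\<beta> / a\<bar> \<le> 1 / 24"
    using \<beta> Cmom_pos by (simp add: a_def field_simps)
  have "(\<integral>\<^sup>+X. ennreal (exp (- (\<beta> / a) / 2 * Ustat k N X + \<beta> * mean h N X)) \<partial>PN N)
      \<le> 2 + (\<integral>\<^sup>+x. ennreal (exp (2 * \<beta> * h x)) \<partial>\<mu>)"
    by (rule tilted_bound[OF deg_kernel_k h_measurable N z])
  also have "\<dots> = ennreal (2 + (LINT x|\<mu>. exp (2 * \<beta> * h x)))"
    by (subst nn_integral_eq_integral[OF int]) (auto simp: ennreal_plus)
  finally have "K_att d N \<beta> \<mu> \<le> ennreal (exp (- \<beta> * I_att d \<mu>)) * ennreal (2 + (LINT x|\<mu>. exp (2 * \<beta> * h x)))"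
    unfolding K_att_eq[OF N] by (rule mult_left_mono) simp
  also have "\<dots> = ennreal (exp (- \<beta> * I_att d \<mu>) * (2 + (LINT x|\<mu>. exp (2 * \<beta> * h x))))"
    by (rule ennreal_mult[symmetric]) auto
  finally show "K_att d N \<beta> \<mu> \<le> ennreal (exp (- \<beta> * I_att d \<mu>) * (2 + (LINT x|\<mu>. exp (2 * \<beta> * h x))))" .
qed

lemma det2_gt:
  assumes z: "\<bar>\<beta> / a\<bar> \<le> 1 / 100"
  shows "det2 \<mu> gt \<beta> = exp (- (\<Sum>n. (- 1) ^ n * (\<beta> / a) ^ (n + 2) * hs \<mu> (gpow \<mu> k n) k / real (n + 2)))"
proof -
  let ?l = "\<lambda>x y. (1 / a) * k x y"
  note kL = deg_kernel_L2ker[OF deg_kernel_k]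
  have lL: "L2ker \<mu> ?l" by (rule L2ker_cmult[OF kL(1)])
  have "AE x in \<mu>. AE y in \<mu>. gt x y = ?l x y"
    using Bad(2)
  proof eventually_elim
    case (elim x)
    show ?case using Bad(2) by eventually_elim (use elim a_pos in \<open>simp add: k_def\<close>)
  qed
  then have "det2 \<mu> gt \<beta> = det2 \<mu> ?l \<beta>"
    by (intro det2_AE_cong gt_measurable L2kerD(2)[OF lL])
  also have "\<dots> = exp (- (\<Sum>n. (- 1) ^ n * \<beta> ^ (n + 2) * hs \<mu> (gpow \<mu> ?l n) ?l / real (n + 2)))"
  \<comment> \<open>The squared norm of \<open>k\<close> is at most 2 \<le> 2^2, hence the norm of
    the unscaled kernel is at most 2 / a.\<close>
  proof (rule det2_eq[where b = "2 / a"])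
    show "sym_kernel \<mu> ?l" using kL(2) by (simp add: sym_kernel_def)
    have "hs \<mu> ?l ?l = (1 / a)\<^sup>2 * hs \<mu> k k"
      unfolding hs_cmult_left by (subst hs_commute, subst hs_cmult_left) (simp add: power2_eq_square)
    also have "\<dots> \<le> (1 / a)\<^sup>2 * 4" using kL(3) by (intro mult_left_mono) auto
    also have "\<dots> = (2 / a)\<^sup>2" by (simp add: power_divide)
    finally show "hs \<mu> ?l ?l \<le> (2 / a)\<^sup>2" .
    show "\<bar>\<beta>\<bar> * (2 / a) \<le> 1 / 2" using z a_pos by (simp add: abs_divide)
  qed (use a_pos lL in auto)
  also have "(\<lambda>n. (- 1) ^ n * \<beta> ^ (n + 2) * hs \<mu> (gpow \<mu> ?l n) ?l / real (n + 2))
      = (\<lambda>n. (- 1) ^ n * (\<beta> / a) ^ (n + 2) * hs \<mu> (gpow \<mu> k n) k / real (n + 2))"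
  proof
    fix n
    have "hs \<mu> (gpow \<mu> ?l n) ?l = hs \<mu> (\<lambda>x y. (1 / a) ^ (n + 1) * gpow \<mu> k n x y) ?l"
      by (rule arg_cong2[where f = "hs \<mu>"]) (auto intro!: ext simp only: gpow_scale)
    also have "\<dots> = (1 / a) ^ (n + 1) * ((1 / a) * hs \<mu> (gpow \<mu> k n) k)"
      unfolding hs_cmult_left by (subst hs_commute, subst hs_cmult_left, subst hs_commute) simp
    finally show "(- 1) ^ n * \<beta> ^ (n + 2) * hs \<mu> (gpow \<mu> ?l n) ?l / real (n + 2)
      = (- 1) ^ n * (\<beta> / a) ^ (n + 2) * hs \<mu> (gpow \<mu> k n) k / real (n + 2)"
      by (simp add: power_divide)
  qed
  finally show ?thesis .
qed

text \<open>The singularities of \<open>log|x - y|\<close> for two distinct values of \<open>y\<close> are disjoint, so the lower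
  exponential moments of \<open>h\<close> are inherited from \<open>gt\<close>.\<close>

lemma h_exp_moment:
  assumes \<beta>: "0 < \<beta>" and int: "integrable \<mu> (\<lambda>x. exp (4 * \<beta> * h x))"
  obtains l where "0 < l" "integrable \<mu> (\<lambda>x. exp (l * \<bar>h x - m\<bar>))"
proof -
  define p0 where "p0 = (\<lambda>i\<in>{..<d}. 0 :: real)"
  define p1 where "p1 = (\<lambda>i\<in>{..<d}. 1 :: real)"
  have p: "p0 \<in> space \<mu>" "p1 \<in> space \<mu>" unfolding p0_def p1_def by (rule Rd_point)+
  note [measurable] = gt_row_measurable[OF p(1)] gt_row_measurable[OF p(2)]
  \<comment> \<open>By the triangle inequality each x is at distance at least \<open>D\<close> from
    one of the two reference points. There the logarithm is bounded below, and - h x can be read off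
    from the corresponding row of \<open>gt\<close>.\<close>
  define D where "D = edist d p0 p1 / 2"
  have "edist d p0 p1 \<noteq> 0" using d by (auto simp: edist_eq_0_iff p0_def p1_def intro!: exI[of _ 0])
  then have D0: "0 < D" using edist_nonneg[of d p0 p1] by (simp add: D_def)
  define c where "c = \<bar>ln D\<bar> + \<bar>h p0\<bar> + \<bar>h p1\<bar> + 2 * \<bar>m\<bar>"
  have lower: "m - h x \<le> c + (\<bar>gt x p0\<bar> + \<bar>gt x p1\<bar>)" for x
  proof -
    have "edist d p0 p1 \<le> edist d x p0 + edist d x p1"
      using edist_triangle[of d p0 p1 x] edist_commute[of d p0 x] by simp
    then have "D \<le> edist d x p0 \<or> D \<le> edist d x p1" by (auto simp: D_def)
    then obtain q where q: "q = p0 \<or> q = p1" "D \<le> edist d x q" by auto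
    have "ln D \<le> ln (edist d x q)" using D0 q(2) by simp
    moreover have "- h x = gt x q - ln (edist d x q) + h q - m" by (simp add: gt_eq)
    moreover have "gt x q \<le> \<bar>gt x p0\<bar> + \<bar>gt x p1\<bar>" "h q \<le> \<bar>h p0\<bar> + \<bar>h p1\<bar>" using q(1) by auto
    ultimately show ?thesis unfolding c_def by linarith
  qed
  \<comment> \<open>4 \<beta> is the moment available for large values of \<open>h\<close>. For
    small values two rows of \<open>gt\<close> enter as a product, and separating them by AM-GM
    halves the available exponent a.\<close>
  define l where "l = min (4 * \<beta>) (a / 2)"
  have l: "0 < l" "l \<le> 4 * \<beta>" "l \<le> a / 2" using \<beta> a_pos by (auto simp: l_def)
  have ea: "integrable \<mu> (\<lambda>x. exp (a * \<bar>gt x q\<bar>))" if q: "q \<in> {p0, p1}" for q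
  proof (rule integrableI_nonneg)
    show "(\<integral>\<^sup>+ x. ennreal (exp (a * \<bar>gt x q\<bar>)) \<partial>\<mu>) < \<infinity>"
      using gt_exp_moment[of q] q p a_pos by (auto simp: abs_mult intro: le_less_trans)
  qed (use q in auto)
  let ?B = "\<lambda>x. exp (l * \<bar>m\<bar>) * (1 + exp (4 * \<beta> * h x)) + exp (l * c) * (exp (a * \<bar>gt x p0\<bar>) + exp (a * \<bar>gt x p1\<bar>))"
  have B: "integrable \<mu> ?B" using int ea[of p0] ea[of p1] by simp
  have le: "exp (l * \<bar>h x - m\<bar>) \<le> ?B x" for x
  proof (cases "h x \<ge> m")
    case True
    have "l * \<bar>h x - m\<bar> \<le> l * \<bar>m\<bar> + l * h x" using True l by (simp add: distrib_left[symmetric])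
    then have "exp (l * \<bar>h x - m\<bar>) \<le> exp (l * \<bar>m\<bar>) * exp (l * h x)" by (simp add: exp_add[symmetric])
    also have "\<dots> \<le> exp (l * \<bar>m\<bar>) * (1 + exp (4 * \<beta> * h x))"
    proof (rule mult_left_mono)
      show "exp (l * h x) \<le> 1 + exp (4 * \<beta> * h x)"
      proof (cases "h x \<ge> 0")
        case True
        then have "exp (l * h x) \<le> exp (4 * \<beta> * h x)" using l by (simp add: mult_right_mono)
        also have "\<dots> \<le> 1 + exp (4 * \<beta> * h x)" by (rule le_add_same_cancel2[THEN iffD2]) simp
        finally show ?thesis .
      next
        case False
        then have "exp (l * h x) \<le> 1" using l by (simp add: mult_nonneg_nonpos)
        then show ?thesis by (simp add: add_increasing2)
      qed
    qed simp
    also have "\<dots> \<le> ?B x" by simp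
    finally show ?thesis .
  next
    case False
    then have "l * \<bar>h x - m\<bar> \<le> l * (c + (\<bar>gt x p0\<bar> + \<bar>gt x p1\<bar>))" using lower[of x] l by (intro mult_left_mono) auto
    also have "\<dots> \<le> l * c + (a / 2 * \<bar>gt x p0\<bar> + a / 2 * \<bar>gt x p1\<bar>)"
      using mult_right_mono[OF l(3), of "\<bar>gt x p0\<bar>"] mult_right_mono[OF l(3), of "\<bar>gt x p1\<bar>"]
      by (simp only: distrib_left abs_ge_zero add_left_mono add_mono)
    finally have "exp (l * \<bar>h x - m\<bar>) \<le> exp (l * c + (a / 2 * \<bar>gt x p0\<bar> + a / 2 * \<bar>gt x p1\<bar>))" by simp
    also have "\<dots> = exp (l * c) * (exp (a / 2 * \<bar>gt x p0\<bar>) * exp (a / 2 * \<bar>gt x p1\<bar>))" by (simp only: exp_add)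
    also have "\<dots> \<le> exp (l * c) * (exp (a * \<bar>gt x p0\<bar>) + exp (a * \<bar>gt x p1\<bar>))"
    proof (rule mult_left_mono)
      let ?u = "exp (a / 2 * \<bar>gt x p0\<bar>)" and ?v = "exp (a / 2 * \<bar>gt x p1\<bar>)"
      have "2 * ?u * ?v \<le> ?u\<^sup>2 + ?v\<^sup>2" by (rule sum_squares_bound)
      moreover have "0 \<le> ?u * ?v" by simp
      moreover have "?u\<^sup>2 = exp (a * \<bar>gt x p0\<bar>)" "?v\<^sup>2 = exp (a * \<bar>gt x p1\<bar>)"
        by (simp_all add: exp_of_nat_mult[symmetric])
      ultimately show "?u * ?v \<le> exp (a * \<bar>gt x p0\<bar>) + exp (a * \<bar>gt x p1\<bar>)" by linarith
    qed simp
    also have "\<dots> \<le> ?B x" by (simp add: add_nonneg_nonneg)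
    finally show ?thesis .
  qed
  have "integrable \<mu> (\<lambda>x. exp (l * \<bar>h x - m\<bar>))"
    by (rule Bochner_Integration.integrable_bound[OF B])
      (use le in \<open>auto intro!: AE_I2 intro: order_trans[OF _ abs_ge_self]\<close>)
  then show thesis using that l(1) by blast
qed

text \<open>Since m = 2 I, the prefactor exp (- \<beta> I) and the tilt exp (\<beta> m) combine to
  exp (\<beta> I), while det2 = exp (- T) turns exp (T / 2) into the power -1/2 of the determinant.
  The condition z = 2 Cmom \<beta> \<le> 1/100 gives the threshold 1 / (200 Cmom).\<close>

lemma quantitative_limit:
  assumes \<beta>: "0 < \<beta>" "\<beta> < 1 / (200 * Cmom)" and int: "integrable \<mu> (\<lambda>x. exp (4 * \<beta> * h x))"
  shows "0 < det2 \<mu> gt \<beta>"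
    and "\<exists>(Crate :: real) c. 0 < c \<and> (\<forall>N\<ge>1. K_att d N \<beta> \<mu> < \<infinity> \<and>
      \<bar>enn2real (K_att d N \<beta> \<mu>) - K_inf_att d \<beta> \<mu>\<bar> \<le> Crate * (exp 1 + real N) powr (- c))"
proof -
  define z where "z = \<beta> / a"
  have z: "0 < z" "z \<le> 1 / 100"
    using \<beta> Cmom_pos by (simp_all add: z_def a_def field_simps)
  define T where "T = (\<Sum>n. (- 1) ^ n * z ^ (n + 2) * hs \<mu> (gpow \<mu> k n) k / real (n + 2))"
  have det: "det2 \<mu> gt \<beta> = exp (- T)"
    using det2_gt[of \<beta>] z unfolding T_def z_def by simp
  then show "0 < det2 \<mu> gt \<beta>" by simp
  let ?I = "I_att d \<mu>"
  have Kinf: "K_inf_att d \<beta> \<mu> = exp (- \<beta> * ?I) * (exp (\<beta> * m) * exp (1 / 2 * T))"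
  proof -
    have "K_inf_att d \<beta> \<mu> = exp (\<beta> * ?I) * exp (1 / 2 * T)"
      by (simp add: K_inf_att_def det exp_powr_real)
    also have "exp (\<beta> * ?I) = exp (- \<beta> * ?I) * exp (\<beta> * m)" by (simp add: exp_add[symmetric])
    finally show ?thesis by simp
  qed
  obtain l0 where l0: "0 < l0" "integrable \<mu> (\<lambda>x. exp (l0 * \<bar>h x - m\<bar>))"
    using h_exp_moment[OF \<beta>(1) int] by blast
  have "(LINT x|\<mu>. h x - m) = 0" using h_mean by (simp add: prob_space)
  then obtain l where l: "0 < l" "subexp \<mu> (\<lambda>x. l * (h x - m))"
    using subexp_scaled[of "\<lambda>x. h x - m" l0] l0 by auto
  obtain C where C: "0 \<le> C"
    "\<And>N. 0 < N \<Longrightarrow> integrable (PN N) (\<lambda>X. exp (- z / 2 * Ustat k N X + \<beta> * mean h N X))"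
    "\<And>N. 0 < N \<Longrightarrow> \<bar>(LINT X|PN N. exp (- z / 2 * Ustat k N X + \<beta> * mean h N X)) - exp (\<beta> * m) * exp (1 / 2 * T)\<bar> \<le> C / sqrt N"
    using tilted_limit[OF deg_kernel_k h_measurable z \<beta>(1) l(2,1) int] unfolding T_def by blast
  show "\<exists>(Crate :: real) c. 0 < c \<and> (\<forall>N\<ge>1. K_att d N \<beta> \<mu> < \<infinity> \<and>
      \<bar>enn2real (K_att d N \<beta> \<mu>) - K_inf_att d \<beta> \<mu>\<bar> \<le> Crate * (exp 1 + real N) powr (- c))"
  proof (rule exI[of _ "exp (- \<beta> * ?I) * (2 * C)"], rule exI[of _ "1 / 2"], intro conjI allI impI)
    fix N :: nat assume "1 \<le> N"
    then have N: "0 < N" by simp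
    let ?E = "LINT X|PN N. exp (- z / 2 * Ustat k N X + \<beta> * mean h N X)"
    have K: "K_att d N \<beta> \<mu> = ennreal (exp (- \<beta> * ?I) * ?E)"
      unfolding K_att_eq[OF N] z_def[symmetric]
      by (subst nn_integral_eq_integral[OF C(2)[OF N]]) (auto simp: ennreal_mult)
    then show "K_att d N \<beta> \<mu> < \<infinity>" by simp
    have "0 \<le> ?E" by simp
    then have "enn2real (K_att d N \<beta> \<mu>) = exp (- \<beta> * ?I) * ?E" unfolding K by (intro enn2real_ennreal) simp
    moreover have "\<bar>exp u * v - exp u * w\<bar> = exp u * \<bar>v - w\<bar>" for u v w :: real
      by (simp add: right_diff_distrib[symmetric] abs_mult)
    ultimately have "\<bar>enn2real (K_att d N \<beta> \<mu>) - K_inf_att d \<beta> \<mu>\<bar> = exp (- \<beta> * ?I) * \<bar>?E - exp (\<beta> * m) * exp (1 / 2 * T)\<bar>"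
      using Kinf by presburger
    also have "\<dots> \<le> exp (- \<beta> * ?I) * (C / sqrt N)" by (intro mult_left_mono C(3)[OF N]) simp
    also have "\<dots> \<le> exp (- \<beta> * ?I) * (2 * C * (exp 1 + real N) powr (- (1 / 2)))"
    proof (rule mult_left_mono)
      \<comment> \<open>e \<le> 3 \<le> 3 N, so passing from N to e + N costs a factor 2 in the rate
        of order -1/2.\<close>
      have "exp 1 + real N \<le> 4 * real N" using exp_le N by linarith
      then have "(4 * real N) powr (- (1 / 2)) \<le> (exp 1 + real N) powr (- (1 / 2))"
        by (intro powr_mono2') (auto intro: add_pos_nonneg)
      moreover have "(4 * real N) powr (- (1 / 2)) = 1 / (2 * sqrt N)"
        using N by (simp only: powr_minus_divide powr_half_sqrt real_sqrt_mult real_sqrt_four of_nat_0_le_iff mult_nonneg_nonneg zero_le_numeral)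
      ultimately have "1 / (2 * sqrt N) \<le> (exp 1 + real N) powr (- (1 / 2))" by simp
      then have "2 * C * (1 / (2 * sqrt N)) \<le> 2 * C * (exp 1 + real N) powr (- (1 / 2))"
        using C(1) by (intro mult_left_mono) auto
      then show "C / sqrt N \<le> 2 * C * (exp 1 + real N) powr (- (1 / 2))" by simp
    qed simp
    finally show "\<bar>enn2real (K_att d N \<beta> \<mu>) - K_inf_att d \<beta> \<mu>\<bar> \<le> exp (- \<beta> * ?I) * (2 * C) * (exp 1 + real N) powr (- (1 / 2))"
      by (simp only: mult.assoc)
  qed simp
qed

end

theorem theorem2p6:
  "\<exists>Cstar > (0::real). \<exists>\<beta>q :: nat \<Rightarrow> real \<Rightarrow> real \<Rightarrow> real.
     \<forall>d \<ge> 1. \<forall>\<mu> \<in> prob_measures d. \<forall>Cmom :: real.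
       g_att_L1 d \<mu> \<longrightarrow>
       (\<forall>p::nat. p \<ge> 1 \<longrightarrow>
          (SUP y\<in>space (Rd d). \<integral>\<^sup>+ x. ennreal (\<bar>gt_att d \<mu> x y\<bar> ^ p) \<partial>\<mu>)
            \<le> ennreal (Cmom ^ p * fact p)) \<longrightarrow>
       (let \<beta>0 = 1 / (Cstar * Cmom) in
          (\<forall>\<beta>. 0 \<le> \<beta> \<and> \<beta> < \<beta>0 \<and> integrable \<mu> (\<lambda>x. exp (2 * \<beta> * h_att d \<mu> x)) \<longrightarrow>
             (\<exists>Cub :: real. (SUP N\<in>{1..}. K_att d N \<beta> \<mu>) \<le> ennreal Cub)) \<and>
          (in_Linf d \<mu> \<longrightarrow>
             (let b = \<beta>q d (enn2real (Linf_norm d \<mu>)) Cmom in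
                0 < b \<and> b \<le> \<beta>0 / 2 \<and>
                (\<forall>\<beta>. 0 < \<beta> \<and> \<beta> < b \<and> integrable \<mu> (\<lambda>x. exp (4 * \<beta> * h_att d \<mu> x)) \<longrightarrow>
                   0 < det2 \<mu> (gt_att d \<mu>) \<beta> \<and>
                   (\<exists>(Crate :: real) c. 0 < c \<and>
                      (\<forall>N\<ge>1. K_att d N \<beta> \<mu> < \<infinity> \<and>
                         \<bar>enn2real (K_att d N \<beta> \<mu>) - K_inf_att d \<beta> \<mu>\<bar>
                           \<le> Crate * (exp 1 + real N) powr (- c)))))))"
\<comment> \<open>As 200 exceeds 2 * 48, the threshold lies below half of 1 / (48 Cmom); it is
  positive by \<open>Cmom_pos\<close>.\<close>
proof (rule exI[of _ "48 :: real"], intro conjI exI[of _ "\<lambda>d L C. 1 / (200 * C)"] allI ballI impI)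
  fix d :: nat and \<mu> :: "point measure" and Cmom :: real
  assume "1 \<le> d" "\<mu> \<in> prob_measures d" "g_att_L1 d \<mu>"
    "\<forall>p::nat. p \<ge> 1 \<longrightarrow> (SUP y\<in>space (Rd d). \<integral>\<^sup>+ x. ennreal (\<bar>gt_att d \<mu> x y\<bar> ^ p) \<partial>\<mu>) \<le> ennreal (Cmom ^ p * fact p)"
  then interpret log_gas d \<mu> Cmom by unfold_locales auto
  have "0 < 1 / (200 * Cmom)" "1 / (200 * Cmom) \<le> 1 / (48 * Cmom) / 2"
    using Cmom_pos by (simp_all add: field_simps)
  then show "let \<beta>0 = 1 / (48 * Cmom) in
          (\<forall>\<beta>. 0 \<le> \<beta> \<and> \<beta> < \<beta>0 \<and> integrable \<mu> (\<lambda>x. exp (2 * \<beta> * h_att d \<mu> x)) \<longrightarrow>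
             (\<exists>Cub :: real. (SUP N\<in>{1..}. K_att d N \<beta> \<mu>) \<le> ennreal Cub)) \<and>
          (in_Linf d \<mu> \<longrightarrow>
             (let b = 1 / (200 * Cmom) in
                0 < b \<and> b \<le> \<beta>0 / 2 \<and>
                (\<forall>\<beta>. 0 < \<beta> \<and> \<beta> < b \<and> integrable \<mu> (\<lambda>x. exp (4 * \<beta> * h_att d \<mu> x)) \<longrightarrow>
                   0 < det2 \<mu> (gt_att d \<mu>) \<beta> \<and>
                   (\<exists>(Crate :: real) c. 0 < c \<and>
                      (\<forall>N\<ge>1. K_att d N \<beta> \<mu> < \<infinity> \<and>
                         \<bar>enn2real (K_att d N \<beta> \<mu>) - K_inf_att d \<beta> \<mu>\<bar>
                           \<le> Crate * (exp 1 + real N) powr (- c))))))"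
    unfolding Let_def using uniform_bound quantitative_limit by blast
qed simp

end
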